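(* Fix a choice of sign $\pm$, let $t_0>0$ and let $s\ge1$ be an integer. There exists a constant $a_0>0$ such that for all $0<a<a_0$ and for all $u_+$ small in $\dot H^{-2}\cap H^s\cap W^{s,1}$ with respect to $a_0$ and $t_0$ (i.e. $\|u_+\|_{\dot H^{-2}}+\|u_+\|_{H^s}+\|u_+\|_{W^{s,1}}\le\delta$ for some $\delta>0$ depending only on $a_0$, $t_0$ and $s$), the equation $$i v_t+v_{xx}\pm\frac1t\left(|v|^2-a^2\right)v=0,\qquad t\ge t_0,\ x\in\mathbb{R},$$ has a unique solution $v$ with $$v-v_1\in\mathcal{C}([t_0,\infty),H^s(\mathbb{R})),\qquad v_1(t,x)=a+e^{\pm ia^2\log t}\,e^{it\partial_x^2}u_+(x),$$ satisfying, as $t\to\infty$ and for all integers $0<k\le s$, $$\|(v-v_1)(t)\|_{L^2}=\mathcal{O}(t^{-\frac12}),\qquad \|\nabla^k(v-v_1)(t)\|_{L^2}=\mathcal{O}(t^{-1}).$$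
   Context: Functions are complex valued on $\mathbb{R}$. $e^{it\partial_x^2}u_+$ denotes the solution at time $t$ of $iw_t+w_{xx}=0$ with $w(0)=u_+$. $\nabla=\partial_x$. $u_+\in\dot H^{-2}$ means $\hat u_+(\xi)/|\xi|^2\in L^2$, with norm $\|\hat u_+/|\xi|^2\|_{L^2}$. For integers $s,p\geq 1$, $W^{s,p}=\{f: \nabla^kf\in L^p,\ 0\le k\le s\}$ and $H^s=W^{s,2}$. The signs $\pm$ in the equation and in $v_1$ are the same. Solutions are understood in the usual integral (Duhamel) sense. *)

theory Defs
  imports "HOL-Analysis.Analysis" "HOL-Library.Landau_Symbols"
begin

section \<open>Lebesgue and Sobolev spaces on the line\<close>

text \<open>
  Elements of Lebesgue spaces are represented by Borel functions; every class modulo null sets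
  has such a representative, and equality of classes is written out as equality almost everywhere.
  \<open>Lp_norm p f\<close> is meaningful only for \<open>f \<in> Lp p\<close>: the Bochner integral of a non-integrable
  function is 0, so membership in \<open>Lp p\<close> is always required separately.
\<close>

definition Lp :: "nat \<Rightarrow> (real \<Rightarrow> complex) set" where
  "Lp p = {f \<in> borel_measurable lborel. integrable lborel (\<lambda>x. norm (f x) ^ p)}"

definition Lp_norm :: "nat \<Rightarrow> (real \<Rightarrow> complex) \<Rightarrow> real" where
  "Lp_norm p f = root p (LINT x|lborel. norm (f x) ^ p)"

definition locally_integrable :: "(real \<Rightarrow> complex) \<Rightarrow> bool" where
  "locally_integrable f \<longleftrightarrow> (\<forall>K. compact K \<longrightarrow> set_integrable lborel K f)"

definition test_function :: "(real \<Rightarrow> real) \<Rightarrow> bool" where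
  "test_function \<phi> \<longleftrightarrow> (\<forall>n x. (deriv ^^ n) \<phi> field_differentiable at x) \<and>
     compact (closure {x. \<phi> x \<noteq> 0})"

definition weak_deriv :: "nat \<Rightarrow> (real \<Rightarrow> complex) \<Rightarrow> (real \<Rightarrow> complex) \<Rightarrow> bool" where
  "weak_deriv k f g \<longleftrightarrow> locally_integrable f \<and> locally_integrable g \<and>
     (\<forall>\<phi>. test_function \<phi> \<longrightarrow>
        (LINT x|lborel. (deriv ^^ k) \<phi> x *\<^sub>R f x) = (-1) ^ k * (LINT x|lborel. \<phi> x *\<^sub>R g x))"

text \<open>A representative of the \<open>k\<close>-th weak derivative, which is unique almost everywhere.\<close>

definition nabla :: "nat \<Rightarrow> (real \<Rightarrow> complex) \<Rightarrow> real \<Rightarrow> complex" where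
  "nabla k f = (SOME g. weak_deriv k f g)"

definition sobolev :: "nat \<Rightarrow> nat \<Rightarrow> (real \<Rightarrow> complex) set" where
  "sobolev s p = {f. \<forall>k\<le>s. \<exists>g\<in>Lp p. weak_deriv k f g}"

definition sobolev_norm :: "nat \<Rightarrow> nat \<Rightarrow> (real \<Rightarrow> complex) \<Rightarrow> real" where
  "sobolev_norm s p f = (\<Sum>k\<le>s. Lp_norm p (nabla k f))"

text \<open>Continuity of \<open>w : I \<rightarrow> H\<^sup>s\<close>, where \<open>H\<^sup>s = W\<^sup>s\<^sup>,\<^sup>2\<close>.\<close>

definition continuous_into_Hs :: "nat \<Rightarrow> real set \<Rightarrow> (real \<Rightarrow> real \<Rightarrow> complex) \<Rightarrow> bool" where
  "continuous_into_Hs s I w \<longleftrightarrow> (\<forall>t\<in>I. w t \<in> sobolev s 2) \<and>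
     (\<forall>t\<in>I. ((\<lambda>\<tau>. sobolev_norm s 2 (\<lambda>x. w \<tau> x - w t x)) \<longlongrightarrow> 0) (at t within I))"

section \<open>The Fourier transform on \<open>L\<^sup>2\<close> and the free evolution\<close>

definition truncated_fourier :: "real \<Rightarrow> (real \<Rightarrow> complex) \<Rightarrow> real \<Rightarrow> complex" where
  "truncated_fourier R f \<xi> = (LINT x:{-R..R}|lborel. cis (- (x * \<xi>)) * f x)"

text \<open>The Plancherel definition: the Fourier integral converges in quadratic mean.\<close>

definition is_fourier :: "(real \<Rightarrow> complex) \<Rightarrow> (real \<Rightarrow> complex) \<Rightarrow> bool" where
  "is_fourier f F \<longleftrightarrow> f \<in> Lp 2 \<and> F \<in> Lp 2 \<and>
     (\<forall>\<^sub>F R in at_top. (\<lambda>\<xi>. F \<xi> - truncated_fourier R f \<xi>) \<in> Lp 2) \<and>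
     ((\<lambda>R. Lp_norm 2 (\<lambda>\<xi>. F \<xi> - truncated_fourier R f \<xi>)) \<longlongrightarrow> 0) at_top"

definition fourier :: "(real \<Rightarrow> complex) \<Rightarrow> real \<Rightarrow> complex" where
  "fourier f = (SOME F. is_fourier f F)"

definition inv_fourier :: "(real \<Rightarrow> complex) \<Rightarrow> real \<Rightarrow> complex" where
  "inv_fourier F = (\<lambda>x. fourier F (- x) / (2 * pi))"

text \<open>
  The group \<open>exp (i t \<partial>\<^sub>x\<^sup>2)\<close> on \<open>L\<^sup>2\<close>: on the Fourier side \<open>i w\<^sub>t + w\<^sub>x\<^sub>x = 0\<close> becomes
  \<open>i W\<^sub>t = \<xi>\<^sup>2 W\<close>, whence the multiplier \<open>exp (- i t \<xi>\<^sup>2)\<close>.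
\<close>

definition schroedinger :: "real \<Rightarrow> (real \<Rightarrow> complex) \<Rightarrow> real \<Rightarrow> complex" where
  "schroedinger t f = inv_fourier (\<lambda>\<xi>. cis (- (t * \<xi>\<^sup>2)) * fourier f \<xi>)"

text \<open>
  The part of the homogeneous space of order \<open>-2\<close> lying in \<open>L\<^sup>2\<close>; the value of the quotient at
  \<open>\<xi> = 0\<close> is irrelevant.
\<close>

definition Hdot_minus2 :: "(real \<Rightarrow> complex) set" where
  "Hdot_minus2 = {f \<in> Lp 2. (\<lambda>\<xi>. fourier f \<xi> / complex_of_real (\<bar>\<xi>\<bar>\<^sup>2)) \<in> Lp 2}"

definition Hdot_minus2_norm :: "(real \<Rightarrow> complex) \<Rightarrow> real" where
  "Hdot_minus2_norm f = Lp_norm 2 (\<lambda>\<xi>. fourier f \<xi> / complex_of_real (\<bar>\<xi>\<bar>\<^sup>2))"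

section \<open>Solutions in the Duhamel sense\<close>

text \<open>
  The integral over \<open>[a, b]\<close> of a function with values in \<open>L\<^sup>2\<close>: this is
  the definition of \<open>has_integral\<close> with convergence of the Riemann sums in the \<open>L\<^sup>2\<close> norm.
\<close>

definition has_L2_integral ::
    "(real \<Rightarrow> real \<Rightarrow> complex) \<Rightarrow> (real \<Rightarrow> complex) \<Rightarrow> real \<Rightarrow> real \<Rightarrow> bool" where
  "has_L2_integral G J a b \<longleftrightarrow> (\<forall>\<tau>\<in>{a..b}. G \<tau> \<in> Lp 2) \<and> J \<in> Lp 2 \<and>
     ((\<lambda>p. Lp_norm 2 (\<lambda>x. (\<Sum>(\<tau>, K)\<in>p. measure lborel K *\<^sub>R G \<tau> x) - J x)) \<longlongrightarrow> 0)
       (division_filter {a..b})"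

definition nonlinearity :: "real \<Rightarrow> real \<Rightarrow> real \<Rightarrow> (real \<Rightarrow> complex) \<Rightarrow> real \<Rightarrow> complex" where
  "nonlinearity \<sigma> a t f = (\<lambda>x. complex_of_real (\<sigma> / t * ((cmod (f x))\<^sup>2 - a\<^sup>2)) * f x)"

text \<open>
  Solutions of \<open>i v\<^sub>t + v\<^sub>x\<^sub>x + \<sigma>/t (|v|\<^sup>2 - a\<^sup>2) v = 0\<close> on \<open>[t0, \<infinity>)\<close> with \<open>v - a\<close> valued in \<open>L\<^sup>2\<close>.
  The constant \<open>a\<close> is invariant under the free evolution, so \<open>v - a\<close> satisfies
  \<open>v(t) - a = S(t - t0) (v(t0) - a) + i \<integral>\<^bsub>t0\<^esub>\<^bsup>t\<^esup> S(t - \<tau>) N(\<tau>) d\<tau>\<close>, with \<open>S\<close> the free group and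
  \<open>N\<close> the nonlinear term.
\<close>

definition duhamel_solution ::
    "real \<Rightarrow> real \<Rightarrow> real \<Rightarrow> (real \<Rightarrow> real \<Rightarrow> complex) \<Rightarrow> bool" where
  "duhamel_solution \<sigma> a t0 v \<longleftrightarrow>
     (\<forall>t\<ge>t0. (\<lambda>x. v t x - a) \<in> Lp 2 \<and> nonlinearity \<sigma> a t (v t) \<in> Lp 2) \<and>
     (\<forall>t\<ge>t0. \<exists>J. has_L2_integral (\<lambda>\<tau>. schroedinger (t - \<tau>) (nonlinearity \<sigma> a \<tau> (v \<tau>))) J t0 t \<and>
        (AE x in lborel. v t x - a = schroedinger (t - t0) (\<lambda>y. v t0 y - a) x + \<i> * J x))"

definition v1 :: "real \<Rightarrow> real \<Rightarrow> (real \<Rightarrow> complex) \<Rightarrow> real \<Rightarrow> real \<Rightarrow> complex" where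
  "v1 \<sigma> a u t x = complex_of_real a + cis (\<sigma> * a\<^sup>2 * ln t) * schroedinger t u x"

definition asymptotic_solution ::
    "real \<Rightarrow> real \<Rightarrow> nat \<Rightarrow> real \<Rightarrow> (real \<Rightarrow> complex) \<Rightarrow> (real \<Rightarrow> real \<Rightarrow> complex) \<Rightarrow> bool" where
  "asymptotic_solution \<sigma> t0 s a u v \<longleftrightarrow>
     duhamel_solution \<sigma> a t0 v \<and>
     continuous_into_Hs s {t0..} (\<lambda>t x. v t x - v1 \<sigma> a u t x) \<and>
     (\<lambda>t. Lp_norm 2 (\<lambda>x. v t x - v1 \<sigma> a u t x)) \<in> O(\<lambda>t. t powr (-1/2)) \<and>
     (\<forall>k. 0 < k \<and> k \<le> s \<longrightarrow>
        (\<lambda>t. Lp_norm 2 (nabla k (\<lambda>x. v t x - v1 \<sigma> a u t x))) \<in> O(\<lambda>t. t powr (-1)))"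

end

theory Submission
  imports Defs "HOL-Probability.Probability"
begin

text \<open>
  Write \<open>v = a + p + r\<close>, where \<open>p = v\<^sub>1 - a\<close>, and let \<open>y(t) = exp (- i t \<partial>\<^sub>x\<^sup>2) r(t)\<close> be the profile of the
  remainder. The phase of \<open>v\<^sub>1\<close> cancels the resonant term \<open>a\<^sup>2 p / t\<close>, so that \<open>y\<close> solves an integral
  equation from infinite time with kernel \<open>1 / t\<close>, whose linear part has Lipschitz constant
  \<open>2 a\<^sup>2\<close> and is therefore a contraction for small \<open>a\<close> on functions of size \<open>t\<^bsup>-1/2\<^esup>\<close> in \<open>H\<^sup>s\<close>.
  By the dispersive estimate \<open>p = O(t\<^bsup>-1/2\<^esup>)\<close> in \<open>W\<^bsup>s,\<infinity>\<^esup>\<close>, which controls the higher order terms.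
  In the sources, \<open>cnj p / t\<close> and \<open>p\<^sup>2 / t\<close> oscillate: as \<open>u\<^sub>+\<close> has antiderivatives of order one and two,
  they are total time derivatives up to \<open>O(t\<^bsup>-2\<^esup>)\<close>. The source \<open>|p|\<^sup>2 / t\<close> only yields \<open>t\<^bsup>-1/2\<^esup>\<close>, but its
  space derivative is a total time derivative too; hence the derivatives of \<open>r\<close> decay like \<open>t\<^bsup>-1\<^esup>\<close>.
\<close>

section \<open>The Hilbert space of square integrable functions\<close>

text \<open>The kernel \<open>1 / t\<close> is not integrable at infinity, so each contribution must
  either decay further or oscillate. At the rate \<open>1 / sqrt t\<close> the linear part survives
  because the integral of t^(-3/2) over later times is 2 t^(-1/2): its Lipschitz constant
  \<open>2 * a\<^sup>2\<close> is doubled to \<open>4 * a\<^sup>2\<close>, which stays at most 1/4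
  for \<open>a \<le> 1 / 4\<close>. This is the origin of the absolute threshold for
  \<open>a\<close>. The remaining Lipschitz terms carry another \<open>1 / sqrt t\<close>: existence
  makes them small through the data, but uniqueness is claimed among solutions whose decay constants
  are arbitrary, and there an exponential weight in time absorbs them. The Hilbert space is a type
  of its own, so that derivatives, integrals and the fixed point theorem for Banach spaces apply to
  functions of time. As \<open>s\<close> is a variable, H^s is not a type but the image of this one
  space under a smoothing multiplier. The Fourier transform is constructed on the type, and its
  inversion is taken from Levy's theorem on characteristic functions.\<close>

lemma borel_measurable_cnj [measurable (raw)]:
  "f \<in> borel_measurable M \<Longrightarrow> (\<lambda>x. cnj (f x)) \<in> borel_measurable M"
  by (rule measurable_compose[of f M borel cnj borel])
    (auto intro!: borel_measurable_continuous_onI continuous_intros)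

lemma Lp2_iff:
  "f \<in> Lp 2 \<longleftrightarrow> f \<in> borel_measurable lborel \<and> integrable lborel (\<lambda>x. (cmod (f x))\<^sup>2)"
  by (simp add: Lp_def)

lemma Lp2_measurable [measurable_dest]: "f \<in> Lp 2 \<Longrightarrow> f \<in> borel_measurable borel"
  by (simp add: Lp_def)

lemma Lp2_bound:
  assumes "f \<in> borel_measurable lborel" "g \<in> Lp 2" "AE x in lborel. cmod (f x) \<le> C * cmod (g x)"
  shows "f \<in> Lp 2"
proof -
  have "integrable lborel (\<lambda>x. (cmod (f x))\<^sup>2)"
  proof (rule Bochner_Integration.integrable_bound)
    show "integrable lborel (\<lambda>x. C\<^sup>2 * (cmod (g x))\<^sup>2)"
      using assms(2) by (auto simp: Lp2_iff)
    show "AE x in lborel. norm ((cmod (f x))\<^sup>2) \<le> norm (C\<^sup>2 * (cmod (g x))\<^sup>2)"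
      using assms(3)
    proof eventually_elim
      case (elim x)
      then have "(cmod (f x))\<^sup>2 \<le> (C * cmod (g x))\<^sup>2" by (intro power_mono) auto
      then show ?case by (simp add: power_mult_distrib)
    qed
  qed (use assms in auto)
  with assms show ?thesis by (simp add: Lp2_iff)
qed

lemma Lp2_cong:
  assumes "g \<in> Lp 2" "f \<in> borel_measurable lborel" "AE x in lborel. f x = g x"
  shows "f \<in> Lp 2"
  by (rule Lp2_bound[OF assms(2,1), of 1]) (use assms(3) in auto)

lemma Lp2_mult_integrable:
  assumes "f \<in> Lp 2" "g \<in> Lp 2"
  shows "integrable lborel (\<lambda>x. f x * g x)"
proof (rule Bochner_Integration.integrable_bound)
  show "integrable lborel (\<lambda>x. (cmod (f x))\<^sup>2 + (cmod (g x))\<^sup>2)"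
    using assms by (auto simp: Lp2_iff)
  have "cmod (f x) * cmod (g x) \<le> (cmod (f x))\<^sup>2 + (cmod (g x))\<^sup>2" for x
  proof -
    have "0 \<le> cmod (f x) * cmod (g x)" by simp
    then show ?thesis using sum_squares_bound[of "cmod (f x)" "cmod (g x)"] by linarith
  qed
  then show "AE x in lborel. norm (f x * g x) \<le> norm ((cmod (f x))\<^sup>2 + (cmod (g x))\<^sup>2)"
    by (auto simp: norm_mult)
qed (use assms in auto)

lemma Lp2_add:
  assumes "f \<in> Lp 2" "g \<in> Lp 2"
  shows "(\<lambda>x. f x + g x) \<in> Lp 2"
proof -
  have "integrable lborel (\<lambda>x. (cmod (f x + g x))\<^sup>2)"
  proof (rule Bochner_Integration.integrable_bound)
    show "integrable lborel (\<lambda>x. 2 * (cmod (f x))\<^sup>2 + 2 * (cmod (g x))\<^sup>2)"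
      using assms by (auto simp: Lp2_iff)
    have "(cmod (f x + g x))\<^sup>2 \<le> 2 * (cmod (f x))\<^sup>2 + 2 * (cmod (g x))\<^sup>2" for x
    proof -
      have "(cmod (f x + g x))\<^sup>2 \<le> (cmod (f x) + cmod (g x))\<^sup>2"
        by (intro power_mono norm_triangle_ineq) auto
      also have "\<dots> \<le> 2 * (cmod (f x))\<^sup>2 + 2 * (cmod (g x))\<^sup>2"
        using sum_squares_bound[of "cmod (f x)" "cmod (g x)"] by (simp add: power2_sum)
      finally show ?thesis .
    qed
    then show "AE x in lborel. norm ((cmod (f x + g x))\<^sup>2) \<le> norm (2 * (cmod (f x))\<^sup>2 + 2 * (cmod (g x))\<^sup>2)"
      by auto
  qed (use assms in auto)
  with assms show ?thesis by (auto simp: Lp2_iff)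
qed

lemma Lp2_cmult: "f \<in> Lp 2 \<Longrightarrow> (\<lambda>x. c * f x) \<in> Lp 2"
  by (rule Lp2_bound[of _ f "cmod c"]) (auto simp: norm_mult)

lemma Lp2_bounded_mult:
  assumes "m \<in> borel_measurable lborel" "\<And>x. cmod (m x) \<le> B" "f \<in> Lp 2"
  shows "(\<lambda>x. m x * f x) \<in> Lp 2"
  by (rule Lp2_bound[of _ f B]) (use assms in \<open>auto simp: norm_mult intro!: mult_right_mono\<close>)

lemma Lp2_zero: "(\<lambda>x. 0) \<in> Lp 2" by (simp add: Lp2_iff)

lemma Lp2_uminus: "f \<in> Lp 2 \<Longrightarrow> (\<lambda>x. - f x) \<in> Lp 2"
  using Lp2_cmult[of f "-1"] by simp

lemma Lp2_diff: "f \<in> Lp 2 \<Longrightarrow> g \<in> Lp 2 \<Longrightarrow> (\<lambda>x. f x - g x) \<in> Lp 2"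
  using Lp2_add[of f "\<lambda>x. - g x"] Lp2_uminus[of g] by simp

lemma Lp2_scaleR: "f \<in> Lp 2 \<Longrightarrow> (\<lambda>x. r *\<^sub>R f x) \<in> Lp 2"
  using Lp2_cmult[of f "of_real r"] by (simp add: scaleR_conv_of_real)

lemma Lp2_cnj: "f \<in> Lp 2 \<Longrightarrow> (\<lambda>x. cnj (f x)) \<in> Lp 2"
  by (rule Lp2_bound[of _ f 1]) auto

text \<open>Relating only members of \<open>Lp 2\<close> makes the relation partial, so that the
  quotient consists exactly of the classes modulo null sets.\<close>

definition l2eq :: "(real \<Rightarrow> complex) \<Rightarrow> (real \<Rightarrow> complex) \<Rightarrow> bool" where
  "l2eq f g \<longleftrightarrow> f \<in> Lp 2 \<and> g \<in> Lp 2 \<and> (AE x in lborel. f x = g x)"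

quotient_type l2 = "real \<Rightarrow> complex" / partial: l2eq
proof (rule part_equivpI)
  show "\<exists>f. l2eq f f" using Lp2_zero by (auto simp: l2eq_def)
  show "symp l2eq" by (auto simp: symp_def l2eq_def)
  have "AE x in lborel. f x = h x" if "AE x in lborel. f x = g x" "AE x in lborel. g x = h x" for f g h :: "real \<Rightarrow> complex"
    using that by eventually_elim simp
  then show "transp l2eq" by (auto simp: transp_def l2eq_def)
qed

text \<open>Outside \<open>Lp 2\<close> the value is the class of zero. Multipliers and products
  defined through \<open>emb\<close> therefore return 0 when they leave the space, and their laws
  have to secure membership first.\<close>

definition emb :: "(real \<Rightarrow> complex) \<Rightarrow> l2" where
  "emb f = (if f \<in> Lp 2 then abs_l2 f else abs_l2 (\<lambda>x. 0))"

lemma rep_l2_Lp2 [simp, intro]: "rep_l2 F \<in> Lp 2"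
  using Quotient3_rep_reflp[OF Quotient3_l2, of F] by (simp add: l2eq_def)

lemma rep_l2_measurable [measurable]: "rep_l2 F \<in> borel_measurable borel"
  by (rule Lp2_measurable) simp

lemma emb_rep [simp]: "emb (rep_l2 F) = F"
  by (simp add: emb_def Quotient3_abs_rep[OF Quotient3_l2])

lemma rep_emb: "f \<in> Lp 2 \<Longrightarrow> AE x in lborel. rep_l2 (emb f) x = f x"
  using Quotient3_rep_abs[OF Quotient3_l2, of f] by (simp add: emb_def l2eq_def)

lemma l2_eqI:
  assumes "AE x in lborel. rep_l2 F x = rep_l2 G x"
  shows "F = G"
  using assms Quotient3_rel_rep[OF Quotient3_l2, of F G] by (simp add: l2eq_def)

lemma emb_cong:
  assumes "f \<in> Lp 2" "g \<in> Lp 2" "AE x in lborel. f x = g x"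
  shows "emb f = emb g"
  using assms Quotient3_rel[OF Quotient3_l2, of f g] by (auto simp: emb_def l2eq_def)

lemma emb_eq_iff:
  assumes "f \<in> Lp 2" "g \<in> Lp 2"
  shows "emb f = emb g \<longleftrightarrow> (AE x in lborel. f x = g x)"
proof
  assume "emb f = emb g"
  with rep_emb[OF assms(1)] have "AE x in lborel. rep_l2 (emb g) x = f x" by simp
  with rep_emb[OF assms(2)] show "AE x in lborel. f x = g x" by eventually_elim simp
qed (rule emb_cong[OF assms])

instantiation l2 :: real_inner
begin
definition "0 = emb (\<lambda>x. 0)"
definition "F + G = emb (\<lambda>x. rep_l2 F x + rep_l2 G x)"
definition "F - G = emb (\<lambda>x. rep_l2 F x - rep_l2 G x)"
definition "- F = emb (\<lambda>x. - rep_l2 F x)"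
definition "r *\<^sub>R F = emb (\<lambda>x. r *\<^sub>R rep_l2 F x)"
text \<open>The real part of the Hermitian product, as the type class is over the reals. Complex
  identities are recovered by testing with a vector multiplied by 1 and by
  \<open>\<i>\<close>.\<close>

definition "inner F G = Re (LINT x|lborel. rep_l2 F x * cnj (rep_l2 G x))"
definition "norm (F::l2) = sqrt (inner F F)"
definition "dist F G = norm (F - (G::l2))"
definition "sgn (F::l2) = inverse (norm F) *\<^sub>R F"
definition "(uniformity :: (l2 \<times> l2) filter) = (INF e\<in>{0 <..}. principal {(x, y). dist x y < e})"
definition "open (U :: l2 set) \<longleftrightarrow> (\<forall>x\<in>U. eventually (\<lambda>(x', y). x' = x \<longrightarrow> y \<in> U) uniformity)"

lemma rep_zero: "AE x in lborel. rep_l2 0 x = 0"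
  unfolding zero_l2_def by (rule rep_emb) (rule Lp2_zero)
lemma rep_plus: "AE x in lborel. rep_l2 (F + G) x = rep_l2 F x + rep_l2 G x"
  unfolding plus_l2_def by (rule rep_emb) (auto intro: Lp2_add)
lemma rep_minus: "AE x in lborel. rep_l2 (F - G) x = rep_l2 F x - rep_l2 G x"
  unfolding minus_l2_def by (rule rep_emb) (auto intro: Lp2_diff)
lemma rep_uminus: "AE x in lborel. rep_l2 (- F) x = - rep_l2 F x"
  unfolding uminus_l2_def by (rule rep_emb) (auto intro: Lp2_uminus)
lemma rep_scaleR: "AE x in lborel. rep_l2 (r *\<^sub>R F) x = r *\<^sub>R rep_l2 F x"
  unfolding scaleR_l2_def by (rule rep_emb) (auto intro: Lp2_scaleR)

lemma inner_integrable: "integrable lborel (\<lambda>x. rep_l2 F x * cnj (rep_l2 G x))"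
  by (intro Lp2_mult_integrable Lp2_cnj rep_l2_Lp2)

lemma inner_self: "inner F F = (LINT x|lborel. (cmod (rep_l2 F x))\<^sup>2)"
proof -
  have "inner F F = Re (LINT x|lborel. complex_of_real ((cmod (rep_l2 F x))\<^sup>2))"
    unfolding inner_l2_def by (simp only: complex_norm_square)
  then show ?thesis unfolding integral_complex_of_real by (simp only: Re_complex_of_real)
qed

instance
proof
  fix F G H :: l2 and r q :: real
  show "F + G + H = F + (G + H)"
    by (rule l2_eqI) (use rep_plus[of "F + G" H] rep_plus[of F G] rep_plus[of F "G + H"] rep_plus[of G H] in eventually_elim, simp)
  show "F + G = G + F" by (simp add: plus_l2_def add.commute)
  show "0 + F = F"
    by (rule l2_eqI) (use rep_plus[of 0 F] rep_zero in eventually_elim, simp)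
  show "- F + F = 0"
    by (rule l2_eqI) (use rep_plus[of "- F" F] rep_zero rep_uminus[of F] in eventually_elim, simp)
  show "F - G = F + - G"
    by (rule l2_eqI) (use rep_plus[of F "- G"] rep_minus[of F G] rep_uminus[of G] in eventually_elim, simp)
  show "r *\<^sub>R (F + G) = r *\<^sub>R F + r *\<^sub>R G"
    by (rule l2_eqI) (use rep_plus[of F G] rep_scaleR[of r "F + G"] rep_scaleR[of r F] rep_scaleR[of r G]
      rep_plus[of "r *\<^sub>R F" "r *\<^sub>R G"] in eventually_elim, simp add: scaleR_add_right)
  show "(r + q) *\<^sub>R F = r *\<^sub>R F + q *\<^sub>R F"
    by (rule l2_eqI) (use rep_scaleR[of "r + q" F] rep_scaleR[of r F] rep_scaleR[of q F]
      rep_plus[of "r *\<^sub>R F" "q *\<^sub>R F"] in eventually_elim, simp add: scaleR_add_left)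
  show "r *\<^sub>R q *\<^sub>R F = (r * q) *\<^sub>R F"
    by (rule l2_eqI) (use rep_scaleR[of "r * q" F] rep_scaleR[of r "q *\<^sub>R F"] rep_scaleR[of q F] in eventually_elim, simp)
  show "1 *\<^sub>R F = F"
    by (rule l2_eqI) (use rep_scaleR[of 1 F] in eventually_elim, simp)
  show "dist F G = norm (F - G)" by (simp add: dist_l2_def)
  show "sgn F = inverse (norm F) *\<^sub>R F" by (simp add: sgn_l2_def)
  show "(uniformity :: (l2 \<times> l2) filter) = (INF e\<in>{0 <..}. principal {(x, y). dist x y < e})"
    by (rule uniformity_l2_def)
  show "open U \<longleftrightarrow> (\<forall>x\<in>U. eventually (\<lambda>(x', y). x' = x \<longrightarrow> y \<in> U) uniformity)" for U :: "l2 set"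
    by (rule open_l2_def)
  show "norm F = sqrt (inner F F)" by (simp add: norm_l2_def)
  show "inner F G = inner G F"
  proof -
    have "(LINT x|lborel. rep_l2 F x * cnj (rep_l2 G x)) = cnj (LINT x|lborel. rep_l2 G x * cnj (rep_l2 F x))"
      by (simp flip: Bochner_Integration.integral_cnj add: mult.commute)
    then show ?thesis unfolding inner_l2_def by simp
  qed
  show "inner (F + G) H = inner F H + inner G H"
  proof -
    have "(LINT x|lborel. rep_l2 (F + G) x * cnj (rep_l2 H x)) =
        (LINT x|lborel. rep_l2 F x * cnj (rep_l2 H x) + rep_l2 G x * cnj (rep_l2 H x))"
      by (rule integral_cong_AE) (measurable, use rep_plus[of F G] in eventually_elim, simp add: distrib_right)
    then show ?thesis unfolding inner_l2_def
      by (simp add: Bochner_Integration.integral_add[OF inner_integrable inner_integrable])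
  qed
  show "inner (r *\<^sub>R F) G = r * inner F G"
  proof -
    have "(LINT x|lborel. rep_l2 (r *\<^sub>R F) x * cnj (rep_l2 G x)) =
        (LINT x|lborel. complex_of_real r * (rep_l2 F x * cnj (rep_l2 G x)))"
      by (rule integral_cong_AE) (measurable, use rep_scaleR[of r F] in eventually_elim, simp add: scaleR_conv_of_real)
    then show ?thesis unfolding inner_l2_def by simp
  qed
  show "0 \<le> inner F F" unfolding inner_self by simp
  show "inner F F = 0 \<longleftrightarrow> F = 0"
  proof -
    have "inner F F = 0 \<longleftrightarrow> (AE x in lborel. (cmod (rep_l2 F x))\<^sup>2 = 0)"
      unfolding inner_self using rep_l2_Lp2[of F]
      by (intro integral_nonneg_eq_0_iff_AE) (auto simp: Lp2_iff)
    also have "\<dots> \<longleftrightarrow> (AE x in lborel. rep_l2 F x = rep_l2 0 x)"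
      by (intro eventually_subst) (use rep_zero in eventually_elim, simp)
    also have "\<dots> \<longleftrightarrow> F = 0" using l2_eqI[of F 0] by auto
    finally show ?thesis .
  qed
qed

end

lemma norm_l2_sq: "(norm F)\<^sup>2 = (LINT x|lborel. (cmod (rep_l2 F x))\<^sup>2)"
  unfolding norm_l2_def inner_self[symmetric] by simp

lemma norm_emb_sq:
  assumes "f \<in> Lp 2"
  shows "(norm (emb f))\<^sup>2 = (LINT x|lborel. (cmod (f x))\<^sup>2)"
proof -
  note [measurable] = Lp2_measurable[OF assms]
  show ?thesis
  unfolding norm_l2_sq
  by (intro integral_cong_AE) (measurable, use rep_emb[OF assms] in eventually_elim, simp)
qed

lemma norm_emb: "f \<in> Lp 2 \<Longrightarrow> norm (emb f) = Lp_norm 2 f"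
  unfolding Lp_norm_def sqrt_def[symmetric] norm_emb_sq[symmetric] by simp

lemma inner_emb:
  assumes "f \<in> Lp 2" "g \<in> Lp 2"
  shows "inner (emb f) (emb g) = Re (LINT x|lborel. f x * cnj (g x))"
proof -
  note [measurable] = Lp2_measurable[OF assms(1)] Lp2_measurable[OF assms(2)]
  have "(LINT x|lborel. rep_l2 (emb f) x * cnj (rep_l2 (emb g) x)) = (LINT x|lborel. f x * cnj (g x))"
    by (intro integral_cong_AE) (measurable, use rep_emb[OF assms(1)] rep_emb[OF assms(2)] in eventually_elim, simp)
  then show ?thesis by (simp add: inner_l2_def)
qed

lemma emb_add:
  assumes "f \<in> Lp 2" "g \<in> Lp 2"
  shows "emb (\<lambda>x. f x + g x) = emb f + emb g"
  by (rule l2_eqI)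
    (use rep_emb[OF assms(1)] rep_emb[OF assms(2)] rep_emb[OF Lp2_add[OF assms]] rep_plus[of "emb f" "emb g"]
      in eventually_elim, simp)

lemma emb_diff:
  assumes "f \<in> Lp 2" "g \<in> Lp 2"
  shows "emb (\<lambda>x. f x - g x) = emb f - emb g"
  by (rule l2_eqI)
    (use rep_emb[OF assms(1)] rep_emb[OF assms(2)] rep_emb[OF Lp2_diff[OF assms]] rep_minus[of "emb f" "emb g"]
      in eventually_elim, simp)

lemma emb_scaleR:
  assumes "f \<in> Lp 2"
  shows "emb (\<lambda>x. r *\<^sub>R f x) = r *\<^sub>R emb f"
  by (rule l2_eqI)
    (use rep_emb[OF assms] rep_emb[OF Lp2_scaleR[OF assms, of r]] rep_scaleR[of r "emb f"] in eventually_elim, simp)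

lemma norm_emb_mono:
  assumes "f \<in> Lp 2" "g \<in> Lp 2" "AE x in lborel. cmod (f x) \<le> C * cmod (g x)" "0 \<le> C"
  shows "norm (emb f) \<le> C * norm (emb g)"
proof -
  have "(norm (emb f))\<^sup>2 \<le> (LINT x|lborel. C\<^sup>2 * (cmod (g x))\<^sup>2)"
    unfolding norm_emb_sq[OF assms(1)]
  proof (rule integral_mono_AE)
    show "AE x in lborel. (cmod (f x))\<^sup>2 \<le> C\<^sup>2 * (cmod (g x))\<^sup>2"
      using assms(3)
    proof eventually_elim
      case (elim x)
      then have "(cmod (f x))\<^sup>2 \<le> (C * cmod (g x))\<^sup>2" by (intro power_mono) auto
      then show ?case by (simp add: power_mult_distrib)
    qed
  qed (use assms(1,2) in \<open>auto simp: Lp2_iff\<close>)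
  also have "\<dots> = (C * norm (emb g))\<^sup>2" by (simp add: norm_emb_sq[OF assms(2)] power_mult_distrib)
  finally show ?thesis by (rule power2_le_imp_le) (use assms(4) in auto)
qed

lemma l2_tendsto_iff:
  "(X \<longlongrightarrow> (F::l2)) A \<longleftrightarrow> ((\<lambda>n. LINT x|lborel. (cmod (rep_l2 (X n) x - rep_l2 F x))\<^sup>2) \<longlongrightarrow> 0) A"
proof -
  have "(norm (X n - F))\<^sup>2 = (LINT x|lborel. (cmod (rep_l2 (X n) x - rep_l2 F x))\<^sup>2)" for n
    unfolding norm_l2_sq by (intro integral_cong_AE) (measurable, use rep_minus[of "X n" F] in eventually_elim, simp)
  moreover have "(X \<longlongrightarrow> F) A \<longleftrightarrow> ((\<lambda>n. (norm (X n - F))\<^sup>2) \<longlongrightarrow> 0) A"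
  proof
    assume "((\<lambda>n. (norm (X n - F))\<^sup>2) \<longlongrightarrow> 0) A"
    from tendsto_real_sqrt[OF this] show "(X \<longlongrightarrow> F) A"
      by (simp add: tendsto_norm_zero_iff LIM_zero_iff)
  next
    assume "(X \<longlongrightarrow> F) A"
    then have "((\<lambda>n. norm (X n - F)) \<longlongrightarrow> 0) A" by (simp add: LIM_zero tendsto_norm_zero)
    from tendsto_power[OF this, of 2] show "((\<lambda>n. (norm (X n - F))\<^sup>2) \<longlongrightarrow> 0) A" by simp
  qed
  ultimately show ?thesis by simp
qed

text \<open>The squared differences tend to 0 in L1, which provides a subsequence converging almost
  everywhere. This is how pointwise bounds and identities pass to limits in norm.\<close>

lemma l2_AE_subseq:
  assumes "(X \<longlongrightarrow> (F::l2)) sequentially"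
  shows "\<exists>r. strict_mono r \<and> (AE x in lborel. (\<lambda>n. rep_l2 (X (r n)) x) \<longlonglongrightarrow> rep_l2 F x)"
proof -
  let ?u = "\<lambda>n x. (cmod (rep_l2 (X n) x - rep_l2 F x))\<^sup>2"
  have "\<exists>r. strict_mono r \<and> (AE x in lborel. (\<lambda>n. ?u (r n) x) \<longlonglongrightarrow> 0)"
  proof (rule tendsto_L1_AE_subseq)
    show "integrable lborel (?u n)" for n
      using Lp2_diff[OF rep_l2_Lp2 rep_l2_Lp2, of "X n" F] unfolding Lp2_iff by blast
    show "(\<lambda>n. LINT x|lborel. norm (?u n x)) \<longlonglongrightarrow> 0"
      using assms by (simp add: l2_tendsto_iff)
  qed
  then obtain r where "strict_mono r" and r: "AE x in lborel. (\<lambda>n. ?u (r n) x) \<longlonglongrightarrow> 0" by blast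
  have "AE x in lborel. (\<lambda>n. rep_l2 (X (r n)) x) \<longlonglongrightarrow> rep_l2 F x"
    using r
  proof eventually_elim
    case (elim x)
    from tendsto_real_sqrt[OF this] show ?case
      by (simp add: tendsto_norm_zero_iff LIM_zero_iff)
  qed
  with \<open>strict_mono r\<close> show ?thesis by blast
qed

lemma l2_dominated_convergence:
  assumes "\<And>n. f n \<in> borel_measurable lborel" "g \<in> borel_measurable lborel" "w \<in> Lp 2"
    and "\<And>n. AE x in lborel. cmod (f n x) \<le> cmod (w x)"
    and "AE x in lborel. (\<lambda>n. f n x) \<longlonglongrightarrow> g x"
  shows "g \<in> Lp 2" "(\<lambda>n. emb (f n)) \<longlonglongrightarrow> emb g"
proof -
  note [measurable] = assms(1)[simplified] assms(2)[simplified]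
  have f: "f n \<in> Lp 2" for n
    by (rule Lp2_bound[OF assms(1,3), of n 1]) (use assms(4)[of n] in auto)
  have all: "AE x in lborel. \<forall>n. cmod (f n x) \<le> cmod (w x)"
    using assms(4) by (simp add: AE_all_countable)
  have gw: "AE x in lborel. cmod (g x) \<le> cmod (w x)"
    using all assms(5)
  proof eventually_elim
    case (elim x)
    from tendsto_norm[OF elim(2)] show ?case
      by (rule Lim_bounded) (use elim in auto)
  qed
  show g: "g \<in> Lp 2" by (rule Lp2_bound[OF assms(2,3), of 1]) (use gw in auto)
  have "(\<lambda>n. LINT x|lborel. (cmod (f n x - g x))\<^sup>2) \<longlonglongrightarrow> (LINT (x::real)|lborel. (0::real))"
  proof (rule integral_dominated_convergence)
    show "integrable lborel (\<lambda>x. 4 * (cmod (w x))\<^sup>2)" using assms(3) by (auto simp: Lp2_iff)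
    show "AE x in lborel. (\<lambda>n. (cmod (f n x - g x))\<^sup>2) \<longlonglongrightarrow> 0"
      using assms(5)
    proof eventually_elim
      case (elim x)
      then have "(\<lambda>n. cmod (f n x - g x)) \<longlonglongrightarrow> 0" by (simp add: LIM_zero tendsto_norm_zero)
      from tendsto_power[OF this, of 2] show ?case by simp
    qed
    show "AE x in lborel. norm ((cmod (f n x - g x))\<^sup>2) \<le> 4 * (cmod (w x))\<^sup>2" for n
      using assms(4)[of n] gw
    proof eventually_elim
      case (elim x)
      have "(cmod (f n x - g x))\<^sup>2 \<le> (cmod (f n x) + cmod (g x))\<^sup>2"
        by (intro power_mono norm_triangle_ineq4) auto
      also have "\<dots> \<le> (2 * cmod (w x))\<^sup>2" using elim by (intro power_mono) auto
      finally show ?case by (simp add: power_mult_distrib)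
    qed
  qed (use assms(1,2) in auto)
  moreover have "(LINT x|lborel. (cmod (f n x - g x))\<^sup>2) =
      (LINT x|lborel. (cmod (rep_l2 (emb (f n)) x - rep_l2 (emb g) x))\<^sup>2)" for n
    by (intro integral_cong_AE) (measurable, use rep_emb[OF f, of n] rep_emb[OF g] in eventually_elim, simp)
  ultimately show "(\<lambda>n. emb (f n)) \<longlonglongrightarrow> emb g" by (simp add: l2_tendsto_iff)
qed

text \<open>Riesz--Fischer: the increments of a fast Cauchy subsequence are absolutely summable almost everywhere.\<close>

lemma l2_fast_Cauchy_convergent:
  fixes X :: "nat \<Rightarrow> l2"
  assumes fast: "\<And>n. norm (X (Suc n) - X n) \<le> (1/2) ^ n"
  shows "convergent X"
proof -
  define d where "d = (\<lambda>n x. cmod (rep_l2 (X (Suc n)) x - rep_l2 (X n) x))"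
  have [measurable]: "d n \<in> borel_measurable lborel" for n unfolding d_def by measurable
  have dL: "(\<lambda>x. complex_of_real (d n x)) \<in> Lp 2" for n
    by (rule Lp2_bound[of _ "\<lambda>x. rep_l2 (X (Suc n)) x - rep_l2 (X n) x" 1]) (auto simp: d_def intro: Lp2_diff)
  have dn: "norm (emb (\<lambda>x. complex_of_real (d n x))) \<le> (1/2) ^ n" for n
  proof -
    have "norm (emb (\<lambda>x. complex_of_real (d n x))) \<le> 1 * norm (emb (\<lambda>x. rep_l2 (X (Suc n)) x - rep_l2 (X n) x))"
      by (rule norm_emb_mono[OF dL]) (auto simp: d_def intro: Lp2_diff)
    also have "emb (\<lambda>x. rep_l2 (X (Suc n)) x - rep_l2 (X n) x) = X (Suc n) - X n"
      by (simp add: minus_l2_def)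
    finally show ?thesis using fast[of n] by simp
  qed
  \<comment> \<open>The triangle inequality bounds these partial sums by a geometric series, hence
    by 2 in norm. Monotone convergence of their squares makes the full sum finite almost everywhere
    and square integrable.\<close>
  define s where "s = (\<lambda>N x. \<Sum>n<N. d n x)"
  have [measurable]: "s N \<in> borel_measurable lborel" for N unfolding s_def by measurable
  have sL: "(\<lambda>x. complex_of_real (s N x)) \<in> Lp 2 \<and>
      norm (emb (\<lambda>x. complex_of_real (s N x))) \<le> (\<Sum>n<N. (1/2) ^ n)" for N
  proof (induction N)
    case 0
    then show ?case using Lp2_zero by (simp add: s_def flip: zero_l2_def)
  next
    case (Suc N)
    then have "(\<lambda>x. complex_of_real (s N x) + complex_of_real (d N x)) \<in> Lp 2" by (intro Lp2_add dL) auto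
    moreover have "norm (emb (\<lambda>x. complex_of_real (s N x) + complex_of_real (d N x))) \<le> (\<Sum>n<Suc N. (1/2) ^ n)"
      using Suc dL[of N] dn[of N] by (subst emb_add) (auto intro!: order.trans[OF norm_triangle_ineq])
    ultimately show ?case by (simp add: s_def)
  qed
  have s2: "(norm (emb (\<lambda>x. complex_of_real (s N x))))\<^sup>2 \<le> 4" for N
  proof -
    have "(\<Sum>n<N. (1/2::real) ^ n) \<le> 2" by (simp add: sum_gp_strict)
    with sL[of N] have "norm (emb (\<lambda>x. complex_of_real (s N x))) \<le> 2" by linarith
    then have "(norm (emb (\<lambda>x. complex_of_real (s N x))))\<^sup>2 \<le> 2\<^sup>2" by (intro power_mono) auto
    then show ?thesis by simp
  qed
  have nn: "(\<integral>\<^sup>+ x. ennreal ((s N x)\<^sup>2) \<partial>lborel) \<le> 4" for N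
  proof -
    have "integrable lborel (\<lambda>x. (s N x)\<^sup>2)" using sL[of N] by (simp add: Lp2_iff)
    then have "(\<integral>\<^sup>+ x. ennreal ((s N x)\<^sup>2) \<partial>lborel) = ennreal (LINT x|lborel. (s N x)\<^sup>2)"
      by (intro nn_integral_eq_integral) auto
    also have "(LINT x|lborel. (s N x)\<^sup>2) = (norm (emb (\<lambda>x. complex_of_real (s N x))))\<^sup>2"
      using norm_emb_sq[of "\<lambda>x. complex_of_real (s N x)"] sL[of N] by simp
    finally show ?thesis using s2[of N] by (metis ennreal_leI ennreal_numeral)
  qed
  have d0: "0 \<le> d n x" for n x by (simp add: d_def)
  have mono: "incseq (\<lambda>N x. ennreal ((s N x)\<^sup>2))"
    unfolding s_def using d0
    by (auto simp: mono_iff_le_Suc le_fun_def intro!: ennreal_leI power_mono sum_nonneg)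
  have "(\<integral>\<^sup>+ x. (SUP N. ennreal ((s N x)\<^sup>2)) \<partial>lborel) \<le> 4"
    by (subst nn_integral_monotone_convergence_SUP[OF mono]) (auto intro!: SUP_least nn)
  then have "(\<integral>\<^sup>+ x. (SUP N. ennreal ((s N x)\<^sup>2)) \<partial>lborel) \<noteq> \<infinity>" by (auto simp: top_unique)
  then have fin: "AE x in lborel. (SUP N. ennreal ((s N x)\<^sup>2)) \<noteq> \<infinity>"
    by (intro nn_integral_PInf_AE) auto
  have conv: "AE x in lborel. summable (\<lambda>n. d n x)"
    using fin
  proof eventually_elim
    case (elim x)
    then obtain c where c: "0 \<le> c" "(SUP N. ennreal ((s N x)\<^sup>2)) = ennreal c"
      by (cases "SUP N. ennreal ((s N x)\<^sup>2)") auto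
    have "s N x \<le> sqrt c" for N
    proof -
      have "ennreal ((s N x)\<^sup>2) \<le> ennreal c" unfolding c(2)[symmetric] by (rule SUP_upper) simp
      then have "(s N x)\<^sup>2 \<le> c" using c(1) by simp
      then show ?thesis by (rule real_le_rsqrt)
    qed
    then show ?case using d0 by (intro bounded_imp_summable[of _ "sqrt c"]) (auto simp: s_def simp flip: lessThan_Suc_atMost simp del: sum.lessThan_Suc)
  qed
  define h where "h = (\<lambda>x. lim (\<lambda>n. rep_l2 (X n) x))"
  have hm [measurable]: "h \<in> borel_measurable lborel" unfolding h_def by measurable
  define w where "w = (\<lambda>x. \<Sum>n. d n x)"
  have wm [measurable]: "w \<in> borel_measurable lborel" unfolding w_def by measurable
  have tele: "cmod (rep_l2 (X N) x - rep_l2 (X 0) x) \<le> s N x" for N x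
  proof -
    have "rep_l2 (X N) x - rep_l2 (X 0) x = (\<Sum>n<N. rep_l2 (X (Suc n)) x - rep_l2 (X n) x)"
      by (simp add: sum_lessThan_telescope[of "\<lambda>n. rep_l2 (X n) x"])
    then show ?thesis unfolding s_def d_def by (simp add: norm_sum)
  qed
  have sw: "s N x \<le> w x" if "summable (\<lambda>n. d n x)" for N x
    using that d0 by (auto simp: w_def s_def intro: sum_le_suminf)
  have wL: "(\<lambda>x. complex_of_real (w x)) \<in> Lp 2"
  proof -
    have "(\<integral>\<^sup>+ x. ennreal ((w x)\<^sup>2) \<partial>lborel) \<le> (\<integral>\<^sup>+ x. (SUP N. ennreal ((s N x)\<^sup>2)) \<partial>lborel)"
    proof (rule nn_integral_mono_AE)
      show "AE x in lborel. ennreal ((w x)\<^sup>2) \<le> (SUP N. ennreal ((s N x)\<^sup>2))"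
        using conv
      proof eventually_elim
        case (elim x)
        then have "(\<lambda>N. s N x) \<longlonglongrightarrow> w x" unfolding s_def w_def by (simp add: summable_LIMSEQ)
        then have "(\<lambda>N. ennreal ((s N x)\<^sup>2)) \<longlonglongrightarrow> ennreal ((w x)\<^sup>2)"
          by (intro tendsto_ennrealI tendsto_power)
        then show ?case by (rule LIMSEQ_le_const2) (auto intro!: SUP_upper)
      qed
    qed
    also have "\<dots> \<le> 4" by fact
    finally have "(\<integral>\<^sup>+ x. ennreal ((w x)\<^sup>2) \<partial>lborel) < \<infinity>" by (rule le_less_trans) (simp add: less_top)
    then have "integrable lborel (\<lambda>x. (w x)\<^sup>2)" by (intro integrableI_nonneg) auto
    then show ?thesis by (simp add: Lp2_iff)
  qed
  \<comment> \<open>Subtracting \<open>X 0\<close> makes the sum \<open>w\<close> of all increments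
    a dominating function.\<close>
  have "(\<lambda>n. emb (\<lambda>x. rep_l2 (X n) x - rep_l2 (X 0) x)) \<longlonglongrightarrow> emb (\<lambda>x. h x - rep_l2 (X 0) x)"
  proof (rule l2_dominated_convergence[OF _ _ wL])
    show "AE x in lborel. cmod (rep_l2 (X n) x - rep_l2 (X 0) x) \<le> cmod (complex_of_real (w x))" for n
      using conv
    proof eventually_elim
      case (elim x)
      have "s n x \<le> w x" using sw[OF elim] .
      moreover have "0 \<le> s n x" unfolding s_def by (intro sum_nonneg d0)
      ultimately show ?case using tele[of n x] by simp
    qed
    show "AE x in lborel. (\<lambda>n. rep_l2 (X n) x - rep_l2 (X 0) x) \<longlonglongrightarrow> h x - rep_l2 (X 0) x"
      using conv
    proof eventually_elim
      case (elim x)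
      then have "summable (\<lambda>n. rep_l2 (X (Suc n)) x - rep_l2 (X n) x)"
        unfolding d_def by (rule summable_norm_cancel)
      then have "convergent (\<lambda>N. \<Sum>n<N. rep_l2 (X (Suc n)) x - rep_l2 (X n) x)"
        by (simp add: summable_iff_convergent)
      then have "convergent (\<lambda>N. (rep_l2 (X N) x - rep_l2 (X 0) x))"
        by (simp add: sum_lessThan_telescope[of "\<lambda>n. rep_l2 (X n) x"])
      then have "convergent (\<lambda>N. (rep_l2 (X N) x - rep_l2 (X 0) x) + rep_l2 (X 0) x)"
        by (intro convergent_add convergent_const)
      then have "(\<lambda>N. rep_l2 (X N) x) \<longlonglongrightarrow> h x" by (simp add: h_def convergent_LIMSEQ_iff)
      then show ?case by (intro tendsto_intros)
    qed
  qed auto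
  then have "convergent (\<lambda>n. X n - X 0)" by (auto simp: convergent_def minus_l2_def[symmetric])
  from convergent_add[OF this convergent_const[of "X 0"]] show ?thesis by simp
qed

instance l2 :: banach
proof
  fix X :: "nat \<Rightarrow> l2"
  assume C: "Cauchy X"
  \<comment> \<open>Choosing each index beyond the previous one, with the tail within
    \<open>(1/2)^n\<close>, gives a subsequence to which the criterion for fast sequences
    applies.\<close>
  have "\<exists>r. \<forall>n. (\<forall>m\<ge>r n. norm (X m - X (r n)) \<le> (1/2)^n) \<and> r n < r (Suc n)"
  proof (rule dependent_nat_choice)
    have key: "\<exists>M. \<forall>m\<ge>M. \<forall>k\<ge>M. norm (X m - X k) < (1/2)^n" for n
      using CauchyD[OF C, of "(1/2)^n"] by auto
    show "\<exists>x. \<forall>m\<ge>x. norm (X m - X x) \<le> (1/2) ^ 0" using key[of 0] by (meson less_imp_le order_refl)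
    show "\<exists>y. (\<forall>m\<ge>y. norm (X m - X y) \<le> (1/2) ^ Suc n) \<and> x < y" for x n
    proof -
      obtain M where "\<forall>m\<ge>M. \<forall>k\<ge>M. norm (X m - X k) < (1/2)^Suc n" using key by blast
      then show ?thesis by (intro exI[of _ "max M (Suc x)"]) (auto intro: less_imp_le)
    qed
  qed
  then obtain r where r: "\<And>n m. m \<ge> r n \<Longrightarrow> norm (X m - X (r n)) \<le> (1/2)^n" "\<And>n. r n < r (Suc n)"
    by blast
  have "convergent (X \<circ> r)"
    by (rule l2_fast_Cauchy_convergent) (use r in \<open>auto intro: less_imp_le\<close>)
  moreover have "strict_mono r" using r(2) by (simp add: strict_mono_Suc_iff)
  ultimately obtain L where L: "(X \<circ> r) \<longlonglongrightarrow> L" by (auto simp: convergent_def)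
  from Cauchy_converges_subseq[OF C \<open>strict_mono r\<close> L] show "convergent X" by (auto simp: convergent_def)
qed

section \<open>Operators on the Hilbert space\<close>

definition bm :: "(real \<Rightarrow> complex) \<Rightarrow> bool" where
  "bm m \<longleftrightarrow> m \<in> borel_measurable borel \<and> (\<exists>B. \<forall>x. cmod (m x) \<le> B)"

definition mulf :: "(real \<Rightarrow> complex) \<Rightarrow> l2 \<Rightarrow> l2" where
  "mulf m F = emb (\<lambda>x. m x * rep_l2 F x)"

lemma bmI: "m \<in> borel_measurable borel \<Longrightarrow> (\<And>x. cmod (m x) \<le> B) \<Longrightarrow> bm m"
  unfolding bm_def by blast

lemma bm_measurable [measurable_dest]: "bm m \<Longrightarrow> m \<in> borel_measurable borel"
  by (simp add: bm_def)

lemma bm_const [simp, intro]: "bm (\<lambda>x. c)" by (rule bmI[of _ "cmod c"]) auto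

lemma bm_mult [intro]:
  assumes "bm m" "bm n" shows "bm (\<lambda>x. m x * n x)"
proof -
  obtain A B where "\<And>x. cmod (m x) \<le> A" "\<And>x. cmod (n x) \<le> B" using assms by (auto simp: bm_def)
  then show ?thesis using assms
    by (intro bmI[of _ "A * B"]) (auto simp: norm_mult intro!: mult_mono' borel_measurable_times bm_measurable)
qed

lemma bm_add [intro]:
  assumes "bm m" "bm n" shows "bm (\<lambda>x. m x + n x)"
proof -
  obtain A B where "\<And>x. cmod (m x) \<le> A" "\<And>x. cmod (n x) \<le> B" using assms by (auto simp: bm_def)
  then show ?thesis using assms
    by (intro bmI[of _ "A + B"]) (auto intro!: norm_triangle_le add_mono borel_measurable_add bm_measurable)
qed

lemma bm_cis [intro]: "g \<in> borel_measurable borel \<Longrightarrow> bm (\<lambda>x. cis (g x))"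
proof (rule bmI[of _ 1])
  assume "g \<in> borel_measurable borel"
  then show "(\<lambda>x. cis (g x)) \<in> borel_measurable borel"
    by (rule measurable_compose) (auto intro!: borel_measurable_continuous_onI continuous_intros)
qed auto

lemma measurable_cis [measurable]: "cis \<in> borel_measurable borel"
  by (auto intro!: borel_measurable_continuous_onI continuous_intros)

lemma mulf_Lp2: "bm m \<Longrightarrow> f \<in> Lp 2 \<Longrightarrow> (\<lambda>x. m x * f x) \<in> Lp 2"
  unfolding bm_def by (auto intro: Lp2_bounded_mult)

lemma rep_mulf': "(\<lambda>x. m x * rep_l2 F x) \<in> Lp 2 \<Longrightarrow> AE x in lborel. rep_l2 (mulf m F) x = m x * rep_l2 F x"
  unfolding mulf_def by (rule rep_emb)

lemma rep_mulf: "bm m \<Longrightarrow> AE x in lborel. rep_l2 (mulf m F) x = m x * rep_l2 F x"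
  by (intro rep_mulf' mulf_Lp2) auto

lemma mulf_emb:
  assumes "bm m" "f \<in> Lp 2" shows "mulf m (emb f) = emb (\<lambda>x. m x * f x)"
  unfolding mulf_def
proof (rule emb_cong)
  show "AE x in lborel. m x * rep_l2 (emb f) x = m x * f x"
    using rep_emb[OF assms(2)] by eventually_elim simp
qed (use assms in \<open>auto intro: mulf_Lp2\<close>)

lemma norm_mulf_le:
  assumes "m \<in> borel_measurable borel" "\<And>x. cmod (m x) \<le> B"
  shows "norm (mulf m F) \<le> B * norm F"
proof -
  have "0 \<le> B" using assms(2)[of 0] norm_ge_zero order_trans by blast
  have "norm (emb (\<lambda>x. m x * rep_l2 F x)) \<le> B * norm (emb (rep_l2 F))"
    by (rule norm_emb_mono)
      (use assms bmI[OF assms] \<open>0 \<le> B\<close> in \<open>auto simp: norm_mult intro!: mult_right_mono mulf_Lp2\<close>)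
  then show ?thesis by (simp add: mulf_def)
qed

lemma mulf_add:
  assumes a: "bm m"
  shows "mulf m (F + G) = mulf m F + mulf m G"
  by (rule l2_eqI) (use rep_mulf[OF a, of "F + G"] rep_mulf[OF a, of F] rep_mulf[OF a, of G] rep_plus[of F G]
    rep_plus[of "mulf m F" "mulf m G"] in \<open>eventually_elim\<close>, simp add: distrib_left)

lemma mulf_scaleR:
  assumes a: "bm m"
  shows "mulf m (r *\<^sub>R F) = r *\<^sub>R mulf m F"
  by (rule l2_eqI) (use rep_mulf[OF a, of "r *\<^sub>R F"] rep_mulf[OF a, of F] rep_scaleR[of r F]
    rep_scaleR[of r "mulf m F"] in \<open>eventually_elim\<close>, simp)

lemma bounded_linear_mulf:
  assumes "bm m" shows "bounded_linear (mulf m)"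
proof -
  obtain B where "m \<in> borel_measurable borel" "\<And>x. cmod (m x) \<le> B" using assms by (auto simp: bm_def)
  with assms show ?thesis
    by (intro bounded_linear_intro[of _ B])
      (auto simp: mulf_add mulf_scaleR mult.commute[of _ B] intro: norm_mulf_le)
qed

lemma mulf_mulf:
  assumes a: "bm m" "bm n"
  shows "mulf m (mulf n F) = mulf (\<lambda>x. m x * n x) F"
  by (rule l2_eqI) (use rep_mulf[OF a(1), of "mulf n F"] rep_mulf[OF a(2), of F] rep_mulf[OF bm_mult[OF a], of F]
     in \<open>eventually_elim\<close>, simp add: mult.assoc)

lemma mulf_add_fun:
  assumes a: "bm m" "bm n"
  shows "mulf (\<lambda>x. m x + n x) F = mulf m F + mulf n F"
  by (rule l2_eqI) (use rep_mulf[OF bm_add[OF a], of F] rep_mulf[OF a(1), of F] rep_mulf[OF a(2), of F]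
     rep_plus[of "mulf m F" "mulf n F"] in \<open>eventually_elim\<close>, simp add: distrib_right)

lemma mulf_one [simp]: "mulf (\<lambda>x. 1) F = F"
  by (simp add: mulf_def)

lemma mulf_of_real: "mulf (\<lambda>x. complex_of_real r) F = r *\<^sub>R F"
  by (simp add: mulf_def scaleR_l2_def scaleR_conv_of_real)

text \<open>Multiplication by the conjugate is the inverse, and both operators are
  contractions.\<close>

lemma norm_mulf_unit:
  assumes "bm m" "\<And>x. cmod (m x) = 1" shows "norm (mulf m F) = norm F"
proof (rule antisym)
  show "norm (mulf m F) \<le> norm F" using norm_mulf_le[of m 1 F] assms by (auto simp: bm_def)
  have bc: "bm (\<lambda>x. cnj (m x))"
    by (rule bmI[of _ 1]) (use assms in \<open>auto intro!: borel_measurable_cnj bm_measurable\<close>)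
  have "mulf (\<lambda>x. cnj (m x)) (mulf m F) = F"
    using assms bc by (simp add: mulf_mulf mult.commute[of "cnj _"] flip: complex_norm_square)
  then show "norm F \<le> norm (mulf m F)"
    using norm_mulf_le[of "\<lambda>x. cnj (m x)" 1 "mulf m F"] assms bc by (auto simp: bm_def)
qed

text \<open>Dominated convergence for one fixed \<open>F\<close>: bounded symbols converging
  pointwise give strong convergence, while the operator norms need not converge.\<close>

lemma mulf_tendsto_sequentially:
  assumes "\<And>n. m n \<in> borel_measurable borel" "m' \<in> borel_measurable borel"
    and "\<And>n x. cmod (m n x) \<le> B" "\<And>x. (\<lambda>n. m n x) \<longlonglongrightarrow> m' x"
  shows "(\<lambda>n. mulf (m n) F) \<longlonglongrightarrow> mulf m' F"
  unfolding mulf_def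
proof (rule l2_dominated_convergence[where w = "\<lambda>x. complex_of_real B * rep_l2 F x"])
  note [measurable] = assms(1,2)
  show "(\<lambda>x. complex_of_real B * rep_l2 F x) \<in> Lp 2" by (auto intro: Lp2_cmult)
  have "0 \<le> B" using assms(3)[of 0 0] norm_ge_zero order_trans by blast
  then show "AE x in lborel. cmod (m n x * rep_l2 F x) \<le> cmod (complex_of_real B * rep_l2 F x)" for n
    using assms(3) by (auto simp: norm_mult intro!: mult_right_mono)
  show "AE x in lborel. (\<lambda>n. m n x * rep_l2 F x) \<longlonglongrightarrow> m' x * rep_l2 F x"
    using assms(4) by (auto intro!: tendsto_intros)
  show "(\<lambda>x. m n x * rep_l2 F x) \<in> borel_measurable lborel" for n by measurable
  show "(\<lambda>x. m' x * rep_l2 F x) \<in> borel_measurable lborel" by measurable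
qed

lemma mulf_tendsto_at:
  fixes m :: "'a::first_countable_topology \<Rightarrow> real \<Rightarrow> complex"
  assumes "\<And>t. m t \<in> borel_measurable borel" "m' \<in> borel_measurable borel"
    and "\<And>t x. cmod (m t x) \<le> B" "\<And>x. ((\<lambda>t. m t x) \<longlongrightarrow> m' x) (at t0 within S)"
  shows "((\<lambda>t. mulf (m t) F) \<longlongrightarrow> mulf m' F) (at t0 within S)"
  unfolding tendsto_at_iff_sequentially comp_def
proof (intro allI impI)
  fix X assume X: "\<forall>i. X i \<in> S - {t0}" "X \<longlonglongrightarrow> t0"
  show "(\<lambda>n. mulf (m (X n)) F) \<longlonglongrightarrow> mulf m' F"
    by (rule mulf_tendsto_sequentially)
      (use assms X in \<open>auto simp: tendsto_at_iff_sequentially comp_def\<close>)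
qed

lemma mulf_tendsto_at_top:
  fixes m :: "real \<Rightarrow> real \<Rightarrow> complex"
  assumes "\<And>t. m t \<in> borel_measurable borel" "m' \<in> borel_measurable borel"
    and "\<And>t x. cmod (m t x) \<le> B" "\<And>x. ((\<lambda>t. m t x) \<longlongrightarrow> m' x) at_top"
  shows "((\<lambda>t. mulf (m t) F) \<longlongrightarrow> mulf m' F) at_top"
proof (rule tendsto_at_topI_sequentially)
  fix X :: "nat \<Rightarrow> real" assume X: "filterlim X at_top sequentially"
  show "(\<lambda>n. mulf (m (X n)) F) \<longlonglongrightarrow> mulf m' F"
    by (rule mulf_tendsto_sequentially)
      (use assms X in \<open>auto intro: filterlim_compose[OF assms(4)]\<close>)
qed

section \<open>Conjugation, reflection and translation on the Hilbert space\<close>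

lemma AE_lborel_affine:
  fixes P :: "real \<Rightarrow> bool"
  assumes "AE x in lborel. P x" "c \<noteq> 0"
  shows "AE x in lborel. P (t + c * x)"
proof -
  obtain N where N: "{x \<in> space lborel. \<not> P x} \<subseteq> N" "emeasure lborel N = 0" "N \<in> sets lborel"
    using assms(1) by (auto elim: AE_E)
  have "0 = emeasure lborel N" using N by simp
  also have "\<dots> = emeasure (density (distr lborel borel (\<lambda>x. t + c * x)) (\<lambda>_. ennreal \<bar>c\<bar>)) N"
    using lborel_real_affine[OF assms(2), of t] by simp
  also have "\<dots> = \<bar>c\<bar> * emeasure (distr lborel borel (\<lambda>x. t + c * x)) N"
    using N by (subst emeasure_density) (auto simp: nn_integral_cmult)
  also have "emeasure (distr lborel borel (\<lambda>x. t + c * x)) N = emeasure lborel ((\<lambda>x. t + c * x) -` N)"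
    using N by (subst emeasure_distr) auto
  finally have "emeasure lborel ((\<lambda>x. t + c * x) -` N) = 0" using assms(2) by simp
  moreover have "(\<lambda>x. t + c * x) -` N \<in> sets lborel"
    using measurable_sets[of "\<lambda>x. t + c * x" lborel borel N] N by auto
  ultimately show ?thesis using N by (intro AE_I[of _ _ "(\<lambda>x. t + c * x) -` N"]) auto
qed

lemma Lp2_affine:
  assumes "f \<in> Lp 2" "c \<noteq> 0" shows "(\<lambda>x. f (t + c * x)) \<in> Lp 2"
proof -
  note [measurable] = Lp2_measurable[OF assms(1)]
  have "integrable lborel (\<lambda>x. (cmod (f (t + c * x)))\<^sup>2)"
    using lborel_integrable_real_affine[of "\<lambda>x. (cmod (f x))\<^sup>2" c t] assms by (auto simp: Lp2_iff)
  then show ?thesis by (simp add: Lp2_iff)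
qed

lemma norm_emb_affine:
  assumes "f \<in> Lp 2" "\<bar>c\<bar> = 1" shows "norm (emb (\<lambda>x. f (t + c * x))) = norm (emb f)"
proof -
  have "c \<noteq> 0" using assms(2) by auto
  then have "(norm (emb (\<lambda>x. f (t + c * x))))\<^sup>2 = (norm (emb f))\<^sup>2"
    using assms lborel_integral_real_affine[of c "\<lambda>x. (cmod (f x))\<^sup>2" t]
    by (simp add: norm_emb_sq Lp2_affine)
  then show ?thesis by simp
qed

definition lcnj :: "l2 \<Rightarrow> l2" where "lcnj F = emb (\<lambda>x. cnj (rep_l2 F x))"
definition refl2 :: "l2 \<Rightarrow> l2" where "refl2 F = emb (\<lambda>x. rep_l2 F (- x))"
definition tr :: "real \<Rightarrow> l2 \<Rightarrow> l2" where "tr h F = emb (\<lambda>x. rep_l2 F (x + h))"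

lemma rep_lcnj: "AE x in lborel. rep_l2 (lcnj F) x = cnj (rep_l2 F x)"
  unfolding lcnj_def by (intro rep_emb Lp2_cnj) auto

lemma rep_refl2: "AE x in lborel. rep_l2 (refl2 F) x = rep_l2 F (- x)"
  unfolding refl2_def using Lp2_affine[of "rep_l2 F" "-1" 0] by (intro rep_emb) auto

lemma rep_tr: "AE x in lborel. rep_l2 (tr h F) x = rep_l2 F (x + h)"
  unfolding tr_def using Lp2_affine[of "rep_l2 F" 1 h] by (intro rep_emb) (auto simp: add.commute)

lemma AE_refl: "AE x in lborel. P x \<Longrightarrow> AE x in lborel. P (- (x::real))"
  using AE_lborel_affine[of P "-1" 0] by simp

lemma AE_shift: "AE x in lborel. P x \<Longrightarrow> AE x in lborel. P (x + h)" for h :: real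
  using AE_lborel_affine[of P 1 h] by (simp add: add.commute)

lemma lcnj_emb:
  assumes "f \<in> Lp 2" shows "lcnj (emb f) = emb (\<lambda>x. cnj (f x))"
  by (rule l2_eqI) (use rep_lcnj[of "emb f"] rep_emb[OF assms] rep_emb[OF Lp2_cnj[OF assms]] in \<open>eventually_elim\<close>, simp)

lemma refl2_emb:
  assumes "f \<in> Lp 2" shows "refl2 (emb f) = emb (\<lambda>x. f (- x))"
proof (rule l2_eqI)
  have "(\<lambda>x. f (- x)) \<in> Lp 2" using Lp2_affine[OF assms, of "-1" 0] by simp
  from rep_emb[OF this] show "AE x in lborel. rep_l2 (refl2 (emb f)) x = rep_l2 (emb (\<lambda>x. f (- x))) x"
    using rep_refl2[of "emb f"] AE_refl[OF rep_emb[OF assms]] by eventually_elim simp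
qed

lemma tr_emb:
  assumes "f \<in> Lp 2" shows "tr h (emb f) = emb (\<lambda>x. f (x + h))"
proof (rule l2_eqI)
  have "(\<lambda>x. f (x + h)) \<in> Lp 2" using Lp2_affine[OF assms, of 1 h] by (simp add: add.commute)
  from rep_emb[OF this] show "AE x in lborel. rep_l2 (tr h (emb f)) x = rep_l2 (emb (\<lambda>x. f (x + h))) x"
    using rep_tr[of h "emb f"] AE_shift[OF rep_emb[OF assms]] by eventually_elim simp
qed

lemma norm_lcnj [simp]: "norm (lcnj F) = norm F"
proof -
  have "(norm (lcnj F))\<^sup>2 = (norm F)\<^sup>2"
    unfolding lcnj_def by (subst norm_emb_sq) (auto intro: Lp2_cnj simp: norm_l2_sq)
  then show ?thesis by simp
qed

lemma norm_refl2 [simp]: "norm (refl2 F) = norm F"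
  using norm_emb_affine[of "rep_l2 F" "-1" 0] by (simp add: refl2_def)

lemma norm_tr [simp]: "norm (tr h F) = norm F"
  using norm_emb_affine[of "rep_l2 F" 1 h] by (simp add: tr_def add.commute)

lemma bounded_linear_lcnj: "bounded_linear lcnj"
proof (rule bounded_linear_intro[of _ 1])
  show "lcnj (F + G) = lcnj F + lcnj G" for F G
    by (rule l2_eqI) (use rep_lcnj[of "F + G"] rep_lcnj[of F] rep_lcnj[of G] rep_plus[of F G]
      rep_plus[of "lcnj F" "lcnj G"] in \<open>eventually_elim\<close>, simp)
  show "lcnj (r *\<^sub>R F) = r *\<^sub>R lcnj F" for r F
    by (rule l2_eqI) (use rep_lcnj[of "r *\<^sub>R F"] rep_lcnj[of F] rep_scaleR[of r F]
      rep_scaleR[of r "lcnj F"] in \<open>eventually_elim\<close>, simp add: scaleR_conv_of_real)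
qed auto

lemma bounded_linear_refl2: "bounded_linear refl2"
proof (rule bounded_linear_intro[of _ 1])
  show "refl2 (F + G) = refl2 F + refl2 G" for F G
    by (rule l2_eqI) (use rep_refl2[of "F + G"] rep_refl2[of F] rep_refl2[of G] AE_refl[OF rep_plus[of F G]]
      rep_plus[of "refl2 F" "refl2 G"] in \<open>eventually_elim\<close>, simp)
  show "refl2 (r *\<^sub>R F) = r *\<^sub>R refl2 F" for r F
    by (rule l2_eqI) (use rep_refl2[of "r *\<^sub>R F"] rep_refl2[of F] AE_refl[OF rep_scaleR[of r F]]
      rep_scaleR[of r "refl2 F"] in \<open>eventually_elim\<close>, simp)
qed auto

lemma bounded_linear_tr: "bounded_linear (tr h)"
proof (rule bounded_linear_intro[of _ 1])
  show "tr h (F + G) = tr h F + tr h G" for F G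
    by (rule l2_eqI) (use rep_tr[of h "F + G"] rep_tr[of h F] rep_tr[of h G] AE_shift[OF rep_plus[of F G], of h]
      rep_plus[of "tr h F" "tr h G"] in \<open>eventually_elim\<close>, simp)
  show "tr h (r *\<^sub>R F) = r *\<^sub>R tr h F" for r F
    by (rule l2_eqI) (use rep_tr[of h "r *\<^sub>R F"] rep_tr[of h F] AE_shift[OF rep_scaleR[of r F], of h]
      rep_scaleR[of r "tr h F"] in \<open>eventually_elim\<close>, simp)
qed auto

lemma lcnj_lcnj [simp]: "lcnj (lcnj F) = F"
  by (rule l2_eqI) (use rep_lcnj[of F] rep_lcnj[of "lcnj F"] in \<open>eventually_elim\<close>, simp)

lemma refl2_refl2 [simp]: "refl2 (refl2 F) = F"
  by (rule l2_eqI) (use rep_refl2[of "refl2 F"] AE_refl[OF rep_refl2[of F]] in \<open>eventually_elim\<close>, simp)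

lemma lcnj_refl2: "lcnj (refl2 F) = refl2 (lcnj F)"
  by (rule l2_eqI) (use rep_refl2[of F] rep_refl2[of "lcnj F"] rep_lcnj[of "refl2 F"] AE_refl[OF rep_lcnj[of F]]
    in \<open>eventually_elim\<close>, simp)

lemma bm_cnj [intro]: "bm m \<Longrightarrow> bm (\<lambda>x. cnj (m x))"
  by (auto simp: bm_def intro!: borel_measurable_cnj)

lemma bm_uminus [intro]: "bm m \<Longrightarrow> bm (\<lambda>x. m (- x))"
  by (auto simp: bm_def)

lemma lcnj_mulf:
  assumes a: "bm m"
  shows "lcnj (mulf m F) = mulf (\<lambda>x. cnj (m x)) (lcnj F)"
  by (rule l2_eqI) (use rep_lcnj[of "mulf m F"] rep_mulf[OF a, of F] rep_mulf[OF bm_cnj[OF a], of "lcnj F"] rep_lcnj[of F]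
    in \<open>eventually_elim\<close>, simp)

lemma refl2_mulf:
  assumes a: "bm m"
  shows "refl2 (mulf m F) = mulf (\<lambda>x. m (- x)) (refl2 F)"
  by (rule l2_eqI) (use rep_refl2[of "mulf m F"] AE_refl[OF rep_mulf[OF a, of F]] rep_mulf[OF bm_uminus[OF a], of "refl2 F"] rep_refl2[of F]
    in \<open>eventually_elim\<close>, simp)

lemma inner_mulf:
  assumes "bm m" shows "inner (mulf m F) G = inner F (mulf (\<lambda>x. cnj (m x)) G)"
proof -
  note [measurable] = bm_measurable[OF assms]
  have "(LINT x|lborel. rep_l2 (mulf m F) x * cnj (rep_l2 G x)) = (LINT x|lborel. rep_l2 F x * cnj (rep_l2 (mulf (\<lambda>x. cnj (m x)) G) x))"
    by (intro integral_cong_AE) (measurable, use rep_mulf[OF assms, of F] rep_mulf[OF bm_cnj[OF assms], of G] in eventually_elim, simp)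
  then show ?thesis by (simp add: inner_l2_def)
qed

section \<open>The Fourier transform\<close>

definition fi :: "(real \<Rightarrow> complex) \<Rightarrow> real \<Rightarrow> complex" where
  "fi f \<xi> = (LINT x|lborel. cis (- (x * \<xi>)) * f x)"

lemma fi_measurable [measurable]:
  assumes [measurable]: "f \<in> borel_measurable borel" shows "fi f \<in> borel_measurable borel"
  unfolding fi_def by measurable

lemma fi_integrable: "integrable lborel f \<Longrightarrow> integrable lborel (\<lambda>x. cis (g x) * f x)"
  if [measurable]: "g \<in> borel_measurable borel"
  by (rule Bochner_Integration.integrable_bound[of _ f]) (auto simp: norm_mult)

lemma fi_bound: "integrable lborel f \<Longrightarrow> cmod (fi f \<xi>) \<le> (LINT x|lborel. cmod (f x))"
  unfolding fi_def by (rule order_trans[OF integral_norm_bound]) (simp add: norm_mult)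

lemma fi_add:
  assumes "integrable lborel f" "integrable lborel g"
  shows "fi (\<lambda>x. f x + g x) = (\<lambda>\<xi>. fi f \<xi> + fi g \<xi>)"
proof
  fix \<xi>
  show "fi (\<lambda>x. f x + g x) \<xi> = fi f \<xi> + fi g \<xi>"
    unfolding fi_def using fi_integrable[OF _ assms(1), of "\<lambda>x. - (x * \<xi>)"] fi_integrable[OF _ assms(2), of "\<lambda>x. - (x * \<xi>)"]
    by (simp add: distrib_left)
qed

lemma fi_cmult: "fi (\<lambda>x. c * f x) = (\<lambda>\<xi>. c * fi f \<xi>)"
proof
  fix \<xi>
  have "fi (\<lambda>x. c * f x) \<xi> = (LINT x|lborel. c * (cis (- (x * \<xi>)) * f x))"
    unfolding fi_def by (intro Bochner_Integration.integral_cong) auto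
  then show "fi (\<lambda>x. c * f x) \<xi> = c * fi f \<xi>" by (simp add: fi_def)
qed

lemma fi_zero: "fi (\<lambda>x. 0) = (\<lambda>\<xi>. 0)"
  by (simp add: fi_def fun_eq_iff)

text \<open>The kernel is symmetric in the two variables, so Fubini moves the transform to the other
  factor; no conjugate appears.\<close>

lemma fi_Parseval:
  assumes "integrable lborel f" "integrable lborel g"
  shows "(LINT \<xi>|lborel. fi f \<xi> * g \<xi>) = (LINT x|lborel. f x * fi g x)"
proof -
  note [measurable] = borel_measurable_integrable[OF assms(1), simplified] borel_measurable_integrable[OF assms(2), simplified]
  have I: "integrable (lborel \<Otimes>\<^sub>M lborel) (case_prod (\<lambda>x \<xi>. cis (- (x * \<xi>)) * f x * g \<xi>))"
  proof (rule lborel_pair.Fubini_integrable)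
    show "integrable lborel (\<lambda>x. LINT y|lborel. norm (case (x, y) of (x, \<xi>) \<Rightarrow> cis (- (x * \<xi>)) * f x * g \<xi>))"
      using assms by (auto simp: norm_mult)
    have "integrable lborel (\<lambda>y. cis (- (x * y)) * (f x * g y))" for x
      by (rule fi_integrable) (use assms in auto)
    then show "AE x in lborel. integrable lborel (\<lambda>y. case (x, y) of (x, \<xi>) \<Rightarrow> cis (- (x * \<xi>)) * f x * g \<xi>)"
      by (simp add: mult.assoc)
  qed measurable
  have "(LINT \<xi>|lborel. fi f \<xi> * g \<xi>) = (LINT \<xi>|lborel. LINT x|lborel. cis (- (x * \<xi>)) * f x * g \<xi>)"
    unfolding fi_def by simp
  also have "\<dots> = (LINT x|lborel. LINT \<xi>|lborel. cis (- (x * \<xi>)) * f x * g \<xi>)"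
    by (rule lborel_pair.Fubini_integral[OF I])
  also have "\<dots> = (LINT x|lborel. LINT \<xi>|lborel. f x * (cis (- (\<xi> * x)) * g \<xi>))"
    by (simp add: mult_ac)
  also have "\<dots> = (LINT x|lborel. f x * fi g x)"
    unfolding fi_def by simp
  finally show ?thesis .
qed

text \<open>The Gaussian regularization turns the \<open>L\<^sup>2\<close> norm of the transform into a quadratic form with a
  positive kernel of total mass \<open>2 * pi\<close>, which Schur's test bounds.\<close>

definition gw :: "nat \<Rightarrow> real \<Rightarrow> real" where
  "gw n \<xi> = exp (- (\<xi> / Suc n)\<^sup>2 / 2)"

lemma gw_bounds: "0 \<le> gw n x" "gw n x \<le> 1"
  by (auto simp: gw_def)

lemma gw_measurable [measurable]: "gw n \<in> borel_measurable borel"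
  unfolding gw_def by measurable

lemma gw_eq: "gw n x = sqrt (2 * pi) * std_normal_density (x / Suc n)"
  by (simp add: gw_def std_normal_density_def)

lemma integrable_gw: "integrable lborel (gw n)"
proof -
  have "integrable lborel (\<lambda>x. std_normal_density (0 + (1 / Suc n) * x))"
    by (subst lborel_integrable_real_affine_iff) auto
  then show ?thesis unfolding gw_eq[abs_def] by simp
qed

lemma char_std_normal_integral:
  "(LINT x|lborel. cis (t * x) * complex_of_real (std_normal_density x)) = complex_of_real (exp (- (t\<^sup>2) / 2))"
proof -
  have "char std_normal_distribution t = (LINT x|lborel. std_normal_density x *\<^sub>R exp (\<i> * complex_of_real (t * x)))"
    unfolding char_def by (subst integral_density) auto
  also have "\<dots> = (LINT x|lborel. cis (t * x) * complex_of_real (std_normal_density x))"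
    by (simp add: cis_conv_exp scaleR_conv_of_real mult.commute)
  finally show ?thesis by (simp add: char_std_normal_distribution)
qed

text \<open>The Gaussian integral is the characteristic function of the standard normal
  distribution, rescaled. The result is an approximate identity of mass \<open>2 * pi\<close> at
  scale \<open>1 / Suc n\<close>; the successor avoids a zero denominator.\<close>

lemma fourier_gw:
  "(LINT \<xi>|lborel. cis (z * \<xi>) * complex_of_real (gw n \<xi>)) = complex_of_real (2 * pi * normal_density 0 (1 / Suc n) z)"
proof -
  have "(LINT \<xi>|lborel. cis (z * \<xi>) * complex_of_real (gw n \<xi>)) =
     \<bar>real (Suc n)\<bar> *\<^sub>R (LINT x|lborel. cis (z * (0 + Suc n * x)) * complex_of_real (gw n (0 + Suc n * x)))"
    by (rule lborel_integral_real_affine) auto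
  also have "\<dots> = Suc n * (LINT x|lborel. complex_of_real (sqrt (2 * pi)) * (cis ((z * Suc n) * x) * complex_of_real (std_normal_density x)))"
    by (simp add: gw_eq scaleR_conv_of_real mult_ac del: of_nat_Suc)
  also have "\<dots> = Suc n * (complex_of_real (sqrt (2 * pi)) * complex_of_real (exp (- ((z * Suc n)\<^sup>2) / 2)))"
    by (subst integral_mult_right_zero) (simp only: char_std_normal_integral)
  also have "\<dots> = complex_of_real (Suc n * (sqrt (2 * pi) * exp (- ((z * Suc n)\<^sup>2) / 2)))"
    by (simp only: of_real_mult of_real_of_nat_eq)
  also have "Suc n * (sqrt (2 * pi) * exp (- ((z * Suc n)\<^sup>2) / 2)) = 2 * pi * normal_density 0 (1 / Suc n) z"
  proof -
    have *: "N * (sqrt (2 * pi) * exp (- ((z * N)\<^sup>2) / 2)) = 2 * pi * normal_density 0 (1 / N) z" if "N > 0" for N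
    proof -
      have 1: "sqrt (2 * pi * (1 / N)\<^sup>2) = sqrt (2 * pi) / N"
        using that by (simp add: real_sqrt_mult real_sqrt_divide)
      have 2: "- (z - 0)\<^sup>2 / (2 * (1 / N)\<^sup>2) = - ((z * N)\<^sup>2) / 2"
        using that by (simp add: field_simps)
      have 3: "2 * pi / sqrt (2 * pi) = sqrt (2 * pi)" by (rule real_div_sqrt) simp
      have "2 * pi * normal_density 0 (1 / N) z = 2 * pi * (1 / (sqrt (2 * pi) / N) * exp (- ((z * N)\<^sup>2) / 2))"
        unfolding normal_density_def 1 2 ..
      also have "\<dots> = (2 * pi / sqrt (2 * pi)) * (N * exp (- ((z * N)\<^sup>2) / 2))" by simp
      also have "\<dots> = N * (sqrt (2 * pi) * exp (- ((z * N)\<^sup>2) / 2))"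
        unfolding 3 by (simp only: mult_ac)
      finally show ?thesis ..
    qed
    show ?thesis by (rule *) simp
  qed
  finally show ?thesis .
qed

lemma nn_normal_density_shift: "(\<integral>\<^sup>+ x. ennreal (2 * pi * normal_density 0 (1 / Suc n) (t + x)) \<partial>lborel) = 2 * pi"
proof -
  have "(\<integral>\<^sup>+ x. ennreal (2 * pi * normal_density 0 (1 / Suc n) x) \<partial>lborel) = ennreal (LINT x|lborel. 2 * pi * normal_density 0 (1 / Suc n) x)"
    by (intro nn_integral_eq_integral) auto
  also have "\<dots> = 2 * pi" by simp
  finally show ?thesis
    using nn_integral_real_affine[of "\<lambda>x. ennreal (2 * pi * normal_density 0 (1 / Suc n) x)" 1 t] by simp
qed

text \<open>Both marginals of the kernel have mass \<open>2 * pi\<close>. Splitting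
  \<open>u y * v x\<close> into half the sum of the squares leaves two iterated integrals, each
  equal to half of the bound.\<close>

lemma schur_form:
  fixes u v :: "real \<Rightarrow> real"
  assumes [measurable]: "u \<in> borel_measurable borel" "v \<in> borel_measurable borel"
    and nn: "\<And>x. 0 \<le> u x" "\<And>x. 0 \<le> v x"
    and I: "integrable lborel (\<lambda>x. (u x)\<^sup>2)" "integrable lborel (\<lambda>x. (v x)\<^sup>2)"
    and eq: "(LINT x|lborel. (u x)\<^sup>2) = A" "(LINT x|lborel. (v x)\<^sup>2) = A"
  shows "(\<integral>\<^sup>+ y. \<integral>\<^sup>+ x. ennreal (u y * v x * (2 * pi * normal_density 0 (1 / Suc n) (x + y))) \<partial>lborel \<partial>lborel) \<le> ennreal (2 * pi * A)"
proof -
  define G where "G = (\<lambda>z. 2 * pi * normal_density 0 (1 / Suc n) z)"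
  have [measurable]: "G \<in> borel_measurable borel" unfolding G_def by measurable
  have G0: "0 \<le> G z" for z unfolding G_def by simp
  have GI: "(\<integral>\<^sup>+ x. ennreal (G (t + x)) \<partial>lborel) = ennreal (2 * pi)" for t
    using nn_normal_density_shift by (simp add: G_def)
  have GI': "(\<integral>\<^sup>+ x. ennreal (G (x + t)) \<partial>lborel) = ennreal (2 * pi)" for t
    using GI[of t] by (simp add: add.commute)
  have A0: "0 \<le> A" unfolding eq(1)[symmetric] by simp
  have "(\<integral>\<^sup>+ y. \<integral>\<^sup>+ x. ennreal (u y * v x * G (x + y)) \<partial>lborel \<partial>lborel)
    \<le> (\<integral>\<^sup>+ y. \<integral>\<^sup>+ x. (ennreal ((u y)\<^sup>2 / 2) * ennreal (G (x + y)) + ennreal ((v x)\<^sup>2 / 2) * ennreal (G (x + y))) \<partial>lborel \<partial>lborel)"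
  proof (intro nn_integral_mono)
    fix x y
    have "u y * v x \<le> (u y)\<^sup>2 / 2 + (v x)\<^sup>2 / 2"
      using sum_squares_bound[of "u y" "v x"] by simp
    then have "u y * v x * G (x + y) \<le> ((u y)\<^sup>2 / 2 + (v x)\<^sup>2 / 2) * G (x + y)"
      by (rule mult_right_mono) (rule G0)
    then show "ennreal (u y * v x * G (x + y)) \<le> ennreal ((u y)\<^sup>2 / 2) * ennreal (G (x + y)) + ennreal ((v x)\<^sup>2 / 2) * ennreal (G (x + y))"
      using G0 by (simp add: ennreal_leI distrib_right flip: ennreal_mult' ennreal_plus)
  qed
  also have "\<dots> = (\<integral>\<^sup>+ y. \<integral>\<^sup>+ x. ennreal ((u y)\<^sup>2 / 2) * ennreal (G (x + y)) \<partial>lborel \<partial>lborel)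
      + (\<integral>\<^sup>+ y. \<integral>\<^sup>+ x. ennreal ((v x)\<^sup>2 / 2) * ennreal (G (x + y)) \<partial>lborel \<partial>lborel)"
    by (subst nn_integral_add[symmetric]) (auto simp: nn_integral_add)
  also have "(\<integral>\<^sup>+ y. \<integral>\<^sup>+ x. ennreal ((v x)\<^sup>2 / 2) * ennreal (G (x + y)) \<partial>lborel \<partial>lborel) =
     (\<integral>\<^sup>+ x. \<integral>\<^sup>+ y. ennreal ((v x)\<^sup>2 / 2) * ennreal (G (x + y)) \<partial>lborel \<partial>lborel)"
    by (rule lborel_pair.Fubini') measurable
  also have "\<dots> = (\<integral>\<^sup>+ x. ennreal ((v x)\<^sup>2 / 2) * ennreal (2 * pi) \<partial>lborel)"
    by (simp add: nn_integral_cmult GI)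
  also have "\<dots> = ennreal (A / 2) * ennreal (2 * pi)"
    using I(2) eq(2) by (simp add: nn_integral_multc nn_integral_eq_integral)
  also have "(\<integral>\<^sup>+ y. \<integral>\<^sup>+ x. ennreal ((u y)\<^sup>2 / 2) * ennreal (G (x + y)) \<partial>lborel \<partial>lborel) =
    (\<integral>\<^sup>+ y. ennreal ((u y)\<^sup>2 / 2) * ennreal (2 * pi) \<partial>lborel)"
    by (simp add: nn_integral_cmult GI')
  also have "\<dots> = ennreal (A / 2) * ennreal (2 * pi)"
    using I(1) eq(1) by (simp add: nn_integral_multc nn_integral_eq_integral)
  finally show ?thesis
    unfolding G_def using A0 by (simp add: field_simps flip: ennreal_mult' ennreal_plus)
qed

lemma fi_gaussian_bound:
  assumes f: "integrable lborel f" "f \<in> Lp 2"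
  shows "(\<integral>\<^sup>+ \<xi>. ennreal (gw n \<xi> * (cmod (fi f \<xi>))\<^sup>2) \<partial>lborel) \<le> ennreal (2 * pi * (LINT x|lborel. (cmod (f x))\<^sup>2))"
proof -
  note [measurable] = borel_measurable_integrable[OF f(1), simplified]
  define G where "G = (\<lambda>z. 2 * pi * normal_density 0 (1 / Suc n) z)"
  have [measurable]: "G \<in> borel_measurable borel" unfolding G_def by measurable
  have G0: "0 \<le> G z" for z unfolding G_def by simp
  define B where "B = (LINT x|lborel. cmod (f x))"
  have B: "cmod (fi f \<xi>) \<le> B" for \<xi> unfolding B_def by (rule fi_bound[OF f(1)])
  \<comment> \<open>The transform of this reflected conjugate is \<open>cnj (fi f \<xi>)\<close>, so
    the weighted square of the modulus becomes \<open>fi h \<xi> * g \<xi>\<close> and Parseval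
    applies.\<close>
  define h where "h = (\<lambda>y. cnj (f (- y)))"
  have hI: "integrable lborel h"
    using lborel_integrable_real_affine[OF f(1), of "-1" 0] unfolding h_def by auto
  have hL: "h \<in> Lp 2" unfolding h_def using Lp2_affine[OF f(2), of "-1" 0] by (auto intro: Lp2_cnj)
  note [measurable] = borel_measurable_integrable[OF hI, simplified]
  have fih: "fi h \<xi> = cnj (fi f \<xi>)" for \<xi>
  proof -
    have "cnj (fi f \<xi>) = (LINT x|lborel. cis (x * \<xi>) * cnj (f x))"
      unfolding fi_def by (simp flip: Bochner_Integration.integral_cnj add: cis_cnj)
    also have "\<dots> = \<bar>-1\<bar> *\<^sub>R (LINT x|lborel. cis ((0 + (-1) * x) * \<xi>) * cnj (f (0 + (-1) * x)))"
      by (rule lborel_integral_real_affine) simp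
    finally show ?thesis by (simp add: fi_def h_def)
  qed
  define g where "g = (\<lambda>\<xi>. complex_of_real (gw n \<xi>) * fi f \<xi>)"
  have [measurable]: "g \<in> borel_measurable borel" unfolding g_def by measurable
  have gI: "integrable lborel g"
  proof (rule Bochner_Integration.integrable_bound)
    show "integrable lborel (\<lambda>\<xi>. B * gw n \<xi>)" using integrable_gw by simp
    show "AE \<xi> in lborel. norm (g \<xi>) \<le> norm (B * gw n \<xi>)"
      using B gw_bounds[of n] unfolding g_def
      by (auto simp: norm_mult abs_mult mult.commute[of "gw n _"] intro!: mult_right_mono order_trans[OF B])
  qed auto
  have figy: "fi g y = (LINT x|lborel. f x * complex_of_real (G (x + y)))" for y
  proof -
    have kI: "integrable lborel (\<lambda>\<xi>. cis (- (\<xi> * y)) * complex_of_real (gw n \<xi>))"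
      by (rule fi_integrable) (use integrable_gw in auto)
    have "fi g y = (LINT \<xi>|lborel. fi f \<xi> * (cis (- (\<xi> * y)) * complex_of_real (gw n \<xi>)))"
      unfolding fi_def[of g] by (simp add: g_def mult_ac)
    also have "\<dots> = (LINT x|lborel. f x * fi (\<lambda>\<xi>. cis (- (\<xi> * y)) * complex_of_real (gw n \<xi>)) x)"
      by (rule fi_Parseval[OF f(1) kI])
    also have "fi (\<lambda>\<xi>. cis (- (\<xi> * y)) * complex_of_real (gw n \<xi>)) = (\<lambda>x. complex_of_real (G (x + y)))"
    proof
      fix x
      have "fi (\<lambda>\<xi>. cis (- (\<xi> * y)) * complex_of_real (gw n \<xi>)) x =
         (LINT \<xi>|lborel. cis (- (x + y) * \<xi>) * complex_of_real (gw n \<xi>))"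
        unfolding fi_def mult.assoc[symmetric] cis_mult by (simp add: algebra_simps)
      also have "\<dots> = complex_of_real (G (- (x + y)))" unfolding fourier_gw G_def ..
      also have "G (- (x + y)) = G (x + y)" unfolding G_def normal_density_def by (simp add: power2_commute power2_sum)
      finally show "fi (\<lambda>\<xi>. cis (- (\<xi> * y)) * complex_of_real (gw n \<xi>)) x = complex_of_real (G (x + y))" .
    qed
    finally show ?thesis .
  qed
  have wfI: "integrable lborel (\<lambda>\<xi>. gw n \<xi> * (cmod (fi f \<xi>))\<^sup>2)"
  proof (rule Bochner_Integration.integrable_bound)
    show "integrable lborel (\<lambda>\<xi>. B\<^sup>2 * gw n \<xi>)" using integrable_gw by simp
    show "AE \<xi> in lborel. norm (gw n \<xi> * (cmod (fi f \<xi>))\<^sup>2) \<le> norm (B\<^sup>2 * gw n \<xi>)"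
      using B gw_bounds[of n] by (auto simp: abs_mult mult.commute[of "gw n _"] intro!: mult_right_mono power_mono)
  qed auto
  have "complex_of_real (LINT \<xi>|lborel. gw n \<xi> * (cmod (fi f \<xi>))\<^sup>2) = (LINT \<xi>|lborel. fi h \<xi> * g \<xi>)"
    unfolding fih g_def integral_complex_of_real[symmetric] of_real_mult complex_norm_square by (simp add: mult_ac)
  also have "\<dots> = (LINT y|lborel. h y * fi g y)" by (rule fi_Parseval[OF hI gI])
  finally have *: "complex_of_real (LINT \<xi>|lborel. gw n \<xi> * (cmod (fi f \<xi>))\<^sup>2) = (LINT y|lborel. h y * fi g y)" .
  have hgI: "integrable lborel (\<lambda>y. h y * fi g y)"
  proof (rule Bochner_Integration.integrable_bound)
    show "integrable lborel (\<lambda>y. complex_of_real (LINT x|lborel. cmod (g x)) * h y)" using hI by simp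
    show "AE y in lborel. norm (h y * fi g y) \<le> norm (complex_of_real (LINT x|lborel. cmod (g x)) * h y)"
      using fi_bound[OF gI] by (auto simp: norm_mult mult.commute[of "norm (h _)"] intro!: mult_right_mono order_trans[OF _ abs_ge_self])
  qed measurable
  have "(\<integral>\<^sup>+ \<xi>. ennreal (gw n \<xi> * (cmod (fi f \<xi>))\<^sup>2) \<partial>lborel) = ennreal (LINT \<xi>|lborel. gw n \<xi> * (cmod (fi f \<xi>))\<^sup>2)"
    using wfI gw_bounds by (intro nn_integral_eq_integral) auto
  also have "\<dots> = ennreal (cmod (LINT y|lborel. h y * fi g y))"
    unfolding *[symmetric] norm_of_real using gw_bounds by simp
  also have "\<dots> \<le> (\<integral>\<^sup>+ y. ennreal (cmod (h y * fi g y)) \<partial>lborel)"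
    by (rule integral_norm_bound_ennreal[OF hgI])
  also have "\<dots> \<le> (\<integral>\<^sup>+ y. \<integral>\<^sup>+ x. ennreal (cmod (h y) * cmod (f x) * G (x + y)) \<partial>lborel \<partial>lborel)"
  proof (rule nn_integral_mono)
    fix y
    have GB: "G z \<le> G 0" for z unfolding G_def normal_density_def by (auto intro!: mult_left_mono divide_right_mono)
    have I: "integrable lborel (\<lambda>x. f x * complex_of_real (G (x + y)))"
    proof (rule Bochner_Integration.integrable_bound)
      show "integrable lborel (\<lambda>x. complex_of_real (G 0) * f x)" using f by simp
      show "AE x in lborel. norm (f x * complex_of_real (G (x + y))) \<le> norm (complex_of_real (G 0) * f x)"
        using GB G0 by (auto simp: norm_mult mult.commute[of "norm (f _)"] intro!: mult_right_mono)
    qed measurable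
    have "ennreal (cmod (h y * fi g y)) = ennreal (cmod (h y)) * ennreal (cmod (fi g y))"
      by (simp add: norm_mult ennreal_mult')
    also have "\<dots> \<le> ennreal (cmod (h y)) * (\<integral>\<^sup>+ x. ennreal (cmod (f x * complex_of_real (G (x + y)))) \<partial>lborel)"
      unfolding figy by (intro mult_left_mono integral_norm_bound_ennreal[OF I]) simp
    also have "\<dots> = (\<integral>\<^sup>+ x. ennreal (cmod (h y) * cmod (f x) * G (x + y)) \<partial>lborel)"
      using G0 by (subst nn_integral_cmult[symmetric]) (auto simp: norm_mult mult.assoc ennreal_mult')
    finally show "ennreal (cmod (h y * fi g y)) \<le> (\<integral>\<^sup>+ x. ennreal (cmod (h y) * cmod (f x) * G (x + y)) \<partial>lborel)" .
  qed
  also have "\<dots> \<le> ennreal (2 * pi * (LINT x|lborel. (cmod (f x))\<^sup>2))"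
    unfolding G_def
  proof (rule schur_form)
    show "(LINT x|lborel. (cmod (h x))\<^sup>2) = (LINT x|lborel. (cmod (f x))\<^sup>2)"
      using lborel_integral_real_affine[of "-1" "\<lambda>x. (cmod (f x))\<^sup>2" 0] by (simp add: h_def)
  qed (use f hL in \<open>auto simp: Lp2_iff\<close>)
  finally show ?thesis .
qed

text \<open>Fatou's lemma removes the Gaussian weight, since the bound does not depend on
  \<open>n\<close>.\<close>

lemma fi_L2:
  assumes f: "integrable lborel f" "f \<in> Lp 2"
  shows "fi f \<in> Lp 2" "norm (emb (fi f)) \<le> sqrt (2 * pi) * norm (emb f)"
proof -
  note [measurable] = borel_measurable_integrable[OF f(1), simplified]
  let ?A = "2 * pi * (LINT x|lborel. (cmod (f x))\<^sup>2)"
  have lim: "(\<lambda>n. ennreal (gw n \<xi> * (cmod (fi f \<xi>))\<^sup>2)) \<longlonglongrightarrow> ennreal ((cmod (fi f \<xi>))\<^sup>2)" for \<xi>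
  proof -
    have "(\<lambda>n. \<xi> / real (Suc n)) \<longlonglongrightarrow> 0" by (rule LIMSEQ_Suc) (rule lim_const_over_n)
    then have "(\<lambda>n. exp (- (\<xi> / real (Suc n))\<^sup>2 / 2) * (cmod (fi f \<xi>))\<^sup>2) \<longlonglongrightarrow> exp (- 0\<^sup>2 / 2) * (cmod (fi f \<xi>))\<^sup>2"
      by (intro tendsto_intros) auto
    then show ?thesis unfolding gw_def by (intro tendsto_ennrealI) simp
  qed
  have "(\<integral>\<^sup>+ \<xi>. ennreal ((cmod (fi f \<xi>))\<^sup>2) \<partial>lborel) = (\<integral>\<^sup>+ \<xi>. liminf (\<lambda>n. ennreal (gw n \<xi> * (cmod (fi f \<xi>))\<^sup>2)) \<partial>lborel)"
    by (intro nn_integral_cong) (use lim in \<open>auto intro!: lim_imp_Liminf[symmetric]\<close>)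
  also have "\<dots> \<le> liminf (\<lambda>n. \<integral>\<^sup>+ \<xi>. ennreal (gw n \<xi> * (cmod (fi f \<xi>))\<^sup>2) \<partial>lborel)"
    by (rule nn_integral_liminf) measurable
  also have "\<dots> \<le> liminf (\<lambda>n::nat. ennreal ?A)"
    by (intro Liminf_mono always_eventually allI fi_gaussian_bound f)
  also have "\<dots> = ennreal ?A" by (simp add: Liminf_const)
  finally have le: "(\<integral>\<^sup>+ \<xi>. ennreal ((cmod (fi f \<xi>))\<^sup>2) \<partial>lborel) \<le> ennreal ?A" .
  have I: "integrable lborel (\<lambda>\<xi>. (cmod (fi f \<xi>))\<^sup>2)"
    by (intro integrableI_nonneg) (use le in \<open>auto intro: le_less_trans\<close>)
  then show L: "fi f \<in> Lp 2" by (simp add: Lp2_iff)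
  have "(norm (emb (fi f)))\<^sup>2 \<le> ?A"
    using le I unfolding norm_emb_sq[OF L] by (subst (asm) nn_integral_eq_integral) auto
  also have "\<dots> = (sqrt (2 * pi) * norm (emb f))\<^sup>2"
    by (simp add: power_mult_distrib norm_emb_sq[OF f(2)])
  finally show "norm (emb (fi f)) \<le> sqrt (2 * pi) * norm (emb f)" by (rule power2_le_imp_le) simp
qed

subsection \<open>Extension to square integrable functions\<close>

definition cut :: "real \<Rightarrow> real \<Rightarrow> complex" where
  "cut R x = complex_of_real (indicat_real {-R..R} x)"

lemma cut_measurable [measurable]: "cut R \<in> borel_measurable borel"
  unfolding cut_def[abs_def] by measurable

lemma cut_le: "cmod (cut R x) \<le> 1" by (auto simp: cut_def indicator_def)

lemma bm_cut [simp, intro]: "bm (cut R)" by (rule bmI[of _ 1]) (auto simp: cut_le)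

lemma cut_Lp2: "cut R \<in> Lp 2"
proof -
  have "(\<lambda>x. (cmod (cut R x))\<^sup>2) = indicat_real {-R..R}" by (auto simp: cut_def indicator_def fun_eq_iff)
  then show ?thesis by (auto simp: Lp2_iff emeasure_lborel_Icc_eq)
qed

lemma cut_integrable: "f \<in> Lp 2 \<Longrightarrow> integrable lborel (\<lambda>x. cut R x * f x)"
  by (rule Lp2_mult_integrable[OF cut_Lp2])

lemma cut_mult_Lp2: "f \<in> Lp 2 \<Longrightarrow> (\<lambda>x. cut R x * f x) \<in> Lp 2"
  by (rule mulf_Lp2) auto

lemma mulf_cut_tendsto: "((\<lambda>R. mulf (cut R) F) \<longlongrightarrow> F) at_top"
proof -
  have "((\<lambda>R. mulf (cut R) F) \<longlongrightarrow> mulf (\<lambda>x. 1) F) at_top"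
  proof (rule mulf_tendsto_at_top[of _ _ 1])
    show "((\<lambda>R. cut R x) \<longlongrightarrow> 1) at_top" for x
    proof (rule tendsto_eventually)
      show "\<forall>\<^sub>F R in at_top. cut R x = 1"
        using eventually_ge_at_top[of "\<bar>x\<bar>"] by eventually_elim (auto simp: cut_def indicator_def)
    qed
  qed (auto simp: cut_le)
  then show ?thesis by simp
qed

lemma mulf_cut_tendsto_nat: "(\<lambda>n. mulf (cut (real n)) F) \<longlonglongrightarrow> F"
  by (rule filterlim_compose[OF mulf_cut_tendsto filterlim_real_sequentially])

text \<open>The truncations of a square integrable function are integrable and converge to it, and
  \<open>fi_L2\<close> turns this into a Cauchy sequence of transforms; hence the limit exists
  (\<open>FT_LIMSEQ\<close>).\<close>

definition FT :: "l2 \<Rightarrow> l2" where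
  "FT F = lim (\<lambda>n. emb (fi (\<lambda>x. cut (real n) x * rep_l2 F x)))"

lemma fi_diff:
  assumes "integrable lborel f" "integrable lborel g"
  shows "fi (\<lambda>x. f x - g x) = (\<lambda>\<xi>. fi f \<xi> - fi g \<xi>)"
proof
  fix \<xi>
  show "fi (\<lambda>x. f x - g x) \<xi> = fi f \<xi> - fi g \<xi>"
    unfolding fi_def using fi_integrable[OF _ assms(1), of "\<lambda>x. - (x * \<xi>)"] fi_integrable[OF _ assms(2), of "\<lambda>x. - (x * \<xi>)"]
    by (simp add: right_diff_distrib)
qed

lemma norm_fi_diff:
  assumes "integrable lborel f" "f \<in> Lp 2" "integrable lborel g" "g \<in> Lp 2"
  shows "norm (emb (fi f) - emb (fi g)) \<le> sqrt (2 * pi) * norm (emb f - emb g)"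
proof -
  have "emb (fi f) - emb (fi g) = emb (fi (\<lambda>x. f x - g x))"
    using assms fi_L2 by (subst emb_diff[symmetric]) (auto simp: fi_diff)
  moreover have "emb f - emb g = emb (\<lambda>x. f x - g x)" using assms by (simp add: emb_diff)
  ultimately show ?thesis using fi_L2(2)[of "\<lambda>x. f x - g x"] assms by (auto intro: Lp2_diff)
qed

lemma FT_LIMSEQ: "(\<lambda>n. emb (fi (\<lambda>x. cut (real n) x * rep_l2 F x))) \<longlonglongrightarrow> FT F"
proof -
  let ?X = "\<lambda>n. emb (fi (\<lambda>x. cut (real n) x * rep_l2 F x))"
  have C: "Cauchy (\<lambda>n. mulf (cut (real n)) F)" using mulf_cut_tendsto_nat LIMSEQ_imp_Cauchy by blast
  have le: "norm (?X n - ?X m) \<le> sqrt (2 * pi) * norm (mulf (cut (real n)) F - mulf (cut (real m)) F)" for n m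
    unfolding mulf_def by (rule norm_fi_diff) (auto intro: cut_integrable cut_mult_Lp2)
  have "Cauchy ?X"
  proof (rule CauchyI)
    fix e :: real assume "0 < e"
    then have "0 < e / sqrt (2 * pi)" by simp
    from CauchyD[OF C this] obtain M where M: "\<And>m n. m \<ge> M \<Longrightarrow> n \<ge> M \<Longrightarrow>
       norm (mulf (cut (real m)) F - mulf (cut (real n)) F) < e / sqrt (2 * pi)" by blast
    have "norm (?X m - ?X n) < e" if "m \<ge> M" "n \<ge> M" for m n
    proof -
      have "sqrt (2 * pi) * norm (mulf (cut (real m)) F - mulf (cut (real n)) F) < e"
        using M[OF that] by (simp add: pos_less_divide_eq mult.commute)
      with le[of m n] show ?thesis by linarith
    qed
    then show "\<exists>M. \<forall>m\<ge>M. \<forall>n\<ge>M. norm (?X m - ?X n) < e" by blast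
  qed
  then show ?thesis unfolding FT_def by (simp add: Cauchy_convergent_iff convergent_LIMSEQ_iff)
qed

text \<open>One inequality serves three purposes: \<open>g\<close> representing \<open>F\<close>
  gives agreement with the Fourier integral, \<open>g\<close> equal to 0 gives boundedness, and a
  sequence of \<open>g\<close> gives convergence along arbitrary integrable approximations.\<close>

lemma FT_approx:
  assumes "integrable lborel g" "g \<in> Lp 2"
  shows "norm (emb (fi g) - FT F) \<le> sqrt (2 * pi) * norm (emb g - F)"
proof (rule LIMSEQ_le)
  show "(\<lambda>n. norm (emb (fi g) - emb (fi (\<lambda>x. cut (real n) x * rep_l2 F x)))) \<longlonglongrightarrow> norm (emb (fi g) - FT F)"
    by (intro tendsto_intros FT_LIMSEQ)
  show "(\<lambda>n. sqrt (2 * pi) * norm (emb g - mulf (cut (real n)) F)) \<longlonglongrightarrow> sqrt (2 * pi) * norm (emb g - F)"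
    by (intro tendsto_intros mulf_cut_tendsto_nat)
  show "\<exists>N. \<forall>n\<ge>N. norm (emb (fi g) - emb (fi (\<lambda>x. cut (real n) x * rep_l2 F x))) \<le> sqrt (2 * pi) * norm (emb g - mulf (cut (real n)) F)"
    unfolding mulf_def using assms
    by (intro exI[of _ 0] allI impI norm_fi_diff) (auto intro: cut_integrable cut_mult_Lp2)
qed

lemma FT_emb: "integrable lborel g \<Longrightarrow> g \<in> Lp 2 \<Longrightarrow> FT (emb g) = emb (fi g)"
  using FT_approx[of g "emb g"] by simp

lemma L1_dense: "\<exists>g. (\<forall>n. integrable lborel (g n) \<and> g n \<in> Lp 2) \<and> (\<lambda>n. emb (g n)) \<longlonglongrightarrow> F"
  by (rule exI[of _ "\<lambda>n x. cut (real n) x * rep_l2 F x"])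
    (use mulf_cut_tendsto_nat[of F] in \<open>auto simp: mulf_def intro: cut_integrable cut_mult_Lp2\<close>)

lemma FT_tendsto:
  assumes "\<And>n. integrable lborel (g n)" "\<And>n. g n \<in> Lp 2" "(\<lambda>n. emb (g n)) \<longlonglongrightarrow> F"
  shows "(\<lambda>n. emb (fi (g n))) \<longlonglongrightarrow> FT F"
proof (rule Lim_null[THEN iffD2], rule Lim_null_comparison)
  show "\<forall>\<^sub>F n in sequentially. norm (emb (fi (g n)) - FT F) \<le> sqrt (2 * pi) * norm (emb (g n) - F)"
    using assms by (auto intro!: always_eventually FT_approx)
  have "(\<lambda>n. sqrt (2 * pi) * norm (emb (g n) - F)) \<longlonglongrightarrow> sqrt (2 * pi) * norm (F - F)"
    using assms by (intro tendsto_intros) auto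
  then show "(\<lambda>n. sqrt (2 * pi) * norm (emb (g n) - F)) \<longlonglongrightarrow> 0" by simp
qed

lemma bounded_linear_FT: "bounded_linear FT"
proof (rule bounded_linear_intro)
  fix F G :: l2 and r :: real
  obtain f where f: "\<And>n. integrable lborel (f n)" "\<And>n. f n \<in> Lp 2" "(\<lambda>n. emb (f n)) \<longlonglongrightarrow> F"
    using L1_dense[of F] by blast
  obtain g where g: "\<And>n. integrable lborel (g n)" "\<And>n. g n \<in> Lp 2" "(\<lambda>n. emb (g n)) \<longlonglongrightarrow> G"
    using L1_dense[of G] by blast
  have "(\<lambda>n. emb (fi (\<lambda>x. f n x + g n x))) \<longlonglongrightarrow> FT (F + G)"
    by (rule FT_tendsto) (use f g tendsto_add[OF f(3) g(3)] in \<open>auto simp: emb_add intro: Lp2_add\<close>)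
  moreover have "emb (fi (\<lambda>x. f n x + g n x)) = emb (fi (f n)) + emb (fi (g n))" for n
    using f g by (subst emb_add[symmetric]) (auto simp: fi_add fi_L2)
  ultimately show "FT (F + G) = FT F + FT G"
    using tendsto_add[OF FT_tendsto[OF f] FT_tendsto[OF g]] LIMSEQ_unique by fastforce
  have "(\<lambda>n. emb (fi (\<lambda>x. r *\<^sub>R f n x))) \<longlonglongrightarrow> FT (r *\<^sub>R F)"
    by (rule FT_tendsto) (use f tendsto_scaleR[OF tendsto_const[of r] f(3)] in \<open>auto simp: emb_scaleR intro: Lp2_scaleR\<close>)
  moreover have "emb (fi (\<lambda>x. r *\<^sub>R f n x)) = r *\<^sub>R emb (fi (f n))" for n
    using f by (subst emb_scaleR[symmetric]) (auto simp: scaleR_conv_of_real fi_cmult fi_L2)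
  ultimately show "FT (r *\<^sub>R F) = r *\<^sub>R FT F"
    using tendsto_scaleR[OF tendsto_const[of r] FT_tendsto[OF f]] LIMSEQ_unique by fastforce
  have "norm (FT F) \<le> sqrt (2 * pi) * norm F"
    using FT_approx[of "\<lambda>x. 0" F] Lp2_zero by (simp add: fi_zero flip: zero_l2_def)
  then show "norm (FT F) \<le> norm F * sqrt (2 * pi)" by (simp add: mult.commute)
qed

lemma norm_FT_le: "norm (FT F) \<le> sqrt (2 * pi) * norm F"
  using FT_approx[of "\<lambda>x. 0" F] Lp2_zero by (simp add: fi_zero flip: zero_l2_def)

text \<open>The truncations are dense, so identities for \<open>FT\<close> need to be checked only
  where it is an integral.\<close>

lemma bl_eq_dense:
  fixes A B :: "l2 \<Rightarrow> 'a::real_normed_vector"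
  assumes "bounded_linear A" "bounded_linear B"
    and eq: "\<And>g. integrable lborel g \<Longrightarrow> g \<in> Lp 2 \<Longrightarrow> A (emb g) = B (emb g)"
  shows "A F = B F"
proof -
  obtain f where f: "\<And>n. integrable lborel (f n)" "\<And>n. f n \<in> Lp 2" "(\<lambda>n. emb (f n)) \<longlonglongrightarrow> F"
    using L1_dense[of F] by blast
  have "(\<lambda>n. A (emb (f n))) \<longlonglongrightarrow> A F" "(\<lambda>n. B (emb (f n))) \<longlonglongrightarrow> B F"
    using bounded_linear.tendsto[OF assms(1) f(3)] bounded_linear.tendsto[OF assms(2) f(3)] .
  with eq[OF f(1,2)] show ?thesis using LIMSEQ_unique by auto
qed

lemma FT_mulf_const: "FT (mulf (\<lambda>_. c) F) = mulf (\<lambda>_. c) (FT F)"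
proof (rule bl_eq_dense[of "\<lambda>F. FT (mulf (\<lambda>_. c) F)" "\<lambda>F. mulf (\<lambda>_. c) (FT F)"])
  fix g assume g: "integrable lborel g" "g \<in> Lp 2"
  then show "FT (mulf (\<lambda>_. c) (emb g)) = mulf (\<lambda>_. c) (FT (emb g))"
    by (simp add: mulf_emb FT_emb fi_L2 Lp2_cmult fi_cmult)
qed (intro bounded_linear_compose[OF bounded_linear_FT] bounded_linear_compose[OF bounded_linear_mulf]
    bounded_linear_FT bounded_linear_mulf bm_const)+

lemma FT_lcnj: "FT (lcnj F) = refl2 (lcnj (FT F))"
proof (rule bl_eq_dense[of "\<lambda>F. FT (lcnj F)" "\<lambda>F. refl2 (lcnj (FT F))"])
  fix g assume g: "integrable lborel g" "g \<in> Lp 2"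
  have "fi (\<lambda>x. cnj (g x)) \<xi> = cnj (fi g (- \<xi>))" for \<xi>
    unfolding fi_def by (simp flip: Bochner_Integration.integral_cnj add: cis_cnj)
  then have "fi (\<lambda>x. cnj (g x)) = (\<lambda>\<xi>. cnj (fi g (- \<xi>)))" ..
  then show "FT (lcnj (emb g)) = refl2 (lcnj (FT (emb g)))"
    using g fi_L2(1)[OF g] by (simp add: lcnj_emb refl2_emb FT_emb Lp2_cnj)
qed (intro bounded_linear_compose[OF bounded_linear_FT] bounded_linear_compose[OF bounded_linear_lcnj]
    bounded_linear_compose[OF bounded_linear_refl2] bounded_linear_lcnj bounded_linear_FT)+

lemma FT_refl2: "FT (refl2 F) = refl2 (FT F)"
proof (rule bl_eq_dense[of "\<lambda>F. FT (refl2 F)" "\<lambda>F. refl2 (FT F)"])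
  fix g assume g: "integrable lborel g" "g \<in> Lp 2"
  have "fi (\<lambda>x. g (- x)) \<xi> = fi g (- \<xi>)" for \<xi>
    unfolding fi_def using lborel_integral_real_affine[of "-1" "\<lambda>x. cis (x * \<xi>) * g x" 0] by simp
  then have "fi (\<lambda>x. g (- x)) = (\<lambda>\<xi>. fi g (- \<xi>))" ..
  then show "FT (refl2 (emb g)) = refl2 (FT (emb g))"
    using g fi_L2(1)[OF g] Lp2_affine[of g "-1" 0] lborel_integrable_real_affine[OF g(1), of "-1" 0]
    by (simp add: refl2_emb FT_emb)
qed (intro bounded_linear_compose[OF bounded_linear_FT] bounded_linear_compose[OF bounded_linear_refl2]
    bounded_linear_refl2 bounded_linear_FT)+

lemma FT_tr: "FT (tr h F) = mulf (\<lambda>\<xi>. cis (h * \<xi>)) (FT F)"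
proof (rule bl_eq_dense[of "\<lambda>F. FT (tr h F)" "\<lambda>F. mulf (\<lambda>\<xi>. cis (h * \<xi>)) (FT F)"])
  fix g assume g: "integrable lborel g" "g \<in> Lp 2"
  have "fi (\<lambda>x. g (x + h)) \<xi> = cis (h * \<xi>) * fi g \<xi>" for \<xi>
  proof -
    have "fi g \<xi> = (LINT x|lborel. cis (- ((x + h) * \<xi>)) * g (x + h))"
      unfolding fi_def using lborel_integral_real_affine[of 1 "\<lambda>x. cis (- (x * \<xi>)) * g x" h] by (simp add: add.commute)
    then have "cis (h * \<xi>) * fi g \<xi> = (LINT x|lborel. cis (h * \<xi>) * (cis (- ((x + h) * \<xi>)) * g (x + h)))" by simp
    moreover have "cis (h * \<xi>) * (cis (- ((x + h) * \<xi>)) * c) = cis (- (x * \<xi>)) * c" for x c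
      unfolding mult.assoc[symmetric] cis_mult by (simp add: ring_distribs)
    ultimately show ?thesis unfolding fi_def by simp
  qed
  then have "fi (\<lambda>x. g (x + h)) = (\<lambda>\<xi>. cis (h * \<xi>) * fi g \<xi>)" ..
  then show "FT (tr h (emb g)) = mulf (\<lambda>\<xi>. cis (h * \<xi>)) (FT (emb g))"
    using g fi_L2(1)[OF g] Lp2_affine[of g 1 h] lborel_integrable_real_affine[OF g(1), of 1 h]
    by (simp add: tr_emb FT_emb mulf_emb bm_cis add.commute)
qed (intro bounded_linear_compose[OF bounded_linear_FT] bounded_linear_compose[OF bounded_linear_mulf]
    bounded_linear_tr bounded_linear_FT bm_cis; simp)+

text \<open>The map \<open>lcnj\<close> in the second slot undoes the conjugate inside
  \<open>inner\<close>, so this is the bilinear formula \<open>fi_Parseval\<close>, extended by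
  density in one variable at a time.\<close>

lemma FT_Parseval: "inner (FT F) (lcnj G) = inner F (lcnj (FT G))"
proof (rule bl_eq_dense[of "\<lambda>F. inner (FT F) (lcnj G)" "\<lambda>F. inner F (lcnj (FT G))"])
  fix f assume f: "integrable lborel f" "f \<in> Lp 2"
  show "inner (FT (emb f)) (lcnj G) = inner (emb f) (lcnj (FT G))"
  proof (rule bl_eq_dense[of "\<lambda>G. inner (FT (emb f)) (lcnj G)" "\<lambda>G. inner (emb f) (lcnj (FT G))"])
    fix g assume g: "integrable lborel g" "g \<in> Lp 2"
    show "inner (FT (emb f)) (lcnj (emb g)) = inner (emb f) (lcnj (FT (emb g)))"
      using f g fi_L2(1)[OF f] fi_L2(1)[OF g] by (simp add: FT_emb lcnj_emb inner_emb Lp2_cnj fi_Parseval)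
  qed (intro bounded_linear_compose[OF bounded_linear_inner_right] bounded_linear_compose[OF bounded_linear_lcnj]
    bounded_linear_lcnj bounded_linear_FT)+
qed (intro bounded_linear_compose[OF bounded_linear_inner_left] bounded_linear_FT bounded_linear_inner_left)+

subsection \<open>Inversion\<close>

lemma eventually_real_gt: "\<forall>\<^sub>F n in sequentially. (c::real) < real n"
  using filterlim_real_sequentially by (simp add: filterlim_at_top_dense)

text \<open>Half-lines are stable under intersection and generate the Borel sets, so a pi-lambda
  argument makes the integral of \<open>g\<close> vanish over every Borel set.\<close>

lemma AE_zero_if_half_line_integrals_zero:
  fixes g :: "real \<Rightarrow> real"
  assumes I: "integrable lborel g" and z: "\<And>x. (LINT y:{x<..}|lborel. g y) = 0"
  shows "AE x in lborel. g x = 0"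
proof -
  have SI: "set_integrable lborel A g" if "A \<in> sets borel" for A
    using that I unfolding set_integrable_def by (intro integrable_mult_indicator) auto
  have tot: "(LINT y|lborel. g y) = 0"
  proof -
    have "(\<lambda>n. LINT y|lborel. indicat_real {- real n<..} y *\<^sub>R g y) \<longlonglongrightarrow> (LINT y|lborel. g y)"
    proof (rule integral_dominated_convergence[where w = "\<lambda>y. norm (g y)"])
      show "AE y in lborel. (\<lambda>n. indicat_real {- real n<..} y *\<^sub>R g y) \<longlonglongrightarrow> g y"
      proof (rule AE_I2, rule tendsto_eventually)
        fix y :: real
        show "\<forall>\<^sub>F n in sequentially. indicat_real {- real n<..} y *\<^sub>R g y = g y"
          using eventually_real_gt[of "\<bar>y\<bar>"]
          by eventually_elim (auto simp: indicator_def)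
      qed
    qed (use I in \<open>auto simp: indicator_def\<close>)
    moreover have "(LINT y|lborel. indicat_real {- real n<..} y *\<^sub>R g y) = 0" for n
      using z by (simp add: set_lebesgue_integral_def)
    ultimately show ?thesis using LIMSEQ_unique[OF tendsto_const] by fastforce
  qed
  have Int_st: "Int_stable (range (\<lambda>a::real. {a<..}))"
  proof -
    have "{a<..} \<inter> {b<..} = {max a b<..}" for a b :: real by auto
    then show ?thesis by (auto simp: Int_stable_def)
  qed
  have sub: "range (\<lambda>a::real. {a<..}) \<subseteq> Pow UNIV" by simp
  have all: "(LINT y:A|lborel. g y) = 0" if "A \<in> sigma_sets UNIV (range (\<lambda>a::real. {a<..}))" for A
    using Int_st sub that
  proof (induction rule: sigma_sets_induct_disjoint)
    case (basic A) then show ?case using z by auto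
  next
    case empty then show ?case by (simp add: set_lebesgue_integral_def)
  next
    case (compl A)
    then have [measurable]: "A \<in> sets borel" by (simp add: borel_Ioi)
    have "(LINT y:(A \<union> (UNIV - A))|lborel. g y) = (LINT y:A|lborel. g y) + (LINT y:UNIV - A|lborel. g y)"
      by (rule set_integral_Un) (auto intro: SI)
    with compl tot show ?case by (simp add: set_lebesgue_integral_def)
  next
    case (union A)
    then have [measurable]: "A i \<in> sets borel" for i by (auto simp: borel_Ioi)
    have "(LINT y:(\<Union>i. A i)|lborel. g y) = (\<Sum>i. LINT y:A i|lborel. g y)"
      by (rule lebesgue_integral_countable_add) (use union in \<open>auto intro: SI simp: disjoint_family_on_def\<close>)
    with union show ?case by simp
  qed
  have "AE x in lborel. g x = (\<lambda>x. 0) x"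
  proof (rule density_unique_real[OF I])
    fix A :: "real set" assume "A \<in> sets lborel"
    then have "A \<in> sigma_sets UNIV (range (\<lambda>a::real. {a<..}))" by (simp add: borel_Ioi)
    from all[OF this] show "(LINT x:A|lborel. g x) = (LINT x:A|lborel. 0)" by (simp add: set_lebesgue_integral_def)
  qed simp
  then show ?thesis by simp
qed

text \<open>Restriction to \<open>{- real n..real n}\<close> gives global integrability, and the
  real and imaginary parts reduce to the half-line criterion.\<close>

lemma AE_zero_if_interval_integrals_zero:
  fixes f :: "real \<Rightarrow> complex"
  assumes I: "\<And>a b. set_integrable lborel {a..b} f"
    and z: "\<And>a b. a < b \<Longrightarrow> (LINT y:{a..b}|lborel. f y) = 0"
  shows "AE x in lborel. f x = 0"
proof -
  have N: "AE x in lborel. indicat_real {- real n..real n} x *\<^sub>R f x = 0" for n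
  proof -
    let ?g = "\<lambda>x. indicat_real {- real n..real n} x *\<^sub>R f x"
    have gI: "integrable lborel ?g" using I[of "- real n" "real n"] by (simp add: set_integrable_def)
    have zx: "(LINT y:{x<..}|lborel. ?g y) = 0" for x
    proof -
      have z': "(LINT y:{a..b}|lborel. f y) = 0" for a b
      proof (cases "a < b")
        case True then show ?thesis by (rule z)
      next
        case False
        then have "AE y in lborel. indicat_real {a..b} y *\<^sub>R f y = 0"
          by (intro AE_I[where N = "{a}"]) (auto simp: indicator_def)
        then show ?thesis unfolding set_lebesgue_integral_def by (rule integral_eq_zero_AE)
      qed
      have "(LINT y:{x<..}|lborel. ?g y) = (LINT y:{max x (- real n)..real n}|lborel. f y)"
        unfolding set_lebesgue_integral_def
      proof (rule integral_cong_AE)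
        show "AE y in lborel. indicat_real {x<..} y *\<^sub>R ?g y = indicat_real {max x (- real n)..real n} y *\<^sub>R f y"
          by (rule AE_I[where N = "{x}"]) (auto simp: indicator_def split: if_splits)
        show "(\<lambda>y. indicat_real {x<..} y *\<^sub>R ?g y) \<in> borel_measurable lborel"
          using borel_measurable_integrable[OF gI] by measurable
        show "(\<lambda>y. indicat_real {max x (- real n)..real n} y *\<^sub>R f y) \<in> borel_measurable lborel"
          using I[of "max x (- real n)" "real n"] unfolding set_integrable_def by (rule borel_measurable_integrable)
      qed
      with z' show ?thesis by simp
    qed
    have sI: "integrable lborel (\<lambda>y. indicat_real {x<..} y *\<^sub>R ?g y)" for x
      by (rule integrable_mult_indicator[OF _ gI]) simp
    have "AE x in lborel. Re (?g x) = 0"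
    proof (rule AE_zero_if_half_line_integrals_zero)
      show "(LINT y:{x<..}|lborel. Re (?g y)) = 0" for x
        using zx[of x] integral_Re[OF sI[of x]] by (simp add: set_lebesgue_integral_def mult.assoc)
    qed (rule integrable_Re[OF gI])
    moreover have "AE x in lborel. Im (?g x) = 0"
    proof (rule AE_zero_if_half_line_integrals_zero)
      show "(LINT y:{x<..}|lborel. Im (?g y)) = 0" for x
        using zx[of x] integral_Im[OF sI[of x]] by (simp add: set_lebesgue_integral_def mult.assoc)
    qed (rule integrable_Im[OF gI])
    ultimately show ?thesis by eventually_elim (simp add: complex_eq_iff)
  qed
  then have "AE x in lborel. \<forall>n. indicat_real {- real n..real n} x *\<^sub>R f x = 0"
    unfolding AE_all_countable ..
  then show ?thesis
  proof eventually_elim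
    case (elim x)
    obtain n :: nat where "\<bar>x\<bar> \<le> real n" using real_arch_simple by blast
    with elim[rule_format, of n] show ?case by (auto simp: indicator_def abs_le_iff split: if_splits)
  qed
qed

definition ivl :: "real \<Rightarrow> real \<Rightarrow> real \<Rightarrow> complex" where
  "ivl a b x = complex_of_real (indicat_real {a..b} x)"

lemma ivl_measurable [measurable]: "ivl a b \<in> borel_measurable borel"
  unfolding ivl_def[abs_def] by measurable

lemma ivl_Lp2: "ivl a b \<in> Lp 2"
proof -
  have "(\<lambda>x. (cmod (ivl a b x))\<^sup>2) = indicat_real {a..b}" by (auto simp: ivl_def indicator_def fun_eq_iff)
  then show ?thesis by (auto simp: Lp2_iff emeasure_lborel_Icc_eq)
qed

lemma ivl_integrable: "integrable lborel (ivl a b)"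
  unfolding ivl_def[abs_def] by (auto simp: emeasure_lborel_Icc_eq)

lemma set_integrable_Lp2:
  assumes "f \<in> Lp 2" shows "set_integrable lborel {a..b} f"
  using Lp2_mult_integrable[OF ivl_Lp2[of a b] assms]
  by (simp add: set_integrable_def ivl_def scaleR_conv_of_real)

text \<open>The scalar \<open>d\<close> compensates for \<open>inner\<close> being only a real part:
  \<open>d = 1\<close> and \<open>d = \<i>\<close> yield both components of the integral over the
  interval.\<close>

lemma l2_eq_by_intervals:
  assumes "\<And>a b d. a < b \<Longrightarrow> inner F (emb (\<lambda>x. d * ivl a b x)) = inner G (emb (\<lambda>x. d * ivl a b x))"
  shows "F = G"
proof -
  have "AE x in lborel. rep_l2 (F - G) x = 0"
  proof (rule AE_zero_if_interval_integrals_zero)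
    fix a b :: real assume "a < b"
    let ?J = "LINT y:{a..b}|lborel. rep_l2 (F - G) y"
    have "inner (F - G) (emb (\<lambda>x. d * ivl a b x)) = Re (cnj d * ?J)" for d
    proof -
      have "inner (emb (rep_l2 (F - G))) (emb (\<lambda>x. d * ivl a b x)) = Re (LINT x|lborel. rep_l2 (F - G) x * cnj (d * ivl a b x))"
        by (rule inner_emb) (auto intro: Lp2_cmult ivl_Lp2)
      also have "(LINT x|lborel. rep_l2 (F - G) x * cnj (d * ivl a b x)) = (LINT x|lborel. cnj d * (indicat_real {a..b} x *\<^sub>R rep_l2 (F - G) x))"
        by (intro Bochner_Integration.integral_cong) (auto simp: ivl_def scaleR_conv_of_real)
      finally show ?thesis unfolding integral_mult_right_zero set_lebesgue_integral_def by simp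
    qed
    with assms[OF \<open>a < b\<close>] have "Re (cnj d * ?J) = 0" for d by (simp add: inner_diff_left)
    from this[of 1] this[of \<i>] show "?J = 0" by (simp add: complex_eq_iff)
  qed (simp add: set_integrable_Lp2)
  then have "AE x in lborel. rep_l2 F x = rep_l2 G x"
    using rep_minus[of F G] by eventually_elim simp
  then show ?thesis by (rule l2_eqI)
qed

lemma fi_ivl:
  assumes "a \<le> b" "t \<noteq> 0"
  shows "fi (ivl a b) t = (cis (- (t * a)) - cis (- (t * b))) / (\<i> * t)"
proof -
  have "fi (ivl a b) t = (LBINT x:{a..b}. cis (- (x * t)))"
    unfolding fi_def ivl_def set_lebesgue_integral_def by (simp add: scaleR_conv_of_real mult.commute)
  also have "\<dots> = (LBINT x=a..b. cis (- (x * t)))" using assms by (simp add: interval_integral_Icc)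
  also have "\<dots> = \<i> / t * cis (- (b * t)) - \<i> / t * cis (- (a * t))"
  proof (rule interval_integral_FTC_finite)
    show "continuous_on {min a b..max a b} (\<lambda>x. cis (- (x * t)))" by (intro continuous_intros)
    fix x
    have "((\<lambda>x. cis (- (x * t))) has_vector_derivative (- t) *\<^sub>R (\<i> * cis (- (x * t)))) (at x within {min a b..max a b})"
      unfolding has_vector_derivative_def
      by (rule has_derivative_eq_rhs, rule has_derivative_cis[THEN has_derivative_compose[rotated]], (rule derivative_intros)+)
       (auto simp: fun_eq_iff scaleR_conv_of_real)
    from has_vector_derivative_mult_right[OF this, of "\<i> / t"]
    show "((\<lambda>x. \<i> / t * cis (- (x * t))) has_vector_derivative cis (- (x * t))) (at x within {min a b..max a b})"
      using assms by (simp add: scaleR_conv_of_real)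
  qed
  also have "\<dots> = (cis (- (t * a)) - cis (- (t * b))) / (\<i> * t)"
    using assms by (simp add: field_simps)
  finally show ?thesis .
qed

text \<open>This is Levy's inversion theorem for the uniform distribution on \<open>{c..d}\<close>,
  whose characteristic function is \<open>fi (ivl c d) (- t) / (d - c)\<close>. It provides Fourier
  inversion for indicators of intervals.\<close>

lemma Levy_intervals:
  assumes "a < b" "c < d"
  shows "(LINT t|lborel. fi (ivl a b) t * fi (ivl c d) (- t)) = 2 * pi * complex_of_real (measure lborel ({a..b} \<inter> {c..d}))"
proof -
  define M where "M = uniform_measure lborel {c..d}"
  have pos: "emeasure lborel {c..d} \<noteq> 0" "emeasure lborel {c..d} \<noteq> \<infinity>"
    using assms by (auto simp: emeasure_lborel_Icc_eq)
  have Mden: "M = density lborel (\<lambda>x. ennreal (indicat_real {c..d} x / (d - c)))"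
    unfolding M_def uniform_measure_def
  proof (rule arg_cong[where f = "density lborel"], rule ext)
    fix x show "indicator {c..d} x / emeasure lborel {c..d} = ennreal (indicat_real {c..d} x / (d - c))"
      using assms by (auto simp: emeasure_lborel_Icc_eq indicator_def divide_ennreal[symmetric])
  qed
  interpret M: real_distribution M
    unfolding real_distribution_def real_distribution_axioms_def
    using prob_space_uniform_measure[OF pos] by (simp add: M_def)
  have meas: "measure M B = measure lborel ({c..d} \<inter> B) / (d - c)" if "B \<in> sets borel" for B
    using that assms pos unfolding M_def by (subst measure_uniform_measure) auto
  \<comment> \<open>Levy's theorem asks for endpoints without mass.\<close>
  have zero: "measure M {x} = 0" for x
  proof -
    have "measure lborel ({c..d} \<inter> {x}) = 0"
      by (cases "x \<in> {c..d}") (auto simp: measure_def)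
    then show ?thesis by (simp add: meas)
  qed
  have char: "char M t = fi (ivl c d) (- t) / (d - c)" for t
  proof -
    have "char M t = (LINT x|lborel. (indicat_real {c..d} x / (d - c)) *\<^sub>R exp (\<i> * complex_of_real (t * x)))"
      unfolding char_def Mden using assms by (subst integral_density) auto
    also have "\<dots> = (LINT x|lborel. complex_of_real (1 / (d - c)) * (cis (- (x * (- t))) * ivl c d x))"
      by (intro Bochner_Integration.integral_cong) (auto simp: ivl_def scaleR_conv_of_real cis_conv_exp mult_ac)
    also have "\<dots> = fi (ivl c d) (- t) / (d - c)"
      by (subst integral_mult_right_zero) (simp add: fi_def)
    finally show ?thesis .
  qed
  let ?h = "\<lambda>t. fi (ivl a b) t * fi (ivl c d) (- t)"
  \<comment> \<open>Levy's theorem yields only a limit over symmetric intervals. The integrand is a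
    product of two square integrable functions, so that limit is a Lebesgue integral.\<close>
  have hI: "integrable lborel ?h"
    using fi_L2(1)[OF ivl_integrable ivl_Lp2] Lp2_affine[OF fi_L2(1)[OF ivl_integrable ivl_Lp2], of "-1" c d 0]
    by (intro Lp2_mult_integrable) auto
  have "(\<lambda>T. 1 / (2 * pi) * (CLBINT t=-T..T. (iexp (-(t * a)) - iexp (-(t * b))) / (\<i> * t) * char M t))
    \<longlonglongrightarrow> measure M {a<..b}"
    by (rule M.Levy_Inversion) (use assms zero in auto)
  moreover have "1 / (2 * pi) * (CLBINT t=-(real T)..T. (iexp (-(t * a)) - iexp (-(t * b))) / (\<i> * t) * char M t) =
      1 / (2 * pi * (d - c)) * (LINT t|lborel. indicat_real {- real T..real T} t *\<^sub>R ?h t)" for T :: nat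
  proof -
    have "(CLBINT t=-(real T)..T. (iexp (-(t * a)) - iexp (-(t * b))) / (\<i> * t) * char M t)
      = (LBINT t:{- real T..real T}. (iexp (-(t * a)) - iexp (-(t * b))) / (\<i> * t) * char M t)"
      by (simp add: interval_integral_Icc)
    also have "\<dots> = (LINT t|lborel. (1 / complex_of_real (d - c)) * (indicat_real {- real T..real T} t *\<^sub>R ?h t))"
      unfolding set_lebesgue_integral_def
    proof (rule integral_cong_AE)
      show "AE t in lborel. indicat_real {- real T..real T} t *\<^sub>R ((iexp (-(t * a)) - iexp (-(t * b))) / (\<i> * t) * char M t)
         = (1 / complex_of_real (d - c)) * (indicat_real {- real T..real T} t *\<^sub>R ?h t)"
      proof (rule AE_I[where N = "{0}"])
        have e: "(iexp (-(t * a)) - iexp (-(t * b))) / (\<i> * t) * char M t = (1 / complex_of_real (d - c)) * ?h t" if "t \<noteq> 0" for t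
          using assms that by (simp add: char fi_ivl cis_conv_exp)
        have "indicat_real {- real T..real T} t *\<^sub>R ((iexp (-(t * a)) - iexp (-(t * b))) / (\<i> * t) * char M t)
         = (1 / complex_of_real (d - c)) * (indicat_real {- real T..real T} t *\<^sub>R ?h t)" if "t \<noteq> 0" for t
          by (simp only: e[OF that] mult_scaleR_right)
        then show "{t \<in> space lborel. indicat_real {- real T..real T} t *\<^sub>R ((iexp (-(t * a)) - iexp (-(t * b))) / (\<i> * t) * char M t)
         \<noteq> (1 / complex_of_real (d - c)) * (indicat_real {- real T..real T} t *\<^sub>R ?h t)} \<subseteq> {0}"
          by (auto simp del: times_divide_eq_left times_divide_eq_right of_real_diff of_real_minus of_real_mult)
      qed auto
      show "(\<lambda>t. indicat_real {- real T..real T} t *\<^sub>R ((iexp (-(t * a)) - iexp (-(t * b))) / (\<i> * t) * char M t)) \<in> borel_measurable lborel"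
        unfolding char by measurable
    qed measurable
    also have "\<dots> = (1 / complex_of_real (d - c)) * (LINT t|lborel. indicat_real {- real T..real T} t *\<^sub>R ?h t)"
      by (rule integral_mult_right_zero)
    finally show ?thesis by simp
  qed
  ultimately have L: "(\<lambda>T::nat. 1 / (2 * pi * (d - c)) * (LINT t|lborel. indicat_real {- real T..real T} t *\<^sub>R ?h t))
     \<longlonglongrightarrow> complex_of_real (measure M {a<..b})" by simp
  have "(\<lambda>T::nat. LINT t|lborel. indicat_real {- real T..real T} t *\<^sub>R ?h t) \<longlonglongrightarrow> (LINT t|lborel. ?h t)"
  proof (rule integral_dominated_convergence[where w = "\<lambda>t. norm (?h t)"])
    show "AE y in lborel. (\<lambda>n. indicat_real {- real n..real n} y *\<^sub>R ?h y) \<longlonglongrightarrow> ?h y"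
    proof (rule AE_I2, rule tendsto_eventually)
      fix y :: real
      show "\<forall>\<^sub>F n in sequentially. indicat_real {- real n..real n} y *\<^sub>R ?h y = ?h y"
        using eventually_real_gt[of "\<bar>y\<bar>"]
        by eventually_elim (auto simp: indicator_def)
    qed
  qed (use hI in \<open>auto simp: indicator_def\<close>)
  then have "(\<lambda>T::nat. 1 / (2 * pi * (d - c)) * (LINT t|lborel. indicat_real {- real T..real T} t *\<^sub>R ?h t))
     \<longlonglongrightarrow> complex_of_real (1 / (2 * pi * (d - c))) * (LINT t|lborel. ?h t)"
    by (intro tendsto_intros) auto
  from LIMSEQ_unique[OF this L]
  have "(LINT t|lborel. ?h t) = complex_of_real (2 * pi * (d - c)) * complex_of_real (measure M {a<..b})"
    using assms by (simp add: field_simps)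
  also have "measure M {a<..b} = measure lborel ({c..d} \<inter> {a<..b}) / (d - c)" by (simp add: meas)
  also have "measure lborel ({c..d} \<inter> {a<..b}) = measure lborel ({a..b} \<inter> {c..d})"
  proof (rule measure_eq_AE)
    show "AE x in lborel. (x \<in> {c..d} \<inter> {a<..b}) = (x \<in> {a..b} \<inter> {c..d})"
      by (rule AE_I[where N = "{a}"]) auto
  qed auto
  finally show ?thesis using assms by simp
qed

lemma fi_ivl_reflect: "fi (ivl c d) t = fi (ivl (- d) (- c)) (- t)"
proof -
  have "fi (ivl c d) t = (LINT x|lborel. cis (- ((0 + (-1) * x) * t)) * ivl c d (0 + (-1) * x))"
    unfolding fi_def using lborel_integral_real_affine[of "-1" "\<lambda>x. cis (- (x * t)) * ivl c d x" 0] by simp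
  also have "\<dots> = fi (ivl (- d) (- c)) (- t)"
    unfolding fi_def by (intro Bochner_Integration.integral_cong) (auto simp: ivl_def indicator_def)
  finally show ?thesis .
qed

lemma FT_FT_ivl:
  assumes "a < b"
  shows "FT (FT (emb (ivl a b))) = (2 * pi) *\<^sub>R refl2 (emb (ivl a b))"
proof (rule l2_eq_by_intervals)
  fix c d :: real and k :: complex
  assume "c < d"
  have L: "(\<lambda>x. cnj k * ivl c d x) \<in> Lp 2" by (intro Lp2_cmult ivl_Lp2)
  have I: "integrable lborel (\<lambda>x. cnj k * ivl c d x)" using ivl_integrable by simp
  have L': "(\<lambda>\<xi>. cnj k * fi (ivl c d) \<xi>) \<in> Lp 2" by (intro Lp2_cmult fi_L2 ivl_integrable ivl_Lp2)
  have R: "(\<lambda>x. ivl a b (- x)) = ivl (- b) (- a)" by (auto simp: ivl_def indicator_def fun_eq_iff)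
  have k: "(\<lambda>x. k * ivl c d x) = (\<lambda>x. cnj (cnj k * ivl c d x))" by (auto simp: ivl_def)
  have "inner (FT (FT (emb (ivl a b)))) (emb (\<lambda>x. k * ivl c d x)) = inner (FT (emb (ivl a b))) (lcnj (FT (emb (\<lambda>x. cnj k * ivl c d x))))"
    unfolding k lcnj_emb[OF L, symmetric] by (rule FT_Parseval)
  also have "\<dots> = Re (LINT t|lborel. fi (ivl a b) t * (cnj k * fi (ivl c d) t))"
    unfolding FT_emb[OF I L] FT_emb[OF ivl_integrable ivl_Lp2] fi_cmult lcnj_emb[OF L']
    by (subst inner_emb) (auto intro!: fi_L2 ivl_integrable ivl_Lp2 Lp2_cnj Lp2_cmult)
  also have "(LINT t|lborel. fi (ivl a b) t * (cnj k * fi (ivl c d) t)) = (LINT t|lborel. cnj k * (fi (ivl a b) t * fi (ivl (- d) (- c)) (- t)))"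
    by (subst fi_ivl_reflect[of c d]) (simp add: mult_ac)
  also have "\<dots> = cnj k * (2 * pi * complex_of_real (measure lborel ({a..b} \<inter> {- d.. - c})))"
    by (subst integral_mult_right_zero) (use assms \<open>c < d\<close> in \<open>simp add: Levy_intervals\<close>)
  finally have 1: "inner (FT (FT (emb (ivl a b)))) (emb (\<lambda>x. k * ivl c d x)) =
    Re (cnj k * (2 * pi * complex_of_real (measure lborel ({a..b} \<inter> {- d.. - c}))))" .
  have "inner ((2 * pi) *\<^sub>R refl2 (emb (ivl a b))) (emb (\<lambda>x. k * ivl c d x)) = 2 * pi * Re (LINT x|lborel. ivl (- b) (- a) x * cnj (k * ivl c d x))"
    unfolding refl2_emb[OF ivl_Lp2] R by (subst inner_scaleR_left, subst inner_emb) (auto intro: Lp2_cmult ivl_Lp2)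
  also have "(LINT x|lborel. ivl (- b) (- a) x * cnj (k * ivl c d x)) = (LINT x|lborel. cnj k * complex_of_real (indicat_real ({- b..- a} \<inter> {c..d}) x))"
    by (intro Bochner_Integration.integral_cong) (auto simp: ivl_def indicator_def)
  also have "\<dots> = cnj k * complex_of_real (measure lborel ({- b..- a} \<inter> {c..d}))"
    by (simp add: integral_complex_of_real)
  also have "measure lborel ({- b..- a} \<inter> {c..d}) = measure lborel ({a..b} \<inter> {- d.. - c})"
    by (simp add: Int_atLeastAtMost) (auto simp: max_def min_def)
  finally show "inner (FT (FT (emb (ivl a b)))) (emb (\<lambda>x. k * ivl c d x)) = inner ((2 * pi) *\<^sub>R refl2 (emb (ivl a b))) (emb (\<lambda>x. k * ivl c d x))"
    using 1 by simp
qed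

lemma inner_refl2: "inner (refl2 F) G = inner F (refl2 G)"
proof -
  have "(LINT x|lborel. rep_l2 (refl2 F) x * cnj (rep_l2 G x)) = (LINT x|lborel. rep_l2 F (- x) * cnj (rep_l2 G x))"
    by (intro integral_cong_AE) (measurable, use rep_refl2[of F] in eventually_elim, simp)
  also have "\<dots> = (LINT x|lborel. rep_l2 F x * cnj (rep_l2 G (- x)))"
    using lborel_integral_real_affine[of "-1" "\<lambda>x. rep_l2 F x * cnj (rep_l2 G (- x))" 0] by simp
  also have "\<dots> = (LINT x|lborel. rep_l2 F x * cnj (rep_l2 (refl2 G) x))"
    by (intro integral_cong_AE) (measurable, use rep_refl2[of G] in eventually_elim, simp)
  finally show ?thesis by (simp add: inner_l2_def)
qed

text \<open>Two applications of \<open>FT_Parseval\<close> move both transforms onto the test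
  interval, where Levy's theorem has settled the claim.\<close>

theorem FT_FT: "FT (FT F) = (2 * pi) *\<^sub>R refl2 F"
proof (rule l2_eq_by_intervals)
  fix a b :: real and k :: complex
  assume ab: "a < b"
  let ?G = "mulf (\<lambda>_. cnj k) (emb (ivl a b))"
  have k: "emb (\<lambda>x. k * ivl a b x) = lcnj ?G"
    by (simp add: mulf_emb ivl_Lp2 lcnj_emb Lp2_cmult) (simp add: ivl_def)
  have "inner (FT (FT F)) (lcnj ?G) = inner F (lcnj (FT (FT ?G)))"
    unfolding FT_Parseval ..
  also have "FT (FT ?G) = (2 * pi) *\<^sub>R refl2 ?G"
    by (simp add: FT_mulf_const FT_FT_ivl[OF ab] mulf_scaleR refl2_mulf)
  also have "inner F (lcnj \<dots>) = inner ((2 * pi) *\<^sub>R refl2 F) (lcnj ?G)"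
    by (simp add: linear_cmul[OF bounded_linear.linear[OF bounded_linear_lcnj]] lcnj_refl2 inner_refl2)
  finally show "inner (FT (FT F)) (emb (\<lambda>x. k * ivl a b x)) = inner ((2 * pi) *\<^sub>R refl2 F) (emb (\<lambda>x. k * ivl a b x))"
    unfolding k .
qed

definition iFT :: "l2 \<Rightarrow> l2" where "iFT F = (1 / (2 * pi)) *\<^sub>R refl2 (FT F)"

lemma refl2_scaleR: "refl2 (r *\<^sub>R F) = r *\<^sub>R refl2 F"
  by (rule linear_cmul[OF bounded_linear.linear[OF bounded_linear_refl2]])
lemma FT_scaleR: "FT (r *\<^sub>R F) = r *\<^sub>R FT F"
  by (rule linear_cmul[OF bounded_linear.linear[OF bounded_linear_FT]])
lemma lcnj_scaleR: "lcnj (r *\<^sub>R F) = r *\<^sub>R lcnj F"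
  by (rule linear_cmul[OF bounded_linear.linear[OF bounded_linear_lcnj]])

lemma iFT_FT [simp]: "iFT (FT F) = F"
  by (simp add: iFT_def FT_FT refl2_scaleR)

lemma FT_iFT [simp]: "FT (iFT F) = F"
  by (simp add: iFT_def FT_scaleR FT_refl2 FT_FT refl2_scaleR)

text \<open>The upper bound used twice along \<open>FT_FT\<close> leaves no room: a loss in either
  application would contradict the exact factor \<open>2 * pi\<close>.\<close>

lemma norm_FT: "norm (FT F) = sqrt (2 * pi) * norm F"
proof (rule antisym[OF norm_FT_le])
  have "2 * pi * norm F = norm (FT (FT F))" by (simp add: FT_FT)
  also have "\<dots> \<le> sqrt (2 * pi) * norm (FT F)" by (rule norm_FT_le)
  finally have "sqrt (2 * pi) * (sqrt (2 * pi) * norm F) \<le> sqrt (2 * pi) * norm (FT F)"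
    by (simp add: mult.assoc[symmetric])
  then show "sqrt (2 * pi) * norm F \<le> norm (FT F)" by simp
qed

lemma bounded_linear_iFT: "bounded_linear iFT"
  unfolding iFT_def[abs_def]
  by (intro bounded_linear_compose[OF bounded_linear_scaleR_right] bounded_linear_compose[OF bounded_linear_refl2] bounded_linear_FT)

lemma lcnj_iFT: "lcnj (iFT G) = iFT (refl2 (lcnj G))"
  by (simp add: iFT_def lcnj_scaleR lcnj_refl2 FT_refl2 FT_lcnj)

subsection \<open>Agreement with the Plancherel definition\<close>

lemma truncated_fourier_eq: "truncated_fourier R f = fi (\<lambda>x. cut R x * f x)"
  unfolding truncated_fourier_def[abs_def] fi_def set_lebesgue_integral_def cut_def
  by (intro ext Bochner_Integration.integral_cong) (auto simp: scaleR_conv_of_real)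

text \<open>The truncated integrals converge in norm to \<open>FT (emb f)\<close>, so the Plancherel
  definition fixes the transform up to null sets and the choice made by \<open>fourier\<close> is
  harmless.\<close>

lemma is_fourier_iff:
  assumes f: "f \<in> Lp 2"
  shows "is_fourier f F \<longleftrightarrow> F \<in> Lp 2 \<and> emb F = FT (emb f)"
proof -
  have tL: "truncated_fourier R f \<in> Lp 2" for R
    unfolding truncated_fourier_eq using f by (intro fi_L2 cut_integrable cut_mult_Lp2)
  have lim: "((\<lambda>R. emb (truncated_fourier R f)) \<longlongrightarrow> FT (emb f)) at_top"
  proof (rule Lim_null[THEN iffD2], rule Lim_null_comparison)
    show "\<forall>\<^sub>F R in at_top. norm (emb (truncated_fourier R f) - FT (emb f)) \<le> sqrt (2 * pi) * norm (mulf (cut R) (emb f) - emb f)"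
      unfolding truncated_fourier_eq using f
      by (auto intro!: always_eventually FT_approx cut_integrable cut_mult_Lp2 simp: mulf_emb)
    have "((\<lambda>R. sqrt (2 * pi) * norm (mulf (cut R) (emb f) - emb f)) \<longlongrightarrow> sqrt (2 * pi) * norm (emb f - emb f)) at_top"
      by (intro tendsto_intros mulf_cut_tendsto)
    then show "((\<lambda>R. sqrt (2 * pi) * norm (mulf (cut R) (emb f) - emb f)) \<longlongrightarrow> 0) at_top" by simp
  qed
  have "((\<lambda>R. Lp_norm 2 (\<lambda>\<xi>. F \<xi> - truncated_fourier R f \<xi>)) \<longlongrightarrow> 0) at_top \<longleftrightarrow> emb F = FT (emb f)"
    if F: "F \<in> Lp 2"
  proof -
    have "Lp_norm 2 (\<lambda>\<xi>. F \<xi> - truncated_fourier R f \<xi>) = norm (emb F - emb (truncated_fourier R f))" for R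
      using F tL by (simp add: norm_emb[symmetric] Lp2_diff emb_diff)
    moreover have "((\<lambda>R. norm (emb F - emb (truncated_fourier R f))) \<longlongrightarrow> norm (emb F - FT (emb f))) at_top"
      by (intro tendsto_intros lim)
    ultimately show ?thesis
      using tendsto_unique[OF trivial_limit_at_top_linorder] by fastforce
  qed
  then show ?thesis unfolding is_fourier_def using f tL by (auto intro!: always_eventually Lp2_diff)
qed

lemma fourier_Lp2: "f \<in> Lp 2 \<Longrightarrow> fourier f \<in> Lp 2"
  and emb_fourier: "f \<in> Lp 2 \<Longrightarrow> emb (fourier f) = FT (emb f)"
proof -
  assume f: "f \<in> Lp 2"
  have "is_fourier f (rep_l2 (FT (emb f)))" using f by (simp add: is_fourier_iff)
  then have "is_fourier f (fourier f)" unfolding fourier_def by (rule someI[of "is_fourier f"])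
  with f show "fourier f \<in> Lp 2" "emb (fourier f) = FT (emb f)" by (simp_all add: is_fourier_iff)
qed

lemma inv_fourier_Lp2: "F \<in> Lp 2 \<Longrightarrow> inv_fourier F \<in> Lp 2"
  and emb_inv_fourier: "F \<in> Lp 2 \<Longrightarrow> emb (inv_fourier F) = iFT (emb F)"
proof -
  assume F: "F \<in> Lp 2"
  have r: "(\<lambda>x. fourier F (- x)) \<in> Lp 2" using Lp2_affine[OF fourier_Lp2[OF F], of "-1" 0] by simp
  have e: "inv_fourier F = (\<lambda>x. (1 / (2 * pi)) *\<^sub>R fourier F (- x))"
    by (auto simp: inv_fourier_def scaleR_conv_of_real)
  show "inv_fourier F \<in> Lp 2" unfolding e by (intro Lp2_scaleR r)
  show "emb (inv_fourier F) = iFT (emb F)"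
    unfolding e iFT_def using r F by (simp add: emb_scaleR emb_fourier[symmetric] refl2_emb fourier_Lp2)
qed

definition mult :: "(real \<Rightarrow> complex) \<Rightarrow> l2 \<Rightarrow> l2" where "mult m F = iFT (mulf m (FT F))"

definition sg :: "real \<Rightarrow> l2 \<Rightarrow> l2" where "sg t = mult (\<lambda>\<xi>. cis (- (t * \<xi>\<^sup>2)))"

lemma bm_sg [simp, intro]: "bm (\<lambda>\<xi>. cis (- (t * \<xi>\<^sup>2)))" by (rule bm_cis) measurable

lemma schroedinger_Lp2: "f \<in> Lp 2 \<Longrightarrow> schroedinger t f \<in> Lp 2"
  and emb_schroedinger: "f \<in> Lp 2 \<Longrightarrow> emb (schroedinger t f) = sg t (emb f)"
proof -
  assume f: "f \<in> Lp 2"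
  have L: "(\<lambda>\<xi>. cis (- (t * \<xi>\<^sup>2)) * fourier f \<xi>) \<in> Lp 2" by (intro mulf_Lp2 bm_sg fourier_Lp2 f)
  show "schroedinger t f \<in> Lp 2" unfolding schroedinger_def by (rule inv_fourier_Lp2[OF L])
  show "emb (schroedinger t f) = sg t (emb f)"
    unfolding schroedinger_def sg_def mult_def emb_inv_fourier[OF L]
    by (simp add: emb_fourier[OF f, symmetric] mulf_emb fourier_Lp2[OF f])
qed

subsection \<open>Fourier multipliers\<close>

lemma FT_mult [simp]: "FT (mult m F) = mulf m (FT F)"
  by (simp add: mult_def)

lemma FT_eqI: "FT F = FT G \<Longrightarrow> F = G"
  by (metis iFT_FT)

lemma bounded_linear_mult: "bm m \<Longrightarrow> bounded_linear (mult m)"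
  unfolding mult_def[abs_def]
  by (intro bounded_linear_compose[OF bounded_linear_iFT] bounded_linear_compose[OF bounded_linear_mulf] bounded_linear_FT)

lemma mult_mult: "bm m \<Longrightarrow> bm n \<Longrightarrow> mult m (mult n F) = mult (\<lambda>x. m x * n x) F"
  by (rule FT_eqI) (simp add: mulf_mulf)

lemma mult_one [simp]: "mult (\<lambda>x. 1) F = F" by (rule FT_eqI) simp

lemma mult_const: "mult (\<lambda>_. c) F = mulf (\<lambda>_. c) F"
  by (rule FT_eqI) (simp add: FT_mulf_const)

lemma mult_commute: "bm m \<Longrightarrow> bm n \<Longrightarrow> mult m (mult n F) = mult n (mult m F)"
  by (simp add: mult_mult mult.commute)

lemma norm_mult_le:
  assumes "m \<in> borel_measurable borel" "\<And>x. cmod (m x) \<le> B"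
  shows "norm (mult m F) \<le> B * norm F"
proof -
  have "sqrt (2 * pi) * norm (mult m F) \<le> B * (sqrt (2 * pi) * norm F)"
    using norm_mulf_le[OF assms, of "FT F"] unfolding FT_mult[symmetric] norm_FT .
  then show ?thesis by (simp add: mult.left_commute)
qed

lemma norm_mult_unit:
  assumes "bm m" "\<And>x. cmod (m x) = 1" shows "norm (mult m F) = norm F"
  using norm_mulf_unit[OF assms, of "FT F"] unfolding FT_mult[symmetric] norm_FT by simp

lemma lcnj_mult: "bm m \<Longrightarrow> lcnj (mult m F) = mult (\<lambda>x. cnj (m (- x))) (lcnj F)"
  unfolding mult_def lcnj_iFT FT_lcnj by (simp add: lcnj_mulf refl2_mulf bm_cnj)

lemma tr_eq_mult: "tr h F = mult (\<lambda>\<xi>. cis (h * \<xi>)) F"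
  by (rule FT_eqI) (simp add: FT_tr)

lemma mult_tendsto_at:
  fixes m :: "'a::first_countable_topology \<Rightarrow> real \<Rightarrow> complex"
  assumes "\<And>t. m t \<in> borel_measurable borel" "m' \<in> borel_measurable borel"
    and "\<And>t x. cmod (m t x) \<le> B" "\<And>x. ((\<lambda>t. m t x) \<longlongrightarrow> m' x) (at t0 within S)"
  shows "((\<lambda>t. mult (m t) F) \<longlongrightarrow> mult m' F) (at t0 within S)"
  unfolding mult_def by (intro bounded_linear.tendsto[OF bounded_linear_iFT] mulf_tendsto_at[OF assms])

section \<open>Test functions and weak derivatives\<close>

text \<open>Differentiability of finite order, so that sums, products and affine substitutions can
  be treated by induction on the order; smoothness is \<open>diffk n f\<close> for every
  \<open>n\<close>.\<close>

definition diffk :: "nat \<Rightarrow> (real \<Rightarrow> real) \<Rightarrow> bool" where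
  "diffk n f \<longleftrightarrow> (\<forall>m<n. \<forall>x. (deriv ^^ m) f field_differentiable at x)"

lemma diffk_0 [simp]: "diffk 0 f" by (simp add: diffk_def)

lemma diffk_Suc: "diffk (Suc n) f \<longleftrightarrow> (\<forall>x. f field_differentiable at x) \<and> diffk n (deriv f)"
proof -
  have "(deriv ^^ m) (deriv f) = (deriv ^^ Suc m) f" for m by (simp add: funpow_swap1)
  then show ?thesis unfolding diffk_def by (simp add: All_less_Suc2 flip: funpow_swap1)
qed

lemma diffk_mono: "diffk (Suc n) f \<Longrightarrow> diffk n f"
  by (auto simp: diffk_def)

lemma diffk_add: "diffk n f \<Longrightarrow> diffk n g \<Longrightarrow> diffk n (\<lambda>x. f x + g x)"
proof (induction n arbitrary: f g)
  case (Suc n)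
  then have "deriv (\<lambda>x. f x + g x) = (\<lambda>x. deriv f x + deriv g x)"
    by (auto simp: diffk_Suc fun_eq_iff)
  with Suc show ?case by (auto simp: diffk_Suc intro!: field_differentiable_add)
qed simp

lemma diffk_mult: "diffk n f \<Longrightarrow> diffk n g \<Longrightarrow> diffk n (\<lambda>x. f x * g x)"
proof (induction n arbitrary: f g)
  case (Suc n)
  then have "deriv (\<lambda>x. f x * g x) = (\<lambda>x. f x * deriv g x + deriv f x * g x)"
    by (auto simp: diffk_Suc fun_eq_iff)
  with Suc show ?case
    using diffk_mono[OF Suc.prems(1)] diffk_mono[OF Suc.prems(2)]
    by (auto simp: diffk_Suc intro!: field_differentiable_mult diffk_add)
qed simp

lemma deriv_affine:
  fixes f :: "real \<Rightarrow> real"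
  assumes "\<And>x. f field_differentiable at x"
  shows "((\<lambda>x. f (c * x + d)) has_field_derivative c * deriv f (c * x + d)) (at x)"
proof -
  have "((\<lambda>x. c * x + d) has_field_derivative c) (at x)" by (auto intro!: derivative_eq_intros)
  from DERIV_chain2[OF field_differentiable_derivI[OF assms] this] show ?thesis by (simp add: mult.commute)
qed

lemma diffk_affine: "diffk n f \<Longrightarrow> diffk n (\<lambda>x. f (c * x + d))"
proof (induction n arbitrary: f)
  case (Suc n)
  then have D: "((\<lambda>x. f (c * x + d)) has_field_derivative c * deriv f (c * x + d)) (at x)" for x
    by (intro deriv_affine) (simp add: diffk_Suc)
  then have "deriv (\<lambda>x. f (c * x + d)) = (\<lambda>x. c * deriv f (c * x + d))" by (auto intro!: DERIV_imp_deriv)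
  moreover have "diffk n (\<lambda>x. c)" for n c
    by (induction n arbitrary: c) (auto simp: diffk_Suc)
  moreover have "(\<lambda>x. f (c * x + d)) field_differentiable at x" for x
    using D by (auto simp: field_differentiable_def)
  ultimately show ?case
    using Suc by (auto simp: diffk_Suc intro!: diffk_mult)
qed simp

section \<open>Smooth cut-off functions\<close>

definition flat :: "real poly \<Rightarrow> real \<Rightarrow> real" where
  "flat p x = (if x \<le> 0 then 0 else poly p (1 / x) * exp (- (1 / x)))"

lemma poly_exp_tendsto_0: "((\<lambda>y::real. poly p y * exp (- y)) \<longlongrightarrow> 0) at_top"
proof -
  have "((\<lambda>y. \<Sum>i\<le>degree p. coeff p i * (y ^ i / exp y)) \<longlongrightarrow> (\<Sum>i\<le>degree p. coeff p i * 0)) at_top"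
    by (intro tendsto_intros tendsto_power_div_exp_0)
  then show ?thesis by (simp add: poly_altdef sum_distrib_right exp_minus divide_inverse mult.assoc)
qed

text \<open>Carrying a polynomial in \<open>1 / x\<close> closes the family under differentiation,
  so one computation yields all orders. At 0 the exponential beats every polynomial.\<close>

lemma flat_deriv: "(flat p has_field_derivative flat ([:0, 0, 1:] * (p - pderiv p)) x) (at x)"
proof -
  consider "x < 0" | "x = 0" | "x > 0" by linarith
  then show ?thesis
  proof cases
    case 1
    have "((\<lambda>x. 0) has_field_derivative 0) (at x)" by simp
    then have "(flat p has_field_derivative 0) (at x)"
      by (rule has_field_derivative_transform_within_open[of _ _ _ "{..<0}"]) (use 1 in \<open>auto simp: flat_def\<close>)
    then show ?thesis using 1 by (simp add: flat_def)
  next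
    case 3
    have "((\<lambda>x. poly p (1 / x) * exp (- (1 / x))) has_field_derivative
        (poly (pderiv p) (1 / x) * (- (1 / x\<^sup>2))) * exp (- (1 / x)) + poly p (1 / x) * (exp (- (1 / x)) * (1 / x\<^sup>2))) (at x)"
      using 3 by (auto intro!: derivative_eq_intros DERIV_chain2[OF poly_DERIV] simp: power2_eq_square field_simps)
    then have "(flat p has_field_derivative
        (poly (pderiv p) (1 / x) * (- (1 / x\<^sup>2))) * exp (- (1 / x)) + poly p (1 / x) * (exp (- (1 / x)) * (1 / x\<^sup>2))) (at x)"
      by (rule has_field_derivative_transform_within_open[of _ _ _ "{0<..}"]) (use 3 in \<open>auto simp: flat_def\<close>)
    then show ?thesis using 3 by (simp add: flat_def power2_eq_square algebra_simps)
  next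
    case 2
    have "((\<lambda>y. flat p y / y) \<longlongrightarrow> 0) (at_left 0)"
      by (rule tendsto_eventually, rule eventually_at_leftI[of "-1"]) (auto simp: flat_def)
    moreover have "((\<lambda>y. flat p y / y) \<longlongrightarrow> 0) (at_right 0)"
      unfolding filterlim_at_right_to_top
    proof (rule Lim_transform_eventually)
      show "((\<lambda>y. poly (pCons 0 p) y * exp (- y)) \<longlongrightarrow> 0) at_top" by (rule poly_exp_tendsto_0)
      show "\<forall>\<^sub>F y in at_top. poly (pCons 0 p) y * exp (- y) = flat p (inverse y) / inverse y"
        using eventually_gt_at_top[of 0] by eventually_elim (auto simp: flat_def divide_inverse)
    qed
    ultimately have "((\<lambda>y. flat p y / y) \<longlongrightarrow> 0) (at 0)" by (rule filterlim_split_at)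
    then show ?thesis using 2 unfolding has_field_derivative_iff by (simp add: flat_def)
  qed
qed

lemma diffk_flat: "diffk n (flat p)"
proof (induction n arbitrary: p)
  case (Suc n)
  have "deriv (flat p) = flat ([:0, 0, 1:] * (p - pderiv p))" by (rule ext, rule DERIV_imp_deriv, rule flat_deriv)
  with Suc show ?case by (auto simp: diffk_Suc field_differentiable_def intro: flat_deriv)
qed simp

lemma test_functionI:
  assumes "\<And>n. diffk n \<phi>" "\<And>x. \<phi> x \<noteq> 0 \<Longrightarrow> a \<le> x \<and> x \<le> b"
  shows "test_function \<phi>"
proof -
  have "closure {x. \<phi> x \<noteq> 0} \<subseteq> {a..b}" using assms(2) by (intro closure_minimal) auto
  then have "compact (closure {x. \<phi> x \<noteq> 0})"
    by (meson bounded_closed_interval bounded_subset closed_closure compact_eq_bounded_closed)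
  with assms(1) show ?thesis unfolding test_function_def diffk_def by blast
qed

text \<open>Stretching the argument of \<open>flat\<close> by \<open>Suc n\<close> drives both
  factors to 1 inside the interval. The bumps thus converge to an indicator, and no integral has to
  be normalized.\<close>

definition bump :: "real \<Rightarrow> real \<Rightarrow> nat \<Rightarrow> real \<Rightarrow> real" where
  "bump a b n x = flat 1 (real (Suc n) * (x - a)) * flat 1 (real (Suc n) * (b - x))"

lemma flat_1: "flat 1 x = (if x \<le> 0 then 0 else exp (- (1 / x)))" by (simp add: flat_def)

lemma test_function_bump: "test_function (bump a b n)"
proof (rule test_functionI[of _ a b])
  show "diffk m (bump a b n)" for m
  proof -
    have "bump a b n = (\<lambda>x. flat 1 (real (Suc n) * x + - real (Suc n) * a) * flat 1 (- real (Suc n) * x + real (Suc n) * b))"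
      by (simp add: fun_eq_iff bump_def algebra_simps)
    then show ?thesis by (simp only:) (intro diffk_mult diffk_affine diffk_flat)
  qed
  show "a \<le> x \<and> x \<le> b" if "bump a b n x \<noteq> 0" for x
    using that by (auto simp: bump_def flat_1 zero_less_mult_iff not_le split: if_splits)
qed

lemma bump_bounds: "0 \<le> bump a b n x" "bump a b n x \<le> indicat_real {a..b} x"
proof -
  have f: "0 \<le> flat 1 y" "flat 1 y \<le> 1" for y by (auto simp: flat_1)
  then show "0 \<le> bump a b n x" by (simp add: bump_def)
  show "bump a b n x \<le> indicat_real {a..b} x"
  proof (cases "x \<in> {a..b}")
    case True then show ?thesis unfolding bump_def using f by (simp add: mult_le_one)
  next
    case False then show ?thesis by (auto simp: bump_def flat_1 zero_less_mult_iff not_le)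
  qed
qed

lemma bump_tendsto: "(\<lambda>n. bump a b n x) \<longlonglongrightarrow> indicat_real {a<..<b} x"
proof (cases "x \<in> {a<..<b}")
  case True
  have "(\<lambda>n. exp (- (1 / (real (Suc n) * (x - a)))) * exp (- (1 / (real (Suc n) * (b - x))))) \<longlonglongrightarrow> exp (- 0) * exp (- 0)"
  proof (intro tendsto_intros)
    have *: "(\<lambda>n. 1 / (real (Suc n) * c)) \<longlonglongrightarrow> 0" for c :: real
    proof -
      have "(\<lambda>n. (1 / c) / real (Suc n)) \<longlonglongrightarrow> 0" by (rule LIMSEQ_Suc) (rule lim_const_over_n)
      then show ?thesis by (simp add: mult.commute)
    qed
    show "(\<lambda>n. 1 / (real (Suc n) * (x - a))) \<longlonglongrightarrow> 0" "(\<lambda>n. 1 / (real (Suc n) * (b - x))) \<longlonglongrightarrow> 0" by (rule *)+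
  qed
  moreover have "bump a b n x = exp (- (1 / (real (Suc n) * (x - a)))) * exp (- (1 / (real (Suc n) * (b - x))))" for n
    using True by (simp add: bump_def flat_1 mult_le_0_iff not_le del: of_nat_Suc)
  ultimately show ?thesis using True by (simp del: of_nat_Suc)
next
  case False
  then have "bump a b n x = 0" for n by (auto simp: bump_def flat_1 mult_le_0_iff not_le)
  with False show ?thesis by simp
qed

lemma test_function_deriv: "test_function \<phi> \<Longrightarrow> test_function (deriv \<phi>)"
proof -
  assume t: "test_function \<phi>"
  have "(deriv ^^ n) (deriv \<phi>) = (deriv ^^ Suc n) \<phi>" for n by (simp add: funpow_swap1)
  with t have d: "(deriv ^^ n) (deriv \<phi>) field_differentiable at x" for n x
    unfolding test_function_def by metis
  have "{x. deriv \<phi> x \<noteq> 0} \<subseteq> closure {x. \<phi> x \<noteq> 0}"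
  proof (rule subsetI, rule ccontr)
    fix x assume x: "x \<in> {x. deriv \<phi> x \<noteq> 0}" "x \<notin> closure {x. \<phi> x \<noteq> 0}"
    have "((\<lambda>x. 0) has_field_derivative 0) (at x)" by simp
    then have "(\<phi> has_field_derivative 0) (at x)"
      by (rule has_field_derivative_transform_within_open[of _ _ _ "- closure {x. \<phi> x \<noteq> 0}"])
        (use x closure_subset[of "{x. \<phi> x \<noteq> 0}"] in auto)
    with x show False by (auto dest: DERIV_imp_deriv)
  qed
  then have "closure {x. deriv \<phi> x \<noteq> 0} \<subseteq> closure {x. \<phi> x \<noteq> 0}" by (intro closure_minimal) auto
  then have "closure {x. deriv \<phi> x \<noteq> 0} = closure {x. \<phi> x \<noteq> 0} \<inter> closure {x. deriv \<phi> x \<noteq> 0}" by blast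
  moreover have "compact (closure {x. \<phi> x \<noteq> 0})" using t by (simp add: test_function_def)
  ultimately have "compact (closure {x. deriv \<phi> x \<noteq> 0})" by (metis compact_Int_closed closed_closure)
  with d show ?thesis unfolding test_function_def by blast
qed

lemma test_function_support:
  assumes "test_function \<phi>"
  shows "\<exists>K>0. \<forall>x. \<bar>x\<bar> \<ge> K \<longrightarrow> \<phi> x = 0"
proof -
  have "bounded {x. \<phi> x \<noteq> 0}"
    using assms unfolding test_function_def by (meson bounded_subset closure_subset compact_imp_bounded)
  then obtain K where K: "K > 0" "\<And>x. x \<in> {x. \<phi> x \<noteq> 0} \<Longrightarrow> norm x \<le> K" by (auto simp: bounded_pos)
  show ?thesis by (rule exI[of _ "K + 1"]) (use K in force)
qed

lemma test_function_DERIV: "test_function \<phi> \<Longrightarrow> (\<phi> has_field_derivative deriv \<phi> x) (at x)"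
  unfolding test_function_def using field_differentiable_derivI by (metis funpow_0)

lemma test_function_continuous: "test_function \<phi> \<Longrightarrow> continuous_on S \<phi>"
  by (meson DERIV_isCont continuous_at_imp_continuous_on test_function_DERIV)

lemma test_function_measurable: "test_function \<phi> \<Longrightarrow> \<phi> \<in> borel_measurable borel"
  by (intro borel_measurable_continuous_onI test_function_continuous)

lemma test_function_bounded:
  assumes "test_function \<phi>" shows "\<exists>B. \<forall>x. \<bar>\<phi> x\<bar> \<le> B"
proof -
  obtain K where K: "K > 0" "\<And>x. \<bar>x\<bar> \<ge> K \<Longrightarrow> \<phi> x = 0" using test_function_support[OF assms] by blast
  have "compact (\<phi> ` {-K..K})" by (intro compact_continuous_image test_function_continuous assms) simp
  then obtain B where B: "\<And>y. y \<in> \<phi> ` {-K..K} \<Longrightarrow> norm y \<le> B" using compact_imp_bounded bounded_iff by metis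
  show ?thesis
  proof (rule exI[of _ "max B 0"], rule allI)
    fix x show "\<bar>\<phi> x\<bar> \<le> max B 0"
    proof (cases "\<bar>x\<bar> \<ge> K")
      case False
      then have "\<phi> x \<in> \<phi> ` {-K..K}" by (intro imageI) auto
      from B[OF this] show ?thesis by simp
    qed (use K(2) in simp)
  qed
qed

lemma test_function_shift: "test_function \<phi> \<Longrightarrow> test_function (\<lambda>x. \<phi> (x + h))"
  and deriv_shift: "test_function \<phi> \<Longrightarrow> deriv (\<lambda>x. \<phi> (x + h)) = (\<lambda>x. deriv \<phi> (x + h))"
proof -
  assume t: "test_function \<phi>"
  obtain K where K: "K > 0" "\<And>x. \<bar>x\<bar> \<ge> K \<Longrightarrow> \<phi> x = 0" using test_function_support[OF t] by blast
  have "diffk n \<phi>" for n using t by (simp add: test_function_def diffk_def)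
  from diffk_affine[OF this, of _ 1 h] show "test_function (\<lambda>x. \<phi> (x + h))"
  proof (intro test_functionI[of _ "- K - h" "K - h"])
    fix x assume "\<phi> (x + h) \<noteq> 0"
    then have "\<not> \<bar>x + h\<bar> \<ge> K" using K(2) by blast
    then show "- K - h \<le> x \<and> x \<le> K - h" by auto
  qed simp
  show "deriv (\<lambda>x. \<phi> (x + h)) = (\<lambda>x. deriv \<phi> (x + h))"
    using deriv_affine[of \<phi> 1 h] test_function_DERIV[OF t]
    by (auto intro!: DERIV_imp_deriv simp: field_differentiable_def)
qed

section \<open>Locally integrable functions and their weak derivatives\<close>

lemma locally_integrable_measurable:
  assumes "locally_integrable f" shows "f \<in> borel_measurable borel"
proof (rule borel_measurable_LIMSEQ_metric)
  fix n :: nat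
  have "set_integrable lborel {- real n..real n} f" using assms by (auto simp: locally_integrable_def)
  then show "(\<lambda>x. indicat_real {- real n..real n} x *\<^sub>R f x) \<in> borel_measurable borel"
    unfolding set_integrable_def by (auto dest: borel_measurable_integrable)
next
  fix x
  show "(\<lambda>n. indicat_real {- real n..real n} x *\<^sub>R f x) \<longlonglongrightarrow> f x"
    by (rule tendsto_eventually, use eventually_real_gt[of "\<bar>x\<bar>"] in eventually_elim) (auto simp: indicator_def)
qed

lemma locally_integrable_test:
  assumes f: "locally_integrable f" and t: "test_function \<phi>"
  shows "integrable lborel (\<lambda>x. \<phi> x *\<^sub>R f x)"
proof -
  note [measurable] = locally_integrable_measurable[OF f] test_function_measurable[OF t]
  obtain K where K: "K > 0" "\<And>x. \<bar>x\<bar> \<ge> K \<Longrightarrow> \<phi> x = 0" using test_function_support[OF t] by blast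
  obtain B where B: "\<And>x. \<bar>\<phi> x\<bar> \<le> B" using test_function_bounded[OF t] by blast
  have "0 \<le> B" using B[of 0] by linarith
  have "integrable lborel (\<lambda>x. indicat_real {-K..K} x *\<^sub>R f x)"
    using f unfolding locally_integrable_def set_integrable_def by (metis compact_Icc)
  then have "integrable lborel (\<lambda>x. B *\<^sub>R (indicat_real {-K..K} x *\<^sub>R f x))"
    by (rule integrable_scaleR_right)
  then show ?thesis
  proof (rule Bochner_Integration.integrable_bound)
    show "AE x in lborel. norm (\<phi> x *\<^sub>R f x) \<le> norm (B *\<^sub>R (indicat_real {-K..K} x *\<^sub>R f x))"
    proof (rule AE_I2)
      fix x
      show "norm (\<phi> x *\<^sub>R f x) \<le> norm (B *\<^sub>R (indicat_real {-K..K} x *\<^sub>R f x))"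
        using K(2)[of x] B[of x] \<open>0 \<le> B\<close> by (cases "\<bar>x\<bar> \<ge> K") (auto simp: indicator_def intro!: mult_right_mono)
    qed
  qed measurable
qed

text \<open>The bumps tend to the indicator of the open interval and are dominated by that of the
  closed one, so vanishing against test functions implies vanishing integrals over
  intervals.\<close>

lemma AE_zero_by_tests:
  assumes w: "locally_integrable w"
    and z: "\<And>\<phi>. test_function \<phi> \<Longrightarrow> (LINT x|lborel. \<phi> x *\<^sub>R w x) = 0"
  shows "AE x in lborel. w x = 0"
proof (rule AE_zero_if_interval_integrals_zero)
  note [measurable] = locally_integrable_measurable[OF w]
  show I: "set_integrable lborel {a..b} w" for a b using w by (auto simp: locally_integrable_def)
  fix a b :: real assume "a < b"
  have "(\<lambda>n. LINT x|lborel. bump a b n x *\<^sub>R w x) \<longlonglongrightarrow> (LINT x|lborel. indicat_real {a<..<b} x *\<^sub>R w x)"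
  proof (rule integral_dominated_convergence[where w = "\<lambda>x. norm (indicat_real {a..b} x *\<^sub>R w x)"])
    show "integrable lborel (\<lambda>x. norm (indicat_real {a..b} x *\<^sub>R w x))"
      using I[of a b] unfolding set_integrable_def by (rule integrable_norm)
    show "AE x in lborel. (\<lambda>n. bump a b n x *\<^sub>R w x) \<longlonglongrightarrow> indicat_real {a<..<b} x *\<^sub>R w x"
      by (intro AE_I2 tendsto_intros bump_tendsto)
    show "AE x in lborel. norm (bump a b n x *\<^sub>R w x) \<le> norm (indicat_real {a..b} x *\<^sub>R w x)" for n
      using bump_bounds[of a b n] by (auto intro!: AE_I2 mult_right_mono)
    show "(\<lambda>x. bump a b n x *\<^sub>R w x) \<in> borel_measurable lborel" for n
      using test_function_measurable[OF test_function_bump, of a b n] by measurable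
  qed measurable
  then have "(LINT x|lborel. indicat_real {a<..<b} x *\<^sub>R w x) = 0"
    using z[OF test_function_bump] LIMSEQ_unique[OF tendsto_const] by fastforce
  moreover have "(LINT x:{a..b}|lborel. w x) = (LINT x|lborel. indicat_real {a<..<b} x *\<^sub>R w x)"
    unfolding set_lebesgue_integral_def
    by (rule integral_cong_AE) (measurable, rule AE_I[where N = "{a, b}"], auto simp: indicator_def emeasure_lborel_countable)
  ultimately show "(LINT x:{a..b}|lborel. w x) = 0" by simp
qed

lemma weak_deriv_unique:
  assumes "weak_deriv k f g" "weak_deriv k f h" shows "AE x in lborel. g x = h x"
proof -
  have gh: "locally_integrable g" "locally_integrable h" using assms by (auto simp: weak_deriv_def)
  have "AE x in lborel. g x - h x = 0"
  proof (rule AE_zero_by_tests)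
    show "locally_integrable (\<lambda>x. g x - h x)" using gh by (auto simp: locally_integrable_def intro: set_integral_diff)
    fix \<phi> assume t: "test_function \<phi>"
    from assms t have "(-1) ^ k * (LINT x|lborel. \<phi> x *\<^sub>R g x) = (-1) ^ k * (LINT x|lborel. \<phi> x *\<^sub>R h x)"
      unfolding weak_deriv_def by metis
    then have "(LINT x|lborel. \<phi> x *\<^sub>R g x) = (LINT x|lborel. \<phi> x *\<^sub>R h x)" by simp
    then show "(LINT x|lborel. \<phi> x *\<^sub>R (g x - h x)) = 0"
      using locally_integrable_test[OF gh(1) t] locally_integrable_test[OF gh(2) t] by (simp add: scaleR_diff_right)
  qed
  then show ?thesis by eventually_elim simp
qed

lemma locally_integrable_cong:
  assumes "locally_integrable f" "f' \<in> borel_measurable borel" "AE x in lborel. f x = f' x"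
  shows "locally_integrable f'"
  unfolding locally_integrable_def
proof (intro allI impI)
  fix K :: "real set" assume "compact K"
  then have [measurable]: "K \<in> sets borel" by (simp add: borel_compact)
  note [measurable] = assms(2) locally_integrable_measurable[OF assms(1)]
  have "set_integrable lborel K f" using assms(1) \<open>compact K\<close> by (simp add: locally_integrable_def)
  then show "set_integrable lborel K f'"
    unfolding set_integrable_def
    by (rule integrable_cong_AE_imp) (measurable, use assms(3) in eventually_elim, simp)
qed

lemma integral_test_cong:
  assumes "f \<in> borel_measurable borel" "f' \<in> borel_measurable borel" "AE x in lborel. f x = f' x"
    "\<phi> \<in> borel_measurable borel"
  shows "(LINT x|lborel. \<phi> x *\<^sub>R f x) = (LINT x|lborel. (\<phi> x :: real) *\<^sub>R (f' x :: complex))"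
proof -
  note [measurable] = assms(1,2,4)
  show ?thesis by (rule integral_cong_AE) (measurable, use assms(3) in eventually_elim, simp)
qed

lemma test_function_funpow: "test_function \<phi> \<Longrightarrow> test_function ((deriv ^^ k) \<phi>)"
  by (induction k) (auto intro: test_function_deriv)

lemma weak_deriv_cong:
  assumes "weak_deriv k f g" "f' \<in> borel_measurable borel" "AE x in lborel. f x = f' x"
    "g' \<in> borel_measurable borel" "AE x in lborel. g x = g' x"
  shows "weak_deriv k f' g'"
proof -
  have L: "locally_integrable f" "locally_integrable g" using assms by (auto simp: weak_deriv_def)
  show ?thesis
    unfolding weak_deriv_def
  proof (intro conjI allI impI)
    show "locally_integrable f'" "locally_integrable g'" using L assms locally_integrable_cong by blast+
    fix \<phi> assume t: "test_function \<phi>"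
    show "(LINT x|lborel. (deriv ^^ k) \<phi> x *\<^sub>R f' x) = (-1) ^ k * (LINT x|lborel. \<phi> x *\<^sub>R g' x)"
      using assms(1) t integral_test_cong[OF locally_integrable_measurable[OF L(1)] assms(2,3) test_function_measurable[OF test_function_funpow[OF t]], of k]
        integral_test_cong[OF locally_integrable_measurable[OF L(2)] assms(4,5) test_function_measurable[OF t]]
      by (simp add: weak_deriv_def)
  qed
qed

lemma weak_deriv_0: "locally_integrable f \<Longrightarrow> weak_deriv 0 f f"
  by (simp add: weak_deriv_def)

lemma weak_deriv_chain:
  assumes "weak_deriv k f g" "weak_deriv (Suc k) f h" shows "weak_deriv 1 g h"
  unfolding weak_deriv_def
proof (intro conjI allI impI)
  fix \<phi> assume t: "test_function \<phi>"
  have "(LINT x|lborel. (deriv ^^ k) (deriv \<phi>) x *\<^sub>R f x) = (-1) ^ k * (LINT x|lborel. deriv \<phi> x *\<^sub>R g x)"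
    using assms(1) test_function_deriv[OF t] by (simp add: weak_deriv_def)
  moreover have "(LINT x|lborel. (deriv ^^ Suc k) \<phi> x *\<^sub>R f x) = (-1) ^ Suc k * (LINT x|lborel. \<phi> x *\<^sub>R h x)"
    using assms(2) t by (simp add: weak_deriv_def)
  moreover have "(deriv ^^ Suc k) \<phi> = (deriv ^^ k) (deriv \<phi>)" by (simp add: funpow_swap1)
  ultimately have "(-1) ^ k * (LINT x|lborel. deriv \<phi> x *\<^sub>R g x) = (-1) ^ k * (- (LINT x|lborel. \<phi> x *\<^sub>R h x))" by simp
  then have "(LINT x|lborel. deriv \<phi> x *\<^sub>R g x) = - (LINT x|lborel. \<phi> x *\<^sub>R h x)"
    by (subst (asm) mult_cancel_left) simp
  then show "(LINT x|lborel. (deriv ^^ 1) \<phi> x *\<^sub>R g x) = (- 1) ^ 1 * (LINT x|lborel. \<phi> x *\<^sub>R h x)" by simp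
qed (use assms in \<open>auto simp: weak_deriv_def\<close>)

lemma weak_deriv_Suc:
  assumes "weak_deriv k f g" "weak_deriv 1 g h" shows "weak_deriv (Suc k) f h"
  unfolding weak_deriv_def
proof (intro conjI allI impI)
  fix \<phi> assume t: "test_function \<phi>"
  have "(LINT x|lborel. (deriv ^^ k) (deriv \<phi>) x *\<^sub>R f x) = (-1) ^ k * (LINT x|lborel. deriv \<phi> x *\<^sub>R g x)"
    using assms(1) test_function_deriv[OF t] by (simp add: weak_deriv_def)
  moreover have "(LINT x|lborel. deriv \<phi> x *\<^sub>R g x) = - (LINT x|lborel. \<phi> x *\<^sub>R h x)"
    using assms(2) t by (simp add: weak_deriv_def)
  moreover have "(deriv ^^ Suc k) \<phi> = (deriv ^^ k) (deriv \<phi>)" by (simp add: funpow_swap1)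
  ultimately show "(LINT x|lborel. (deriv ^^ Suc k) \<phi> x *\<^sub>R f x) = (- 1) ^ Suc k * (LINT x|lborel. \<phi> x *\<^sub>R h x)"
    by (simp del: funpow.simps)
qed (use assms in \<open>auto simp: weak_deriv_def\<close>)

lemma weak_deriv_nabla: "weak_deriv k f g \<Longrightarrow> weak_deriv k f (nabla k f)"
  unfolding nabla_def by (rule someI[of "weak_deriv k f"])

lemma nabla_AE: "weak_deriv k f g \<Longrightarrow> AE x in lborel. nabla k f x = g x"
  using weak_deriv_unique weak_deriv_nabla by blast

lemma weak_deriv_measurable: "weak_deriv k f g \<Longrightarrow> f \<in> borel_measurable borel"
  "weak_deriv k f g \<Longrightarrow> g \<in> borel_measurable borel"
  by (auto simp: weak_deriv_def locally_integrable_measurable)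

section \<open>Unbounded multipliers and derivatives in the Hilbert space\<close>

text \<open>\<open>mrel m F G\<close> says \<open>G = m(D) F\<close>; as a relation it needs no domain for unbounded \<open>m\<close>.\<close>

definition mrel :: "(real \<Rightarrow> complex) \<Rightarrow> l2 \<Rightarrow> l2 \<Rightarrow> bool" where
  "mrel m F G \<longleftrightarrow> (AE \<xi> in lborel. rep_l2 (FT G) \<xi> = m \<xi> * rep_l2 (FT F) \<xi>)"

lemma bm_resolvent:
  assumes [measurable]: "m \<in> borel_measurable borel"
  shows "bm (\<lambda>\<xi>. 1 / complex_of_real (1 + cmod (m \<xi>)))" "bm (\<lambda>\<xi>. m \<xi> / complex_of_real (1 + cmod (m \<xi>)))"
proof -
  have n: "cmod (complex_of_real (1 + cmod z)) = 1 + cmod z" for z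
    by (simp only: norm_of_real) simp
  show "bm (\<lambda>\<xi>. 1 / complex_of_real (1 + cmod (m \<xi>)))"
    by (rule bmI[of _ 1]) (measurable, simp add: norm_divide n divide_le_eq_1 add_pos_nonneg del: of_real_add)
  show "bm (\<lambda>\<xi>. m \<xi> / complex_of_real (1 + cmod (m \<xi>)))"
    by (rule bmI[of _ 1]) (measurable, simp add: norm_divide n divide_le_eq_1 add_pos_nonneg del: of_real_add)
qed

text \<open>Dividing by \<open>1 + |m|\<close> turns the graph of an unbounded multiplier into an equation between bounded
  operators, so that it is closed and stable under integration.\<close>

lemma mrel_iff:
  assumes m: "m \<in> borel_measurable borel"
  shows "mrel m F G \<longleftrightarrow> mult (\<lambda>\<xi>. 1 / complex_of_real (1 + cmod (m \<xi>))) G = mult (\<lambda>\<xi>. m \<xi> / complex_of_real (1 + cmod (m \<xi>))) F"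
    (is "_ \<longleftrightarrow> mult ?c G = mult ?b F")
proof -
  have nz: "complex_of_real (1 + cmod z) \<noteq> 0" for z
    by (metis add_pos_nonneg norm_ge_zero of_real_eq_0_iff order_less_irrefl zero_less_one)
  have 1: "AE \<xi> in lborel. rep_l2 (FT (mult ?c G)) \<xi> = ?c \<xi> * rep_l2 (FT G) \<xi>"
    unfolding FT_mult by (rule rep_mulf[OF bm_resolvent(1)[OF m]])
  have 2: "AE \<xi> in lborel. rep_l2 (FT (mult ?b F)) \<xi> = ?b \<xi> * rep_l2 (FT F) \<xi>"
    unfolding FT_mult by (rule rep_mulf[OF bm_resolvent(2)[OF m]])
  show ?thesis
  proof
    assume r: "mrel m F G"
    show "mult ?c G = mult ?b F"
    proof (rule FT_eqI, rule l2_eqI)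
      show "AE \<xi> in lborel. rep_l2 (FT (mult ?c G)) \<xi> = rep_l2 (FT (mult ?b F)) \<xi>"
        using 1 2 r[unfolded mrel_def]
      proof eventually_elim
        case (elim \<xi>)
        show ?case unfolding elim by simp
      qed
    qed
  next
    assume eq: "mult ?c G = mult ?b F"
    have *: "a = b * d" if "c \<noteq> 0" "x = 1 / c * a" "x = b / c * d" for a b c d x :: complex
      using that by (simp add: field_simps)
    have "AE \<xi> in lborel. rep_l2 (FT (mult ?b F)) \<xi> = ?c \<xi> * rep_l2 (FT G) \<xi>"
      using 1 by (simp only: eq)
    from AE_conjI[OF this 2] show "mrel m F G"
      unfolding mrel_def by (rule AE_mp) (rule AE_I2, blast intro: *[OF nz])
  qed
qed

lemma mrel_unique: "mrel m F G \<Longrightarrow> mrel m F H \<Longrightarrow> G = H"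
  unfolding mrel_def by (rule FT_eqI, rule l2_eqI, erule (1) eventually_elim2) simp

lemma mrel_has_integral:
  assumes m: "m \<in> borel_measurable borel"
    and F: "(f has_integral F) S" and G: "(g has_integral G) S" and r: "\<And>x. x \<in> S \<Longrightarrow> mrel m (f x) (g x)"
  shows "mrel m F G"
proof -
  let ?c = "mult (\<lambda>\<xi>. 1 / complex_of_real (1 + cmod (m \<xi>)))"
  let ?b = "mult (\<lambda>\<xi>. m \<xi> / complex_of_real (1 + cmod (m \<xi>)))"
  have cG: "((?c \<circ> g) has_integral ?c G) S" and bF: "((?b \<circ> f) has_integral ?b F) S"
    by (intro has_integral_linear G F bounded_linear_mult bm_resolvent m)+
  have "(?c \<circ> g) x = (?b \<circ> f) x" if "x \<in> S" for x
    using r[OF that] by (simp add: mrel_iff[OF m])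
  from has_integral_eq[OF this cG] have "((?b \<circ> f) has_integral ?c G) S" .
  from has_integral_unique[OF this bF] show ?thesis by (simp add: mrel_iff[OF m])
qed

lemma FT_add: "FT (F + G) = FT F + FT G"
  by (rule linear_add[OF bounded_linear.linear[OF bounded_linear_FT]])

lemma FT_diff: "FT (F - G) = FT F - FT G"
  by (rule linear_diff[OF bounded_linear.linear[OF bounded_linear_FT]])

lemma mrel_add:
  assumes "mrel m F G" "mrel m F' G'" shows "mrel m (F + F') (G + G')"
  using assms unfolding mrel_def FT_add
  using rep_plus[of "FT F" "FT F'"] rep_plus[of "FT G" "FT G'"]
  by eventually_elim (simp add: distrib_left)

lemma mrel_diff:
  assumes "mrel m F G" "mrel m F' G'" shows "mrel m (F - F') (G - G')"
  using assms unfolding mrel_def FT_diff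
  using rep_minus[of "FT F" "FT F'"] rep_minus[of "FT G" "FT G'"]
  by eventually_elim (simp add: right_diff_distrib)

lemma mrel_mult:
  assumes "bm p" "mrel m F G" shows "mrel m (mult p F) (mult p G)"
  using assms(2) rep_mulf[OF assms(1), of "FT F"] rep_mulf[OF assms(1), of "FT G"]
  unfolding mrel_def FT_mult by eventually_elim simp

lemma mrel_comp:
  assumes "mrel m F G" "mrel n G H" shows "mrel (\<lambda>\<xi>. n \<xi> * m \<xi>) F H"
  using assms unfolding mrel_def by eventually_elim simp

lemma mrel_bm: "bm m \<Longrightarrow> mrel m F G \<longleftrightarrow> G = mult m F"
proof
  assume m: "bm m"
  show "mrel m F G" if "G = mult m F" using rep_mulf[OF m, of "FT F"] by (simp add: mrel_def that)
  then have "mrel m F (mult m F)" by (simp add: mrel_def rep_mulf[OF m])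
  then show "G = mult m F" if "mrel m F G" using that mrel_unique by blast
qed

lemma mrel_lcnj:
  assumes "mrel m F G" shows "mrel (\<lambda>\<xi>. cnj (m (- \<xi>))) (lcnj F) (lcnj G)"
proof -
  have c: "AE \<xi> in lborel. rep_l2 (FT (lcnj H)) \<xi> = cnj (rep_l2 (FT H) (- \<xi>))" for H
    unfolding FT_lcnj using rep_refl2[of "lcnj (FT H)"] AE_refl[OF rep_lcnj[of "FT H"]]
    by eventually_elim simp
  show ?thesis using AE_refl[OF assms[unfolded mrel_def]] c[of F] c[of G]
    unfolding mrel_def by eventually_elim simp
qed

lemma mrel_exists:
  assumes "(\<lambda>\<xi>. m \<xi> * rep_l2 (FT F) \<xi>) \<in> Lp 2" shows "mrel m F (iFT (mulf m (FT F)))"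
  using rep_mulf'[OF assms] by (simp add: mrel_def)

lemma mrel_Lp2: assumes [measurable]: "m \<in> borel_measurable borel" and "mrel m F G"
  shows "(\<lambda>\<xi>. m \<xi> * rep_l2 (FT F) \<xi>) \<in> Lp 2"
  by (rule Lp2_cong[OF rep_l2_Lp2[of "FT G"]]) (measurable, use assms(2) in \<open>auto simp: mrel_def\<close>)

text \<open>An inequality between symbols becomes one between norms by Plancherel, whose factor
  occurs on both sides.\<close>

lemma mrel_norm_le:
  assumes "mrel m F G" "mrel n F H" "0 \<le> C" "\<And>\<xi>. cmod (m \<xi>) \<le> C * cmod (n \<xi>)"
  shows "norm G \<le> C * norm H"
proof -
  have "norm (emb (rep_l2 (FT G))) \<le> C * norm (emb (rep_l2 (FT H)))"
  proof (rule norm_emb_mono)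
    show "AE x in lborel. cmod (rep_l2 (FT G) x) \<le> C * cmod (rep_l2 (FT H) x)"
      using assms(1,2) unfolding mrel_def
    proof eventually_elim
      case (elim x)
      then show ?case using mult_right_mono[OF assms(4)[of x], of "cmod (rep_l2 (FT F) x)"] by (simp add: norm_mult mult_ac)
    qed
  qed (use assms in auto)
  then show ?thesis by (simp add: norm_FT mult.left_commute)
qed

lemma mrel_dominated:
  assumes "mrel n F H" "m \<in> borel_measurable borel" "n \<in> borel_measurable borel" "\<And>\<xi>. cmod (m \<xi>) \<le> C * cmod (n \<xi>)"
  shows "\<exists>G. mrel m F G"
proof -
  note [measurable] = assms(2,3)
  have "(\<lambda>\<xi>. m \<xi> * rep_l2 (FT F) \<xi>) \<in> Lp 2"
  proof (rule Lp2_bound[OF _ mrel_Lp2[OF assms(3,1)], of _ C])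
    show "AE x in lborel. cmod (m x * rep_l2 (FT F) x) \<le> C * cmod (n x * rep_l2 (FT F) x)"
      using assms(4) by (auto simp: norm_mult mult.assoc[symmetric] intro!: mult_right_mono)
  qed measurable
  then show ?thesis by (intro exI) (rule mrel_exists)
qed

section \<open>Derivatives as limits of difference quotients\<close>

lemma cmod_cis_minus_one: "cmod (cis x - 1) \<le> \<bar>x\<bar>"
  using iexp_approx1[of x 0] by (simp add: cis_conv_exp)

lemma has_vector_derivative_quotient:
  "(f has_vector_derivative D) (at t) \<longleftrightarrow> ((\<lambda>h. (f (t + h) - f t) /\<^sub>R h) \<longlongrightarrow> D) (at 0)"
proof -
  have "(f has_vector_derivative D) (at t) \<longleftrightarrow> ((\<lambda>h. norm (f (t + h) - f t - h *\<^sub>R D) / norm h) \<longlongrightarrow> 0) (at 0)"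
    by (simp add: has_vector_derivative_def has_derivative_at bounded_linear_scaleR_left)
  also have "\<dots> \<longleftrightarrow> ((\<lambda>h. norm ((f (t + h) - f t) /\<^sub>R h - D)) \<longlongrightarrow> 0) (at 0)"
  proof (rule tendsto_cong, unfold eventually_at_filter, rule always_eventually, intro allI impI)
    fix h :: real assume "h \<noteq> 0"
    then have "(f (t + h) - f t) /\<^sub>R h - D = (f (t + h) - f t - h *\<^sub>R D) /\<^sub>R h" by (simp add: scaleR_diff_right)
    then show "norm (f (t + h) - f t - h *\<^sub>R D) / norm h = norm ((f (t + h) - f t) /\<^sub>R h - D)"
      by (simp add: divide_inverse mult.commute)
  qed
  also have "\<dots> \<longleftrightarrow> ((\<lambda>h. (f (t + h) - f t) /\<^sub>R h) \<longlongrightarrow> D) (at 0)"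
    by (simp add: tendsto_norm_zero_iff LIM_zero_iff)
  finally show ?thesis .
qed

text \<open>The difference quotient is a multiplier of modulus at most 1 applied to
  \<open>G\<close>, and this multiplier tends to 1 pointwise. Dominated convergence then suffices
  although the generator is unbounded.\<close>

lemma mult_has_vector_derivative:
  fixes \<theta> :: "real \<Rightarrow> real"
  assumes [measurable]: "\<theta> \<in> borel_measurable borel" and r: "mrel (\<lambda>\<xi>. \<i> * complex_of_real (\<theta> \<xi>)) F G"
  shows "((\<lambda>t. mult (\<lambda>\<xi>. cis (t * \<theta> \<xi>)) F) has_vector_derivative mult (\<lambda>\<xi>. cis (t * \<theta> \<xi>)) G) (at t within S)"
proof -
  define m where "m = (\<lambda>h \<xi>. if h * \<theta> \<xi> = 0 then 1 else (cis (h * \<theta> \<xi>) - 1) / (\<i> * complex_of_real (h * \<theta> \<xi>)))"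
  have [measurable]: "m h \<in> borel_measurable borel" for h unfolding m_def by measurable
  have m1: "cmod (m h \<xi>) \<le> 1" for h \<xi>
    using cmod_cis_minus_one[of "h * \<theta> \<xi>"] by (auto simp: m_def norm_divide norm_mult abs_mult divide_le_eq)
  have bmm: "bm (m h)" for h by (rule bmI[of _ 1]) (auto simp: m1)
  have bmc: "bm (\<lambda>\<xi>. cis (s * \<theta> \<xi>))" for s by (rule bm_cis) measurable
  have quot: "(1 / h) *\<^sub>R (mult (\<lambda>\<xi>. cis ((t + h) * \<theta> \<xi>)) F - mult (\<lambda>\<xi>. cis (t * \<theta> \<xi>)) F) = mult (\<lambda>\<xi>. cis (t * \<theta> \<xi>)) (mult (m h) G)"
    if "h \<noteq> 0" for h
  proof (rule FT_eqI, rule l2_eqI)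
    show "AE \<xi> in lborel. rep_l2 (FT ((1 / h) *\<^sub>R (mult (\<lambda>\<xi>. cis ((t + h) * \<theta> \<xi>)) F - mult (\<lambda>\<xi>. cis (t * \<theta> \<xi>)) F))) \<xi> =
        rep_l2 (FT (mult (\<lambda>\<xi>. cis (t * \<theta> \<xi>)) (mult (m h) G))) \<xi>"
      unfolding FT_mult FT_scaleR FT_diff
      using rep_scaleR[of "1 / h" "mulf (\<lambda>\<xi>. cis ((t + h) * \<theta> \<xi>)) (FT F) - mulf (\<lambda>\<xi>. cis (t * \<theta> \<xi>)) (FT F)"]
        rep_minus[of "mulf (\<lambda>\<xi>. cis ((t + h) * \<theta> \<xi>)) (FT F)" "mulf (\<lambda>\<xi>. cis (t * \<theta> \<xi>)) (FT F)"]
        rep_mulf[OF bmc, of "t + h" "FT F"] rep_mulf[OF bmc, of t "FT F"] rep_mulf[OF bmc, of t "mulf (m h) (FT G)"]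
        rep_mulf[OF bmm, of h "FT G"] r[unfolded mrel_def]
    proof eventually_elim
      case (elim \<xi>)
      let ?f = "rep_l2 (FT F) \<xi>"
      have m: "m h \<xi> * (\<i> * complex_of_real (\<theta> \<xi>)) = (cis (h * \<theta> \<xi>) - 1) / h"
        using that by (auto simp: m_def)
      have c: "cis ((t + h) * \<theta> \<xi>) = cis (t * \<theta> \<xi>) * cis (h * \<theta> \<xi>)" by (simp add: cis_mult distrib_right)
      have "(1 / h) *\<^sub>R (cis ((t + h) * \<theta> \<xi>) * ?f - cis (t * \<theta> \<xi>) * ?f) = cis (t * \<theta> \<xi>) * ((cis (h * \<theta> \<xi>) - 1) / h * ?f)"
        unfolding c by (simp add: scaleR_conv_of_real algebra_simps diff_divide_distrib)
      also have "\<dots> = cis (t * \<theta> \<xi>) * (m h \<xi> * (\<i> * complex_of_real (\<theta> \<xi>) * ?f))"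
        unfolding m[symmetric] by (simp only: mult.assoc)
      finally show ?case by (simp only: elim)
    qed
  qed
  have lim: "((\<lambda>h. mult (m h) G) \<longlongrightarrow> mult (\<lambda>\<xi>. 1) G) (at 0 within T)" for T
  proof (rule mult_tendsto_at[of _ _ 1])
    fix \<xi>
    show "((\<lambda>h. m h \<xi>) \<longlongrightarrow> 1) (at 0 within T)"
    proof (cases "\<theta> \<xi> = 0")
      case True then show ?thesis by (simp add: m_def)
    next
      case False
      have "((\<lambda>h. cis (h * \<theta> \<xi>)) has_vector_derivative (\<theta> \<xi>) *\<^sub>R (\<i> * cis (0 * \<theta> \<xi>))) (at 0)"
        unfolding has_vector_derivative_def
        by (rule has_derivative_eq_rhs, rule has_derivative_cis[THEN has_derivative_compose[rotated]], (rule derivative_intros)+)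
          (auto simp: fun_eq_iff scaleR_conv_of_real)
      then have "((\<lambda>h. (cis (h * \<theta> \<xi>) - 1) /\<^sub>R h) \<longlongrightarrow> \<i> * complex_of_real (\<theta> \<xi>)) (at 0)"
        by (simp add: has_vector_derivative_quotient scaleR_conv_of_real mult.commute)
      then have "((\<lambda>h. ((cis (h * \<theta> \<xi>) - 1) /\<^sub>R h) / (\<i> * complex_of_real (\<theta> \<xi>))) \<longlongrightarrow> 1) (at 0)"
        using False tendsto_divide[OF _ tendsto_const, of _ "\<i> * complex_of_real (\<theta> \<xi>)" _ "\<i> * complex_of_real (\<theta> \<xi>)"] by fastforce
      then have "((\<lambda>h. m h \<xi>) \<longlongrightarrow> 1) (at 0)"
        by (rule Lim_transform_eventually)
          (use False in \<open>auto simp: eventually_at_filter m_def scaleR_conv_of_real divide_inverse mult_ac\<close>)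
      then show ?thesis by (rule tendsto_within_subset) auto
    qed
  qed (auto simp: m1)
  have "((\<lambda>h. mult (\<lambda>\<xi>. cis (t * \<theta> \<xi>)) (mult (m h) G)) \<longlongrightarrow> mult (\<lambda>\<xi>. cis (t * \<theta> \<xi>)) G) (at 0)"
    using bounded_linear.tendsto[OF bounded_linear_mult[OF bmc] lim[of UNIV]] by simp
  then have "((\<lambda>h. (mult (\<lambda>\<xi>. cis ((t + h) * \<theta> \<xi>)) F - mult (\<lambda>\<xi>. cis (t * \<theta> \<xi>)) F) /\<^sub>R h) \<longlongrightarrow> mult (\<lambda>\<xi>. cis (t * \<theta> \<xi>)) G) (at 0)"
    by (rule Lim_transform_eventually) (auto simp: eventually_at_filter divide_inverse quot[symmetric])
  then have "((\<lambda>t. mult (\<lambda>\<xi>. cis (t * \<theta> \<xi>)) F) has_vector_derivative mult (\<lambda>\<xi>. cis (t * \<theta> \<xi>)) G) (at t)"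
    by (simp add: has_vector_derivative_quotient)
  then show ?thesis by (rule has_vector_derivative_at_within)
qed

abbreviation dk :: "nat \<Rightarrow> l2 \<Rightarrow> l2 \<Rightarrow> bool" where
  "dk k \<equiv> mrel (\<lambda>\<xi>. (\<i> * complex_of_real \<xi>) ^ k)"

lemma dk_0: "dk 0 F G \<longleftrightarrow> G = F"
  using mrel_bm[of "\<lambda>_. 1"] by simp

lemma dk_add: "dk j F G \<Longrightarrow> dk k G H \<Longrightarrow> dk (j + k) F H"
  using mrel_comp[of _ F G _ H] by (simp add: power_add mult.commute)

lemma dk_lcnj: "dk k F G \<Longrightarrow> dk k (lcnj F) (lcnj G)"
  using mrel_lcnj[of "\<lambda>\<xi>. (\<i> * complex_of_real \<xi>) ^ k" F G] by simp

lemma dk_tr_limit: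
  assumes "dk 1 F G"
  shows "((\<lambda>h. (1 / h) *\<^sub>R (tr h F - F)) \<longlongrightarrow> G) (at 0)"
proof -
  have "((\<lambda>t. mult (\<lambda>\<xi>. cis (t * \<xi>)) F) has_vector_derivative mult (\<lambda>\<xi>. cis (0 * \<xi>)) G) (at 0)"
    using mult_has_vector_derivative[of "\<lambda>\<xi>. \<xi>" F G 0 UNIV] assms by simp
  then show ?thesis by (simp add: tr_eq_mult has_vector_derivative_quotient divide_inverse)
qed

text \<open>Derivatives are recognized by translations alone, which is what products and weak
  derivatives can supply. Along a subsequence the transformed quotients converge almost everywhere,
  and their symbols tend to that of the derivative.\<close>

lemma dk_if_tr_limit:
  assumes h: "h \<longlonglongrightarrow> 0" "\<And>n. h n \<noteq> 0" and lim: "(\<lambda>n. (1 / h n) *\<^sub>R (tr (h n) F - F)) \<longlonglongrightarrow> G"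
  shows "dk 1 F G"
proof -
  have "(\<lambda>n. FT ((1 / h n) *\<^sub>R (tr (h n) F - F))) \<longlonglongrightarrow> FT G"
    by (rule bounded_linear.tendsto[OF bounded_linear_FT lim])
  from l2_AE_subseq[OF this] obtain r where r: "strict_mono r"
    "AE \<xi> in lborel. (\<lambda>n. rep_l2 (FT ((1 / h (r n)) *\<^sub>R (tr (h (r n)) F - F))) \<xi>) \<longlonglongrightarrow> rep_l2 (FT G) \<xi>" by blast
  have bmc: "bm (\<lambda>\<xi>. cis (s * \<xi>))" for s by (rule bm_cis) measurable
  have "AE \<xi> in lborel. rep_l2 (FT ((1 / h n) *\<^sub>R (tr (h n) F - F))) \<xi> = ((cis (h n * \<xi>) - 1) /\<^sub>R h n) * rep_l2 (FT F) \<xi>" for n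
    unfolding FT_scaleR FT_diff FT_tr
    using rep_scaleR[of "1 / h n" "mulf (\<lambda>\<xi>. cis (h n * \<xi>)) (FT F) - FT F"]
      rep_minus[of "mulf (\<lambda>\<xi>. cis (h n * \<xi>)) (FT F)" "FT F"] rep_mulf[OF bmc, of "h n" "FT F"]
    by eventually_elim (simp add: left_diff_distrib scaleR_diff_right divide_inverse)
  then have "AE \<xi> in lborel. \<forall>n. rep_l2 (FT ((1 / h n) *\<^sub>R (tr (h n) F - F))) \<xi> = ((cis (h n * \<xi>) - 1) /\<^sub>R h n) * rep_l2 (FT F) \<xi>"
    unfolding AE_all_countable ..
  with r(2) show ?thesis unfolding mrel_def
  proof eventually_elim
    case (elim \<xi>)
    have "((\<lambda>h. cis (h * \<xi>)) has_vector_derivative \<xi> *\<^sub>R (\<i> * cis (0 * \<xi>))) (at 0)"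
      unfolding has_vector_derivative_def
      by (rule has_derivative_eq_rhs, rule has_derivative_cis[THEN has_derivative_compose[rotated]], (rule derivative_intros)+)
        (auto simp: fun_eq_iff scaleR_conv_of_real)
    then have L: "((\<lambda>h. (cis (h * \<xi>) - 1) /\<^sub>R h) \<longlongrightarrow> \<i> * complex_of_real \<xi>) (at 0)"
      by (simp add: has_vector_derivative_quotient scaleR_conv_of_real mult.commute)
    have "(\<lambda>n. h (r n)) \<longlonglongrightarrow> 0" using LIMSEQ_subseq_LIMSEQ[OF h(1) r(1)] by (simp add: comp_def)
    then have "filterlim (\<lambda>n. h (r n)) (at 0) sequentially" using h(2) by (auto simp: filterlim_at)
    from filterlim_compose[OF L this]
    have "(\<lambda>n. ((cis (h (r n) * \<xi>) - 1) /\<^sub>R h (r n)) * rep_l2 (FT F) \<xi>) \<longlonglongrightarrow> \<i> * complex_of_real \<xi> * rep_l2 (FT F) \<xi>"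
      by (intro tendsto_intros)
    with elim show ?case using LIMSEQ_unique by (auto simp del: divide_inverse)
  qed
qed

lemma inner_FT: "inner (FT F) (FT G) = 2 * pi * inner F G"
proof -
  have "(norm (FT (F + G)))\<^sup>2 = 2 * pi * (norm (F + G))\<^sup>2" by (simp add: norm_FT power_mult_distrib)
  moreover have "(norm (FT F))\<^sup>2 = 2 * pi * (norm F)\<^sup>2" "(norm (FT G))\<^sup>2 = 2 * pi * (norm G)\<^sup>2"
    by (simp_all add: norm_FT power_mult_distrib)
  ultimately show ?thesis by (simp add: FT_add power2_norm_eq_inner inner_add inner_commute algebra_simps)
qed

lemma dk_inner_skew:
  assumes "dk 1 F F'" "dk 1 G G'" shows "inner F' G = - inner F G'"
proof -
  have "(LINT x|lborel. rep_l2 (FT F') x * cnj (rep_l2 (FT G) x)) = (LINT x|lborel. - (rep_l2 (FT F) x * cnj (rep_l2 (FT G') x)))"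
    by (rule integral_cong_AE)
      (measurable, use assms[unfolded mrel_def] in eventually_elim, simp)
  then have "inner (FT F') (FT G) = - inner (FT F) (FT G')" by (simp add: inner_l2_def)
  then have "(2 * pi) * (inner F' G + inner F G') = 0" by (simp add: inner_FT distrib_left)
  then show ?thesis by (simp add: add_eq_0_iff)
qed

lemma dk_mulf_const: "dk k F G \<Longrightarrow> dk k (mulf (\<lambda>_. c) F) (mulf (\<lambda>_. c) G)"
  unfolding mult_const[symmetric] by (rule mrel_mult) auto

subsection \<open>Weak derivatives of square integrable functions\<close>

definition tl :: "(real \<Rightarrow> real) \<Rightarrow> l2" where "tl \<phi> = emb (\<lambda>x. complex_of_real (\<phi> x))"

lemma assumes t: "test_function \<phi>" shows test_Lp2: "(\<lambda>x. complex_of_real (\<phi> x)) \<in> Lp 2"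
  and test_integrable: "integrable lborel (\<lambda>x. complex_of_real (\<phi> x))"
proof -
  note [measurable] = test_function_measurable[OF t]
  obtain K where K: "K > 0" "\<And>x. \<bar>x\<bar> \<ge> K \<Longrightarrow> \<phi> x = 0" using test_function_support[OF t] by blast
  obtain B where B: "\<And>x. \<bar>\<phi> x\<bar> \<le> B" using test_function_bounded[OF t] by blast
  have le: "cmod (complex_of_real (\<phi> x)) \<le> B * cmod (ivl (-K) K x)" for x
    using K(2)[of x] B[of x] by (cases "\<bar>x\<bar> \<ge> K") (auto simp: ivl_def indicator_def)
  show "(\<lambda>x. complex_of_real (\<phi> x)) \<in> Lp 2" by (rule Lp2_bound[OF _ ivl_Lp2[of "-K" K], of _ B]) (use le in auto)
  have "integrable lborel (\<lambda>x. B * cmod (ivl (-K) K x))" using ivl_integrable[of "-K" K] by auto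
  then show "integrable lborel (\<lambda>x. complex_of_real (\<phi> x))"
    by (rule Bochner_Integration.integrable_bound) (use le in \<open>auto intro: order_trans[OF _ abs_ge_self]\<close>)
qed

text \<open>Integration by parts over an interval beyond the supports of \<open>\<phi>\<close> and
  of its derivative leaves no boundary terms.\<close>

lemma dk_tl:
  assumes t: "test_function \<phi>" shows "dk 1 (tl \<phi>) (tl (deriv \<phi>))"
proof -
  note t' = test_function_deriv[OF t]
  have "fi (\<lambda>x. complex_of_real (deriv \<phi> x)) \<xi> = \<i> * complex_of_real \<xi> * fi (\<lambda>x. complex_of_real (\<phi> x)) \<xi>" for \<xi>
  proof -
    obtain K where K: "K > 0" "\<And>x. \<bar>x\<bar> \<ge> K \<Longrightarrow> \<phi> x = 0" using test_function_support[OF t] by blast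
    obtain K' where K': "K' > 0" "\<And>x. \<bar>x\<bar> \<ge> K' \<Longrightarrow> deriv \<phi> x = 0" using test_function_support[OF t'] by blast
    define M where "M = max K K'"
    have M: "M > 0" "\<And>x. \<bar>x\<bar> \<ge> M \<Longrightarrow> \<phi> x = 0" "\<And>x. \<bar>x\<bar> \<ge> M \<Longrightarrow> deriv \<phi> x = 0"
      using K K' by (auto simp: M_def)
    let ?F = "\<lambda>x. cis (- (x * \<xi>)) * complex_of_real (\<phi> x)"
    let ?f = "\<lambda>x. cis (- (x * \<xi>)) * complex_of_real (deriv \<phi> x) - \<i> * complex_of_real \<xi> * (cis (- (x * \<xi>)) * complex_of_real (\<phi> x))"
    have D: "(?F has_vector_derivative ?f x) (at x within {-M..M})" for x
    proof -
      have c: "((\<lambda>x. cis (- (x * \<xi>))) has_vector_derivative (- \<xi>) *\<^sub>R (\<i> * cis (- (x * \<xi>)))) (at x within {-M..M})"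
        unfolding has_vector_derivative_def
        by (rule has_derivative_eq_rhs, rule has_derivative_cis[THEN has_derivative_compose[rotated]], (rule derivative_intros)+)
          (auto simp: fun_eq_iff scaleR_conv_of_real)
      have "(\<phi> has_field_derivative deriv \<phi> x) (at x within {-M..M})"
        by (rule has_field_derivative_at_within[OF test_function_DERIV[OF t]])
      from has_vector_derivative_mult[OF c has_vector_derivative_of_real[OF this]]
      show ?thesis by (simp add: scaleR_conv_of_real algebra_simps)
    qed
    have "has_bochner_integral lborel (\<lambda>x. indicat_real {-M..M} x *\<^sub>R ?f x) (?F M - ?F (-M))"
    proof (rule has_bochner_integral_FTC_Icc)
      show "continuous_on {-M..M} ?f"
        by (intro continuous_intros test_function_continuous t t')
    qed (use M D in auto)
    moreover have "(\<lambda>x. indicat_real {-M..M} x *\<^sub>R ?f x) = ?f"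
    proof
      fix x show "indicat_real {-M..M} x *\<^sub>R ?f x = ?f x"
        using M(2,3)[of x] by (cases "\<bar>x\<bar> \<ge> M") (auto simp: indicator_def)
    qed
    ultimately have "(LINT x|lborel. ?f x) = 0" using M by (simp add: has_bochner_integral_iff)
    moreover have "integrable lborel (\<lambda>x. cis (- (x * \<xi>)) * complex_of_real (deriv \<phi> x))"
      "integrable lborel ?F" by (intro fi_integrable test_integrable t t', measurable)+
    ultimately show ?thesis unfolding fi_def by simp
  qed
  then have e: "fi (\<lambda>x. complex_of_real (deriv \<phi> x)) = (\<lambda>\<xi>. \<i> * complex_of_real \<xi> * fi (\<lambda>x. complex_of_real (\<phi> x)) \<xi>)" ..
  note L = fi_L2(1)[OF test_integrable[OF t] test_Lp2[OF t]] fi_L2(1)[OF test_integrable[OF t'] test_Lp2[OF t']]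
  show ?thesis unfolding mrel_def tl_def FT_emb[OF test_integrable[OF t] test_Lp2[OF t]] FT_emb[OF test_integrable[OF t'] test_Lp2[OF t']]
    using rep_emb[OF L(1)] rep_emb[OF L(2)] by eventually_elim (simp add: e)
qed

lemma inner_tl:
  assumes f: "f \<in> Lp 2" and t: "test_function \<phi>"
  shows "inner (emb f) (mulf (\<lambda>_. d) (tl \<phi>)) = Re (cnj d * (LINT x|lborel. \<phi> x *\<^sub>R f x))"
proof -
  have "inner (emb f) (mulf (\<lambda>_. d) (tl \<phi>)) = Re (LINT x|lborel. f x * cnj (d * complex_of_real (\<phi> x)))"
    unfolding tl_def mulf_emb[OF bm_const test_Lp2[OF t]]
    by (rule inner_emb[OF f]) (intro Lp2_cmult test_Lp2 t)
  also have "(LINT x|lborel. f x * cnj (d * complex_of_real (\<phi> x))) = (LINT x|lborel. cnj d * (\<phi> x *\<^sub>R f x))"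
    by (simp add: scaleR_conv_of_real mult_ac)
  finally show ?thesis unfolding integral_mult_right_zero .
qed

lemma Lp2_locally_integrable: "f \<in> Lp 2 \<Longrightarrow> locally_integrable f"
  unfolding locally_integrable_def
proof (intro allI impI)
  fix K :: "real set" assume f: "f \<in> Lp 2" and K: "compact K"
  have [measurable]: "K \<in> sets borel" using K by (simp add: borel_compact)
  have "(\<lambda>x. complex_of_real (indicat_real K x)) \<in> Lp 2"
  proof -
    have "(\<lambda>x. (cmod (complex_of_real (indicat_real K x)))\<^sup>2) = indicat_real K" by (auto simp: indicator_def fun_eq_iff)
    then show ?thesis using K emeasure_bounded_finite[OF compact_imp_bounded[OF K]]
      by (auto simp: Lp2_iff borel_compact)
  qed
  from Lp2_mult_integrable[OF this f] show "set_integrable lborel K f"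
    by (simp add: set_integrable_def scaleR_conv_of_real)
qed

lemma tl_dense:
  assumes "\<And>\<phi> d. test_function \<phi> \<Longrightarrow> inner F (mulf (\<lambda>_. d) (tl \<phi>)) = inner G (mulf (\<lambda>_. d) (tl \<phi>))"
  shows "F = G"
proof -
  have L: "rep_l2 (F - G) \<in> Lp 2" by simp
  have "AE x in lborel. rep_l2 (F - G) x = 0"
  proof (rule AE_zero_by_tests[OF Lp2_locally_integrable[OF L]])
    fix \<phi> assume t: "test_function \<phi>"
    have "Re (cnj d * (LINT x|lborel. \<phi> x *\<^sub>R rep_l2 (F - G) x)) = 0" for d
      using inner_tl[OF L t, of d] assms[OF t, of d] by (simp add: inner_diff_left)
    from this[of 1] this[of \<i>] show "(LINT x|lborel. \<phi> x *\<^sub>R rep_l2 (F - G) x) = 0" by (simp add: complex_eq_iff)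
  qed
  then have "AE x in lborel. rep_l2 F x = rep_l2 G x"
    using rep_minus[of F G] by eventually_elim simp
  then show ?thesis by (rule l2_eqI)
qed

lemma tr_tl: assumes "test_function \<phi>" shows "tr h (tl \<phi>) = tl (\<lambda>x. \<phi> (x + h))"
  unfolding tl_def by (rule tr_emb[OF test_Lp2[OF assms]])

lemma tr_mulf_const: "tr h (mulf (\<lambda>_. d) F) = mulf (\<lambda>_. d) (tr h F)"
  unfolding mult_const[symmetric] tr_eq_mult by (rule mult_commute) (auto intro: bm_cis)

lemma inner_tr: "inner (tr (- h) F) G = inner F (tr h G)"
proof -
  have b: "bm (\<lambda>\<xi>. cis (h * \<xi>))" for h by (rule bm_cis) measurable
  have "inner (FT (tr (- h) F)) (FT G) = inner (FT F) (FT (tr h G))"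
    unfolding FT_tr by (subst inner_mulf[OF b]) (simp add: cis_cnj)
  then show ?thesis by (simp add: inner_FT)
qed

text \<open>Pairing with test functions and moving translations onto them shows weakly that
  \<open>tr (- h) (emb f)\<close> has the derivative \<open>- tr (- h) (emb g)\<close> in
  \<open>h\<close>. Integrated in \<open>h\<close> this is an identity between vectors, whose
  derivative at 0 is a limit in norm.\<close>

lemma weak_deriv_imp_dk:
  assumes f: "f \<in> Lp 2" and g: "g \<in> Lp 2" and w: "weak_deriv 1 f g"
  shows "dk 1 (emb f) (emb g)"
proof -
  let ?F = "emb f" and ?G = "emb g"
  have by_parts: "inner ?F (mulf (\<lambda>_. d) (tl (deriv \<phi>))) = - inner ?G (mulf (\<lambda>_. d) (tl \<phi>))" if t: "test_function \<phi>" for \<phi> d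
    using w t unfolding inner_tl[OF f test_function_deriv[OF t]] inner_tl[OF g t] by (simp add: weak_deriv_def)
  have cont: "continuous_on S (\<lambda>y. tr (- y) ?G)" for S
    unfolding continuous_on_def tr_eq_mult
  proof
    fix x
    show "((\<lambda>y. mult (\<lambda>\<xi>. cis (- y * \<xi>)) (emb g)) \<longlongrightarrow> mult (\<lambda>\<xi>. cis (- x * \<xi>)) (emb g)) (at x within S)"
      by (rule mult_tendsto_at[of _ _ 1]) (auto intro!: tendsto_intros)
  qed
  have D: "((\<lambda>y. tr y (tl \<phi>)) has_vector_derivative tr y (tl (deriv \<phi>))) (at y within S)" if t: "test_function \<phi>" for \<phi> y S
    using mult_has_vector_derivative[of "\<lambda>\<xi>. \<xi>" "tl \<phi>" "tl (deriv \<phi>)" y S] dk_tl[OF t] by (simp add: tr_eq_mult)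
  let ?I = "\<lambda>h. integral {0..h} (\<lambda>y. tr (- y) ?G)"
  have key: "tr (- h) ?F + ?I h = ?F" if h: "0 \<le> h" "h \<le> 1" for h
  proof (rule tl_dense)
    fix \<phi> d assume t: "test_function \<phi>"
    let ?b = "\<lambda>h. inner (tr (- h) ?F + ?I h) (mulf (\<lambda>_. d) (tl \<phi>))"
    have "(?b has_vector_derivative 0) (at y within {0..1})" if y: "y \<in> {0..1}" for y
    proof -
      have 1: "((\<lambda>h. inner ?F (mulf (\<lambda>_. d) (tr h (tl \<phi>)))) has_vector_derivative inner ?F (mulf (\<lambda>_. d) (tr y (tl (deriv \<phi>))))) (at y within {0..1})"
        by (intro bounded_linear.has_vector_derivative[OF bounded_linear_inner_right]
          bounded_linear.has_vector_derivative[OF bounded_linear_mulf] bm_const D t)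
      have 2: "((\<lambda>h. inner (?I h) (mulf (\<lambda>_. d) (tl \<phi>))) has_vector_derivative inner (tr (- y) ?G) (mulf (\<lambda>_. d) (tl \<phi>))) (at y within {0..1})"
        by (intro bounded_linear.has_vector_derivative[OF bounded_linear_inner_left] integral_has_vector_derivative cont y)
      have "inner ?F (mulf (\<lambda>_. d) (tr y (tl (deriv \<phi>)))) = - inner (tr (- y) ?G) (mulf (\<lambda>_. d) (tl \<phi>))"
        using by_parts[OF test_function_shift[OF t, of y], of d]
        by (simp add: tr_tl t test_function_deriv deriv_shift inner_tr tr_mulf_const)
      with has_vector_derivative_add[OF 1 2] show ?thesis
        by (simp add: inner_add_left inner_tr tr_mulf_const)
    qed
    then obtain c where c: "\<And>y. y \<in> {0..1} \<Longrightarrow> ?b y = c"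
      using has_derivative_zero_constant[of "{0..1}" ?b] by (auto simp: has_vector_derivative_def)
    have "?b h = ?b 0" using c[of h] c[of 0] h by simp
    then show "?b h = inner ?F (mulf (\<lambda>_. d) (tl \<phi>))" by (simp add: tr_eq_mult)
  qed
  have "(?I has_vector_derivative tr (- 0) ?G) (at 0 within {0..1})"
    by (rule integral_has_vector_derivative) (auto intro: cont)
  then have V: "((\<lambda>h. tr (- h) ?F) has_vector_derivative - ?G) (at 0 within {0..1})"
  proof -
    assume "(?I has_vector_derivative tr (- 0) ?G) (at 0 within {0..1})"
    from has_vector_derivative_diff[OF has_vector_derivative_const this, of ?F]
    have "((\<lambda>h. ?F - ?I h) has_vector_derivative - ?G) (at 0 within {0..1})" by (simp add: tr_eq_mult)
    then show ?thesis
      by (rule has_vector_derivative_transform[rotated 2]) (use key in \<open>auto simp: algebra_simps\<close>)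
  qed
  have "dk 1 ?F (- (- ?G))"
  \<comment> \<open>The identity \<open>key\<close> concerns translations by \<open>- h\<close> with
    \<open>h\<close> in \<open>{0..1}\<close>, so the available steps are negative.\<close>
  proof (rule dk_if_tr_limit[of "\<lambda>n. - (1 / real (Suc n))"])
    show "(\<lambda>n. - (1 / real (Suc n))) \<longlonglongrightarrow> 0"
      using tendsto_minus[OF LIMSEQ_Suc[OF lim_const_over_n[of 1]]] by simp
    have "((\<lambda>y. (tr (- y) ?F - tr (- 0) ?F - (y - 0) *\<^sub>R (- ?G)) /\<^sub>R norm (y - 0)) \<longlongrightarrow> 0) (at 0 within {0..1})"
      using V by (simp add: has_vector_derivative_def has_derivative_within divide_inverse algebra_simps)
    moreover have "filterlim (\<lambda>n. 1 / real (Suc n)) (at 0 within {0..1}) sequentially"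
      unfolding filterlim_at using LIMSEQ_Suc[OF lim_const_over_n[of 1]] by auto
    ultimately have "(\<lambda>n. (tr (- (1 / real (Suc n))) ?F - tr (- 0) ?F - (1 / real (Suc n) - 0) *\<^sub>R (- ?G)) /\<^sub>R norm (1 / real (Suc n) - 0)) \<longlonglongrightarrow> 0"
      by (rule filterlim_compose)
    then have "(\<lambda>n. real (Suc n) *\<^sub>R (tr (- (1 / real (Suc n))) ?F - ?F) + ?G) \<longlonglongrightarrow> 0"
      by (simp add: tr_eq_mult scaleR_diff_right scaleR_add_right del: of_nat_Suc)
    from tendsto_minus[OF tendsto_diff[OF this tendsto_const[of ?G]]]
    have "(\<lambda>n. - (real (Suc n) *\<^sub>R (tr (- (1 / real (Suc n))) ?F - ?F))) \<longlonglongrightarrow> ?G" by simp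
    moreover have "- (real (Suc n) *\<^sub>R X) = (1 / - (1 / real (Suc n))) *\<^sub>R X" for n and X :: l2
      by (simp del: of_nat_Suc)
    ultimately show "(\<lambda>n. (1 / - (1 / real (Suc n))) *\<^sub>R (tr (- (1 / real (Suc n))) ?F - ?F)) \<longlonglongrightarrow> - (- ?G)"
      by (simp only: minus_minus)
  qed simp
  then show ?thesis by simp
qed

lemma dk_imp_weak_deriv_1:
  assumes f: "f \<in> Lp 2" and g: "g \<in> Lp 2" and d: "dk 1 (emb f) (emb g)"
  shows "weak_deriv 1 f g"
  unfolding weak_deriv_def
proof (intro conjI allI impI Lp2_locally_integrable f g)
  fix \<phi> assume t: "test_function \<phi>"
  have "inner (emb f) (mulf (\<lambda>_. c) (tl (deriv \<phi>))) = - inner (emb g) (mulf (\<lambda>_. c) (tl \<phi>))" for c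
    using dk_inner_skew[OF d dk_mulf_const[OF dk_tl[OF t]]] by simp
  then have "Re (cnj c * ((LINT x|lborel. deriv \<phi> x *\<^sub>R f x) + (LINT x|lborel. \<phi> x *\<^sub>R g x))) = 0" for c
    unfolding inner_tl[OF f test_function_deriv[OF t]] inner_tl[OF g t] by (simp add: algebra_simps)
  from this[of 1] this[of \<i>] have "(LINT x|lborel. deriv \<phi> x *\<^sub>R f x) + (LINT x|lborel. \<phi> x *\<^sub>R g x) = 0"
    by (simp add: complex_eq_iff)
  then show "(LINT x|lborel. (deriv ^^ 1) \<phi> x *\<^sub>R f x) = (- 1) ^ 1 * (LINT x|lborel. \<phi> x *\<^sub>R g x)"
    by (simp add: eq_neg_iff_add_eq_0)
qed

text \<open>At low frequencies the function itself takes over: \<open>\<bar>\<xi>\<bar> ^ j\<close>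
  is at most \<open>\<bar>\<xi>\<bar> ^ k + 1\<close>.\<close>

lemma dk_lower:
  assumes "dk k F G" "j \<le> k" shows "\<exists>H. dk j F H"
proof -
  have [measurable]: "(\<lambda>\<xi>. (\<i> * complex_of_real \<xi>) ^ k) \<in> borel_measurable borel" for k by measurable
  have L: "(\<lambda>\<xi>. (\<i> * complex_of_real \<xi>) ^ k * rep_l2 (FT F) \<xi>) \<in> Lp 2"
    by (rule mrel_Lp2[OF _ assms(1)]) measurable
  have A: "(\<lambda>\<xi>. complex_of_real (cmod ((\<i> * complex_of_real \<xi>) ^ k * rep_l2 (FT F) \<xi>)) + complex_of_real (cmod (rep_l2 (FT F) \<xi>))) \<in> Lp 2"
    by (intro Lp2_add Lp2_bound[OF _ L, of _ 1] Lp2_bound[OF _ rep_l2_Lp2[of "FT F"], of _ 1]) auto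
  have "(\<lambda>\<xi>. (\<i> * complex_of_real \<xi>) ^ j * rep_l2 (FT F) \<xi>) \<in> Lp 2"
  proof (rule Lp2_bound[OF _ A, of _ 1], measurable, rule AE_I2)
    fix \<xi> :: real
    let ?c = "cmod (rep_l2 (FT F) \<xi>)"
    have "\<bar>\<xi>\<bar> ^ j \<le> \<bar>\<xi>\<bar> ^ k + 1"
    proof (cases "\<bar>\<xi>\<bar> \<le> 1")
      case True then have "\<bar>\<xi>\<bar> ^ j \<le> 1" by (intro power_le_one) auto
      then show ?thesis using zero_le_power[of "\<bar>\<xi>\<bar>" k] by linarith
    next
      case False then have "\<bar>\<xi>\<bar> ^ j \<le> \<bar>\<xi>\<bar> ^ k" using assms(2) by (intro power_increasing) auto
      then show ?thesis by linarith
    qed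
    then have "\<bar>\<xi>\<bar> ^ j * ?c \<le> (\<bar>\<xi>\<bar> ^ k + 1) * ?c" by (intro mult_right_mono) auto
    moreover have "cmod (complex_of_real (cmod ((\<i> * complex_of_real \<xi>) ^ k * rep_l2 (FT F) \<xi>)) + complex_of_real ?c)
        = \<bar>\<xi>\<bar> ^ k * ?c + ?c"
      unfolding of_real_add[symmetric] norm_of_real by (simp add: norm_mult norm_power)
    ultimately show "cmod ((\<i> * complex_of_real \<xi>) ^ j * rep_l2 (FT F) \<xi>) \<le> 1 * cmod (complex_of_real (cmod ((\<i> * complex_of_real \<xi>) ^ k * rep_l2 (FT F) \<xi>)) + complex_of_real ?c)"
      by (simp add: norm_mult norm_power distrib_right)
  qed
  then show ?thesis by (intro exI) (rule mrel_exists)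
qed

lemma dk_split:
  assumes "dk (j + k) F H" "dk j F G" shows "dk k G H"
  unfolding mrel_def using assms[unfolded mrel_def] by eventually_elim (simp add: power_add)

lemma dk_imp_weak_deriv:
  assumes "f \<in> Lp 2" "g \<in> Lp 2" "dk k (emb f) (emb g)"
  shows "weak_deriv k f g"
  using assms
proof (induction k arbitrary: g)
  case 0
  then have "emb g = emb f" unfolding dk_0 by blast
  then have "AE x in lborel. f x = g x" using 0 by (simp add: emb_eq_iff AE_symmetric)
  then show ?case
    by (intro weak_deriv_cong[OF weak_deriv_0[OF Lp2_locally_integrable[OF 0(1)]]])
      (use 0 in \<open>auto intro: Lp2_measurable\<close>)
next
  case (Suc k)
  obtain H where H: "dk k (emb f) H" using dk_lower[OF Suc.prems(3), of k] by auto
  have "weak_deriv k f (rep_l2 H)" using Suc.IH[of "rep_l2 H"] Suc.prems H by simp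
  moreover have "dk 1 H (emb g)" using dk_split[of k 1] Suc.prems(3) H by simp
  then have "weak_deriv 1 (rep_l2 H) g" by (intro dk_imp_weak_deriv_1) (use Suc.prems in auto)
  ultimately show ?case by (rule weak_deriv_Suc)
qed

lemma sobolev_Lp2: "f \<in> sobolev s 2 \<Longrightarrow> f \<in> Lp 2"
proof -
  assume "f \<in> sobolev s 2"
  then obtain g where g: "g \<in> Lp 2" "weak_deriv 0 f g" unfolding sobolev_def by blast
  have f: "locally_integrable f" using g(2) by (simp add: weak_deriv_def)
  have "AE x in lborel. f x = g x" using weak_deriv_unique[OF weak_deriv_0[OF f] g(2)] .
  then show "f \<in> Lp 2" by (intro Lp2_cong[OF g(1)]) (simp_all add: locally_integrable_measurable[OF f])
qed

text \<open>Only first derivatives are compared directly. The induction climbs through the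
  intermediate weak derivatives, which membership in \<open>sobolev s 2\<close> keeps square
  integrable.\<close>

lemma sobolev_dk:
  assumes "f \<in> sobolev s 2" "k \<le> s" "weak_deriv k f g" "g \<in> Lp 2"
  shows "dk k (emb f) (emb g)"
  using assms(2-)
proof (induction k arbitrary: g)
  case 0
  have "AE x in lborel. f x = g x"
    using weak_deriv_unique[OF weak_deriv_0 0(2)] 0(2) by (auto simp: weak_deriv_def)
  then show ?case using 0 sobolev_Lp2[OF assms(1)] unfolding dk_0 by (simp add: emb_eq_iff AE_symmetric)
next
  case (Suc k)
  have "k \<le> s" using Suc.prems(1) by simp
  then obtain h where h: "h \<in> Lp 2" "weak_deriv k f h" using assms(1) unfolding sobolev_def by blast
  have "dk k (emb f) (emb h)" using Suc h by auto
  moreover have "dk 1 (emb h) (emb g)"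
    using weak_deriv_chain[OF h(2) Suc.prems(2)] h(1) Suc.prems(3) by (intro weak_deriv_imp_dk)
  ultimately show ?case using dk_add[of k _ _ 1] by fastforce
qed

lemma nabla_dk:
  assumes f: "f \<in> Lp 2" and d: "dk k (emb f) G"
  shows "nabla k f \<in> Lp 2" "emb (nabla k f) = G"
proof -
  have w: "weak_deriv k f (rep_l2 G)" using f d by (intro dk_imp_weak_deriv) auto
  have ae: "AE x in lborel. nabla k f x = rep_l2 G x" by (rule nabla_AE[OF w])
  show L: "nabla k f \<in> Lp 2"
    by (rule Lp2_cong[OF rep_l2_Lp2[of G] _ ae]) (use weak_deriv_measurable(2)[OF weak_deriv_nabla[OF w]] in simp)
  show "emb (nabla k f) = G" using emb_cong[OF L rep_l2_Lp2 ae] by simp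
qed

lemma sobolev_2_iff:
  assumes f: "f \<in> Lp 2"
  shows "f \<in> sobolev s 2 \<longleftrightarrow> (\<exists>G. dk s (emb f) G)"
proof
  assume fs: "f \<in> sobolev s 2"
  then obtain g where "g \<in> Lp 2" "weak_deriv s f g" unfolding sobolev_def by blast
  from sobolev_dk[OF fs order_refl this(2,1)] show "\<exists>G. dk s (emb f) G" by blast
next
  assume "\<exists>G. dk s (emb f) G"
  then obtain G where G: "dk s (emb f) G" by blast
  show "f \<in> sobolev s 2" unfolding sobolev_def
  proof (intro CollectI allI impI)
    fix k assume "k \<le> s"
    then obtain H where H: "dk k (emb f) H" using dk_lower[OF G] by blast
    then have "weak_deriv k f (rep_l2 H)" using f by (intro dk_imp_weak_deriv) auto
    then show "\<exists>g\<in>Lp 2. weak_deriv k f g" by (intro bexI[of _ "rep_l2 H"]) auto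
  qed
qed

section \<open>Products and pointwise bounds\<close>

definition bd :: "real \<Rightarrow> l2 \<Rightarrow> bool" where
  "bd B F \<longleftrightarrow> (AE x in lborel. cmod (rep_l2 F x) \<le> B)"

text \<open>A product of two square integrable functions may leave \<open>Lp 2\<close>, where
  \<open>emb\<close> returns 0; the laws that use its values therefore ask for an essential bound on
  a factor.\<close>

definition pr :: "l2 \<Rightarrow> l2 \<Rightarrow> l2" where
  "pr F G = emb (\<lambda>x. rep_l2 F x * rep_l2 G x)"

lemma pr_commute: "pr F G = pr G F" by (simp add: pr_def mult.commute)

lemma bd_nonneg: assumes "bd B F" shows "0 \<le> B"
proof (rule ccontr)
  assume "\<not> 0 \<le> B"
  then have "\<not> cmod z \<le> B" for z using norm_ge_zero[of z] by linarith
  with assms have "AE x::real in lborel. False" by (simp add: bd_def)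
  then have "ae_filter (lborel :: real measure) = bot" by (simp add: trivial_limit_def)
  then show False by (simp add: ae_filter_eq_bot_iff)
qed

lemma bd_mono: "bd A F \<Longrightarrow> A \<le> B \<Longrightarrow> bd B F"
  unfolding bd_def by (auto elim: eventually_mono)

lemma pr_Lp2: assumes "bd B F" shows "(\<lambda>x. rep_l2 F x * rep_l2 G x) \<in> Lp 2"
  by (rule Lp2_bound[OF _ rep_l2_Lp2[of G], of _ B], measurable)
    (use assms in \<open>auto simp: bd_def norm_mult elim!: eventually_mono intro!: mult_right_mono\<close>)

lemma rep_pr: "bd B F \<Longrightarrow> AE x in lborel. rep_l2 (pr F G) x = rep_l2 F x * rep_l2 G x"
  unfolding pr_def by (intro rep_emb pr_Lp2)

lemma norm_pr: assumes "bd B F" shows "norm (pr F G) \<le> B * norm G"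
proof -
  have "norm (emb (\<lambda>x. rep_l2 F x * rep_l2 G x)) \<le> B * norm (emb (rep_l2 G))"
    by (rule norm_emb_mono[OF pr_Lp2[OF assms] rep_l2_Lp2 _ bd_nonneg[OF assms]])
      (use assms in \<open>auto simp: bd_def norm_mult elim!: eventually_mono intro!: mult_right_mono\<close>)
  then show ?thesis by (simp add: pr_def)
qed

lemma bounded_linear_pr: assumes b: "bd B F" shows "bounded_linear (pr F)"
proof (rule bounded_linear_intro[of _ B])
  show "pr F (G + H) = pr F G + pr F H" for G H
    by (rule l2_eqI) (use rep_pr[OF b, of "G + H"] rep_pr[OF b, of G] rep_pr[OF b, of H] rep_plus[of G H]
      rep_plus[of "pr F G" "pr F H"] in \<open>eventually_elim\<close>, simp add: distrib_left)
  show "pr F (r *\<^sub>R G) = r *\<^sub>R pr F G" for r G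
    by (rule l2_eqI) (use rep_pr[OF b, of "r *\<^sub>R G"] rep_pr[OF b, of G] rep_scaleR[of r G]
      rep_scaleR[of r "pr F G"] in \<open>eventually_elim\<close>, simp)
  show "norm (pr F G) \<le> norm G * B" for G using norm_pr[OF b] by (simp add: mult.commute)
qed

lemma pr_diff: "bd B F \<Longrightarrow> pr F (G - H) = pr F G - pr F H"
  by (rule linear_diff[OF bounded_linear.linear[OF bounded_linear_pr]])

lemma bd_lcnj: assumes "bd B F" shows "bd B (lcnj F)"
  using assms rep_lcnj[of F] unfolding bd_def by eventually_elim simp

lemma bd_tr: assumes "bd B F" shows "bd B (tr h F)"
  using AE_shift[OF assms[unfolded bd_def], of h] rep_tr[of h F] unfolding bd_def by eventually_elim simp

text \<open>Convergence in norm says nothing about the supremum, but an almost everywhere convergent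
  subsequence preserves a common bound.\<close>

lemma bd_limit:
  assumes "f \<longlonglongrightarrow> F" "\<And>n. bd B (f n)" shows "bd B F"
proof -
  obtain r where r: "AE x in lborel. (\<lambda>n. rep_l2 (f (r n)) x) \<longlonglongrightarrow> rep_l2 F x"
    using l2_AE_subseq[OF assms(1)] by blast
  have "AE x in lborel. \<forall>n. cmod (rep_l2 (f n) x) \<le> B"
    using assms(2) unfolding AE_all_countable bd_def by blast
  with r show ?thesis unfolding bd_def
  proof eventually_elim
    case (elim x)
    show ?case by (rule Lim_bounded[OF tendsto_norm[OF elim(1)]]) (use elim(2) in auto)
  qed
qed

lemma lcnj_pr: assumes b: "bd B F" shows "lcnj (pr F G) = pr (lcnj F) (lcnj G)"
  by (rule l2_eqI) (use rep_pr[OF b, of G] rep_pr[OF bd_lcnj[OF b], of "lcnj G"] rep_lcnj[of F] rep_lcnj[of G]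
    rep_lcnj[of "pr F G"] in \<open>eventually_elim\<close>, simp)

lemma tr_pr: assumes b: "bd B F" shows "tr h (pr F G) = pr (tr h F) (tr h G)"
  by (rule l2_eqI) (use AE_shift[OF rep_pr[OF b, of G], of h] rep_pr[OF bd_tr[OF b], of h "tr h G"] rep_tr[of h F] rep_tr[of h G]
    rep_tr[of h "pr F G"] in \<open>eventually_elim\<close>, simp)

lemma pr_assoc: assumes a: "bd A F" and b: "bd B G" and c: "bd C (pr F G)" shows "pr (pr F G) H = pr F (pr G H)"
  by (rule l2_eqI) (use rep_pr[OF a, of G] rep_pr[OF b, of H] rep_pr[OF a, of "pr G H"] rep_pr[OF c, of H]
     in \<open>eventually_elim\<close>, simp)

subsection \<open>The Sobolev bound\<close>

definition sobw :: "real \<Rightarrow> complex" where "sobw \<xi> = complex_of_real (1 / (1 + \<bar>\<xi>\<bar>))"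

lemma sobw_Lp2: "sobw \<in> Lp 2"
proof -
  have "integrable lborel (\<lambda>x::real. inverse (1 + x\<^sup>2))"
    using integrable_inverse_1_plus_square(1) by (simp add: set_integrable_def einterval_def)
  then have "integrable lborel (\<lambda>x. (cmod (sobw x))\<^sup>2)"
  proof (rule Bochner_Integration.integrable_bound)
    show "AE x in lborel. norm ((cmod (sobw x))\<^sup>2) \<le> norm (inverse (1 + x\<^sup>2))"
    proof (rule AE_I2)
      fix x :: real
      have "1 + x\<^sup>2 \<le> (1 + \<bar>x\<bar>)\<^sup>2" by (simp add: power2_sum)
      then have "inverse ((1 + \<bar>x\<bar>)\<^sup>2) \<le> inverse (1 + x\<^sup>2)" by (intro le_imp_inverse_le) (auto simp: add_pos_nonneg)
      moreover have "(cmod (sobw x))\<^sup>2 = inverse ((1 + \<bar>x\<bar>)\<^sup>2)"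
        unfolding sobw_def norm_of_real by (simp add: power_divide divide_inverse power_inverse)
      ultimately show "norm ((cmod (sobw x))\<^sup>2) \<le> norm (inverse (1 + x\<^sup>2))" by simp
    qed
  qed (simp add: sobw_def[abs_def])
  then show ?thesis by (simp add: Lp2_iff sobw_def[abs_def])
qed

definition sobC :: real where "sobC = norm (emb sobw)"

lemma sobC_nonneg: "0 \<le> sobC" by (simp add: sobC_def)

lemma integral_mult_le_norm:
  assumes "f \<in> Lp 2" "g \<in> Lp 2"
  shows "(LINT x|lborel. cmod (f x) * cmod (g x)) \<le> norm (emb f) * norm (emb g)"
proof -
  have L: "(\<lambda>x. complex_of_real (cmod (f x))) \<in> Lp 2" "(\<lambda>x. complex_of_real (cmod (g x))) \<in> Lp 2"
    using assms by (auto intro: Lp2_bound[of _ f 1] Lp2_bound[of _ g 1])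
  have "inner (emb (\<lambda>x. complex_of_real (cmod (f x)))) (emb (\<lambda>x. complex_of_real (cmod (g x)))) = (LINT x|lborel. cmod (f x) * cmod (g x))"
    unfolding inner_emb[OF L] by (simp flip: of_real_mult)
  moreover have "norm (emb (\<lambda>x. complex_of_real (cmod (f x)))) = norm (emb f)" "norm (emb (\<lambda>x. complex_of_real (cmod (g x)))) = norm (emb g)"
  proof -
    have "(norm (emb (\<lambda>x. complex_of_real (cmod (f x)))))\<^sup>2 = (norm (emb f))\<^sup>2"
      unfolding norm_emb_sq[OF L(1)] norm_emb_sq[OF assms(1)] by simp
    then show "norm (emb (\<lambda>x. complex_of_real (cmod (f x)))) = norm (emb f)" by simp
    have "(norm (emb (\<lambda>x. complex_of_real (cmod (g x)))))\<^sup>2 = (norm (emb g))\<^sup>2"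
      unfolding norm_emb_sq[OF L(2)] norm_emb_sq[OF assms(2)] by simp
    then show "norm (emb (\<lambda>x. complex_of_real (cmod (g x)))) = norm (emb g)" by simp
  qed
  ultimately show ?thesis using norm_cauchy_schwarz[of "emb (\<lambda>x. complex_of_real (cmod (f x)))" "emb (\<lambda>x. complex_of_real (cmod (g x)))"] by simp
qed

lemma bd_iFT:
  assumes "integrable lborel g" "g \<in> Lp 2"
    and "\<And>x. cmod (fi g x) \<le> C"
  shows "bd (C / (2 * pi)) (iFT (emb g))"
proof -
  have L: "fi g \<in> Lp 2" by (rule fi_L2(1)[OF assms(1,2)])
  have "AE x in lborel. rep_l2 (iFT (emb g)) x = (1 / (2 * pi)) *\<^sub>R fi g (- x)"
    unfolding iFT_def FT_emb[OF assms(1,2)]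
    using rep_scaleR[of "1 / (2 * pi)" "refl2 (emb (fi g))"] rep_refl2[of "emb (fi g)"] AE_refl[OF rep_emb[OF L]]
    by eventually_elim simp
  then show ?thesis unfolding bd_def
    by eventually_elim (use assms(3) in \<open>auto intro!: divide_right_mono\<close>)
qed

text \<open>By Cauchy-Schwarz against the square integrable weight \<open>sobw\<close> the transform
  of \<open>F\<close> is integrable, and inversion bounds \<open>F\<close> by the integral of its
  transform.\<close>

lemma sobolev_bound:
  assumes d: "dk 1 F F'"
  shows "bd (sobC * (norm F + norm F')) F"
proof -
  let ?f = "rep_l2 (FT F)"
  have [measurable]: "sobw \<in> borel_measurable borel" by (simp add: sobw_def[abs_def])
  define h where "h = (\<lambda>\<xi>. complex_of_real (1 + \<bar>\<xi>\<bar>) * ?f \<xi>)"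
  have d': "AE \<xi> in lborel. rep_l2 (FT F') \<xi> = \<i> * complex_of_real \<xi> * ?f \<xi>" using d by (simp add: mrel_def)
  have hle: "AE \<xi> in lborel. cmod (h \<xi>) \<le> cmod (?f \<xi>) + cmod (rep_l2 (FT F') \<xi>)"
    using d'
  proof eventually_elim
    case (elim \<xi>)
    have "cmod (h \<xi>) = (1 + \<bar>\<xi>\<bar>) * cmod (?f \<xi>)" unfolding h_def norm_mult norm_of_real by simp
    then show ?case unfolding elim by (simp add: norm_mult distrib_right)
  qed
  let ?s = "\<lambda>\<xi>. complex_of_real (cmod (?f \<xi>)) + complex_of_real (cmod (rep_l2 (FT F') \<xi>))"
  have s: "?s \<in> Lp 2" by (intro Lp2_add Lp2_bound[OF _ rep_l2_Lp2[of "FT F"], of _ 1] Lp2_bound[OF _ rep_l2_Lp2[of "FT F'"], of _ 1]) auto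
  have hs: "AE \<xi> in lborel. cmod (h \<xi>) \<le> 1 * cmod (?s \<xi>)"
    using hle unfolding of_real_add[symmetric] norm_of_real by eventually_elim simp
  have hL: "h \<in> Lp 2" by (rule Lp2_bound[OF _ s hs]) (simp add: h_def[abs_def])
  have "norm (emb h) \<le> 1 * norm (emb ?s)" by (rule norm_emb_mono[OF hL s hs]) simp
  also have "emb ?s = emb (\<lambda>\<xi>. complex_of_real (cmod (?f \<xi>))) + emb (\<lambda>\<xi>. complex_of_real (cmod (rep_l2 (FT F') \<xi>)))"
    by (intro emb_add Lp2_bound[OF _ rep_l2_Lp2[of "FT F"], of _ 1] Lp2_bound[OF _ rep_l2_Lp2[of "FT F'"], of _ 1]) auto
  also have "1 * norm \<dots> \<le> 1 * norm (emb ?f) + 1 * norm (emb (rep_l2 (FT F')))"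
    unfolding mult_1_left
    by (rule order_trans[OF norm_triangle_ineq], intro add_mono)
      (rule norm_emb_mono[of _ _ 1, simplified]; auto intro: Lp2_bound[OF _ rep_l2_Lp2[of "FT F"], of _ 1] Lp2_bound[OF _ rep_l2_Lp2[of "FT F'"], of _ 1])+
  finally have hn: "norm (emb h) \<le> sqrt (2 * pi) * (norm F + norm F')" by (simp add: norm_FT distrib_left)
  have fh: "?f \<xi> = sobw \<xi> * h \<xi>" for \<xi>
  proof -
    have "1 + \<bar>\<xi>\<bar> \<noteq> 0" by linarith
    then have "complex_of_real (1 / (1 + \<bar>\<xi>\<bar>)) * complex_of_real (1 + \<bar>\<xi>\<bar>) = 1" unfolding of_real_mult[symmetric] by simp
    then show ?thesis unfolding sobw_def h_def mult.assoc[symmetric] by simp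
  qed
  have fI: "integrable lborel ?f" using Lp2_mult_integrable[OF sobw_Lp2 hL] unfolding fh[symmetric] .
  have "(LINT x|lborel. cmod (?f x)) \<le> sobC * norm (emb h)"
    using integral_mult_le_norm[OF sobw_Lp2 hL] unfolding sobC_def by (simp add: fh norm_mult)
  also have "\<dots> \<le> sobC * (sqrt (2 * pi) * (norm F + norm F'))" by (intro mult_left_mono hn sobC_nonneg)
  finally have "cmod (fi ?f x) \<le> sobC * (sqrt (2 * pi) * (norm F + norm F'))" for x
    using fi_bound[OF fI, of x] by linarith
  from bd_iFT[OF fI rep_l2_Lp2 this]
  have "bd (sobC * (sqrt (2 * pi) * (norm F + norm F')) / (2 * pi)) F" by simp
  then show ?thesis
  proof (rule bd_mono)
    \<comment> \<open>The Plancherel and inversion factors combine to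
      \<open>sqrt (2 * pi) / (2 * pi)\<close>, which is at most 1 and is dropped.\<close>
    have "1 \<le> 2 * pi" using pi_gt3 by linarith
    then have "sqrt (2 * pi) \<le> 2 * pi" using mult_left_mono[of 1 "2 * pi" "2 * pi"] by (intro real_le_lsqrt) (auto simp: power2_eq_square)
    then have "sqrt (2 * pi) / (2 * pi) \<le> 1" by simp
    then have "sobC * (norm F + norm F') * (sqrt (2 * pi) / (2 * pi)) \<le> sobC * (norm F + norm F') * 1"
      by (intro mult_left_mono) (auto simp: sobC_nonneg)
    then show "sobC * (sqrt (2 * pi) * (norm F + norm F')) / (2 * pi) \<le> sobC * (norm F + norm F')" by (simp add: mult_ac)
  qed
qed

subsection \<open>The dispersive estimate\<close>

lemma cis_quadratic_DERIV:
  "((\<lambda>\<xi>. cis (- (t * (\<xi> - c)\<^sup>2))) has_vector_derivative (- (2 * t * (\<xi> - c))) *\<^sub>R (\<i> * cis (- (t * (\<xi> - c)\<^sup>2)))) (at \<xi> within S)"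
  unfolding has_vector_derivative_def
  by (rule has_derivative_eq_rhs, rule has_derivative_cis[THEN has_derivative_compose[rotated]], (rule derivative_intros)+)
    (auto simp: fun_eq_iff scaleR_conv_of_real algebra_simps)

text \<open>Integration by parts away from the stationary point. The modulus
  \<open>1 / (2 * t * (\<xi> - c)\<^sup>2)\<close> of the remainder is itself a derivative, so it is
  integrated exactly; in all four boundary values occur, each at most
  \<open>1 / (2 * t * \<delta>)\<close>.\<close>

lemma oscillatory_off_center:
  fixes \<alpha> \<beta> \<delta> t c :: real
  assumes "\<alpha> \<le> \<beta>" "0 < \<delta>" "0 < t" and far: "\<And>\<xi>. \<xi> \<in> {\<alpha>..\<beta>} \<Longrightarrow> \<delta> \<le> \<bar>\<xi> - c\<bar>"
  shows "cmod (integral {\<alpha>..\<beta>} (\<lambda>\<xi>. cis (- (t * (\<xi> - c)\<^sup>2)))) \<le> 2 / (t * \<delta>)"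
proof -
  let ?e = "\<lambda>\<xi>. cis (- (t * (\<xi> - c)\<^sup>2))"
  let ?F = "\<lambda>\<xi>. (1 / (2 * t * (\<xi> - c))) *\<^sub>R (\<i> * ?e \<xi>)"
  let ?r = "\<lambda>\<xi>. (1 / (2 * t * (\<xi> - c)\<^sup>2)) *\<^sub>R (\<i> * ?e \<xi>)"
  have inv_le: "\<bar>1 / (2 * t * u)\<bar> \<le> 1 / (2 * t * \<delta>)" if "\<delta> \<le> \<bar>u\<bar>" for u
  proof -
    have "1 / (2 * t * \<bar>u\<bar>) \<le> 1 / (2 * t * \<delta>)" by (rule frac_le) (use that assms in auto)
    then show ?thesis using assms(3) by (simp add: abs_mult)
  qed
  have nz: "\<xi> - c \<noteq> 0" if "\<xi> \<in> {\<alpha>..\<beta>}" for \<xi> using far[OF that] assms(2) by auto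
  have inv: "((\<lambda>\<xi>. 1 / (2 * t * (\<xi> - c))) has_field_derivative - (1 / (2 * t * (\<xi> - c)\<^sup>2))) (at \<xi> within {\<alpha>..\<beta>})"
    if "\<xi> \<in> {\<alpha>..\<beta>}" for \<xi>
  proof -
    have "((\<lambda>\<xi>. \<xi> - c) has_field_derivative 1) (at \<xi> within {\<alpha>..\<beta>})" by (auto intro!: derivative_eq_intros)
    from DERIV_cmult[OF DERIV_inverse'[OF this nz[OF that]], of "1 / (2 * t)"]
    have "((\<lambda>\<xi>. 1 / (2 * t) * inverse (\<xi> - c)) has_field_derivative 1 / (2 * t) * - (inverse (\<xi> - c) * 1 * inverse (\<xi> - c))) (at \<xi> within {\<alpha>..\<beta>})" .
    moreover have "(\<lambda>\<xi>. 1 / (2 * t) * inverse (\<xi> - c)) = (\<lambda>\<xi>. 1 / (2 * t * (\<xi> - c)))"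
      by (rule ext) (simp add: inverse_eq_divide)
    moreover have "1 / (2 * t) * - (inverse u * 1 * inverse u) = - (1 / (2 * t * u\<^sup>2))" for u
      by (simp add: inverse_eq_divide power2_eq_square)
    ultimately show ?thesis by (simp only:)
  qed
  have D: "(?F has_vector_derivative ?e \<xi> - ?r \<xi>) (at \<xi> within {\<alpha>..\<beta>})" if \<xi>: "\<xi> \<in> {\<alpha>..\<beta>}" for \<xi>
  proof -
    have "((\<lambda>\<xi>. \<i> * ?e \<xi>) has_vector_derivative \<i> * ((- (2 * t * (\<xi> - c))) *\<^sub>R (\<i> * ?e \<xi>))) (at \<xi> within {\<alpha>..\<beta>})"
      by (intro has_vector_derivative_mult_right cis_quadratic_DERIV)
    from has_vector_derivative_scaleR[OF inv[OF \<xi>] this]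
    have "(?F has_vector_derivative (1 / (2 * t * (\<xi> - c))) *\<^sub>R (\<i> * ((- (2 * t * (\<xi> - c))) *\<^sub>R (\<i> * ?e \<xi>))) + (- (1 / (2 * t * (\<xi> - c)\<^sup>2))) *\<^sub>R (\<i> * ?e \<xi>)) (at \<xi> within {\<alpha>..\<beta>})" .
    moreover have "(1 / (2 * t * (\<xi> - c))) *\<^sub>R (\<i> * ((- (2 * t * (\<xi> - c))) *\<^sub>R (\<i> * ?e \<xi>))) = ?e \<xi>"
    proof -
      have "\<i> * ((- (2 * t * (\<xi> - c))) *\<^sub>R (\<i> * ?e \<xi>)) = (2 * t * (\<xi> - c)) *\<^sub>R ?e \<xi>"
        by (simp add: scaleR_conv_of_real)
      then show ?thesis using nz[OF \<xi>] assms(3) by simp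
    qed
    ultimately show ?thesis by simp
  qed
  have e_int: "?e integrable_on {\<alpha>..\<beta>}" by (intro integrable_continuous_real continuous_intros)
  have r_int: "?r integrable_on {\<alpha>..\<beta>}"
    using assms nz by (intro integrable_continuous_real continuous_intros) auto
  have "((\<lambda>\<xi>. ?e \<xi> - ?r \<xi>) has_integral ?F \<beta> - ?F \<alpha>) {\<alpha>..\<beta>}"
    by (rule fundamental_theorem_of_calculus[OF assms(1)]) (rule D)
  then have "integral {\<alpha>..\<beta>} ?e - integral {\<alpha>..\<beta>} ?r = ?F \<beta> - ?F \<alpha>"
    using e_int r_int by (simp add: integral_diff[symmetric] integral_unique)
  then have eq: "integral {\<alpha>..\<beta>} ?e = ?F \<beta> - ?F \<alpha> + integral {\<alpha>..\<beta>} ?r" by (simp add: algebra_simps)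
  have Fb: "cmod (?F \<xi>) \<le> 1 / (2 * t * \<delta>)" if "\<xi> \<in> {\<alpha>..\<beta>}" for \<xi>
    using inv_le[OF far[OF that]] by (simp only: norm_scaleR norm_mult norm_ii norm_cis mult_1_right)
  have gI: "((\<lambda>\<xi>. 1 / (2 * t * (\<xi> - c)\<^sup>2)) has_integral (- (1 / (2 * t * (\<beta> - c)))) - (- (1 / (2 * t * (\<alpha> - c))))) {\<alpha>..\<beta>}"
  proof (rule fundamental_theorem_of_calculus[OF assms(1)])
    fix \<xi> assume "\<xi> \<in> {\<alpha>..\<beta>}"
    from DERIV_minus[OF inv[OF this]]
    show "((\<lambda>\<xi>. - (1 / (2 * t * (\<xi> - c)))) has_vector_derivative 1 / (2 * t * (\<xi> - c)\<^sup>2)) (at \<xi> within {\<alpha>..\<beta>})"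
      by (simp add: has_real_derivative_iff_has_vector_derivative)
  qed
  have "cmod (integral {\<alpha>..\<beta>} ?r) \<le> integral {\<alpha>..\<beta>} (\<lambda>\<xi>. 1 / (2 * t * (\<xi> - c)\<^sup>2))"
    by (rule integral_norm_bound_integral[OF r_int]) (use gI assms in \<open>auto simp: norm_mult has_integral_integrable abs_mult\<close>)
  also have "\<dots> = (1 / (2 * t * (\<alpha> - c))) - (1 / (2 * t * (\<beta> - c)))" using integral_unique[OF gI] by simp
  also have "\<dots> \<le> \<bar>1 / (2 * t * (\<alpha> - c))\<bar> + \<bar>1 / (2 * t * (\<beta> - c))\<bar>" by linarith
  also have "\<dots> \<le> 1 / (2 * t * \<delta>) + 1 / (2 * t * \<delta>)"
    using assms(1) by (intro add_mono inv_le far) auto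
  finally have rb: "cmod (integral {\<alpha>..\<beta>} ?r) \<le> 1 / (2 * t * \<delta>) + 1 / (2 * t * \<delta>)" .
  have "cmod (integral {\<alpha>..\<beta>} ?e) \<le> cmod (?F \<beta>) + cmod (?F \<alpha>) + cmod (integral {\<alpha>..\<beta>} ?r)"
    unfolding eq by (rule order_trans[OF norm_triangle_ineq]) (intro add_mono norm_triangle_ineq4 order_refl)
  also have "\<dots> \<le> 1 / (2 * t * \<delta>) + 1 / (2 * t * \<delta>) + (1 / (2 * t * \<delta>) + 1 / (2 * t * \<delta>))"
    using assms(1) by (intro add_mono Fb rb) auto
  also have "\<dots> = 2 / (t * \<delta>)"
  proof -
    have e: "1 / (2 * t * \<delta>) = (1 / 2) * (1 / (t * \<delta>))" "2 / (t * \<delta>) = 2 * (1 / (t * \<delta>))" by simp_all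
    have "(1 / 2) * q + (1 / 2) * q + ((1 / 2) * q + (1 / 2) * q) = 2 * q" for q :: real by simp
    then show ?thesis unfolding e .
  qed
  finally show ?thesis .
qed

text \<open>The interval is split at distance \<open>1 / sqrt t\<close> from the stationary point:
  the middle piece is bounded by its length and the outer ones by integration by parts, each by
  \<open>2 / sqrt t\<close>. The bound is uniform in the endpoints.\<close>

lemma oscillatory_bound:
  fixes a b t c :: real
  assumes ab: "a \<le> b" and t: "0 < t"
  shows "cmod (integral {a..b} (\<lambda>\<xi>. cis (- (t * (\<xi> - c)\<^sup>2)))) \<le> 6 / sqrt t"
proof -
  let ?e = "\<lambda>\<xi>. cis (- (t * (\<xi> - c)\<^sup>2))"
  define \<delta> where "\<delta> = 1 / sqrt t"
  have \<delta>: "0 < \<delta>" "2 / (t * \<delta>) = 2 / sqrt t"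
    using t by (auto simp: \<delta>_def field_simps)
  \<comment> \<open>Clamping to \<open>{a..b}\<close> lets any of the three pieces degenerate,
    wherever \<open>c\<close> lies.\<close>
  define m1 where "m1 = max a (min b (c - \<delta>))"
  define m2 where "m2 = max a (min b (c + \<delta>))"
  have m: "a \<le> m1" "m1 \<le> m2" "m2 \<le> b" using ab \<delta>(1) by (auto simp: m1_def m2_def)
  have I: "?e integrable_on {x..y}" for x y by (intro integrable_continuous_real continuous_intros)
  have "integral {a..b} ?e = integral {a..m1} ?e + integral {m1..m2} ?e + integral {m2..b} ?e"
    using Henstock_Kurzweil_Integration.integral_combine[OF m(1) order_trans[OF m(2,3)] I] Henstock_Kurzweil_Integration.integral_combine[OF m(2,3) I] by (simp only: add.assoc)
  then have "cmod (integral {a..b} ?e) \<le> cmod (integral {a..m1} ?e) + cmod (integral {m1..m2} ?e) + cmod (integral {m2..b} ?e)"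
    by (simp only:) (intro norm_triangle_le add_mono norm_triangle_ineq order_refl)
  moreover have "cmod (integral {a..m1} ?e) \<le> 2 / sqrt t"
  proof (cases "a = m1")
    case False
    then have "m1 \<le> c - \<delta>" by (auto simp: m1_def)
    then show ?thesis unfolding \<delta>(2)[symmetric] by (intro oscillatory_off_center m \<delta> t) auto
  qed (use t in auto)
  moreover have "cmod (integral {m2..b} ?e) \<le> 2 / sqrt t"
  proof (cases "b = m2")
    case False
    then have "c + \<delta> \<le> m2" using ab by (auto simp: m2_def)
    then show ?thesis unfolding \<delta>(2)[symmetric] by (intro oscillatory_off_center m \<delta> t) auto
  qed (use t in auto)
  moreover have "cmod (integral {m1..m2} ?e) \<le> 2 / sqrt t"
  proof -
    have "cmod (integral {m1..m2} ?e) \<le> 1 * (m2 - m1)"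
      by (rule integral_bound[OF m(2)]) (auto intro!: continuous_intros)
    also have "\<dots> \<le> 2 * \<delta>" using \<delta>(1) by (auto simp: m1_def m2_def)
    finally show ?thesis by (simp add: \<delta>_def)
  qed
  ultimately show ?thesis by simp
qed

text \<open>Completing the square reduces the phase to a pure quadratic. What matters is the
  uniformity in \<open>R\<close>, which allows the cut-off to be removed later.\<close>

lemma fi_schroedinger_kernel_bound:
  assumes R: "0 \<le> R" and t: "0 < t"
  shows "cmod (fi (\<lambda>\<xi>. cut R \<xi> * cis (x * \<xi> - t * \<xi>\<^sup>2)) y) \<le> 6 / sqrt t"
proof -
  define c where "c = (x - y) / (2 * t)"
  have ph: "cis (- (\<xi> * y)) * cis (x * \<xi> - t * \<xi>\<^sup>2) = cis (t * c\<^sup>2) * cis (- (t * (\<xi> - c)\<^sup>2))" for \<xi>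
    unfolding cis_mult using t by (intro arg_cong[where f = cis]) (simp add: c_def power2_eq_square field_simps)
  have "fi (\<lambda>\<xi>. cut R \<xi> * cis (x * \<xi> - t * \<xi>\<^sup>2)) y = (LINT \<xi>|lborel. cis (t * c\<^sup>2) * (indicat_real {-R..R} \<xi> *\<^sub>R cis (- (t * (\<xi> - c)\<^sup>2))))"
    unfolding fi_def
  proof (rule Bochner_Integration.integral_cong[OF refl])
    fix \<xi>
    have "cis (- (\<xi> * y)) * (cut R \<xi> * cis (x * \<xi> - t * \<xi>\<^sup>2)) = cut R \<xi> * (cis (- (\<xi> * y)) * cis (x * \<xi> - t * \<xi>\<^sup>2))" by simp
    then show "cis (- (\<xi> * y)) * (cut R \<xi> * cis (x * \<xi> - t * \<xi>\<^sup>2)) = cis (t * c\<^sup>2) * (indicat_real {-R..R} \<xi> *\<^sub>R cis (- (t * (\<xi> - c)\<^sup>2)))"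
      unfolding ph cut_def by (simp add: scaleR_conv_of_real)
  qed
  also have "\<dots> = cis (t * c\<^sup>2) * (LINT \<xi>:{-R..R}|lborel. cis (- (t * (\<xi> - c)\<^sup>2)))"
    unfolding set_lebesgue_integral_def by (rule integral_mult_right_zero)
  also have "(LINT \<xi>:{-R..R}|lborel. cis (- (t * (\<xi> - c)\<^sup>2))) = integral {-R..R} (\<lambda>\<xi>. cis (- (t * (\<xi> - c)\<^sup>2)))"
    by (rule set_borel_integral_eq_integral(2)) (unfold set_integrable_def, intro borel_integrable_compact continuous_intros compact_Icc)
  finally show ?thesis using oscillatory_bound[of "-R" R t c] R t by (simp add: norm_mult)
qed

text \<open>A cut-off in frequency makes the kernel integrable, so Parseval writes the truncated
  evolution as an integral of \<open>u\<close> against it. The bound \<open>6 / sqrt t\<close> is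
  independent of the cut-off, which \<open>bd_limit\<close> removes, and \<open>6 / (2 * pi)\<close>
  is at most 1.\<close>

lemma dispersive:
  assumes u: "u \<in> Lp 2" "integrable lborel u" and t: "0 < t"
  shows "bd ((LINT x|lborel. cmod (u x)) / sqrt t) (sg t (emb u))"
proof (rule bd_limit)
  let ?N = "LINT x|lborel. cmod (u x)"
  show "(\<lambda>n. mult (cut (real n)) (sg t (emb u))) \<longlonglongrightarrow> sg t (emb u)"
    using bounded_linear.tendsto[OF bounded_linear_iFT mulf_cut_tendsto_nat[of "FT (sg t (emb u))"]] by (simp add: mult_def)
  fix n :: nat
  define g where "g = (\<lambda>\<xi>. (cut (real n) \<xi> * cis (- (t * \<xi>\<^sup>2))) * fi u \<xi>)"
  have fL: "fi u \<in> Lp 2" by (rule fi_L2(1)[OF u(2,1)])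
  have gL: "g \<in> Lp 2" unfolding g_def by (rule mulf_Lp2) (auto intro: fL)
  have gI: "integrable lborel g" using cut_integrable[OF mulf_Lp2[OF bm_sg fL], of "real n" t] by (simp add: g_def mult.assoc)
  have e: "mult (cut (real n)) (sg t (emb u)) = iFT (emb g)"
    by (rule FT_eqI) (simp add: sg_def FT_emb[OF u(2,1)] mulf_emb[OF bm_sg fL] mulf_emb[OF bm_cut mulf_Lp2[OF bm_sg fL]] g_def mult.assoc)
  have "cmod (fi g x) \<le> 6 / sqrt t * ?N" for x
  proof -
    let ?k = "\<lambda>\<xi>. cut (real n) \<xi> * cis (- x * \<xi> - t * \<xi>\<^sup>2)"
    have kI: "integrable lborel ?k"
      using fi_integrable[of "\<lambda>\<xi>. - x * \<xi> - t * \<xi>\<^sup>2" "cut (real n)"] ivl_integrable[of "- real n" "real n"]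
      by (simp add: mult.commute ivl_def[abs_def] cut_def[abs_def])
    have "fi g x = (LINT \<xi>|lborel. fi u \<xi> * ?k \<xi>)"
      unfolding fi_def[of g]
    proof (rule Bochner_Integration.integral_cong[OF refl])
      fix \<xi>
      have "cis (- x * \<xi> - t * \<xi>\<^sup>2) = cis (- (\<xi> * x)) * cis (- (t * \<xi>\<^sup>2))" by (simp add: cis_mult mult.commute)
      then show "cis (- (\<xi> * x)) * g \<xi> = fi u \<xi> * ?k \<xi>" unfolding g_def by (simp only: mult_ac)
    qed
    also have "\<dots> = (LINT y|lborel. u y * fi ?k y)" by (rule fi_Parseval[OF u(2) kI])
    also have "cmod \<dots> \<le> (LINT y|lborel. 6 / sqrt t * cmod (u y))"
    proof (rule order_trans[OF integral_norm_bound integral_mono])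
      have km: "fi ?k \<in> borel_measurable borel" by measurable
      have um: "u \<in> borel_measurable borel" by (rule Lp2_measurable[OF u(1)])
      have le: "cmod (u y * fi ?k y) \<le> 6 / sqrt t * cmod (u y)" for y
        using mult_right_mono[OF fi_schroedinger_kernel_bound[of "real n" t "- x" y], of "cmod (u y)"] t
        by (simp add: norm_mult mult.commute)
      then show "cmod (u y * fi ?k y) \<le> 6 / sqrt t * cmod (u y)" for y .
      show "integrable lborel (\<lambda>y. 6 / sqrt t * cmod (u y))" using u(2) by simp
      then show "integrable lborel (\<lambda>y. cmod (u y * fi ?k y))"
        by (rule Bochner_Integration.integrable_bound) (use km um le t in \<open>auto\<close>)
    qed
    also have "\<dots> = 6 / sqrt t * ?N" by simp
    finally show ?thesis .
  qed
  from bd_iFT[OF gI gL this] have "bd (6 / sqrt t * ?N / (2 * pi)) (mult (cut (real n)) (sg t (emb u)))" unfolding e .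
  then show "bd (?N / sqrt t) (mult (cut (real n)) (sg t (emb u)))"
  proof (rule bd_mono)
    have "6 / (2 * pi) \<le> 1" using pi_gt3 by simp
    moreover have "0 \<le> ?N / sqrt t" using t by simp
    ultimately have "(6 / (2 * pi)) * (?N / sqrt t) \<le> 1 * (?N / sqrt t)" by (rule mult_right_mono)
    then show "6 / sqrt t * ?N / (2 * pi) \<le> ?N / sqrt t" by (simp add: mult_ac)
  qed
qed

subsection \<open>The product rule\<close>

lemma tr_tendsto: "((\<lambda>h. tr h F) \<longlongrightarrow> F) (at 0)"
proof -
  have "((\<lambda>h. mult (\<lambda>\<xi>. cis (h * \<xi>)) F) \<longlongrightarrow> mult (\<lambda>\<xi>. 1) F) (at 0)"
  proof (rule mult_tendsto_at[of _ _ 1])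
    show "((\<lambda>h. cis (h * \<xi>)) \<longlongrightarrow> 1) (at 0)" for \<xi>
      using tendsto_cis[of "\<lambda>h. h * \<xi>" 0 "at 0"] by (auto intro!: tendsto_eq_intros)
  qed auto
  then show ?thesis by (simp add: tr_eq_mult)
qed

lemma dk_tr: "dk 1 F F' \<Longrightarrow> dk 1 (tr h F) (tr h F')"
  unfolding tr_eq_mult by (rule mrel_mult) (auto intro: bm_cis)

text \<open>In the difference quotient the translated factor has to converge in the supremum, not
  only in norm. Applying \<open>sobolev_bound\<close> to \<open>tr h F - F\<close>, whose derivative
  also tends to 0, provides this.\<close>

lemma dk_pr:
  assumes F: "dk 1 F F'" and G: "dk 1 G G'"
  shows "dk 1 (pr F G) (pr F' G + pr F G')"
proof (rule dk_if_tr_limit)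
  define h where "h = (\<lambda>n. 1 / real (Suc n))"
  show h0: "h \<longlonglongrightarrow> 0" unfolding h_def by (rule LIMSEQ_Suc) (rule lim_const_over_n)
  show hn: "h n \<noteq> 0" for n by (simp add: h_def)
  have at: "filterlim h (at 0) sequentially" using h0 hn by (auto simp: filterlim_at)
  note bF = sobolev_bound[OF F] and bG = sobolev_bound[OF G]
  let ?C = "sobC * (norm F + norm F')"
  define P where "P = (\<lambda>n. (1 / h n) *\<^sub>R (tr (h n) F - F))"
  define Q where "Q = (\<lambda>n. (1 / h n) *\<^sub>R (tr (h n) G - G))"
  have P: "P \<longlonglongrightarrow> F'" and Q: "Q \<longlonglongrightarrow> G'"
    unfolding P_def Q_def by (rule filterlim_compose[OF dk_tr_limit[OF F] at] filterlim_compose[OF dk_tr_limit[OF G] at])+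
  have lin: "pr A (r *\<^sub>R B) = r *\<^sub>R pr A B" if "bd c A" for A B r c
    by (rule linear_cmul[OF bounded_linear.linear[OF bounded_linear_pr[OF that]]])
  have quot: "(1 / h n) *\<^sub>R (tr (h n) (pr F G) - pr F G) = pr (tr (h n) F) (Q n) + pr G (P n)" for n
  proof -
    have "pr (tr (h n) F) (Q n) = (1 / h n) *\<^sub>R (pr (tr (h n) F) (tr (h n) G) - pr (tr (h n) F) G)"
      unfolding Q_def by (simp add: lin[OF bd_tr[OF bF]] pr_diff[OF bd_tr[OF bF]])
    moreover have "pr G (P n) = (1 / h n) *\<^sub>R (pr (tr (h n) F) G - pr F G)"
      unfolding P_def lin[OF bG] pr_diff[OF bG] by (simp only: pr_commute[of G])
    ultimately show ?thesis by (simp add: tr_pr[OF bF] scaleR_diff_right)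
  qed
  have 1: "(\<lambda>n. pr G (P n)) \<longlonglongrightarrow> pr G F'" by (rule bounded_linear.tendsto[OF bounded_linear_pr[OF bG] P])
  have 2: "(\<lambda>n. pr (tr (h n) F) (Q n)) \<longlonglongrightarrow> pr F G'"
  proof (rule Lim_null[THEN iffD2], rule Lim_null_comparison)
    show "\<forall>\<^sub>F n in sequentially. norm (pr (tr (h n) F) (Q n) - pr F G') \<le>
        ?C * norm (Q n - G') + sobC * (norm (tr (h n) F - F) + norm (tr (h n) F' - F')) * norm G'"
    proof (rule always_eventually, rule allI)
      fix n
      have b: "bd (sobC * (norm (tr (h n) F - F) + norm (tr (h n) F' - F'))) (tr (h n) F - F)"
        by (rule sobolev_bound) (intro mrel_diff dk_tr F)
      have "pr (tr (h n) F - F) G' = pr (tr (h n) F) G' - pr F G'"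
        by (rule l2_eqI) (use rep_pr[OF b, of G'] rep_pr[OF bF, of G'] rep_pr[OF bd_tr[OF bF], of "h n" G'] rep_minus[of "tr (h n) F" F]
          rep_minus[of "pr (tr (h n) F) G'" "pr F G'"] in \<open>eventually_elim\<close>, simp add: left_diff_distrib)
      then have "pr (tr (h n) F) (Q n) - pr F G' = pr (tr (h n) F) (Q n - G') + pr (tr (h n) F - F) G'"
        by (simp add: pr_diff[OF bd_tr[OF bF]])
      then show "norm (pr (tr (h n) F) (Q n) - pr F G') \<le>
        ?C * norm (Q n - G') + sobC * (norm (tr (h n) F - F) + norm (tr (h n) F' - F')) * norm G'"
        using norm_pr[OF bd_tr[OF bF], of "h n" "Q n - G'"] norm_pr[OF b, of G'] by (auto intro: norm_triangle_le add_mono)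
    qed
    have z: "(\<lambda>n. norm (tr (h n) H - H)) \<longlonglongrightarrow> 0" for H
      using filterlim_compose[OF tr_tendsto[of H] at] by (simp add: LIM_zero tendsto_norm_zero)
    have "(\<lambda>n. norm (Q n - G')) \<longlonglongrightarrow> 0" using Q by (simp add: LIM_zero tendsto_norm_zero)
    then have "(\<lambda>n. ?C * norm (Q n - G') + sobC * (norm (tr (h n) F - F) + norm (tr (h n) F' - F')) * norm G') \<longlonglongrightarrow> ?C * 0 + sobC * (0 + 0) * norm G'"
      by (intro tendsto_intros z)
    then show "(\<lambda>n. ?C * norm (Q n - G') + sobC * (norm (tr (h n) F - F) + norm (tr (h n) F' - F')) * norm G') \<longlonglongrightarrow> 0" by simp
  qed
  show "(\<lambda>n. (1 / h n) *\<^sub>R (tr (h n) (pr F G) - pr F G)) \<longlonglongrightarrow> pr F' G + pr F G'"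
    unfolding quot using tendsto_add[OF 2 1] by (simp add: add.commute pr_commute[of G])
qed

subsection \<open>Sobolev spaces as images of smoothing multipliers\<close>

definition wt :: "nat \<Rightarrow> real \<Rightarrow> complex" where
  "wt s \<xi> = complex_of_real ((1 + \<bar>\<xi>\<bar>) ^ s)"

lemma wt_measurable [measurable]: "wt s \<in> borel_measurable borel"
  unfolding wt_def[abs_def] by measurable

abbreviation en :: "nat \<Rightarrow> l2 \<Rightarrow> l2 \<Rightarrow> bool" where "en s \<equiv> mrel (wt s)"

text \<open>The elements of \<open>H\<^sup>s\<close> are \<open>E s a\<close> with \<open>a\<close> in \<open>L\<^sup>2\<close>, where \<open>E s = (1 + |D|)\<^bsup>-s\<^esup>\<close>; the \<open>H\<^sup>s\<close> norm becomes the norm of \<open>a\<close>.\<close>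

definition iw :: "nat \<Rightarrow> real \<Rightarrow> complex" where "iw s \<xi> = complex_of_real (1 / (1 + \<bar>\<xi>\<bar>) ^ s)"

definition E :: "nat \<Rightarrow> l2 \<Rightarrow> l2" where "E s = mult (iw s)"

lemma iw_le: "cmod (iw s \<xi>) \<le> 1"
  unfolding iw_def norm_of_real by (simp add: one_le_power)

lemma bm_iw [simp, intro]: "bm (iw s)"
  by (rule bmI[of _ 1], simp add: iw_def[abs_def]) (rule iw_le)

lemma wt_iw: "wt s \<xi> * iw s \<xi> = 1"
proof -
  have "(1 + \<bar>\<xi>\<bar>) ^ s * (1 / (1 + \<bar>\<xi>\<bar>) ^ s) = 1" by simp
  then show ?thesis unfolding iw_def wt_def of_real_mult[symmetric] by simp
qed

lemma en_iff: "en s F a \<longleftrightarrow> F = E s a"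
proof
  assume "en s F a"
  then have "AE \<xi> in lborel. rep_l2 (FT F) \<xi> = rep_l2 (FT (E s a)) \<xi>"
    unfolding E_def FT_mult mrel_def using rep_mulf[OF bm_iw, of s "FT a"]
  proof eventually_elim
    case (elim \<xi>)
    show ?case unfolding elim mult.assoc[symmetric] mult.commute[of "iw s \<xi>"] wt_iw by simp
  qed
  then have "FT F = FT (E s a)" by (rule l2_eqI)
  then show "F = E s a" by (rule FT_eqI)
next
  assume "F = E s a"
  then show "en s F a" unfolding E_def FT_mult mrel_def using rep_mulf[OF bm_iw, of s "FT a"]
    by (auto elim!: eventually_mono simp: mult.assoc[symmetric] wt_iw)
qed

lemma norm_E_le: "norm (E s a) \<le> norm a"
  unfolding E_def using norm_mult_le[OF bm_measurable[OF bm_iw] iw_le, of s a] by simp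

lemma bounded_linear_E: "bounded_linear (E s)"
  unfolding E_def by (rule bounded_linear_mult) simp

lemma en_0: "en 0 F a \<longleftrightarrow> F = a"
  unfolding en_iff by (simp add: E_def iw_def[abs_def])

text \<open>The bounded multiplier \<open>- \<i> * sgn \<xi>\<close> turns
  \<open>\<i> * \<xi>\<close> into \<open>\<bar>\<xi>\<bar>\<close>, so one more power of the weight
  \<open>1 + \<bar>\<xi>\<bar>\<close> costs only the encoding of the derivative.\<close>

lemma en_Suc_I:
  assumes x: "en s F x" and d: "dk 1 F F'" and y: "en s F' y"
  shows "\<exists>z. en (Suc s) F z \<and> norm z \<le> norm x + norm y"
proof -
  define p where "p = (\<lambda>\<xi>::real. - \<i> * complex_of_real (sgn \<xi>))"
  have p: "bm p" by (rule bmI[of _ 1]) (auto simp: p_def[abs_def] norm_mult abs_sgn_eq)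
  have "en (Suc s) F (x + mult p y)"
    unfolding mrel_def FT_add FT_mult
    using x[unfolded mrel_def] d[unfolded mrel_def] y[unfolded mrel_def] rep_plus[of "FT x" "mulf p (FT y)"] rep_mulf[OF p, of "FT y"]
  proof eventually_elim
    case (elim \<xi>)
    have "p \<xi> * (\<i> * complex_of_real \<xi>) = complex_of_real \<bar>\<xi>\<bar>"
      by (auto simp: p_def sgn_if abs_if)
    then have "wt (Suc s) \<xi> = wt s \<xi> + p \<xi> * (wt s \<xi> * (\<i> * complex_of_real \<xi>))"
      by (simp add: wt_def algebra_simps)
    then show ?case using elim by (simp add: algebra_simps)
  qed
  moreover have "norm (mult p y) \<le> 1 * norm y"
    by (rule norm_mult_le) (use p in \<open>auto simp: bm_def p_def norm_mult abs_sgn_eq\<close>)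
  ultimately show ?thesis by (intro exI[of _ "x + mult p y"]) (auto intro: norm_triangle_le)
qed

text \<open>The symbols \<open>iw 1 \<xi>\<close> and \<open>\<i> * \<xi> * iw 1 \<xi>\<close> are
  bounded by 1, so the function and its derivative are encoded at one order less without growth of
  norms.\<close>

lemma en_Suc_D:
  assumes "en (Suc s) F a"
  shows "\<exists>x F' y. en s F x \<and> dk 1 F F' \<and> en s F' y \<and> norm x \<le> norm a \<and> norm y \<le> norm a"
proof -
  have F: "F = E (Suc s) a" using assms by (simp add: en_iff)
  define q where "q = (\<lambda>\<xi>. \<i> * complex_of_real \<xi> * iw 1 \<xi>)"
  have qle: "cmod (q \<xi>) \<le> 1" for \<xi>
    unfolding q_def norm_mult iw_def norm_of_real by (simp add: divide_le_eq)
  have q: "bm q" by (rule bmI[of _ 1]) (auto simp: qle, simp add: q_def[abs_def] iw_def)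
  have S: "E (Suc s) b = E s (mult (iw 1) b)" for b
  proof -
    have "(\<lambda>\<xi>. iw s \<xi> * iw 1 \<xi>) = iw (Suc s)" by (auto simp: iw_def fun_eq_iff)
    then show ?thesis unfolding E_def by (simp add: mult_mult)
  qed
  have "dk 1 F (E s (mult q a))"
    unfolding F E_def mrel_def FT_mult
    using rep_mulf[OF bm_iw, of "Suc s" "FT a"] rep_mulf[OF bm_iw, of s "mulf q (FT a)"] rep_mulf[OF q, of "FT a"]
  proof eventually_elim
    case (elim \<xi>)
    have "iw (Suc s) \<xi> = iw s \<xi> * iw 1 \<xi>" by (simp add: iw_def)
    then show ?case using elim by (simp add: q_def)
  qed
  moreover have "norm (mult (iw 1) a) \<le> 1 * norm a" by (rule norm_mult_le[OF bm_measurable[OF bm_iw] iw_le])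
  moreover have "norm (mult q a) \<le> 1 * norm a" by (rule norm_mult_le) (use q qle in \<open>auto simp: bm_def\<close>)
  ultimately show ?thesis using S[of a] unfolding F
    by (intro exI[of _ "mult (iw 1) a"] exI[of _ "E s (mult q a)"] exI[of _ "mult q a"]) (auto simp: en_iff)
qed

lemma en_add: "en s F a \<Longrightarrow> en s G b \<Longrightarrow> en s (F + G) (a + b)" by (rule mrel_add)

text \<open>Leibniz rule and \<open>en_Suc_I\<close>: each order leads to three products, hence a
  factor 3. The induction starts at order 1, where \<open>sobolev_bound\<close> controls one factor
  pointwise; at order 0 the space is no algebra.\<close>

lemma algebra_estimate:
  "\<exists>C\<ge>0. \<forall>F G a b. en (Suc s) F a \<longrightarrow> en (Suc s) G b \<longrightarrow> (\<exists>c. en (Suc s) (pr F G) c \<and> norm c \<le> C * (norm a * norm b))"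
proof (induction s)
  case 0
  show ?case
  proof (intro exI[of _ "6 * sobC"] conjI allI impI)
    fix F G a b assume F: "en (Suc 0) F a" and G: "en (Suc 0) G b"
    obtain F' y where F': "dk 1 F F'" "en 0 F' y" "norm y \<le> norm a" "norm F \<le> norm a"
      using en_Suc_D[OF F] by (auto simp: en_0)
    obtain G' z where G': "dk 1 G G'" "en 0 G' z" "norm z \<le> norm b" "norm G \<le> norm b"
      using en_Suc_D[OF G] by (auto simp: en_0)
    have bF: "bd (2 * sobC * norm a) F"
      by (rule bd_mono[OF sobolev_bound[OF F'(1)]]) (use F' mult_left_mono[of "norm F + norm F'" "2 * norm a" sobC] in \<open>auto simp: en_0 sobC_nonneg\<close>)
    have bG: "bd (2 * sobC * norm b) G"
      by (rule bd_mono[OF sobolev_bound[OF G'(1)]]) (use G' mult_left_mono[of "norm G + norm G'" "2 * norm b" sobC] in \<open>auto simp: en_0 sobC_nonneg\<close>)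
    have k: "0 \<le> 2 * sobC * norm a" "0 \<le> 2 * sobC * norm b" by (auto simp: sobC_nonneg)
    have n1: "norm (pr F G) \<le> 2 * sobC * norm a * norm b"
      by (rule order_trans[OF norm_pr[OF bF] mult_left_mono[OF G'(4) k(1)]])
    have n2: "norm (pr F G') \<le> 2 * sobC * norm a * norm b"
      using order_trans[OF norm_pr[OF bF] mult_left_mono[OF _ k(1)], of G' "norm b"] G' by (simp add: en_0)
    have n3: "norm (pr F' G) \<le> 2 * sobC * norm a * norm b"
      using order_trans[OF norm_pr[OF bG] mult_left_mono[OF _ k(2)], of F' "norm a"] F' by (simp add: en_0 pr_commute mult_ac)
    have e: "en 0 (pr F G) (pr F G)" "en 0 (pr F' G + pr F G') (pr F' G + pr F G')" by (auto simp: en_0)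
    obtain c where c: "en (Suc 0) (pr F G) c" "norm c \<le> norm (pr F G) + norm (pr F' G + pr F G')"
      using en_Suc_I[OF e(1) dk_pr[OF F'(1) G'(1)] e(2)] by blast
    have "norm c \<le> 6 * sobC * (norm a * norm b)"
      using c(2) n1 n2 n3 norm_triangle_ineq[of "pr F' G" "pr F G'"] by (simp add: mult_ac)
    with c(1) show "\<exists>c. en (Suc 0) (pr F G) c \<and> norm c \<le> 6 * sobC * (norm a * norm b)" by blast
  qed (simp add: sobC_nonneg)
next
  case (Suc s)
  then obtain C where C: "C \<ge> 0" "\<And>F G a b. en (Suc s) F a \<Longrightarrow> en (Suc s) G b \<Longrightarrow> \<exists>c. en (Suc s) (pr F G) c \<and> norm c \<le> C * (norm a * norm b)"
    by blast
  show ?case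
  proof (intro exI[of _ "3 * C"] conjI allI impI)
    fix F G a b assume F: "en (Suc (Suc s)) F a" and G: "en (Suc (Suc s)) G b"
    obtain x F' y where F': "en (Suc s) F x" "dk 1 F F'" "en (Suc s) F' y" "norm x \<le> norm a" "norm y \<le> norm a"
      using en_Suc_D[OF F] by blast
    obtain z G' w where G': "en (Suc s) G z" "dk 1 G G'" "en (Suc s) G' w" "norm z \<le> norm b" "norm w \<le> norm b"
      using en_Suc_D[OF G] by blast
    have le: "C * (norm p * norm q) \<le> C * (norm a * norm b)" if "norm p \<le> norm a" "norm q \<le> norm b" for p q :: l2
      using that C(1) by (intro mult_left_mono mult_mono) auto
    obtain c1 where c1: "en (Suc s) (pr F G) c1" "norm c1 \<le> C * (norm a * norm b)"
      using C(2)[OF F'(1) G'(1)] le[OF F'(4) G'(4)] by (meson order_trans)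
    obtain c2 where c2: "en (Suc s) (pr F' G) c2" "norm c2 \<le> C * (norm a * norm b)"
      using C(2)[OF F'(3) G'(1)] le[OF F'(5) G'(4)] by (meson order_trans)
    obtain c3 where c3: "en (Suc s) (pr F G') c3" "norm c3 \<le> C * (norm a * norm b)"
      using C(2)[OF F'(1) G'(3)] le[OF F'(4) G'(5)] by (meson order_trans)
    obtain c where c: "en (Suc (Suc s)) (pr F G) c" "norm c \<le> norm c1 + norm (c2 + c3)"
      using en_Suc_I[OF c1(1) dk_pr[OF F'(2) G'(2)] en_add[OF c2(1) c3(1)]] by blast
    have "norm c \<le> 3 * C * (norm a * norm b)"
      using c(2) c1(2) c2(2) c3(2) norm_triangle_ineq[of c2 c3] by linarith
    with c(1) show "\<exists>c. en (Suc (Suc s)) (pr F G) c \<and> norm c \<le> 3 * C * (norm a * norm b)" by blast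
  qed (use C in simp)
qed

section \<open>Multiplication by functions with bounded derivatives\<close>

definition wb :: "nat \<Rightarrow> real \<Rightarrow> l2 \<Rightarrow> bool" where
  "wb s B P \<longleftrightarrow> (\<forall>j\<le>s. \<exists>Q. dk j P Q \<and> bd B Q)"

lemma wb_Suc: "wb (Suc s) B P \<Longrightarrow> bd B P \<and> (\<exists>P'. dk 1 P P' \<and> wb s B P) \<and> (\<forall>P'. dk 1 P P' \<longrightarrow> wb s B P')"
proof -
  assume w: "wb (Suc s) B P"
  have "\<exists>Q. dk 0 P Q \<and> bd B Q" using w by (auto simp: wb_def simp del: power_0)
  then have "bd B P" unfolding dk_0 by blast
  moreover have "\<exists>P'. dk 1 P P'" using w unfolding wb_def by (metis One_nat_def Suc_le_mono le0)
  moreover have "wb s B P" using w unfolding wb_def by (meson le_SucI)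
  moreover have "wb s B P'" if P': "dk 1 P P'" for P'
    unfolding wb_def
  proof (intro allI impI)
    fix j assume "j \<le> s"
    then obtain Q where "dk (1 + j) P Q" "bd B Q" using w unfolding wb_def by (metis Suc_le_mono plus_1_eq_Suc)
    with dk_split[OF this(1) P'] show "\<exists>Q. dk j P' Q \<and> bd B Q" by blast
  qed
  ultimately show ?thesis by blast
qed

text \<open>The same Leibniz induction, but the derivatives of \<open>P\<close> are charged to the
  pointwise bound \<open>B\<close> instead of a Sobolev norm. Here the dispersive decay enters:
  later \<open>B\<close> is of size \<open>1 / sqrt t\<close> while the Sobolev norm of
  \<open>P\<close> stays constant.\<close>

lemma bounded_multiplier_estimate:
  "wb s B P \<Longrightarrow> en s G b \<Longrightarrow> \<exists>c. en s (pr P G) c \<and> norm c \<le> 3 ^ s * B * norm b"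
proof (induction s arbitrary: P G b)
  case 0
  from 0(1) have "\<exists>Q. dk 0 P Q \<and> bd B Q" unfolding wb_def by blast
  then have "bd B P" unfolding dk_0 by blast
  then show ?case using norm_pr[of B P G] 0(2) by (auto simp: en_0)
next
  case (Suc s)
  obtain P' where P: "bd B P" "dk 1 P P'" "wb s B P" "wb s B P'" using wb_Suc[OF Suc.prems(1)] by blast
  obtain z G' w where G': "en s G z" "dk 1 G G'" "en s G' w" "norm z \<le> norm b" "norm w \<le> norm b"
    using en_Suc_D[OF Suc.prems(2)] by blast
  have k: "0 \<le> 3 ^ s * B" using bd_nonneg[OF P(1)] by simp
  have le: "3 ^ s * B * norm q \<le> 3 ^ s * B * norm b" if "norm q \<le> norm b" for q :: l2
    by (rule mult_left_mono[OF that k])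
  obtain c1 where c1: "en s (pr P G) c1" "norm c1 \<le> 3 ^ s * B * norm b"
    using Suc.IH[OF P(3) G'(1)] le[OF G'(4)] by (meson order_trans)
  obtain c2 where c2: "en s (pr P' G) c2" "norm c2 \<le> 3 ^ s * B * norm b"
    using Suc.IH[OF P(4) G'(1)] le[OF G'(4)] by (meson order_trans)
  obtain c3 where c3: "en s (pr P G') c3" "norm c3 \<le> 3 ^ s * B * norm b"
    using Suc.IH[OF P(3) G'(3)] le[OF G'(5)] by (meson order_trans)
  obtain c where c: "en (Suc s) (pr P G) c" "norm c \<le> norm c1 + norm (c2 + c3)"
    using en_Suc_I[OF c1(1) dk_pr[OF P(2) G'(2)] en_add[OF c2(1) c3(1)]] by blast
  have "norm c \<le> 3 ^ Suc s * B * norm b"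
    using c(2) c1(2) c2(2) c3(2) norm_triangle_ineq[of c2 c3] by simp
  with c(1) show ?case by blast
qed

section \<open>The algebra of encoded Sobolev functions\<close>

lemma E_inj: "E s a = E s b \<Longrightarrow> a = b"
proof -
  assume "E s a = E s b"
  then have "en s (E s a) a" "en s (E s a) b" by (auto simp: en_iff)
  then show "a = b"
    unfolding mrel_def by (intro l2_eqI[THEN FT_eqI]) (erule (1) eventually_elim2, simp)
qed

text \<open>Inverse of \<open>E s\<close> on its range; elsewhere the weighted transform is not
  square integrable and \<open>mulf\<close> returns 0.\<close>

definition enc :: "nat \<Rightarrow> l2 \<Rightarrow> l2" where "enc s F = iFT (mulf (wt s) (FT F))"

lemma en_enc: "en s F a \<Longrightarrow> enc s F = a"
proof -
  assume e: "en s F a"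
  have "en s F (enc s F)" unfolding enc_def by (rule mrel_exists, rule mrel_Lp2[OF wt_measurable e])
  with e show ?thesis using mrel_unique by blast
qed

text \<open>The product of \<open>H\<^sup>s\<close> transported to \<open>L\<^sup>2\<close>, which turns the nonlinearity into a polynomial.\<close>

definition ph :: "nat \<Rightarrow> l2 \<Rightarrow> l2 \<Rightarrow> l2" where "ph s a b = enc s (pr (E s a) (E s b))"

lemma en_E [simp]: "en s (E s a) a" by (simp add: en_iff)

lemma ph_exists_bound:
  assumes "1 \<le> s"
  shows "\<exists>C\<ge>0. \<forall>a b. E s (ph s a b) = pr (E s a) (E s b) \<and> norm (ph s a b) \<le> C * (norm a * norm b)"
proof -
  obtain s' where s: "s = Suc s'" using assms by (cases s) auto
  obtain C where C: "C \<ge> 0" "\<And>F G a b. en s F a \<Longrightarrow> en s G b \<Longrightarrow> \<exists>c. en s (pr F G) c \<and> norm c \<le> C * (norm a * norm b)"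
    using algebra_estimate[of s'] unfolding s by blast
  have "E s (ph s a b) = pr (E s a) (E s b) \<and> norm (ph s a b) \<le> C * (norm a * norm b)" for a b
  proof -
    obtain c where c: "en s (pr (E s a) (E s b)) c" "norm c \<le> C * (norm a * norm b)"
      using C(2)[OF en_E en_E] by blast
    have "ph s a b = c" unfolding ph_def by (rule en_enc[OF c(1)])
    with c show ?thesis by (simp add: en_iff)
  qed
  with C(1) show ?thesis by blast
qed

text \<open>One fixed algebra constant depending on \<open>s\<close> alone, so that the smallness
  threshold can be expressed through it.\<close>

definition phC :: "nat \<Rightarrow> real" where
  "phC s = (SOME C. C \<ge> 0 \<and> (\<forall>a b. norm (ph s a b) \<le> C * (norm a * norm b)))"

lemma phC: assumes "1 \<le> s" shows "phC s \<ge> 0" "norm (ph s a b) \<le> phC s * (norm a * norm b)"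
proof -
  have "\<exists>C. C \<ge> 0 \<and> (\<forall>a b. norm (ph s a b) \<le> C * (norm a * norm b))" using ph_exists_bound[OF assms] by blast
  from someI_ex[OF this] show "phC s \<ge> 0" "norm (ph s a b) \<le> phC s * (norm a * norm b)" unfolding phC_def by blast+
qed

lemma E_ph: "1 \<le> s \<Longrightarrow> E s (ph s a b) = pr (E s a) (E s b)"
  using ph_exists_bound by blast

lemma E_bd: assumes "1 \<le> s" shows "bd (2 * sobC * norm a) (E s a)"
proof -
  obtain s' where s: "s = Suc s'" using assms by (cases s) auto
  obtain x F' y where d: "en s' (E s a) x" "dk 1 (E s a) F'" "en s' F' y" "norm x \<le> norm a" "norm y \<le> norm a"
    using en_Suc_D[of s' "E s a" a] unfolding s by auto
  have "norm (E s a) \<le> norm a" "norm F' \<le> norm a"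
    using d norm_E_le[of s' y] norm_E_le[of s a] by (auto simp: en_iff)
  then have "sobC * (norm (E s a) + norm F') \<le> sobC * (2 * norm a)" by (intro mult_left_mono) (auto simp: sobC_nonneg)
  with bd_mono[OF sobolev_bound[OF d(2)]] show ?thesis by (simp add: mult_ac)
qed

lemma bounded_bilinear_ph: assumes s: "1 \<le> s" shows "bounded_bilinear (ph s)"
proof
  note Eadd = linear_add[OF bounded_linear.linear[OF bounded_linear_E]]
  note Escale = linear_cmul[OF bounded_linear.linear[OF bounded_linear_E]]
  note pradd = linear_add[OF bounded_linear.linear[OF bounded_linear_pr[OF E_bd[OF s]]]]
  note prscale = linear_cmul[OF bounded_linear.linear[OF bounded_linear_pr[OF E_bd[OF s]]]]
  have prc: "pr F (E s c) = pr (E s c) F" for F c by (rule pr_commute)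
  show "ph s (a + a') b = ph s a b + ph s a' b" for a a' b
    by (rule E_inj[of s]) (simp add: E_ph[OF s] Eadd pradd prc[of _ b])
  show "ph s a (b + b') = ph s a b + ph s a b'" for a b b'
    by (rule E_inj[of s]) (simp add: E_ph[OF s] Eadd pradd)
  show "ph s (r *\<^sub>R a) b = r *\<^sub>R ph s a b" for r a b
    by (rule E_inj[of s]) (simp add: E_ph[OF s] Escale prscale prc[of _ b])
  show "ph s a (r *\<^sub>R b) = r *\<^sub>R ph s a b" for r a b
    by (rule E_inj[of s]) (simp add: E_ph[OF s] Escale prscale)
  show "\<exists>K. \<forall>a b. norm (ph s a b) \<le> norm a * norm b * K"
    by (rule exI[of _ "phC s"]) (use phC(2)[OF s] in \<open>auto simp: mult_ac\<close>)
qed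

lemma ph_commute: "ph s a b = ph s b a" by (simp add: ph_def pr_commute)

lemma lcnj_E: "lcnj (E s a) = E s (lcnj a)"
proof -
  have "(\<lambda>x. cnj (iw s (- x))) = iw s" by (auto simp: iw_def)
  then show ?thesis unfolding E_def lcnj_mult[OF bm_iw] by simp
qed

lemma ph_lcnj: assumes s: "1 \<le> s" shows "lcnj (ph s a b) = ph s (lcnj a) (lcnj b)"
  by (rule E_inj[of s]) (simp add: E_ph[OF s] lcnj_E[symmetric] lcnj_pr[OF E_bd[OF s]])

lemma ph_assoc: assumes s: "1 \<le> s" shows "ph s (ph s a b) c = ph s a (ph s b c)"
proof (rule E_inj[of s])
  have "bd (2 * sobC * norm (ph s a b)) (pr (E s a) (E s b))" using E_bd[OF s, of "ph s a b"] by (simp add: E_ph[OF s])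
  then show "E s (ph s (ph s a b) c) = E s (ph s a (ph s b c))"
    unfolding E_ph[OF s] by (rule pr_assoc[OF E_bd[OF s] E_bd[OF s]])
qed

text \<open>Multiplication by complex scalars, since the vector space structure of \<open>l2\<close>
  is real.\<close>

definition cs :: "complex \<Rightarrow> l2 \<Rightarrow> l2" where "cs c = mulf (\<lambda>_. c)"

lemma cs_eq_mult: "cs c = mult (\<lambda>_. c)" by (simp add: cs_def mult_const fun_eq_iff)

lemma norm_cs_le: "norm (cs c F) \<le> cmod c * norm F"
  unfolding cs_def by (rule norm_mulf_le) auto

lemma norm_cs_unit: "cmod c = 1 \<Longrightarrow> norm (cs c F) = norm F"
  unfolding cs_def by (rule norm_mulf_unit) auto

lemma bounded_bilinear_cs: "bounded_bilinear cs"
proof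
  show "cs (c + d) F = cs c F + cs d F" for c d F unfolding cs_def by (rule mulf_add_fun) auto
  show "cs c (F + G) = cs c F + cs c G" for c F G unfolding cs_def by (rule mulf_add) auto
  show "cs (r *\<^sub>R c) F = r *\<^sub>R cs c F" for r c F
  proof -
    have "cs (r *\<^sub>R c) F = mulf (\<lambda>_. complex_of_real r) (mulf (\<lambda>_. c) F)"
      by (simp add: cs_def mulf_mulf scaleR_conv_of_real)
    then show ?thesis by (simp add: mulf_of_real cs_def)
  qed
  show "cs c (r *\<^sub>R F) = r *\<^sub>R cs c F" for r c F unfolding cs_def by (rule mulf_scaleR) auto
  show "\<exists>K. \<forall>c F. norm (cs c F) \<le> norm c * norm F * K"
    by (rule exI[of _ 1]) (simp add: norm_cs_le)
qed

lemma cs_cs [simp]: "cs c (cs d F) = cs (c * d) F" by (simp add: cs_def mulf_mulf)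
lemma cs_1 [simp]: "cs 1 F = F" by (simp add: cs_def)
lemma cs_of_real: "cs (complex_of_real r) F = r *\<^sub>R F" by (simp add: cs_def mulf_of_real)
lemma lcnj_cs: "lcnj (cs c F) = cs (cnj c) (lcnj F)" by (simp add: cs_def lcnj_mulf)
lemma mult_cs: "bm m \<Longrightarrow> mult m (cs c F) = cs c (mult m F)"
  unfolding cs_eq_mult by (rule mult_commute) auto
lemma E_cs: "E s (cs c F) = cs c (E s F)" unfolding E_def by (rule mult_cs) simp

lemma pr_cs: assumes b: "bd B F" shows "pr F (cs c G) = cs c (pr F G)"
  unfolding cs_def by (rule l2_eqI) (use rep_pr[OF b, of "mulf (\<lambda>_. c) G"] rep_pr[OF b, of G] rep_mulf[OF bm_const, of c G]
     rep_mulf[OF bm_const, of c "pr F G"] in \<open>eventually_elim\<close>, simp)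

lemma ph_cs_right: assumes s: "1 \<le> s" shows "ph s a (cs c b) = cs c (ph s a b)"
  by (rule E_inj[of s]) (simp add: E_ph[OF s] E_cs pr_cs[OF E_bd[OF s]])

lemma ph_cs_left: assumes s: "1 \<le> s" shows "ph s (cs c a) b = cs c (ph s a b)"
  by (simp add: ph_commute[of s _ b] ph_cs_right[OF s])

text \<open>The symbol of \<open>E s\<close> has no zeros and can be divided out.\<close>

lemma mrel_E_cancel: "mrel m (E s a) (E s b) \<Longrightarrow> mrel m a b"
proof -
  assume r: "mrel m (E s a) (E s b)"
  have nz: "iw s \<xi> \<noteq> 0" for \<xi> using wt_iw[of s \<xi>] by auto
  show ?thesis
    using r rep_mulf[OF bm_iw, of s "FT a"] rep_mulf[OF bm_iw, of s "FT b"]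
    unfolding mrel_def E_def FT_mult by eventually_elim (use nz in auto)
qed

lemma dk_ph:
  assumes s: "1 \<le> s" and a: "dk 1 a a'" and b: "dk 1 b b'"
  shows "dk 1 (ph s a b) (ph s a' b + ph s a b')"
proof (rule mrel_E_cancel[of _ s])
  have "dk 1 (E s a) (E s a')" "dk 1 (E s b) (E s b')" unfolding E_def by (rule mrel_mult[OF bm_iw a], rule mrel_mult[OF bm_iw b])
  from dk_pr[OF this] show "dk 1 (E s (ph s a b)) (E s (ph s a' b + ph s a b'))"
    by (simp add: E_ph[OF s] linear_add[OF bounded_linear.linear[OF bounded_linear_E]])
qed

lemma wb_ph: assumes s: "1 \<le> s" and w: "wb s B (E s p)" shows "norm (ph s p b) \<le> 3 ^ s * B * norm b"
proof -
  obtain c where c: "en s (pr (E s p) (E s b)) c" "norm c \<le> 3 ^ s * B * norm b"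
    using bounded_multiplier_estimate[OF w en_E] by blast
  then show ?thesis unfolding ph_def using en_enc[OF c(1)] by simp
qed

section \<open>The free group\<close>

lemma sg_0 [simp]: "sg 0 F = F" by (simp add: sg_def)

lemma sg_sg [simp]: "sg t (sg u F) = sg (t + u) F"
  by (simp add: sg_def mult_mult cis_mult distrib_right add.commute)

lemma norm_sg [simp]: "norm (sg t F) = norm F" unfolding sg_def by (rule norm_mult_unit) auto

lemma bounded_linear_sg: "bounded_linear (sg t)" unfolding sg_def by (rule bounded_linear_mult) simp

lemma sg_diff: "sg t (F - G) = sg t F - sg t G" by (rule linear_diff[OF bounded_linear.linear[OF bounded_linear_sg]])
lemma sg_add: "sg t (F + G) = sg t F + sg t G" by (rule linear_add[OF bounded_linear.linear[OF bounded_linear_sg]])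
lemma sg_scaleR: "sg t (r *\<^sub>R F) = r *\<^sub>R sg t F" by (rule linear_cmul[OF bounded_linear.linear[OF bounded_linear_sg]])

lemma sg_minus: "sg t (- F) = - sg t F" by (rule linear_neg[OF bounded_linear.linear[OF bounded_linear_sg]])

lemma lcnj_sg: "lcnj (sg t F) = sg (- t) (lcnj F)"
  unfolding sg_def lcnj_mult[OF bm_sg] by (simp add: cis_cnj)

lemma sg_mult: "bm m \<Longrightarrow> sg t (mult m F) = mult m (sg t F)" unfolding sg_def by (rule mult_commute) auto
lemma sg_cs: "sg t (cs c F) = cs c (sg t F)" unfolding cs_eq_mult by (rule sg_mult) auto
lemma sg_E: "sg t (E s F) = E s (sg t F)" unfolding E_def by (rule sg_mult) auto
lemma dk_sg: "dk k F G \<Longrightarrow> dk k (sg t F) (sg t G)" unfolding sg_def by (rule mrel_mult) auto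

lemma sg_tendsto_const: "((\<lambda>t. sg t F) \<longlongrightarrow> sg c F) (at c within S)"
  unfolding sg_def by (rule mult_tendsto_at[of _ _ 1]) (auto intro!: tendsto_intros)

lemma isCont_sg: "isCont (\<lambda>t. sg t F) c" using sg_tendsto_const[of F c UNIV] by (simp add: isCont_def)

text \<open>The group is only strongly continuous. Isometry controls the varying argument, so strong
  continuity is needed at the limit vector alone.\<close>

lemma sg_tendsto:
  assumes f: "(f \<longlongrightarrow> L) A" and g: "(g \<longlongrightarrow> c) A"
  shows "((\<lambda>x. sg (g x) (f x)) \<longlongrightarrow> sg c L) A"
proof -
  have "((\<lambda>x. sg (g x) (f x - L)) \<longlongrightarrow> 0) A"
    by (rule tendsto_norm_zero_cancel) (use f in \<open>simp add: LIM_zero tendsto_norm_zero\<close>)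
  moreover have "((\<lambda>x. sg (g x) L) \<longlongrightarrow> sg c L) A"
    by (rule isCont_tendsto_compose[OF isCont_sg g])
  ultimately have "((\<lambda>x. sg (g x) (f x - L) + sg (g x) L) \<longlongrightarrow> 0 + sg c L) A" by (rule tendsto_add)
  then show ?thesis by (simp add: sg_diff)
qed

lemma continuous_on_sg [continuous_intros]:
  "continuous_on S f \<Longrightarrow> continuous_on S g \<Longrightarrow> continuous_on S (\<lambda>x. sg (g x) (f x))"
  unfolding continuous_on_def by (auto intro: sg_tendsto)

lemma continuous_on_lcnj [continuous_intros]: "continuous_on S f \<Longrightarrow> continuous_on S (\<lambda>x. lcnj (f x))"
  by (rule bounded_linear.continuous_on[OF bounded_linear_lcnj])

lemma continuous_on_cs [continuous_intros]:
  "continuous_on S f \<Longrightarrow> continuous_on S g \<Longrightarrow> continuous_on S (\<lambda>x. cs (f x) (g x))"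
  by (rule bounded_bilinear.continuous_on[OF bounded_bilinear_cs])

lemma continuous_on_ph: "1 \<le> s \<Longrightarrow>
  continuous_on S f \<Longrightarrow> continuous_on S g \<Longrightarrow> continuous_on S (\<lambda>x. ph s (f x) (g x))"
  by (rule bounded_bilinear.continuous_on[OF bounded_bilinear_ph])

lemma sg_has_vector_derivative:
  assumes d: "dk 2 F G"
  shows "((\<lambda>t. sg (c * t) F) has_vector_derivative cs (\<i> * complex_of_real c) (sg (c * t) G)) (at t within S)"
proof -
  have "mrel (\<lambda>\<xi>. \<i> * complex_of_real (- (c * \<xi>\<^sup>2))) F (cs (\<i> * complex_of_real c) G)"
    unfolding mrel_def cs_eq_mult FT_mult
    using d[unfolded mrel_def] rep_mulf[OF bm_const, of "\<i> * complex_of_real c" "FT G"]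
    by eventually_elim (simp add: power_mult_distrib)
  from mult_has_vector_derivative[OF _ this, of t S]
  have "((\<lambda>t. mult (\<lambda>\<xi>. cis (t * - (c * \<xi>\<^sup>2))) F) has_vector_derivative mult (\<lambda>\<xi>. cis (t * - (c * \<xi>\<^sup>2))) (cs (\<i> * complex_of_real c) G)) (at t within S)"
    by simp
  moreover have "mult (\<lambda>\<xi>. cis (t * - (c * \<xi>\<^sup>2))) H = sg (c * t) H" for t H by (simp add: sg_def mult_ac)
  ultimately show ?thesis by (simp add: sg_cs)
qed

text \<open>The generator is unbounded, so the usual product rule for bounded bilinear maps does not
  apply. The difference quotient splits into three parts, and two space derivatives are asked only
  of the value at time \<open>t\<close>.\<close>

lemma sg_moving_has_vector_derivative:
  assumes Y: "(Y has_vector_derivative Y') (at t within S)" and d: "dk 2 (Y t) G"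
  shows "((\<lambda>t. sg (- t) (Y t)) has_vector_derivative sg (- t) (Y' - cs \<i> G)) (at t within S)"
proof -
  let ?r = "\<lambda>y. (sg (- y) (Y y) - sg (- t) (Y t) - (y - t) *\<^sub>R sg (- t) (Y' - cs \<i> G)) /\<^sub>R norm (y - t)"
  have 1: "((\<lambda>y. norm ((Y y - Y t - (y - t) *\<^sub>R Y') /\<^sub>R norm (y - t))) \<longlongrightarrow> 0) (at t within S)"
  proof -
    have "((\<lambda>y. (1 / norm (y - t)) *\<^sub>R (Y y - (Y t + (y - t) *\<^sub>R Y'))) \<longlongrightarrow> 0) (at t within S)"
      using Y by (simp only: has_vector_derivative_def has_derivative_within)
    from tendsto_norm_zero[OF this] show ?thesis by (simp only: diff_diff_eq divide_inverse mult_1_left)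
  qed
  have 2: "((\<lambda>y. norm (sg (- y) Y' - sg (- t) Y')) \<longlongrightarrow> 0) (at t within S)"
  proof -
    have "((\<lambda>y. sg (- y) Y') \<longlongrightarrow> sg (- t) Y') (at t within S)" by (intro sg_tendsto tendsto_intros)
    then show ?thesis by (simp add: LIM_zero tendsto_norm_zero)
  qed
  have "((\<lambda>y. sg (- 1 * y) (Y t)) has_vector_derivative cs (\<i> * complex_of_real (- 1)) (sg (- 1 * t) G)) (at t within S)"
    by (rule sg_has_vector_derivative[OF d])
  then have "((\<lambda>y. sg (- y) (Y t)) has_vector_derivative cs (- \<i>) (sg (- t) G)) (at t within S)" by simp
  then have "((\<lambda>y. (1 / norm (y - t)) *\<^sub>R (sg (- y) (Y t) - (sg (- t) (Y t) + (y - t) *\<^sub>R cs (- \<i>) (sg (- t) G)))) \<longlongrightarrow> 0) (at t within S)"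
    by (simp only: has_vector_derivative_def has_derivative_within)
  from tendsto_norm_zero[OF this]
  have 3: "((\<lambda>y. norm ((sg (- y) (Y t) - sg (- t) (Y t) - (y - t) *\<^sub>R cs (- \<i>) (sg (- t) G)) /\<^sub>R norm (y - t))) \<longlongrightarrow> 0) (at t within S)"
    by (simp only: diff_diff_eq divide_inverse mult_1_left)
  have csm: "cs (- \<i>) H = - cs \<i> H" for H using bounded_bilinear.minus_left[OF bounded_bilinear_cs] .
  have "((\<lambda>y. norm (?r y)) \<longlongrightarrow> 0) (at t within S)"
  proof (rule Lim_null_comparison)
    show "((\<lambda>y. norm ((Y y - Y t - (y - t) *\<^sub>R Y') /\<^sub>R norm (y - t)) + norm (sg (- y) Y' - sg (- t) Y') +
      norm ((sg (- y) (Y t) - sg (- t) (Y t) - (y - t) *\<^sub>R cs (- \<i>) (sg (- t) G)) /\<^sub>R norm (y - t))) \<longlongrightarrow> 0) (at t within S)"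
      using tendsto_add[OF tendsto_add[OF 1 2] 3] by simp
    show "\<forall>\<^sub>F y in at t within S. norm (norm (?r y)) \<le> norm ((Y y - Y t - (y - t) *\<^sub>R Y') /\<^sub>R norm (y - t)) + norm (sg (- y) Y' - sg (- t) Y') +
      norm ((sg (- y) (Y t) - sg (- t) (Y t) - (y - t) *\<^sub>R cs (- \<i>) (sg (- t) G)) /\<^sub>R norm (y - t))"
      unfolding eventually_at_filter
    proof (intro always_eventually allI impI)
      fix y assume "y \<noteq> t"
      let ?A = "(Y y - Y t - (y - t) *\<^sub>R Y') /\<^sub>R norm (y - t)"
      let ?B = "((y - t) / norm (y - t)) *\<^sub>R (sg (- y) Y' - sg (- t) Y')"
      let ?C = "(sg (- y) (Y t) - sg (- t) (Y t) - (y - t) *\<^sub>R cs (- \<i>) (sg (- t) G)) /\<^sub>R norm (y - t)"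
      have e: "?r y = sg (- y) ?A + ?B + ?C"
        by (simp add: sg_diff sg_scaleR sg_cs csm scaleR_diff_right scaleR_add_right divide_inverse mult.commute)
      have "norm (?r y) \<le> norm (sg (- y) ?A) + norm ?B + norm ?C"
        unfolding e by (intro norm_triangle_le add_mono norm_triangle_ineq order_refl)
      also have "norm ?B = norm (sg (- y) Y' - sg (- t) Y')" using \<open>y \<noteq> t\<close> by simp
      finally show "norm (norm (?r y)) \<le> norm ?A + norm (sg (- y) Y' - sg (- t) Y') + norm ?C" by simp
    qed
  qed
  then have "(?r \<longlongrightarrow> 0) (at t within S)" by (rule tendsto_norm_zero_cancel)
  then have "((\<lambda>y. (1 / norm (y - t)) *\<^sub>R (sg (- y) (Y y) - (sg (- t) (Y t) + (y - t) *\<^sub>R sg (- t) (Y' - cs \<i> G)))) \<longlongrightarrow> 0) (at t within S)"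
    by (simp only: diff_diff_eq divide_inverse mult_1_left)
  then show ?thesis by (simp only: has_vector_derivative_def has_derivative_within bounded_linear_scaleR_left simp_thms)
qed

section \<open>Oscillatory time integrals\<close>

lemma integral_inverse_square:
  assumes "0 < t" "t \<le> T"
  shows "((\<lambda>\<tau>::real. 1 / \<tau>\<^sup>2) has_integral (1 / t - 1 / T)) {t..T}"
proof -
  have "((\<lambda>\<tau>::real. 1 / \<tau>\<^sup>2) has_integral (- (1 / T) - (- (1 / t)))) {t..T}"
  proof (rule fundamental_theorem_of_calculus[OF assms(2)])
    fix x assume x: "x \<in> {t..T}"
    with assms(1) have "((\<lambda>\<tau>. - (1 / \<tau>)) has_field_derivative 1 / x\<^sup>2) (at x within {t..T})"
      by (auto intro!: derivative_eq_intros simp: power2_eq_square)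
    then show "((\<lambda>\<tau>. - (1 / \<tau>)) has_vector_derivative 1 / x\<^sup>2) (at x within {t..T})"
      by (simp add: has_real_derivative_iff_has_vector_derivative)
  qed
  then show ?thesis by simp
qed

text \<open>Integration by parts in time: \<open>y\<close> itself need not decay, only its primitive
  \<open>Y\<close> be bounded. The boundary terms are of size \<open>1 / t\<close>, and so is the
  tail of the integral of \<open>\<phi>'\<close>.\<close>

lemma ibp_bound:
  fixes \<phi> :: "real \<Rightarrow> complex" and Y y :: "real \<Rightarrow> l2"
  assumes t: "0 < t" "t \<le> T"
    and \<phi>: "\<And>\<tau>. \<tau> \<in> {t..T} \<Longrightarrow> (\<phi> has_vector_derivative \<phi>' \<tau>) (at \<tau> within {t..T})" "continuous_on {t..T} \<phi>'"
    and \<phi>le: "\<And>\<tau>. \<tau> \<in> {t..T} \<Longrightarrow> cmod (\<phi> \<tau>) \<le> 1 / \<tau>" "\<And>\<tau>. \<tau> \<in> {t..T} \<Longrightarrow> cmod (\<phi>' \<tau>) \<le> K / \<tau>\<^sup>2"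
    and Y: "\<And>\<tau>. \<tau> \<in> {t..T} \<Longrightarrow> (Y has_vector_derivative y \<tau>) (at \<tau> within {t..T})" "continuous_on {t..T} y"
    and M: "\<And>\<tau>. \<tau> \<in> {t..T} \<Longrightarrow> norm (Y \<tau>) \<le> M"
  shows "norm (integral {t..T} (\<lambda>\<tau>. cs (\<phi> \<tau>) (y \<tau>))) \<le> (2 + K) * M / t"
proof -
  have M0: "0 \<le> M" using M[of t] t norm_ge_zero[of "Y t"] by (metis atLeastAtMost_iff order.trans order_refl)
  have K0: "0 \<le> K"
  proof -
    have "0 \<le> K / t\<^sup>2" using \<phi>le(2)[of t] t norm_ge_zero[of "\<phi>' t"] by (metis atLeastAtMost_iff order.trans order_refl)
    then show ?thesis using t by (simp add: zero_le_divide_iff)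
  qed
  have cY: "continuous_on {t..T} Y" "continuous_on {t..T} \<phi>"
    using Y(1) \<phi>(1) has_vector_derivative_continuous continuous_on_eq_continuous_within by blast+
  have i1: "(\<lambda>\<tau>. cs (\<phi> \<tau>) (y \<tau>)) integrable_on {t..T}" and i2: "(\<lambda>\<tau>. cs (\<phi>' \<tau>) (Y \<tau>)) integrable_on {t..T}"
    by (intro integrable_continuous_real continuous_intros cY Y(2) \<phi>(2))+
  have "((\<lambda>\<tau>. cs (\<phi> \<tau>) (y \<tau>) + cs (\<phi>' \<tau>) (Y \<tau>)) has_integral (cs (\<phi> T) (Y T) - cs (\<phi> t) (Y t))) {t..T}"
    by (rule fundamental_theorem_of_calculus[OF t(2)])
      (rule bounded_bilinear.has_vector_derivative[OF bounded_bilinear_cs \<phi>(1) Y(1)]; assumption)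
  then have "integral {t..T} (\<lambda>\<tau>. cs (\<phi> \<tau>) (y \<tau>)) + integral {t..T} (\<lambda>\<tau>. cs (\<phi>' \<tau>) (Y \<tau>)) = cs (\<phi> T) (Y T) - cs (\<phi> t) (Y t)"
    using integral_add[OF i1 i2] by (simp add: integral_unique)
  then have e: "integral {t..T} (\<lambda>\<tau>. cs (\<phi> \<tau>) (y \<tau>)) = cs (\<phi> T) (Y T) - cs (\<phi> t) (Y t) - integral {t..T} (\<lambda>\<tau>. cs (\<phi>' \<tau>) (Y \<tau>))"
    by (simp add: algebra_simps)
  have b: "norm (cs (\<phi> \<tau>) (Y \<tau>)) \<le> M / t" if \<tau>: "\<tau> \<in> {t..T}" for \<tau>
  proof -
    have "norm (cs (\<phi> \<tau>) (Y \<tau>)) \<le> (1 / \<tau>) * M"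
      by (rule order_trans[OF norm_cs_le mult_mono[OF \<phi>le(1)[OF \<tau>] M[OF \<tau>]]]) (use \<tau> t in auto)
    also have "\<dots> \<le> (1 / t) * M" by (intro mult_right_mono frac_le) (use \<tau> t M0 in auto)
    finally show ?thesis by simp
  qed
  have g: "((\<lambda>\<tau>. (K * M) * (1 / \<tau>\<^sup>2)) has_integral (K * M) * (1 / t - 1 / T)) {t..T}"
    by (rule has_integral_mult_right[OF integral_inverse_square[OF t]])
  have "norm (integral {t..T} (\<lambda>\<tau>. cs (\<phi>' \<tau>) (Y \<tau>))) \<le> integral {t..T} (\<lambda>\<tau>. (K * M) * (1 / \<tau>\<^sup>2))"
  proof (rule integral_norm_bound_integral[OF i2])
    show "(\<lambda>\<tau>. (K * M) * (1 / \<tau>\<^sup>2)) integrable_on {t..T}" using g by (rule has_integral_integrable)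
    fix \<tau> assume \<tau>: "\<tau> \<in> {t..T}"
    have "norm (cs (\<phi>' \<tau>) (Y \<tau>)) \<le> (K / \<tau>\<^sup>2) * M"
      by (rule order_trans[OF norm_cs_le mult_mono[OF \<phi>le(2)[OF \<tau>] M[OF \<tau>]]]) (use K0 in auto)
    then show "norm (cs (\<phi>' \<tau>) (Y \<tau>)) \<le> (K * M) * (1 / \<tau>\<^sup>2)" by simp
  qed
  also have "\<dots> = (K * M) * (1 / t - 1 / T)" by (rule integral_unique[OF g])
  also have "\<dots> \<le> (K * M) * (1 / t)" using t K0 M0 by (intro mult_left_mono) auto
  finally have r: "norm (integral {t..T} (\<lambda>\<tau>. cs (\<phi>' \<tau>) (Y \<tau>))) \<le> K * M / t" by simp
  have "norm (integral {t..T} (\<lambda>\<tau>. cs (\<phi> \<tau>) (y \<tau>))) \<le> M / t + M / t + K * M / t"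
    unfolding e using b[of T] b[of t] r t
    by (intro order_trans[OF norm_triangle_ineq4] add_mono order_trans[OF norm_triangle_ineq4]) auto
  also have "\<dots> = (2 + K) * M / t" by (simp add: add_divide_distrib distrib_right)
  finally show ?thesis .
qed

text \<open>The kernel \<open>1 / \<tau>\<close> with the logarithmic phase stemming from
  \<open>v1\<close>. That phase has derivative \<open>\<kappa> / \<tau>\<close>, so differentiation
  still gains a factor \<open>1 / \<tau>\<close>.\<close>

definition osc :: "real \<Rightarrow> real \<Rightarrow> complex" where "osc \<kappa> \<tau> = cis (\<kappa> * ln \<tau>) / \<tau>"

lemma osc_deriv:
  assumes "0 < \<tau>"
  shows "(osc \<kappa> has_vector_derivative (\<i> * \<kappa> - 1) * cis (\<kappa> * ln \<tau>) / (complex_of_real \<tau>)\<^sup>2) (at \<tau> within S)"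
proof -
  have 1: "((\<lambda>\<tau>. cis (\<kappa> * ln \<tau>)) has_vector_derivative (\<kappa> / \<tau>) *\<^sub>R (\<i> * cis (\<kappa> * ln \<tau>))) (at \<tau> within S)"
    unfolding has_vector_derivative_def
    by (rule has_derivative_eq_rhs, rule has_derivative_cis[THEN has_derivative_compose[rotated]], (rule derivative_intros assms)+)
      (auto simp: fun_eq_iff scaleR_conv_of_real field_simps)
  have 2: "((\<lambda>\<tau>. complex_of_real (inverse \<tau>)) has_vector_derivative complex_of_real (- (inverse \<tau> * inverse \<tau>))) (at \<tau> within S)"
    using assms by (intro has_vector_derivative_of_real) (auto intro!: derivative_eq_intros simp: power2_eq_square)
  from has_vector_derivative_mult[OF 1 2]
  show ?thesis unfolding osc_def[abs_def]
    using assms by (simp add: divide_inverse scaleR_conv_of_real power2_eq_square algebra_simps)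
qed

lemma osc_le: "0 < \<tau> \<Longrightarrow> cmod (osc \<kappa> \<tau>) \<le> 1 / \<tau>"
  by (simp add: osc_def norm_divide)

lemma osc_deriv_le: "0 < \<tau> \<Longrightarrow> cmod ((\<i> * complex_of_real \<kappa> - 1) * cis (\<kappa> * ln \<tau>) / (complex_of_real \<tau>)\<^sup>2) \<le> (1 + \<bar>\<kappa>\<bar>) / \<tau>\<^sup>2"
proof -
  have "cmod (\<i> * complex_of_real \<kappa> - 1) \<le> \<bar>\<kappa>\<bar> + 1"
    by (rule order_trans[OF norm_triangle_ineq4]) (simp add: norm_mult)
  then show "0 < \<tau> \<Longrightarrow> ?thesis" by (simp add: norm_divide norm_mult norm_power divide_right_mono)
qed

lemma osc_bound:
  assumes t: "0 < t" "t \<le> T"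
    and Y: "\<And>\<tau>. \<tau> \<in> {t..T} \<Longrightarrow> (Y has_vector_derivative y \<tau>) (at \<tau> within {t..T})" "continuous_on {t..T} y"
    and M: "\<And>\<tau>. \<tau> \<in> {t..T} \<Longrightarrow> norm (Y \<tau>) \<le> M"
  shows "norm (integral {t..T} (\<lambda>\<tau>. cs (osc \<kappa> \<tau>) (y \<tau>))) \<le> (3 + \<bar>\<kappa>\<bar>) * M / t"
proof -
  have "norm (integral {t..T} (\<lambda>\<tau>. cs (osc \<kappa> \<tau>) (y \<tau>))) \<le> (2 + (1 + \<bar>\<kappa>\<bar>)) * M / t"
    by (rule ibp_bound[OF t osc_deriv _ osc_le osc_deriv_le Y M]) (use t in \<open>auto intro!: continuous_intros\<close>)
  then show ?thesis by simp
qed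

lemma osc_continuous [continuous_intros]: "S \<subseteq> {0<..} \<Longrightarrow> continuous_on S (osc \<kappa>)"
  unfolding osc_def[abs_def] by (intro continuous_intros) auto

section \<open>The source terms\<close>

text \<open>Conjugation reverses the flow, so the pulled back source moves by
  \<open>sg (- 2 * \<tau>)\<close>. Its time primitive costs two space antiderivatives, which
  \<open>V\<close> supplies; the factor \<open>\<i> / 2\<close> inverts
  \<open>\<i> * (- 2)\<close>.\<close>

lemma source_conj_bound:
  assumes V: "dk 2 V b" and t: "0 < t" "t \<le> T"
  shows "norm (integral {t..T} (\<lambda>\<tau>. cs (osc \<kappa> \<tau>) (sg (- 2 * \<tau>) (lcnj b)))) \<le> (3 + \<bar>\<kappa>\<bar>) * norm V / t"
proof (rule osc_bound[OF t])
  fix \<tau>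
  have "((\<lambda>\<tau>. sg (- 2 * \<tau>) (lcnj V)) has_vector_derivative cs (\<i> * complex_of_real (- 2)) (sg (- 2 * \<tau>) (lcnj b))) (at \<tau> within {t..T})"
    by (rule sg_has_vector_derivative[OF dk_lcnj[OF V]])
  from bounded_linear.has_vector_derivative[OF bounded_bilinear.bounded_linear_right[OF bounded_bilinear_cs, of "\<i> / 2"] this]
  show "((\<lambda>\<tau>. cs (\<i> / 2) (sg (- 2 * \<tau>) (lcnj V))) has_vector_derivative sg (- 2 * \<tau>) (lcnj b)) (at \<tau> within {t..T})"
    by simp
  show "norm (cs (\<i> / 2) (sg (- 2 * \<tau>) (lcnj V))) \<le> norm V"
    by (rule order_trans[OF norm_cs_le]) (simp add: norm_divide)
qed (intro continuous_intros)

lemma cs_half: "cs (\<i> / 2) (cs (- 2 * \<i>) F) = F"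
  by simp

text \<open>If \<open>U' = b\<close>, then \<open>sg (- \<tau>) ((sg \<tau> b)\<^sup>2)\<close> is up to a factor the time derivative of \<open>sg (- \<tau>) ((sg \<tau> U)\<^sup>2)\<close>,
  because only the mixed term of \<open>\<partial>\<^sub>x\<^sup>2 (U\<^sup>2)\<close> survives.\<close>

lemma source_square_bound_smooth:
  assumes s: "1 \<le> s" and U: "dk 1 U b" and b: "dk 1 b b'" and t: "0 < t" "t \<le> T"
  shows "norm (integral {t..T} (\<lambda>\<tau>. cs (osc \<kappa> \<tau>) (sg (- \<tau>) (ph s (sg \<tau> b) (sg \<tau> b))))) \<le> (3 + \<bar>\<kappa>\<bar>) * (phC s * (norm U * norm U)) / t"
proof (rule osc_bound[OF t])
  interpret ph: bounded_bilinear "ph s" by (rule bounded_bilinear_ph[OF s])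
  interpret cs: bounded_bilinear cs by (rule bounded_bilinear_cs)
  fix \<tau>
  have U2: "dk 2 U b'" using dk_add[OF U b] by (simp add: numeral_2_eq_2)
  have DU: "((\<lambda>\<tau>. sg \<tau> U) has_vector_derivative cs \<i> (sg \<tau> b')) (at \<tau> within {t..T})"
    using sg_has_vector_derivative[OF U2, of 1] by simp
  have W: "((\<lambda>\<tau>. ph s (sg \<tau> U) (sg \<tau> U)) has_vector_derivative
     (ph s (sg \<tau> U) (cs \<i> (sg \<tau> b')) + ph s (cs \<i> (sg \<tau> b')) (sg \<tau> U))) (at \<tau> within {t..T})"
    by (rule ph.has_vector_derivative[OF DU DU])
  note dU = dk_sg[OF U, of \<tau>] and db = dk_sg[OF b, of \<tau>]
  have "dk 1 (ph s (sg \<tau> U) (sg \<tau> U)) (ph s (sg \<tau> b) (sg \<tau> U) + ph s (sg \<tau> U) (sg \<tau> b))" by (rule dk_ph[OF s dU dU])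
  moreover have "dk 1 (ph s (sg \<tau> b) (sg \<tau> U) + ph s (sg \<tau> U) (sg \<tau> b))
     ((ph s (sg \<tau> b') (sg \<tau> U) + ph s (sg \<tau> b) (sg \<tau> b)) + (ph s (sg \<tau> b) (sg \<tau> b) + ph s (sg \<tau> U) (sg \<tau> b')))"
    by (intro mrel_add dk_ph[OF s] dU db)
  ultimately have "dk 2 (ph s (sg \<tau> U) (sg \<tau> U))
     ((ph s (sg \<tau> b') (sg \<tau> U) + ph s (sg \<tau> b) (sg \<tau> b)) + (ph s (sg \<tau> b) (sg \<tau> b) + ph s (sg \<tau> U) (sg \<tau> b')))"
    using dk_add[of 1 _ _ 1] by (fastforce simp: numeral_2_eq_2)
  from sg_moving_has_vector_derivative[OF W this]
  have "((\<lambda>\<tau>. sg (- \<tau>) (ph s (sg \<tau> U) (sg \<tau> U))) has_vector_derivative cs (- 2 * \<i>) (sg (- \<tau>) (ph s (sg \<tau> b) (sg \<tau> b)))) (at \<tau> within {t..T})"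
  proof (rule has_vector_derivative_eq_rhs)
    have "cs (- 2 * \<i>) F = - cs \<i> F - cs \<i> F" for F
      using cs.add_left[of "- \<i>" "- \<i>" F] by (simp add: cs.minus_left)
    then show "sg (- \<tau>) (ph s (sg \<tau> U) (cs \<i> (sg \<tau> b')) + ph s (cs \<i> (sg \<tau> b')) (sg \<tau> U) -
        cs \<i> ((ph s (sg \<tau> b') (sg \<tau> U) + ph s (sg \<tau> b) (sg \<tau> b)) + (ph s (sg \<tau> b) (sg \<tau> b) + ph s (sg \<tau> U) (sg \<tau> b')))) =
        cs (- 2 * \<i>) (sg (- \<tau>) (ph s (sg \<tau> b) (sg \<tau> b)))"
      by (simp add: ph_cs_left[OF s] ph_cs_right[OF s] cs.add_right sg_diff sg_add sg_minus sg_cs)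
  qed
  from bounded_linear.has_vector_derivative[OF cs.bounded_linear_right[of "\<i> / 2"] this]
  show "((\<lambda>\<tau>. cs (\<i> / 2) (sg (- \<tau>) (ph s (sg \<tau> U) (sg \<tau> U)))) has_vector_derivative sg (- \<tau>) (ph s (sg \<tau> b) (sg \<tau> b))) (at \<tau> within {t..T})"
    by (simp only: cs_half)
  have "norm (cs (\<i> / 2) (sg (- \<tau>) (ph s (sg \<tau> U) (sg \<tau> U)))) \<le> norm (ph s (sg \<tau> U) (sg \<tau> U))"
    by (rule order_trans[OF norm_cs_le]) (simp add: norm_divide)
  also have "\<dots> \<le> phC s * (norm U * norm U)" using phC(2)[OF s, of "sg \<tau> U" "sg \<tau> U"] by simp
  finally show "norm (cs (\<i> / 2) (sg (- \<tau>) (ph s (sg \<tau> U) (sg \<tau> U)))) \<le> phC s * (norm U * norm U)" .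
qed (intro continuous_intros continuous_on_ph[OF s])

text \<open>\<open>Aop = |D| / (1 + |D|)\<close> dominates the derivatives of positive order of \<open>E s a\<close> and ignores low frequencies.\<close>

definition Aw :: "real \<Rightarrow> complex" where "Aw \<xi> = complex_of_real (\<bar>\<xi>\<bar> / (1 + \<bar>\<xi>\<bar>))"
definition Aop :: "l2 \<Rightarrow> l2" where "Aop = mult Aw"

lemma Aw_le: "cmod (Aw \<xi>) \<le> 1" "cmod (Aw \<xi>) \<le> \<bar>\<xi>\<bar>"
proof -
  have "\<bar>\<xi>\<bar> / (1 + \<bar>\<xi>\<bar>) \<le> \<bar>\<xi>\<bar> / 1" by (rule frac_le) auto
  then show "cmod (Aw \<xi>) \<le> \<bar>\<xi>\<bar>" unfolding Aw_def norm_of_real by simp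
  show "cmod (Aw \<xi>) \<le> 1" unfolding Aw_def norm_of_real by (simp add: divide_le_eq)
qed

lemma bm_Aw [simp, intro]: "bm Aw"
  by (rule bmI[of _ 1], simp add: Aw_def[abs_def]) (rule Aw_le)

lemma norm_Aop_le: "norm (Aop F) \<le> norm F"
  unfolding Aop_def using norm_mult_le[OF bm_measurable[OF bm_Aw] Aw_le(1)] by simp

lemma bounded_linear_Aop: "bounded_linear Aop" unfolding Aop_def by (rule bounded_linear_mult) simp

lemma Aop_dk: "dk 1 F G \<Longrightarrow> norm (Aop F) \<le> norm G"
  using mrel_norm_le[of Aw F "Aop F" "\<lambda>\<xi>. (\<i> * complex_of_real \<xi>) ^ 1" G 1] Aw_le(2)
  by (simp add: mrel_bm Aop_def norm_mult)

text \<open>Only the space derivative of \<open>|b|\<^sup>2\<close> is a time derivative, namely that of \<open>b * cnj U\<close>.\<close>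

lemma source_modulus_bound_smooth:
  assumes s: "1 \<le> s" and U: "dk 1 U b" and b: "dk 1 b b'" and b': "dk 1 b' b''" and t: "0 < t" "t \<le> T"
  shows "norm (Aop (integral {t..T} (\<lambda>\<tau>. cs (osc \<kappa> \<tau>) (sg (- \<tau>) (ph s (sg \<tau> b) (lcnj (sg \<tau> b))))))) \<le> (3 + \<bar>\<kappa>\<bar>) * (phC s * (norm b * norm U)) / t"
proof -
  interpret ph: bounded_bilinear "ph s" by (rule bounded_bilinear_ph[OF s])
  interpret cs: bounded_bilinear cs by (rule bounded_bilinear_cs)
  let ?y = "\<lambda>\<tau>. sg (- \<tau>) (ph s (sg \<tau> b') (lcnj (sg \<tau> b)) + ph s (sg \<tau> b) (lcnj (sg \<tau> b')))"
  have c: "continuous_on {t..T} ?y" by (intro continuous_intros continuous_on_ph[OF s])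
  have pos: "{t..T} \<subseteq> {0<..}" using t by auto
  have "norm (integral {t..T} (\<lambda>\<tau>. cs (osc \<kappa> \<tau>) (?y \<tau>))) \<le> (3 + \<bar>\<kappa>\<bar>) * (phC s * (norm b * norm U)) / t"
  proof (rule osc_bound[OF t _ c])
    fix \<tau>
    have U2: "dk 2 U b'" "dk 2 b b''" using dk_add[OF U b] dk_add[OF b b'] by (simp_all add: numeral_2_eq_2)
    have DU: "((\<lambda>\<tau>. sg \<tau> U) has_vector_derivative cs \<i> (sg \<tau> b')) (at \<tau> within {t..T})"
      using sg_has_vector_derivative[OF U2(1), of 1] by simp
    have Db: "((\<lambda>\<tau>. sg \<tau> b) has_vector_derivative cs \<i> (sg \<tau> b'')) (at \<tau> within {t..T})"
      using sg_has_vector_derivative[OF U2(2), of 1] by simp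
    have W: "((\<lambda>\<tau>. ph s (sg \<tau> b) (lcnj (sg \<tau> U))) has_vector_derivative
       (ph s (sg \<tau> b) (lcnj (cs \<i> (sg \<tau> b'))) + ph s (cs \<i> (sg \<tau> b'')) (lcnj (sg \<tau> U)))) (at \<tau> within {t..T})"
      by (rule ph.has_vector_derivative[OF Db bounded_linear.has_vector_derivative[OF bounded_linear_lcnj DU]])
    note dU = dk_lcnj[OF dk_sg[OF U, of \<tau>]] and db = dk_sg[OF b, of \<tau>] and db' = dk_sg[OF b', of \<tau>] and dc = dk_lcnj[OF dk_sg[OF b, of \<tau>]]
    have "dk 1 (ph s (sg \<tau> b) (lcnj (sg \<tau> U))) (ph s (sg \<tau> b') (lcnj (sg \<tau> U)) + ph s (sg \<tau> b) (lcnj (sg \<tau> b)))" by (rule dk_ph[OF s db dU])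
    moreover have "dk 1 (ph s (sg \<tau> b') (lcnj (sg \<tau> U)) + ph s (sg \<tau> b) (lcnj (sg \<tau> b)))
       ((ph s (sg \<tau> b'') (lcnj (sg \<tau> U)) + ph s (sg \<tau> b') (lcnj (sg \<tau> b))) + (ph s (sg \<tau> b') (lcnj (sg \<tau> b)) + ph s (sg \<tau> b) (lcnj (sg \<tau> b'))))"
      by (intro mrel_add dk_ph[OF s] dU db db' dc)
    ultimately have "dk 2 (ph s (sg \<tau> b) (lcnj (sg \<tau> U)))
       ((ph s (sg \<tau> b'') (lcnj (sg \<tau> U)) + ph s (sg \<tau> b') (lcnj (sg \<tau> b))) + (ph s (sg \<tau> b') (lcnj (sg \<tau> b)) + ph s (sg \<tau> b) (lcnj (sg \<tau> b'))))"
      using dk_add[of 1 _ _ 1] by (fastforce simp: numeral_2_eq_2)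
    from sg_moving_has_vector_derivative[OF W this]
    have "((\<lambda>\<tau>. sg (- \<tau>) (ph s (sg \<tau> b) (lcnj (sg \<tau> U)))) has_vector_derivative cs (- 2 * \<i>) (?y \<tau>)) (at \<tau> within {t..T})"
    proof (rule has_vector_derivative_eq_rhs)
      have "cs (- 2 * \<i>) F = - cs \<i> F - cs \<i> F" for F
        using cs.add_left[of "- \<i>" "- \<i>" F] by (simp add: cs.minus_left)
      then show "sg (- \<tau>) (ph s (sg \<tau> b) (lcnj (cs \<i> (sg \<tau> b'))) + ph s (cs \<i> (sg \<tau> b'')) (lcnj (sg \<tau> U)) -
          cs \<i> ((ph s (sg \<tau> b'') (lcnj (sg \<tau> U)) + ph s (sg \<tau> b') (lcnj (sg \<tau> b))) + (ph s (sg \<tau> b') (lcnj (sg \<tau> b)) + ph s (sg \<tau> b) (lcnj (sg \<tau> b'))))) =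
          cs (- 2 * \<i>) (?y \<tau>)"
        by (simp add: lcnj_cs ph_cs_left[OF s] ph_cs_right[OF s] cs.add_right cs.minus_left cs.diff_right sg_diff sg_add sg_minus sg_cs ph.minus_right)
    qed
    from bounded_linear.has_vector_derivative[OF cs.bounded_linear_right[of "\<i> / 2"] this]
    show "((\<lambda>\<tau>. cs (\<i> / 2) (sg (- \<tau>) (ph s (sg \<tau> b) (lcnj (sg \<tau> U))))) has_vector_derivative ?y \<tau>) (at \<tau> within {t..T})"
      by (simp only: cs_half)
    have "norm (cs (\<i> / 2) (sg (- \<tau>) (ph s (sg \<tau> b) (lcnj (sg \<tau> U))))) \<le> norm (ph s (sg \<tau> b) (lcnj (sg \<tau> U)))"
      by (rule order_trans[OF norm_cs_le]) (simp add: norm_divide)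
    also have "\<dots> \<le> phC s * (norm b * norm U)" using phC(2)[OF s, of "sg \<tau> b" "lcnj (sg \<tau> U)"] by simp
    finally show "norm (cs (\<i> / 2) (sg (- \<tau>) (ph s (sg \<tau> b) (lcnj (sg \<tau> U))))) \<le> phC s * (norm b * norm U)" .
  qed
  moreover have "dk 1 (integral {t..T} (\<lambda>\<tau>. cs (osc \<kappa> \<tau>) (sg (- \<tau>) (ph s (sg \<tau> b) (lcnj (sg \<tau> b)))))) (integral {t..T} (\<lambda>\<tau>. cs (osc \<kappa> \<tau>) (?y \<tau>)))"
  proof (rule mrel_has_integral)
    show "((\<lambda>\<tau>. cs (osc \<kappa> \<tau>) (sg (- \<tau>) (ph s (sg \<tau> b) (lcnj (sg \<tau> b))))) has_integral integral {t..T} (\<lambda>\<tau>. cs (osc \<kappa> \<tau>) (sg (- \<tau>) (ph s (sg \<tau> b) (lcnj (sg \<tau> b)))))) {t..T}"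
      by (intro integrable_integral integrable_continuous_real continuous_intros continuous_on_ph[OF s] pos)
    show "((\<lambda>\<tau>. cs (osc \<kappa> \<tau>) (?y \<tau>)) has_integral integral {t..T} (\<lambda>\<tau>. cs (osc \<kappa> \<tau>) (?y \<tau>))) {t..T}"
      by (intro integrable_integral integrable_continuous_real continuous_intros continuous_on_ph[OF s] pos)
    show "dk 1 (cs (osc \<kappa> \<tau>) (sg (- \<tau>) (ph s (sg \<tau> b) (lcnj (sg \<tau> b))))) (cs (osc \<kappa> \<tau>) (?y \<tau>))" for \<tau>
      unfolding cs_eq_mult by (intro mrel_mult bm_const dk_sg dk_ph[OF s] dk_lcnj b)
  qed measurable
  ultimately show ?thesis using Aop_dk by (meson order_trans)
qed

text \<open>Truncation in frequency makes every vector differentiable. It supplies the extra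
  derivatives asked for by the smooth source bounds, in whose right-hand sides those derivatives do
  not appear.\<close>

lemma dk_cut: "dk 1 (mult (cut R) b) (mult (\<lambda>\<xi>. \<i> * complex_of_real \<xi> * cut R \<xi>) b)"
proof -
  have p: "bm (\<lambda>\<xi>. \<i> * complex_of_real \<xi> * cut R \<xi>)"
    by (rule bmI[of _ "\<bar>R\<bar>"]) (measurable, auto simp: norm_mult cut_def indicator_def)
  show ?thesis unfolding mrel_def FT_mult
    using rep_mulf[OF p, of "FT b"] rep_mulf[OF bm_cut, of R "FT b"] by eventually_elim simp
qed

lemma mult_cut_LIMSEQ: "(\<lambda>n. mult (cut (real n)) b) \<longlonglongrightarrow> b"
  using bounded_linear.tendsto[OF bounded_linear_iFT mulf_cut_tendsto_nat[of "FT b"]] by (simp add: mult_def)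

text \<open>The map \<open>J\<close> stands for the identity or for \<open>lcnj\<close>, so both
  quadratic sources are covered. Convergence at fixed \<open>t\<close> and \<open>T\<close>
  suffices, because the bounds passed to the limit are already uniform in \<open>T\<close>.\<close>

lemma source_continuity:
  assumes s: "1 \<le> s" and t: "0 < t" "t \<le> T" and J: "bounded_linear J" "\<And>x. norm (J x) = norm (x :: l2)"
    and b: "b \<longlonglongrightarrow> B"
  shows "(\<lambda>n. integral {t..T} (\<lambda>\<tau>. cs (osc \<kappa> \<tau>) (sg (- \<tau>) (ph s (sg \<tau> (b n)) (J (sg \<tau> (b n))))))) \<longlonglongrightarrow>
    integral {t..T} (\<lambda>\<tau>. cs (osc \<kappa> \<tau>) (sg (- \<tau>) (ph s (sg \<tau> B) (J (sg \<tau> B)))))"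
proof (rule Lim_null[THEN iffD2], rule Lim_null_comparison)
  interpret ph: bounded_bilinear "ph s" by (rule bounded_bilinear_ph[OF s])
  interpret cs: bounded_bilinear cs by (rule bounded_bilinear_cs)
  have Jd: "J (x - y) = J x - J y" for x y by (rule linear_diff[OF bounded_linear.linear[OF J(1)]])
  let ?f = "\<lambda>b \<tau>. cs (osc \<kappa> \<tau>) (sg (- \<tau>) (ph s (sg \<tau> b) (J (sg \<tau> b))))"
  have I: "?f b integrable_on {t..T}" for b
    by (intro integrable_continuous_real continuous_intros continuous_on_ph[OF s] bounded_linear.continuous_on[OF J(1)]) (use t in auto)
  have pt: "norm (?f x \<tau> - ?f y \<tau>) \<le> (1 / t) * (phC s * (norm (x - y) * norm x) + phC s * (norm y * norm (x - y)))" if \<tau>: "\<tau> \<in> {t..T}" for x y \<tau>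
  proof -
    have "?f x \<tau> - ?f y \<tau> = cs (osc \<kappa> \<tau>) (sg (- \<tau>) (ph s (sg \<tau> (x - y)) (J (sg \<tau> x)) + ph s (sg \<tau> y) (J (sg \<tau> (x - y)))))"
      by (simp add: sg_diff Jd ph.diff_left ph.diff_right cs.diff_right cs.add_right sg_add)
    also have "norm \<dots> \<le> (1 / \<tau>) * norm (ph s (sg \<tau> (x - y)) (J (sg \<tau> x)) + ph s (sg \<tau> y) (J (sg \<tau> (x - y))))"
      using order_trans[OF norm_cs_le mult_right_mono[OF osc_le[of \<tau> \<kappa>] norm_ge_zero]] \<tau> t by (metis (no_types, lifting) atLeastAtMost_iff less_le_trans norm_sg)
    also have "\<dots> \<le> (1 / t) * (phC s * (norm (x - y) * norm x) + phC s * (norm y * norm (x - y)))"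
      using phC(2)[OF s, of "sg \<tau> (x - y)" "J (sg \<tau> x)"] phC(2)[OF s, of "sg \<tau> y" "J (sg \<tau> (x - y))"] \<tau> t
      by (intro mult_mono frac_le norm_triangle_le add_mono) (auto simp: J)
    finally show ?thesis .
  qed
  show "\<forall>\<^sub>F n in sequentially. norm (integral {t..T} (?f (b n)) - integral {t..T} (?f B)) \<le>
      (1 / t) * (phC s * (norm (b n - B) * norm (b n)) + phC s * (norm B * norm (b n - B))) * (T - t)"
  proof (rule always_eventually, rule allI)
    fix n
    have "norm (integral {t..T} (\<lambda>\<tau>. ?f (b n) \<tau> - ?f B \<tau>)) \<le>
      (1 / t) * (phC s * (norm (b n - B) * norm (b n)) + phC s * (norm B * norm (b n - B))) * (T - t)"
      by (rule integral_bound[OF t(2)])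
        (use pt t in \<open>auto intro!: continuous_intros continuous_on_ph[OF s] bounded_linear.continuous_on[OF J(1)]\<close>)
    then show "norm (integral {t..T} (?f (b n)) - integral {t..T} (?f B)) \<le>
      (1 / t) * (phC s * (norm (b n - B) * norm (b n)) + phC s * (norm B * norm (b n - B))) * (T - t)"
      by (simp only: integral_diff[OF I I])
  qed
  have z: "(\<lambda>n. norm (b n - B)) \<longlonglongrightarrow> 0" using b by (simp add: LIM_zero tendsto_norm_zero)
  have "(\<lambda>n. (1 / t) * (phC s * (norm (b n - B) * norm (b n)) + phC s * (norm B * norm (b n - B))) * (T - t)) \<longlonglongrightarrow>
     (1 / t) * (phC s * (0 * norm B) + phC s * (norm B * 0)) * (T - t)"
    by (intro tendsto_intros z b)
  then show "(\<lambda>n. (1 / t) * (phC s * (norm (b n - B) * norm (b n)) + phC s * (norm B * norm (b n - B))) * (T - t)) \<longlonglongrightarrow> 0" by simp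
qed

lemma norm_mult_cut: "norm (mult (cut R) b) \<le> norm b"
  using norm_mult_le[of "cut R" 1 b] cut_le by (simp add: bm_measurable)

text \<open>Truncation commutes with the derivative and does not increase norms, so the smooth bound
  holds with the same right-hand side for every \<open>n\<close> and survives the limit.\<close>

lemma source_square_bound:
  assumes s: "1 \<le> s" and U: "dk 1 U b" and t: "0 < t" "t \<le> T"
  shows "norm (integral {t..T} (\<lambda>\<tau>. cs (osc \<kappa> \<tau>) (sg (- \<tau>) (ph s (sg \<tau> b) (sg \<tau> b))))) \<le> (3 + \<bar>\<kappa>\<bar>) * (phC s * (norm U * norm U)) / t"
proof (rule Lim_bounded[OF tendsto_norm])
  show "(\<lambda>n. integral {t..T} (\<lambda>\<tau>. cs (osc \<kappa> \<tau>) (sg (- \<tau>) (ph s (sg \<tau> (mult (cut (real n)) b)) (sg \<tau> (mult (cut (real n)) b)))))) \<longlonglongrightarrow>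
     integral {t..T} (\<lambda>\<tau>. cs (osc \<kappa> \<tau>) (sg (- \<tau>) (ph s (sg \<tau> b) (sg \<tau> b))))"
    by (rule source_continuity[OF s t, of "\<lambda>x. x"]) (auto intro: mult_cut_LIMSEQ)
  show "\<forall>n\<ge>0. norm (integral {t..T} (\<lambda>\<tau>. cs (osc \<kappa> \<tau>) (sg (- \<tau>) (ph s (sg \<tau> (mult (cut (real n)) b)) (sg \<tau> (mult (cut (real n)) b)))))) \<le> (3 + \<bar>\<kappa>\<bar>) * (phC s * (norm U * norm U)) / t"
  proof (intro allI impI)
    fix n :: nat
    let ?b = "mult (cut (real n)) b" and ?U = "mult (cut (real n)) U"
    have "dk 1 ?U ?b" by (rule mrel_mult[OF bm_cut U])
    from source_square_bound_smooth[OF s this dk_cut t, of \<kappa>]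
    have "norm (integral {t..T} (\<lambda>\<tau>. cs (osc \<kappa> \<tau>) (sg (- \<tau>) (ph s (sg \<tau> ?b) (sg \<tau> ?b))))) \<le> (3 + \<bar>\<kappa>\<bar>) * (phC s * (norm ?U * norm ?U)) / t" .
    also have "\<dots> \<le> (3 + \<bar>\<kappa>\<bar>) * (phC s * (norm U * norm U)) / t"
      using t phC(1)[OF s] by (intro divide_right_mono mult_left_mono mult_mono norm_mult_cut) auto
    finally show "norm (integral {t..T} (\<lambda>\<tau>. cs (osc \<kappa> \<tau>) (sg (- \<tau>) (ph s (sg \<tau> ?b) (sg \<tau> ?b))))) \<le> (3 + \<bar>\<kappa>\<bar>) * (phC s * (norm U * norm U)) / t" .
  qed
qed

lemma source_modulus_bound:
  assumes s: "1 \<le> s" and U: "dk 1 U b" and t: "0 < t" "t \<le> T"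
  shows "norm (Aop (integral {t..T} (\<lambda>\<tau>. cs (osc \<kappa> \<tau>) (sg (- \<tau>) (ph s (sg \<tau> b) (lcnj (sg \<tau> b))))))) \<le> (3 + \<bar>\<kappa>\<bar>) * (phC s * (norm b * norm U)) / t"
proof (rule Lim_bounded[OF tendsto_norm[OF bounded_linear.tendsto[OF bounded_linear_Aop]]])
  show "(\<lambda>n. integral {t..T} (\<lambda>\<tau>. cs (osc \<kappa> \<tau>) (sg (- \<tau>) (ph s (sg \<tau> (mult (cut (real n)) b)) (lcnj (sg \<tau> (mult (cut (real n)) b))))))) \<longlonglongrightarrow>
     integral {t..T} (\<lambda>\<tau>. cs (osc \<kappa> \<tau>) (sg (- \<tau>) (ph s (sg \<tau> b) (lcnj (sg \<tau> b)))))"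
    by (rule source_continuity[OF s t, of lcnj]) (auto intro: mult_cut_LIMSEQ bounded_linear_lcnj)
  show "\<forall>n\<ge>0. norm (Aop (integral {t..T} (\<lambda>\<tau>. cs (osc \<kappa> \<tau>) (sg (- \<tau>) (ph s (sg \<tau> (mult (cut (real n)) b)) (lcnj (sg \<tau> (mult (cut (real n)) b)))))))) \<le> (3 + \<bar>\<kappa>\<bar>) * (phC s * (norm b * norm U)) / t"
  proof (intro allI impI)
    fix n :: nat
    let ?b = "mult (cut (real n)) b" and ?U = "mult (cut (real n)) U"
    let ?b' = "mult (\<lambda>\<xi>. \<i> * complex_of_real \<xi> * cut (real n) \<xi>) b"
    have U': "dk 1 ?U ?b" by (rule mrel_mult[OF bm_cut U])
    have p: "bm (\<lambda>\<xi>. \<i> * complex_of_real \<xi> * cut (real n) \<xi>)"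
      by (rule bmI[of _ "real n"]) (measurable, auto simp: norm_mult cut_def indicator_def)
    \<comment> \<open>The derivative of a truncated vector is itself truncated, so
      \<open>dk_cut\<close> applies a second time.\<close>
    have "mult (cut (real n)) ?b' = ?b'"
      by (subst mult_mult[OF bm_cut p], rule arg_cong[where f = "\<lambda>m. mult m b"]) (auto simp: cut_def indicator_def)
    then have b'': "dk 1 ?b' (mult (\<lambda>\<xi>. \<i> * complex_of_real \<xi> * cut (real n) \<xi>) ?b')" using dk_cut[of "real n" ?b'] by simp
    from source_modulus_bound_smooth[OF s U' dk_cut b'' t, of \<kappa>]
    have "norm (Aop (integral {t..T} (\<lambda>\<tau>. cs (osc \<kappa> \<tau>) (sg (- \<tau>) (ph s (sg \<tau> ?b) (lcnj (sg \<tau> ?b))))))) \<le> (3 + \<bar>\<kappa>\<bar>) * (phC s * (norm ?b * norm ?U)) / t" .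
    also have "\<dots> \<le> (3 + \<bar>\<kappa>\<bar>) * (phC s * (norm b * norm U)) / t"
      using t phC(1)[OF s] by (intro divide_right_mono mult_left_mono mult_mono norm_mult_cut) auto
    finally show "norm (Aop (integral {t..T} (\<lambda>\<tau>. cs (osc \<kappa> \<tau>) (sg (- \<tau>) (ph s (sg \<tau> ?b) (lcnj (sg \<tau> ?b))))))) \<le> (3 + \<bar>\<kappa>\<bar>) * (phC s * (norm b * norm U)) / t" .
  qed
qed

section \<open>Integrals up to infinite time\<close>

text \<open>A limit of proper integrals, because the integrand has parts of norm of size
  \<open>1 / \<tau>\<close> that converge only through cancellation; absolute integrability over the
  half-line may fail.\<close>

definition tail_integral :: "(real \<Rightarrow> l2) \<Rightarrow> real \<Rightarrow> l2" where
  "tail_integral h t = Lim at_top (\<lambda>T. integral {t..T} h)"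

definition tail_converges :: "real \<Rightarrow> (real \<Rightarrow> l2) \<Rightarrow> bool" where
  "tail_converges t0 h \<longleftrightarrow> continuous_on {t0..} h \<and> (\<forall>t\<ge>t0. \<exists>L. ((\<lambda>T. integral {t..T} h) \<longlongrightarrow> L) at_top)"

lemma tail_integral_tendsto: "tail_converges t0 h \<Longrightarrow> t0 \<le> t \<Longrightarrow> ((\<lambda>T. integral {t..T} h) \<longlongrightarrow> tail_integral h t) at_top"
  unfolding tail_converges_def tail_integral_def using tendsto_Lim[OF trivial_limit_at_top_linorder] by metis

lemma tail_integral_unique: "((\<lambda>T. integral {t..T} h) \<longlongrightarrow> L) at_top \<Longrightarrow> tail_integral h t = L"
  unfolding tail_integral_def by (rule tendsto_Lim[OF trivial_limit_at_top_linorder])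

lemma tail_integrable: "continuous_on {t0..} h \<Longrightarrow> t0 \<le> t \<Longrightarrow> h integrable_on {t..(T::real)}"
  for h :: "real \<Rightarrow> l2"
  by (rule integrable_continuous_real, rule continuous_on_subset[of "{t0..}" h]) auto

lemma tail_split:
  fixes h :: "real \<Rightarrow> l2"
  assumes "continuous_on {t0..} h" "t0 \<le> t" "t \<le> u" "u \<le> T"
  shows "integral {t..T} h = integral {t..u} h + integral {u..T} h"
  using Henstock_Kurzweil_Integration.integral_combine[OF assms(3,4) tail_integrable[OF assms(1,2)]] by simp

text \<open>A bound on all later pieces that tends to 0 is Cauchy's criterion. It is used along the
  times \<open>t + real n\<close> and then transferred to all \<open>T\<close>.\<close>

lemma tail_convergesI:
  assumes c: "continuous_on {t0..} h"
    and le: "\<And>t T. t0 \<le> t \<Longrightarrow> t \<le> T \<Longrightarrow> norm (integral {t..T} h) \<le> g t" and g: "(g \<longlongrightarrow> (0::real)) at_top"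
  shows "tail_converges t0 h"
  unfolding tail_converges_def
proof (intro conjI c allI impI)
  fix t assume t: "t0 \<le> t"
  define X where "X = (\<lambda>n. integral {t..t + real n} h)"
  have diff: "norm (integral {t..T} h - integral {t..u} h) \<le> g u" if "t \<le> u" "u \<le> T" for u T
    using le[of u T] that t by (simp add: tail_split[OF c t that])
  have "Cauchy X"
  proof (rule CauchyI)
    fix e :: real assume "0 < e"
    then have "\<forall>\<^sub>F u in at_top. g u < e / 2" using g by (intro order_tendstoD) auto
    then obtain N where N: "\<And>u. u \<ge> N \<Longrightarrow> g u < e / 2" by (auto simp: eventually_at_top_linorder)
    obtain M :: nat where M: "N - t \<le> real M" using real_arch_simple by blast
    have d: "norm (X m - X M) < e / 2" if "m \<ge> M" for m
      using diff[of "t + real M" "t + real m"] N[of "t + real M"] that M unfolding X_def by simp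
    show "\<exists>M. \<forall>m\<ge>M. \<forall>n\<ge>M. norm (X m - X n) < e"
    proof (intro exI allI impI)
      fix m n assume "m \<ge> M" "n \<ge> M"
      have "norm (X m - X n) \<le> norm (X m - X M) + norm (X n - X M)"
        using norm_triangle_ineq4[of "X m - X M" "X n - X M"] by simp
      with d[OF \<open>m \<ge> M\<close>] d[OF \<open>n \<ge> M\<close>] show "norm (X m - X n) < e" by simp
    qed
  qed
  then obtain L where L: "X \<longlonglongrightarrow> L" by (auto simp: Cauchy_convergent_iff convergent_def)
  have "norm (integral {t..T} h - L) \<le> g T" if T: "t \<le> T" for T
  proof -
    obtain M :: nat where M: "T - t \<le> real M" using real_arch_simple by blast
    have "\<forall>n\<ge>M. norm (integral {t..T} h - X n) \<le> g T"
    proof (intro allI impI)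
      fix n assume "M \<le> n"
      with M have "T \<le> t + real n" by simp
      from diff[OF T this] show "norm (integral {t..T} h - X n) \<le> g T" unfolding X_def by (simp only: norm_minus_commute)
    qed
    then show ?thesis by (rule Lim_bounded[OF tendsto_norm[OF tendsto_diff[OF tendsto_const L]]])
  qed
  then have "((\<lambda>T. integral {t..T} h) \<longlongrightarrow> L) at_top"
    by (rule Lim_null[THEN iffD2, OF Lim_null_comparison[OF eventually_mono[OF eventually_ge_at_top[of t]] g]])
  then show "\<exists>L. ((\<lambda>T. integral {t..T} h) \<longlongrightarrow> L) at_top" ..
qed

lemma tail_integral_norm_le:
  assumes "tail_converges t0 h" "t0 \<le> t" "\<And>T. t \<le> T \<Longrightarrow> norm (integral {t..T} h) \<le> c"
  shows "norm (tail_integral h t) \<le> c"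
  by (rule tendsto_upperbound[OF tendsto_norm[OF tail_integral_tendsto[OF assms(1,2)]]])
    (use assms(3) in \<open>auto intro: eventually_mono[OF eventually_ge_at_top[of t]]\<close>)

lemma tail_integral_split:
  assumes h: "tail_converges t0 h" "t0 \<le> t" "t \<le> u"
  shows "tail_integral h t = integral {t..u} h + tail_integral h u"
proof (rule tail_integral_unique)
  have c: "continuous_on {t0..} h" using h by (simp add: tail_converges_def)
  have "((\<lambda>T. integral {t..u} h + integral {u..T} h) \<longlongrightarrow> integral {t..u} h + tail_integral h u) at_top"
    by (intro tendsto_intros tail_integral_tendsto[OF h(1)]) (use h in auto)
  then show "((\<lambda>T. integral {t..T} h) \<longlongrightarrow> integral {t..u} h + tail_integral h u) at_top"
    by (rule Lim_transform_eventually)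
      (rule eventually_mono[OF eventually_ge_at_top[of u]], rule tail_split[OF c h(2,3), symmetric])
qed

lemma tail_converges_diff:
  assumes "tail_converges t0 h" "tail_converges t0 k"
  shows "tail_converges t0 (\<lambda>\<tau>. h \<tau> - k \<tau>)" "t0 \<le> t \<Longrightarrow> tail_integral (\<lambda>\<tau>. h \<tau> - k \<tau>) t = tail_integral h t - tail_integral k t"
proof -
  have c: "continuous_on {t0..} h" "continuous_on {t0..} k" using assms by (auto simp: tail_converges_def)
  have lim: "((\<lambda>T. integral {t..T} (\<lambda>\<tau>. h \<tau> - k \<tau>)) \<longlongrightarrow> tail_integral h t - tail_integral k t) at_top" if t: "t0 \<le> t" for t
    using tendsto_diff[OF tail_integral_tendsto[OF assms(1) t] tail_integral_tendsto[OF assms(2) t]]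
    by (simp add: integral_diff[OF tail_integrable[OF c(1) t] tail_integrable[OF c(2) t]])
  then show "tail_converges t0 (\<lambda>\<tau>. h \<tau> - k \<tau>)" unfolding tail_converges_def using c by (auto intro: continuous_intros)
  show "t0 \<le> t \<Longrightarrow> tail_integral (\<lambda>\<tau>. h \<tau> - k \<tau>) t = tail_integral h t - tail_integral k t" using tail_integral_unique[OF lim] .
qed

lemma tail_integral_continuous:
  assumes h: "tail_converges t0 h" shows "continuous_on {t0..} (tail_integral h)"
proof -
  have c: "continuous_on {t0..} h" using h by (simp add: tail_converges_def)
  have e: "tail_integral h t = tail_integral h t0 - integral {t0..t} h" if "t0 \<le> t" for t
    using tail_integral_split[OF h order_refl that] by simp
  have "continuous_on {t0..T} (tail_integral h)" for T
  proof -
    have "continuous_on {t0..T} (\<lambda>t. tail_integral h t0 - integral {t0..t} h)"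
      by (intro continuous_intros indefinite_integral_continuous_1 tail_integrable[OF c]) simp
    then show ?thesis by (rule continuous_on_eq) (rule e[symmetric], simp)
  qed
  show ?thesis
    unfolding continuous_on_eq_continuous_within
  proof
    fix x assume x: "x \<in> {t0..}"
    have "continuous (at x within {t0..x + 1}) (tail_integral h)"
      using \<open>continuous_on {t0..x + 1} (tail_integral h)\<close> x by (simp add: continuous_on_eq_continuous_within)
    moreover have "at x within {t0..x + 1} = at x within {t0..}"
      by (rule at_within_nhd[of _ "{..<x + 1}"]) auto
    ultimately show "continuous (at x within {t0..}) (tail_integral h)" by (simp add: continuous_within)
  qed
qed

text \<open>The primitive is \<open>- (2 * exp (\<mu> / sqrt \<tau>) / sqrt \<tau>)\<close>, and
  \<open>1 + \<mu> / sqrt \<tau>\<close> is the factor its derivative produces. A Lipschitz constant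
  \<open>k * (1 + \<mu> / sqrt \<tau>)\<close> is thus integrated exactly against this weight;
  \<open>\<mu> = 0\<close> is the plain power.\<close>

lemma weighted_integral:
  assumes t: "0 < t" "t \<le> T"
  shows "((\<lambda>\<tau>. (1 + \<mu> / sqrt \<tau>) * exp (\<mu> / sqrt \<tau>) / (\<tau> * sqrt \<tau>)) has_integral
    (2 * exp (\<mu> / sqrt t) / sqrt t - 2 * exp (\<mu> / sqrt T) / sqrt T)) {t..T}"
proof -
  have "((\<lambda>\<tau>. (1 + \<mu> / sqrt \<tau>) * exp (\<mu> / sqrt \<tau>) / (\<tau> * sqrt \<tau>)) has_integral
    ((- (2 * exp (\<mu> / sqrt T) / sqrt T)) - (- (2 * exp (\<mu> / sqrt t) / sqrt t)))) {t..T}"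
  proof (rule fundamental_theorem_of_calculus[OF t(2)])
    fix x assume x: "x \<in> {t..T}"
    with t have x0: "0 < x" "0 < sqrt x" by auto
    have q: "((\<lambda>\<tau>. 1 / sqrt \<tau>) has_field_derivative - (1 / (2 * (x * sqrt x)))) (at x within {t..T})"
    proof -
      have e: "inverse (sqrt x) * (inverse (sqrt x) / 2) * inverse (sqrt x) = 1 / (2 * (x * sqrt x))"
        using x0 by (simp add: field_simps)
      have "((\<lambda>\<tau>. inverse (sqrt \<tau>)) has_field_derivative - (inverse (sqrt x) * (inverse (sqrt x) / 2) * inverse (sqrt x))) (at x within {t..T})"
        by (rule DERIV_inverse'[OF has_field_derivative_at_within[OF DERIV_real_sqrt[OF x0(1)]]]) (use x0 in simp)
      from this[unfolded e] show ?thesis by (simp only: inverse_eq_divide)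
    qed
    define d where "d = - (1 / (2 * (x * sqrt x)))"
    have "((\<lambda>\<tau>. - (2 * (exp (\<mu> * (1 / sqrt \<tau>)) * (1 / sqrt \<tau>)))) has_field_derivative
        - (2 * ((exp (\<mu> * (1 / sqrt x)) * (\<mu> * d)) * (1 / sqrt x) + d * exp (\<mu> * (1 / sqrt x))))) (at x within {t..T})"
      using q unfolding d_def[symmetric]
      by (intro DERIV_minus DERIV_cmult DERIV_mult DERIV_chain2[OF DERIV_exp])
    moreover have "- (2 * ((exp (\<mu> * (1 / sqrt x)) * (\<mu> * d)) * (1 / sqrt x) + d * exp (\<mu> * (1 / sqrt x)))) = (1 + \<mu> / sqrt x) * exp (\<mu> / sqrt x) / (x * sqrt x)"
      unfolding d_def using x0 by (simp add: distrib_right distrib_left add_divide_distrib mult.assoc[symmetric]) (simp add: mult_ac)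
    ultimately show "((\<lambda>\<tau>. - (2 * exp (\<mu> / sqrt \<tau>) / sqrt \<tau>)) has_vector_derivative (1 + \<mu> / sqrt x) * exp (\<mu> / sqrt x) / (x * sqrt x)) (at x within {t..T})"
      by (simp add: has_real_derivative_iff_has_vector_derivative)
  qed
  then show ?thesis by simp
qed

lemma integral_le_weighted:
  fixes h :: "real \<Rightarrow> l2"
  assumes c: "continuous_on {t0..} h" and t: "0 < t0" "t0 \<le> t" "t \<le> T" and k: "0 \<le> k"
    and le: "\<And>\<tau>. t \<le> \<tau> \<Longrightarrow> norm (h \<tau>) \<le> k * ((1 + \<mu> / sqrt \<tau>) * exp (\<mu> / sqrt \<tau>) / (\<tau> * sqrt \<tau>))"
  shows "norm (integral {t..T} h) \<le> 2 * k * exp (\<mu> / sqrt t) / sqrt t"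
proof -
  have t': "0 < t" using t by simp
  note I = has_integral_mult_right[OF weighted_integral[OF t' t(3), of \<mu>], of k]
  have "norm (integral {t..T} h) \<le> integral {t..T} (\<lambda>\<tau>. k * ((1 + \<mu> / sqrt \<tau>) * exp (\<mu> / sqrt \<tau>) / (\<tau> * sqrt \<tau>)))"
    by (rule integral_norm_bound_integral[OF tail_integrable[OF c t(2)] has_integral_integrable[OF I] le]) simp
  also have "\<dots> = k * (2 * exp (\<mu> / sqrt t) / sqrt t - 2 * exp (\<mu> / sqrt T) / sqrt T)" by (rule integral_unique[OF I])
  also have "\<dots> \<le> k * (2 * exp (\<mu> / sqrt t) / sqrt t)" using k t by (intro mult_left_mono) auto
  also have "\<dots> = 2 * k * exp (\<mu> / sqrt t) / sqrt t" by simp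
  finally show ?thesis .
qed

lemma integral_le_inverse_square:
  fixes h :: "real \<Rightarrow> l2"
  assumes c: "continuous_on {t0..} h" and t: "0 < t0" "t0 \<le> t" "t \<le> T" and k: "0 \<le> k"
    and le: "\<And>\<tau>. t \<le> \<tau> \<Longrightarrow> norm (h \<tau>) \<le> k * (1 / \<tau>\<^sup>2)"
  shows "norm (integral {t..T} h) \<le> k / t"
proof -
  have t': "0 < t" using t by simp
  note I = has_integral_mult_right[OF integral_inverse_square[OF t' t(3)], of k]
  have "norm (integral {t..T} h) \<le> integral {t..T} (\<lambda>\<tau>. k * (1 / \<tau>\<^sup>2))"
    by (rule integral_norm_bound_integral[OF tail_integrable[OF c t(2)] has_integral_integrable[OF I] le]) simp
  also have "\<dots> = k * (1 / t - 1 / T)" by (rule integral_unique[OF I])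
  also have "\<dots> \<le> k * (1 / t)" using k t by (intro mult_left_mono) auto
  finally show ?thesis by simp
qed

section \<open>The nonlinearity\<close>

text \<open>The expansion of \<open>(|a + q|\<^sup>2 - a\<^sup>2) (a + q)\<close>, encoded.\<close>

definition Nh :: "nat \<Rightarrow> real \<Rightarrow> l2 \<Rightarrow> l2" where
  "Nh s a q = a\<^sup>2 *\<^sub>R (q + lcnj q) + (a *\<^sub>R ph s q q + (2 * a) *\<^sub>R ph s q (lcnj q) + ph s q (ph s q (lcnj q)))"

lemma lcnj_diff: "lcnj (F - G) = lcnj F - lcnj G" by (rule linear_diff[OF bounded_linear.linear[OF bounded_linear_lcnj]])
text \<open>The linear part is split off because it has no decay. The hypotheses concern
  multiplication operators rather than norms, as the free part of \<open>q\<close> is small only as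
  a multiplier. The coefficients \<open>a\<close> and \<open>2 * a\<close> with two terms each give
  \<open>6 * a * m\<close>; the cubic term gives three times \<open>m\<^sup>2\<close>.\<close>

lemma Nh_lipschitz:
  assumes s: "1 \<le> s" and a: "0 \<le> a" and m: "0 \<le> m"
    and q: "\<And>f. norm (ph s q f) \<le> m * norm f" and q': "\<And>f. norm (ph s q' f) \<le> m * norm f"
  shows "norm (Nh s a q - Nh s a q' - a\<^sup>2 *\<^sub>R ((q - q') + lcnj (q - q'))) \<le> (6 * a * m + 3 * m\<^sup>2) * norm (q - q')"
proof -
  interpret ph: bounded_bilinear "ph s" by (rule bounded_bilinear_ph[OF s])
  define d where "d = q - q'"
  have qc: "norm (ph s (lcnj q') f) \<le> m * norm f" for f
    using q'[of "lcnj f"] ph_lcnj[OF s, of q' "lcnj f"] by (metis norm_lcnj lcnj_lcnj)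
  have A: "ph s q q - ph s q' q' = ph s q d + ph s q' d"
    by (simp add: d_def ph.diff_left ph.diff_right ph_commute[of s q' q])
  have B: "ph s q (lcnj q) - ph s q' (lcnj q') = ph s q (lcnj d) + ph s (lcnj q') d"
    by (simp add: d_def lcnj_diff ph.diff_left ph.diff_right ph_commute[of s "lcnj q'"])
  have C: "ph s q (ph s q (lcnj q)) - ph s q' (ph s q' (lcnj q')) = ph s q (ph s q (lcnj d)) + ph s q (ph s (lcnj q') d) + ph s q' (ph s (lcnj q') d)"
  proof -
    have "ph s q (ph s q (lcnj q)) - ph s q' (ph s q' (lcnj q')) = ph s q (ph s q (lcnj q) - ph s q' (lcnj q')) + ph s d (ph s q' (lcnj q'))"
      by (simp add: d_def ph.diff_left ph.diff_right)
    \<comment> \<open>Commutativity and associativity bring \<open>d\<close> to the innermost place,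
      so that each other factor acts as a multiplier.\<close>
    also have "ph s d (ph s q' (lcnj q')) = ph s q' (ph s (lcnj q') d)"
      by (simp only: ph_commute[of s d] ph_assoc[OF s])
    finally show ?thesis unfolding B by (simp add: ph.add_right)
  qed
  have m2: "m * (m * x) = m\<^sup>2 * x" for x by (simp add: power2_eq_square)
  have mm: "norm (ph s x (ph s y z)) \<le> m\<^sup>2 * norm z"
    if "\<And>f. norm (ph s x f) \<le> m * norm f" "\<And>f. norm (ph s y f) \<le> m * norm f" for x y z
    using order_trans[OF that(1) mult_left_mono[OF that(2) m]] by (simp only: m2)
  have "Nh s a q - Nh s a q' - a\<^sup>2 *\<^sub>R ((q - q') + lcnj (q - q')) =
     a *\<^sub>R (ph s q q - ph s q' q') + (2 * a) *\<^sub>R (ph s q (lcnj q) - ph s q' (lcnj q')) + (ph s q (ph s q (lcnj q)) - ph s q' (ph s q' (lcnj q')))"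
    unfolding Nh_def by (simp add: lcnj_diff scaleR_diff_right scaleR_add_right)
  also have "norm \<dots> \<le> a * (m * norm d + m * norm d) + (2 * a) * (m * norm d + m * norm d) + (m\<^sup>2 * norm d + m\<^sup>2 * norm d + m\<^sup>2 * norm d)"
    unfolding A B C
  proof (intro norm_triangle_le add_mono)
    show "norm (a *\<^sub>R (ph s q d + ph s q' d)) \<le> a * (m * norm d + m * norm d)"
      unfolding norm_scaleR using a q[of d] q'[of d] by (auto intro!: mult_left_mono norm_triangle_le add_mono)
    show "norm ((2 * a) *\<^sub>R (ph s q (lcnj d) + ph s (lcnj q') d)) \<le> (2 * a) * (m * norm d + m * norm d)"
    proof -
      have "norm (ph s q (lcnj d) + ph s (lcnj q') d) \<le> m * norm d + m * norm d"
        using q[of "lcnj d"] qc[of d] by (intro norm_triangle_le add_mono) auto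
      then have "\<bar>2 * a\<bar> * norm (ph s q (lcnj d) + ph s (lcnj q') d) \<le> \<bar>2 * a\<bar> * (m * norm d + m * norm d)"
        by (rule mult_left_mono) simp
      with a show ?thesis by simp
    qed
    show "norm (ph s q (ph s q (lcnj d))) \<le> m\<^sup>2 * norm d" using mm[OF q q, of "lcnj d"] by simp
    show "norm (ph s q (ph s (lcnj q') d)) \<le> m\<^sup>2 * norm d" using mm[OF q qc, of d] .
    show "norm (ph s q' (ph s (lcnj q') d)) \<le> m\<^sup>2 * norm d" using mm[OF q' qc, of d] .
  qed
  also have "\<dots> = (6 * a * m + 3 * m\<^sup>2) * norm d" by (simp add: algebra_simps)
  finally show ?thesis unfolding d_def .
qed

lemma Nh_continuous [continuous_intros]:
  "1 \<le> s \<Longrightarrow> continuous_on S q \<Longrightarrow> continuous_on S (\<lambda>\<tau>. Nh s a (q \<tau>))"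
  unfolding Nh_def by (intro continuous_intros continuous_on_ph)

section \<open>The integral equation for the remainder\<close>

lemma tendsto_divide_sqrt_at_top: "((\<lambda>t::real. c / sqrt t) \<longlongrightarrow> 0) at_top"
  by (rule tendsto_divide_0[OF tendsto_const filterlim_at_top_imp_at_infinity[OF sqrt_at_top]])

lemma Aop_cs: "Aop (cs c F) = cs c (Aop F)" unfolding Aop_def by (rule mult_cs) simp
lemma Aop_sg: "Aop (sg t F) = sg t (Aop F)" unfolding Aop_def by (simp add: sg_mult)
lemma Aop_lcnj: "Aop (lcnj F) = lcnj (Aop F)"
proof -
  have "(\<lambda>x. cnj (Aw (- x))) = Aw" by (auto simp: Aw_def)
  then show ?thesis unfolding Aop_def by (simp add: lcnj_mult)
qed
lemma Aop_add: "Aop (F + G) = Aop F + Aop G" by (rule linear_add[OF bounded_linear.linear[OF bounded_linear_Aop]])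
lemma Aop_diff: "Aop (F - G) = Aop F - Aop G" by (rule linear_diff[OF bounded_linear.linear[OF bounded_linear_Aop]])
lemma Aop_scaleR: "Aop (r *\<^sub>R F) = r *\<^sub>R Aop F" by (rule linear_cmul[OF bounded_linear.linear[OF bounded_linear_Aop]])

text \<open>\<open>b\<close> encodes \<open>u\<^sub>+\<close>; \<open>U\<close> and \<open>V\<close> are its antiderivatives of order one and two.\<close>

locale scattering_data =
  fixes s :: nat and t0 a \<sigma> M0 :: real and b U V :: l2
  assumes s: "1 \<le> s" and t0: "0 < t0" and a: "0 < a" "a \<le> 1 / 4" and \<sigma>: "\<bar>\<sigma>\<bar> = 1"
    and U: "dk 1 U b" and V: "dk 2 V b"
    and M0: "0 \<le> M0" and ph_b: "\<And>\<tau> f. t0 \<le> \<tau> \<Longrightarrow> norm (ph s (sg \<tau> b) f) \<le> M0 / sqrt \<tau> * norm f"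
begin

text \<open>Encodes \<open>v1\<close> minus its constant. Its norm is constant in time; it decays
  only as a multiplier.\<close>

definition p :: "real \<Rightarrow> l2" where "p \<tau> = cs (cis (\<sigma> * a\<^sup>2 * ln \<tau>)) (sg \<tau> b)"

definition remainder_rhs :: "(real \<Rightarrow> l2) \<Rightarrow> real \<Rightarrow> l2" where
  "remainder_rhs r \<tau> = (1 / \<tau>) *\<^sub>R sg (- \<tau>) (Nh s a (p \<tau> + r \<tau>) - a\<^sup>2 *\<^sub>R p \<tau>)"

lemma norm_p [simp]: "norm (p \<tau>) = norm b" by (simp add: p_def norm_cs_unit)

lemma ph_p: "t0 \<le> \<tau> \<Longrightarrow> norm (ph s (p \<tau>) f) \<le> M0 / sqrt \<tau> * norm f"
  using ph_b[of \<tau> f] by (simp add: p_def ph_cs_left[OF s] norm_cs_unit)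

lemma pos: "t0 \<le> \<tau> \<Longrightarrow> 0 < \<tau>" using t0 by simp

lemma p_continuous: "continuous_on {t0..} p"
  unfolding p_def[abs_def] by (intro continuous_intros) (use t0 in auto)

lemma remainder_rhs_continuous: "continuous_on {t0..} r \<Longrightarrow> continuous_on {t0..} (remainder_rhs r)"
  unfolding remainder_rhs_def[abs_def] by (intro continuous_intros p_continuous s) (use t0 in auto)

abbreviation "src \<equiv> remainder_rhs (\<lambda>_. 0)"
abbreviation "cubic \<tau> \<equiv> (1 / \<tau>) *\<^sub>R sg (- \<tau>) (ph s (p \<tau>) (ph s (p \<tau>) (lcnj (p \<tau>))))"
text \<open>The logarithmic phases of the sources: conjugation reverses the phase of
  \<open>p\<close>, squaring doubles it, and in the squared modulus it cancels. Hence the exponents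
  \<open>- (\<sigma> * a\<^sup>2)\<close>, \<open>2 * (\<sigma> * a\<^sup>2)\<close> and 0.\<close>

abbreviation "src1 \<tau> \<equiv> cs (osc (- (\<sigma> * a\<^sup>2)) \<tau>) (sg (- 2 * \<tau>) (lcnj b))"
abbreviation "src2 \<tau> \<equiv> cs (osc (2 * (\<sigma> * a\<^sup>2)) \<tau>) (sg (- \<tau>) (ph s (sg \<tau> b) (sg \<tau> b)))"
abbreviation "src3 \<tau> \<equiv> cs (osc 0 \<tau>) (sg (- \<tau>) (ph s (sg \<tau> b) (lcnj (sg \<tau> b))))"

lemma src_eq:
  assumes "t0 \<le> \<tau>"
  shows "src \<tau> = a\<^sup>2 *\<^sub>R src1 \<tau> + a *\<^sub>R src2 \<tau> + (2 * a) *\<^sub>R src3 \<tau> + cubic \<tau>"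
proof -
  have r: "(1 / \<tau>) *\<^sub>R F = cs (1 / complex_of_real \<tau>) F" for F
    using cs_of_real[of "1 / \<tau>" F] by simp
  have 1: "(1 / \<tau>) *\<^sub>R sg (- \<tau>) (lcnj (p \<tau>)) = src1 \<tau>"
    unfolding r by (simp add: p_def osc_def lcnj_cs lcnj_sg sg_cs cis_cnj divide_inverse mult_ac)
  have 2: "(1 / \<tau>) *\<^sub>R sg (- \<tau>) (ph s (p \<tau>) (p \<tau>)) = src2 \<tau>"
    unfolding r by (simp add: p_def osc_def ph_cs_left[OF s] ph_cs_right[OF s] sg_cs divide_inverse cis_mult mult.assoc[symmetric])
      (simp add: mult_ac)
  have 3: "(1 / \<tau>) *\<^sub>R sg (- \<tau>) (ph s (p \<tau>) (lcnj (p \<tau>))) = src3 \<tau>"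
    unfolding r by (simp add: p_def osc_def ph_cs_left[OF s] ph_cs_right[OF s] sg_cs lcnj_cs cis_cnj divide_inverse cis_mult mult.assoc[symmetric])
  have "src \<tau> = (1 / \<tau>) *\<^sub>R sg (- \<tau>) (a\<^sup>2 *\<^sub>R lcnj (p \<tau>) + a *\<^sub>R ph s (p \<tau>) (p \<tau>) + (2 * a) *\<^sub>R ph s (p \<tau>) (lcnj (p \<tau>)) + ph s (p \<tau>) (ph s (p \<tau>) (lcnj (p \<tau>))))"
    by (simp add: remainder_rhs_def Nh_def scaleR_add_right add.assoc)
  also have "\<dots> = a\<^sup>2 *\<^sub>R ((1 / \<tau>) *\<^sub>R sg (- \<tau>) (lcnj (p \<tau>))) + a *\<^sub>R ((1 / \<tau>) *\<^sub>R sg (- \<tau>) (ph s (p \<tau>) (p \<tau>))) +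
      (2 * a) *\<^sub>R ((1 / \<tau>) *\<^sub>R sg (- \<tau>) (ph s (p \<tau>) (lcnj (p \<tau>)))) + cubic \<tau>"
    by (simp add: sg_add sg_scaleR scaleR_add_right mult.commute)
  finally show ?thesis unfolding 1 2 3 .
qed

text \<open>An estimate without cancellation, written with the weight for \<open>\<mu> = 0\<close>
  so that \<open>integral_le_weighted\<close> applies. It yields the rate
  \<open>1 / sqrt t\<close>.\<close>

lemma norm_src3: assumes "t0 \<le> \<tau>" shows "norm (src3 \<tau>) \<le> M0 * norm b * ((1 + 0 / sqrt \<tau>) * exp (0 / sqrt \<tau>) / (\<tau> * sqrt \<tau>))"
proof -
  have "norm (src3 \<tau>) \<le> (1 / \<tau>) * norm (ph s (sg \<tau> b) (lcnj (sg \<tau> b)))"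
    using order_trans[OF norm_cs_le mult_right_mono[OF osc_le[OF pos[OF assms], of 0] norm_ge_zero]] by (metis norm_sg)
  also have "\<dots> \<le> (1 / \<tau>) * (M0 / sqrt \<tau> * norm (lcnj (sg \<tau> b)))"
    using pos[OF assms] by (intro mult_left_mono ph_b[OF assms]) auto
  finally show ?thesis by (simp add: mult_ac)
qed

lemma norm_cubic: assumes "t0 \<le> \<tau>" shows "norm (cubic \<tau>) \<le> M0\<^sup>2 * norm b * (1 / \<tau>\<^sup>2)"
proof -
  note q = pos[OF assms]
  have "norm (ph s (p \<tau>) (ph s (p \<tau>) (lcnj (p \<tau>)))) \<le> M0 / sqrt \<tau> * (M0 / sqrt \<tau> * norm (lcnj (p \<tau>)))"
    by (rule order_trans[OF ph_p[OF assms] mult_left_mono[OF ph_p[OF assms]]]) (use M0 q in simp)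
  then have "norm (cubic \<tau>) \<le> (1 / \<tau>) * (M0 / sqrt \<tau> * (M0 / sqrt \<tau> * norm (lcnj (p \<tau>))))"
    using q unfolding norm_scaleR norm_sg by (intro mult_mono) auto
  then show ?thesis using q by (simp add: power2_eq_square mult_ac)
qed

text \<open>\<open>S1\<close> collects the sources that contribute at rate \<open>1 / t\<close>.
  \<open>Z\<close> is the constant of the whole source at rate \<open>1 / sqrt t\<close>, and
  \<open>Z'\<close> its constant at rate \<open>1 / t\<close> after applying \<open>Aop\<close>.
  None of them depends on \<open>a\<close>.\<close>

definition "S1 = norm V + phC s * (norm U * norm U) + M0\<^sup>2 * norm b"
definition "Z = S1 / sqrt t0 + M0 * norm b"
definition "Z' = S1 + 2 * (phC s * (norm b * norm U))"

lemma cont_src: "continuous_on {t0..} src1" "continuous_on {t0..} src2" "continuous_on {t0..} src3" "continuous_on {t0..} cubic"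
  by (intro continuous_intros continuous_on_ph[OF s] p_continuous; use t0 in auto)+

lemma nonneg: "0 \<le> S1" "0 \<le> Z" "0 \<le> Z'" "0 \<le> phC s"
  using phC(1)[OF s] M0 t0 unfolding Z_def Z'_def S1_def by auto

text \<open>These numerical facts keep \<open>a\<close> out of the later constants. The one on
  \<open>2 * a\<^sup>2\<close> concerns the linear Lipschitz constant, which integration in time
  doubles to 1/4.\<close>

lemma a_bounds: "4 * a\<^sup>2 \<le> 1" "a * (3 + 2 * a\<^sup>2) \<le> 1" "6 * a \<le> 2" "2 * a\<^sup>2 \<le> 1 / 8" "a\<^sup>2 \<le> 1"
proof -
  have "a * a \<le> (1 / 4) * (1 / 4)" using a by (intro mult_mono) auto
  then have q: "a\<^sup>2 \<le> 1 / 16" by (simp add: power2_eq_square)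
  then show "4 * a\<^sup>2 \<le> 1" "6 * a \<le> 2" "2 * a\<^sup>2 \<le> 1 / 8" "a\<^sup>2 \<le> 1" using a by auto
  have "a * (3 + 2 * a\<^sup>2) \<le> (1 / 4) * (3 + 2 * (1 / 16))" using a q by (intro mult_mono add_mono) auto
  then show "a * (3 + 2 * a\<^sup>2) \<le> 1" by simp
qed

lemma src_bounds:
  assumes t: "t0 \<le> t" "t \<le> T"
  shows "norm (integral {t..T} src) \<le> Z / sqrt t" "norm (Aop (integral {t..T} src)) \<le> Z' / t"
proof -
  have t': "0 < t" using pos[OF t(1)] .
  note I = tail_integrable[OF cont_src(1) t(1), of T] tail_integrable[OF cont_src(2) t(1), of T] tail_integrable[OF cont_src(3) t(1), of T] tail_integrable[OF cont_src(4) t(1), of T]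
  have "integral {t..T} src = integral {t..T} (\<lambda>\<tau>. a\<^sup>2 *\<^sub>R src1 \<tau> + a *\<^sub>R src2 \<tau> + (2 * a) *\<^sub>R src3 \<tau> + cubic \<tau>)"
    by (rule integral_cong, rule src_eq) (use t in auto)
  also have "\<dots> = a\<^sup>2 *\<^sub>R integral {t..T} src1 + a *\<^sub>R integral {t..T} src2 + (2 * a) *\<^sub>R integral {t..T} src3 + integral {t..T} cubic"
    by (rule integral_unique) (intro has_integral_add has_integral_cmul integrable_integral I)
  finally have e: "integral {t..T} src = (a\<^sup>2 *\<^sub>R integral {t..T} src1 + a *\<^sub>R integral {t..T} src2 + integral {t..T} cubic) + (2 * a) *\<^sub>R integral {t..T} src3"
    by simp
  have b1: "norm (a\<^sup>2 *\<^sub>R integral {t..T} src1) \<le> norm V / t"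
  proof -
    have "\<bar>a\<^sup>2\<bar> * norm (integral {t..T} src1) \<le> a\<^sup>2 * ((3 + \<bar>- (\<sigma> * a\<^sup>2)\<bar>) * norm V / t)"
      by (rule mult_mono[OF _ source_conj_bound[OF V t' t(2)]]) auto
    also have "\<dots> = (a\<^sup>2 * (3 + a\<^sup>2)) * (norm V / t)" using \<sigma> by (simp add: abs_mult)
    also have "\<dots> \<le> 1 * (norm V / t)"
      using a_bounds t' by (intro mult_right_mono) (auto intro: order_trans[OF mult_left_mono[of "3 + a\<^sup>2" 4 "a\<^sup>2"]])
    finally show ?thesis by simp
  qed
  have b2: "norm (a *\<^sub>R integral {t..T} src2) \<le> phC s * (norm U * norm U) / t"
  proof -
    have "\<bar>a\<bar> * norm (integral {t..T} src2) \<le> a * ((3 + \<bar>2 * (\<sigma> * a\<^sup>2)\<bar>) * (phC s * (norm U * norm U)) / t)"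
      using source_square_bound[OF s U t' t(2)] a by (intro mult_mono) auto
    also have "\<dots> = (a * (3 + 2 * a\<^sup>2)) * (phC s * (norm U * norm U) / t)" using \<sigma> by (simp add: abs_mult)
    also have "\<dots> \<le> 1 * (phC s * (norm U * norm U) / t)"
      using a_bounds t' nonneg by (intro mult_right_mono) auto
    finally show ?thesis by simp
  qed
  have b4: "norm (integral {t..T} cubic) \<le> M0\<^sup>2 * norm b / t"
    by (rule integral_le_inverse_square[OF cont_src(4) t0 t]) (use norm_cubic t in auto)
  have b14: "norm (a\<^sup>2 *\<^sub>R integral {t..T} src1 + a *\<^sub>R integral {t..T} src2 + integral {t..T} cubic) \<le> S1 / t"
    unfolding S1_def add_divide_distrib by (intro norm_triangle_le add_mono b1 b2 b4)
  have "norm (integral {t..T} src3) \<le> 2 * (M0 * norm b) * exp (0 / sqrt t) / sqrt t"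
    by (rule integral_le_weighted[OF cont_src(3) t0 t]) (use norm_src3 t M0 in auto)
  then have "\<bar>2 * a\<bar> * norm (integral {t..T} src3) \<le> (1 / 2) * (2 * (M0 * norm b) / sqrt t)"
    using a by (intro mult_mono) auto
  then have b3: "norm ((2 * a) *\<^sub>R integral {t..T} src3) \<le> M0 * norm b / sqrt t" by simp
  \<comment> \<open>From time \<open>t0\<close> on, half a power of \<open>t\<close> is exchanged
    for a constant.\<close>
  have "S1 / t \<le> (S1 / sqrt t0) / sqrt t"
  proof -
    have "S1 / t = S1 / (sqrt t * sqrt t)" using t' by simp
    also have "\<dots> \<le> S1 / (sqrt t0 * sqrt t)" using t t0 nonneg by (intro divide_left_mono mult_right_mono) auto
    finally show ?thesis by simp
  qed
  then show "norm (integral {t..T} src) \<le> Z / sqrt t"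
    unfolding e Z_def add_divide_distrib by (intro norm_triangle_le add_mono order_trans[OF b14] b3)
  \<comment> \<open>Applying \<open>Aop\<close> restores the rate \<open>1 / t\<close> for the one
    source that has no such bound by itself.\<close>
  have b3': "norm (Aop (integral {t..T} src3)) \<le> 3 * (phC s * (norm b * norm U)) / t"
    using source_modulus_bound[OF s U t' t(2), of 0] by simp
  have "\<bar>2 * a\<bar> * norm (Aop (integral {t..T} src3)) \<le> \<bar>2 * a\<bar> * (3 * (phC s * (norm b * norm U)) / t)"
    using b3' by (intro mult_left_mono) auto
  also have "\<dots> = (6 * a) * (phC s * (norm b * norm U) / t)" using a by simp
  also have "\<dots> \<le> 2 * (phC s * (norm b * norm U) / t)"
    using a_bounds nonneg t' by (intro mult_right_mono) auto
  finally have b3'': "norm (Aop ((2 * a) *\<^sub>R integral {t..T} src3)) \<le> 2 * (phC s * (norm b * norm U)) / t"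
    by (simp add: Aop_scaleR)
  show "norm (Aop (integral {t..T} src)) \<le> Z' / t"
    unfolding e Aop_add[of "_ + _ + _"] Z'_def add_divide_distrib
    by (intro norm_triangle_le add_mono order_trans[OF norm_Aop_le b14] b3'')
qed

text \<open>The part of the Lipschitz constant that comes with a factor
  \<open>1 / sqrt \<tau>\<close>. The 2 stems from \<open>6 * a \<le> 2\<close>, the 3 from the
  cubic term, and \<open>1 / sqrt t0\<close> replaces one of the two factors
  \<open>1 / sqrt \<tau>\<close> of the square.\<close>

definition "Lc R = 2 * (M0 + phC s * R) + 3 * (M0 + phC s * R)\<^sup>2 / sqrt t0"

lemma Lc_nonneg: "0 \<le> R \<Longrightarrow> 0 \<le> Lc R" using M0 nonneg t0 by (auto simp: Lc_def)

lemma ph_bound: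
  assumes \<tau>: "t0 \<le> \<tau>" and r: "norm r \<le> R / sqrt \<tau>"
  shows "norm (ph s (p \<tau> + r) f) \<le> (M0 + phC s * R) / sqrt \<tau> * norm f"
proof -
  interpret ph: bounded_bilinear "ph s" by (rule bounded_bilinear_ph[OF s])
  have "norm (ph s r f) \<le> phC s * (R / sqrt \<tau> * norm f)"
    using r nonneg by (intro order_trans[OF phC(2)[OF s]] mult_left_mono mult_right_mono) auto
  then have "norm (ph s (p \<tau> + r) f) \<le> M0 / sqrt \<tau> * norm f + phC s * (R / sqrt \<tau> * norm f)"
    unfolding ph.add_left by (intro norm_triangle_le add_mono ph_p[OF \<tau>])
  then show ?thesis by (simp add: add_divide_distrib distrib_right distrib_left mult_ac)
qed

text \<open>The linear term is kept as an identity and only the error \<open>e\<close> is estimated.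
  The operator \<open>Aop\<close> can then be commuted through the linear term, which a mere bound
  on norms would forbid.\<close>

lemma remainder_rhs_lipschitz:
  assumes \<tau>: "t0 \<le> \<tau>" and R: "0 \<le> R" and r: "norm (r \<tau>) \<le> R / sqrt \<tau>" "norm (r' \<tau>) \<le> R / sqrt \<tau>"
  obtains e where "norm e \<le> (1 / \<tau>) * (Lc R / sqrt \<tau> * norm (r \<tau> - r' \<tau>))"
    "remainder_rhs r \<tau> - remainder_rhs r' \<tau> = (1 / \<tau>) *\<^sub>R (a\<^sup>2 *\<^sub>R sg (- \<tau>) ((r \<tau> - r' \<tau>) + lcnj (r \<tau> - r' \<tau>))) + e"
proof
  let ?d = "r \<tau> - r' \<tau>" and ?m = "(M0 + phC s * R) / sqrt \<tau>"
  let ?w = "Nh s a (p \<tau> + r \<tau>) - Nh s a (p \<tau> + r' \<tau>) - a\<^sup>2 *\<^sub>R (?d + lcnj ?d)"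
  note q = pos[OF \<tau>]
  have m: "0 \<le> ?m" using M0 nonneg R q by simp
  have "norm ?w \<le> (6 * a * ?m + 3 * ?m\<^sup>2) * norm ?d"
    using Nh_lipschitz[OF s _ m ph_bound[OF \<tau> r(1)] ph_bound[OF \<tau> r(2)], of a] a by simp
  also have "\<dots> \<le> Lc R / sqrt \<tau> * norm ?d"
  proof (rule mult_right_mono)
    have "6 * a * ?m \<le> 2 * ?m" using a_bounds m by (intro mult_right_mono) auto
    moreover have "?m\<^sup>2 \<le> (M0 + phC s * R)\<^sup>2 / sqrt t0 / sqrt \<tau>"
    proof -
      have "?m\<^sup>2 = (M0 + phC s * R)\<^sup>2 / (sqrt \<tau> * sqrt \<tau>)" by (simp add: power2_eq_square)
      also have "\<dots> \<le> (M0 + phC s * R)\<^sup>2 / (sqrt t0 * sqrt \<tau>)" using \<tau> t0 by (intro divide_left_mono mult_right_mono) auto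
      finally show ?thesis by simp
    qed
    ultimately have "6 * a * ?m + 3 * ?m\<^sup>2 \<le> 2 * ?m + 3 * ((M0 + phC s * R)\<^sup>2 / sqrt t0 / sqrt \<tau>)" by simp
    then show "6 * a * ?m + 3 * ?m\<^sup>2 \<le> Lc R / sqrt \<tau>" by (simp add: Lc_def add_divide_distrib)
  qed simp
  finally show "norm ((1 / \<tau>) *\<^sub>R sg (- \<tau>) ?w) \<le> (1 / \<tau>) * (Lc R / sqrt \<tau> * norm ?d)"
    using q unfolding norm_scaleR norm_sg by (intro mult_mono) auto
  show "remainder_rhs r \<tau> - remainder_rhs r' \<tau> = (1 / \<tau>) *\<^sub>R (a\<^sup>2 *\<^sub>R sg (- \<tau>) (?d + lcnj ?d)) + (1 / \<tau>) *\<^sub>R sg (- \<tau>) ?w"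
    unfolding remainder_rhs_def by (simp add: sg_diff sg_add sg_scaleR scaleR_diff_right scaleR_add_right)
qed

lemma norm_remainder_rhs_diff:
  assumes \<tau>: "t0 \<le> \<tau>" and R: "0 \<le> R" and r: "norm (r \<tau>) \<le> R / sqrt \<tau>" "norm (r' \<tau>) \<le> R / sqrt \<tau>"
  shows "norm (remainder_rhs r \<tau> - remainder_rhs r' \<tau>) \<le> (1 / \<tau>) * ((1 / 8 + Lc R / sqrt \<tau>) * norm (r \<tau> - r' \<tau>))"
proof (rule remainder_rhs_lipschitz[OF \<tau> R, of r r', OF r])
  fix e let ?d = "r \<tau> - r' \<tau>"
  assume e: "norm e \<le> (1 / \<tau>) * (Lc R / sqrt \<tau> * norm ?d)"
    "remainder_rhs r \<tau> - remainder_rhs r' \<tau> = (1 / \<tau>) *\<^sub>R (a\<^sup>2 *\<^sub>R sg (- \<tau>) (?d + lcnj ?d)) + e"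
  have "norm (a\<^sup>2 *\<^sub>R sg (- \<tau>) (?d + lcnj ?d)) \<le> a\<^sup>2 * (norm ?d + norm ?d)"
    using norm_triangle_ineq[of ?d "lcnj ?d"] by (simp add: mult_left_mono)
  also have "\<dots> = (2 * a\<^sup>2) * norm ?d" by simp
  also have "\<dots> \<le> (1 / 8) * norm ?d" using a_bounds by (intro mult_right_mono) auto
  finally have "norm ((1 / \<tau>) *\<^sub>R (a\<^sup>2 *\<^sub>R sg (- \<tau>) (?d + lcnj ?d))) \<le> (1 / \<tau>) * ((1 / 8) * norm ?d)"
    using pos[OF \<tau>] unfolding norm_scaleR[of "1 / \<tau>"] by (intro mult_mono) auto
  with e(1) have "norm (remainder_rhs r \<tau> - remainder_rhs r' \<tau>) \<le> (1 / \<tau>) * ((1 / 8) * norm ?d) + (1 / \<tau>) * (Lc R / sqrt \<tau> * norm ?d)"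
    unfolding e(2) by (intro norm_triangle_le add_mono)
  then show ?thesis by (simp only: distrib_right distrib_left)
qed

text \<open>The linear part reproduces \<open>Aop (r \<tau>)\<close>. For the error no derivative
  has to be gained: with \<open>r\<close> of size \<open>1 / sqrt \<tau>\<close> it is already of
  size \<open>1 / \<tau>\<^sup>2\<close>.\<close>

lemma norm_Aop_remainder_rhs_diff:
  assumes \<tau>: "t0 \<le> \<tau>" and R: "0 \<le> R" and r: "norm (r \<tau>) \<le> R / sqrt \<tau>"
  shows "norm (Aop (remainder_rhs r \<tau> - src \<tau>)) \<le> (1 / \<tau>) * ((1 / 8) * norm (Aop (r \<tau>))) + Lc R * R * (1 / \<tau>\<^sup>2)"
proof (rule remainder_rhs_lipschitz[OF \<tau> R, of r "\<lambda>_. 0", OF r])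
  note q = pos[OF \<tau>]
  show "norm ((\<lambda>_. 0::l2) \<tau>) \<le> R / sqrt \<tau>" using R q by simp
  fix e let ?d = "r \<tau>"
  assume "norm e \<le> (1 / \<tau>) * (Lc R / sqrt \<tau> * norm (r \<tau> - 0))"
    "remainder_rhs r \<tau> - src \<tau> = (1 / \<tau>) *\<^sub>R (a\<^sup>2 *\<^sub>R sg (- \<tau>) ((r \<tau> - 0) + lcnj (r \<tau> - 0))) + e"
  then have e: "norm e \<le> (1 / \<tau>) * (Lc R / sqrt \<tau> * norm ?d)"
    "remainder_rhs r \<tau> - src \<tau> = (1 / \<tau>) *\<^sub>R (a\<^sup>2 *\<^sub>R sg (- \<tau>) (?d + lcnj ?d)) + e" by simp_all
  have "norm (a\<^sup>2 *\<^sub>R sg (- \<tau>) (Aop ?d + lcnj (Aop ?d))) \<le> a\<^sup>2 * (norm (Aop ?d) + norm (Aop ?d))"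
    using norm_triangle_ineq[of "Aop ?d" "lcnj (Aop ?d)"] by (simp add: mult_left_mono)
  also have "\<dots> = (2 * a\<^sup>2) * norm (Aop ?d)" by simp
  also have "\<dots> \<le> (1 / 8) * norm (Aop ?d)" using a_bounds by (intro mult_right_mono) auto
  finally have A: "norm ((1 / \<tau>) *\<^sub>R (a\<^sup>2 *\<^sub>R sg (- \<tau>) (Aop ?d + lcnj (Aop ?d)))) \<le> (1 / \<tau>) * ((1 / 8) * norm (Aop ?d))"
    using q unfolding norm_scaleR[of "1 / \<tau>"] by (intro mult_mono) auto
  have "(1 / \<tau>) * (Lc R / sqrt \<tau> * norm ?d) \<le> (1 / \<tau>) * (Lc R / sqrt \<tau> * (R / sqrt \<tau>))"
    using q Lc_nonneg[OF R] r by (intro mult_left_mono) auto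
  also have "\<dots> = Lc R * R * (1 / \<tau>\<^sup>2)" using q by (simp add: power2_eq_square)
  finally have B: "norm (Aop e) \<le> Lc R * R * (1 / \<tau>\<^sup>2)" by (intro order_trans[OF norm_Aop_le] order_trans[OF e(1)])
  have "Aop (remainder_rhs r \<tau> - src \<tau>) = (1 / \<tau>) *\<^sub>R (a\<^sup>2 *\<^sub>R sg (- \<tau>) (Aop ?d + lcnj (Aop ?d))) + Aop e"
    unfolding e(2) by (simp only: Aop_add Aop_scaleR Aop_sg Aop_lcnj)
  then show "norm (Aop (remainder_rhs r \<tau> - src \<tau>)) \<le> (1 / \<tau>) * ((1 / 8) * norm (Aop (r \<tau>))) + Lc R * R * (1 / \<tau>\<^sup>2)"
    by (simp only:) (intro norm_triangle_le add_mono A B)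
qed

text \<open>Used in two ways: for uniqueness with \<open>k = 1 / 8\<close> and
  \<open>\<mu> = 8 * Lc R\<close>, where \<open>R\<close> may be large, and for existence with
  \<open>k = 1 / 4\<close> and \<open>\<mu> = 0\<close>, where \<open>Lc R\<close> is small.\<close>

lemma integral_remainder_rhs_diff:
  assumes r: "continuous_on {t0..} r" "continuous_on {t0..} r'" and R: "0 \<le> R"
    and b: "\<And>\<tau>. t0 \<le> \<tau> \<Longrightarrow> norm (r \<tau>) \<le> R / sqrt \<tau>" "\<And>\<tau>. t0 \<le> \<tau> \<Longrightarrow> norm (r' \<tau>) \<le> R / sqrt \<tau>"
    and D: "0 \<le> D" "\<And>\<tau>. t0 \<le> \<tau> \<Longrightarrow> norm (r \<tau> - r' \<tau>) \<le> D * exp (\<mu> / sqrt \<tau>) / sqrt \<tau>"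
    and k: "0 \<le> k" "\<And>\<tau>. t0 \<le> \<tau> \<Longrightarrow> 1 / 8 + Lc R / sqrt \<tau> \<le> k * (1 + \<mu> / sqrt \<tau>)" and t: "t0 \<le> t" "t \<le> T"
  shows "norm (integral {t..T} (\<lambda>\<tau>. remainder_rhs r \<tau> - remainder_rhs r' \<tau>)) \<le> 2 * (k * D) * exp (\<mu> / sqrt t) / sqrt t"
proof (rule integral_le_weighted[OF _ t0 t])
  show "continuous_on {t0..} (\<lambda>\<tau>. remainder_rhs r \<tau> - remainder_rhs r' \<tau>)" by (intro continuous_intros remainder_rhs_continuous r)
  show "0 \<le> k * D" using k(1) D(1) by simp
  fix \<tau> assume "t \<le> \<tau>"
  with t have \<tau>: "t0 \<le> \<tau>" by simp
  note q = pos[OF \<tau>]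
  have "norm (remainder_rhs r \<tau> - remainder_rhs r' \<tau>) \<le> (1 / \<tau>) * ((1 / 8 + Lc R / sqrt \<tau>) * norm (r \<tau> - r' \<tau>))"
    by (rule norm_remainder_rhs_diff[of \<tau> R r r', OF \<tau> R b(1)[OF \<tau>] b(2)[OF \<tau>]])
  also have "\<dots> \<le> (1 / \<tau>) * ((k * (1 + \<mu> / sqrt \<tau>)) * (D * exp (\<mu> / sqrt \<tau>) / sqrt \<tau>))"
    using q Lc_nonneg[OF R] order_trans[OF _ k(2)[OF \<tau>], of 0] by (intro mult_left_mono mult_mono k(2) D(2) \<tau>) auto
  also have "\<dots> = k * D * ((1 + \<mu> / sqrt \<tau>) * exp (\<mu> / sqrt \<tau>) / (\<tau> * sqrt \<tau>))" by simp
  finally show "norm (remainder_rhs r \<tau> - remainder_rhs r' \<tau>) \<le> k * D * ((1 + \<mu> / sqrt \<tau>) * exp (\<mu> / sqrt \<tau>) / (\<tau> * sqrt \<tau>))" .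
qed

text \<open>\<open>remainder_rhs r\<close> is, up to the factor \<open>i \<sigma>\<close>, the time derivative of the profile \<open>sg (- t) (r t)\<close>.\<close>

definition sol :: "(real \<Rightarrow> l2) \<Rightarrow> real \<Rightarrow> bool" where
  "sol r R \<longleftrightarrow> continuous_on {t0..} r \<and> 0 \<le> R \<and> (\<forall>t\<ge>t0. norm (r t) \<le> R / sqrt t) \<and>
    (\<forall>t\<ge>t0. \<forall>T\<ge>t. sg (- t) (r t) = sg (- T) (r T) - cs (\<i> * \<sigma>) (integral {t..T} (remainder_rhs r)))"

lemma solD:
  assumes "sol r R"
  shows "continuous_on {t0..} r" "0 \<le> R" "t0 \<le> t \<Longrightarrow> norm (r t) \<le> R / sqrt t"
    "t0 \<le> t \<Longrightarrow> t \<le> T \<Longrightarrow> sg (- t) (r t) = sg (- T) (r T) - cs (\<i> * \<sigma>) (integral {t..T} (remainder_rhs r))"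
  using assms unfolding sol_def by blast+

lemma sol_mono: "sol r R \<Longrightarrow> R \<le> R' \<Longrightarrow> sol r R'"
  unfolding sol_def using t0 by (auto intro: order_trans[OF _ divide_right_mono])

lemma remainder_rhs_integrable: "continuous_on {t0..} r \<Longrightarrow> t0 \<le> t \<Longrightarrow> remainder_rhs r integrable_on {t..T}"
  by (rule tail_integrable[OF remainder_rhs_continuous])

lemma cmod_i_sigma: "cmod (\<i> * \<sigma>) = 1" using \<sigma> by (simp add: norm_mult)

text \<open>The weight \<open>exp (\<mu> / sqrt t) / sqrt t\<close> absorbs the decaying part of the Lipschitz constant, however large \<open>R\<close> is.\<close>

lemma sol_unique:
  assumes r: "sol r R" "sol r' R'" and t: "t0 \<le> t"
  shows "r t = r' t"
proof -
  define S where "S = max R R'"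
  have r: "sol r S" "sol r' S" using r by (auto simp: S_def intro: sol_mono)
  note d = solD[OF r(1)] and d' = solD[OF r(2)]
  define \<mu> where "\<mu> = 8 * Lc S"
  have \<mu>: "0 \<le> \<mu>" using Lc_nonneg[OF d(2)] by (simp add: \<mu>_def)
  have step: "norm (r t - r' t) \<le> 2 * S / sqrt T + norm (integral {t..T} (\<lambda>\<tau>. remainder_rhs r \<tau> - remainder_rhs r' \<tau>))" if t: "t0 \<le> t" "t \<le> T" for t T
  proof -
    have T: "t0 \<le> T" using t by simp
    have "sg (- t) (r t - r' t) = sg (- T) (r T - r' T) - cs (\<i> * \<sigma>) (integral {t..T} (\<lambda>\<tau>. remainder_rhs r \<tau> - remainder_rhs r' \<tau>))"
      unfolding sg_diff d(4)[OF t] d'(4)[OF t] integral_diff[OF remainder_rhs_integrable[OF d(1) t(1)] remainder_rhs_integrable[OF d'(1) t(1)]]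
        bounded_bilinear.diff_right[OF bounded_bilinear_cs] by simp
    then have "norm (sg (- t) (r t - r' t)) \<le> norm (r T - r' T) + norm (integral {t..T} (\<lambda>\<tau>. remainder_rhs r \<tau> - remainder_rhs r' \<tau>))"
      by (simp only:) (rule order_trans[OF norm_triangle_ineq4], simp only: norm_sg norm_cs_unit[OF cmod_i_sigma] order_refl)
    moreover have "norm (r T - r' T) \<le> S / sqrt T + S / sqrt T"
      by (rule order_trans[OF norm_triangle_ineq4 add_mono[OF d(3)[OF T] d'(3)[OF T]]])
    ultimately show ?thesis by simp
  qed
  \<comment> \<open>Each pass through the equation multiplies the weighted distance by
    \<open>2 * (1 / 8)\<close>, that is by 1/4.\<close>
  have it: "\<forall>t\<ge>t0. norm (r t - r' t) \<le> (2 * S / 4 ^ n) * exp (\<mu> / sqrt t) / sqrt t" for n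
  proof (induction n)
    case 0
    show ?case
    proof (intro allI impI)
      fix t assume t: "t0 \<le> t"
      have "norm (r t - r' t) \<le> S / sqrt t + S / sqrt t"
        by (rule order_trans[OF norm_triangle_ineq4 add_mono[OF d(3)[OF t] d'(3)[OF t]]])
      also have "\<dots> = (2 * S) * 1 / sqrt t" by simp
      also have "\<dots> \<le> (2 * S) * exp (\<mu> / sqrt t) / sqrt t"
        using \<mu> pos[OF t] d(2) by (intro divide_right_mono mult_left_mono) auto
      finally show "norm (r t - r' t) \<le> (2 * S / 4 ^ 0) * exp (\<mu> / sqrt t) / sqrt t" by simp
    qed
  next
    case (Suc n)
    show ?case
    proof (intro allI impI)
      fix t assume t: "t0 \<le> t"
      let ?c = "2 * (1 / 8 * (2 * S / 4 ^ n)) * exp (\<mu> / sqrt t) / sqrt t"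
      have "norm (r t - r' t) \<le> 2 * S / sqrt T + ?c" if T: "t \<le> T" for T
      proof (rule order_trans[OF step[OF t T] add_left_mono])
        show "norm (integral {t..T} (\<lambda>\<tau>. remainder_rhs r \<tau> - remainder_rhs r' \<tau>)) \<le> ?c"
          by (rule integral_remainder_rhs_diff[OF d(1) d'(1) d(2) d(3) d'(3)])
            (use Suc d(2) t T \<mu> Lc_nonneg[OF d(2)] in \<open>auto simp: \<mu>_def mult.commute\<close>)
      qed
      \<comment> \<open>As \<open>T\<close> tends to infinity the contribution of the final time
        disappears, since both solutions vanish there.\<close>
      then have "norm (r t - r' t) \<le> 0 + ?c"
        by (intro tendsto_lowerbound[OF tendsto_add[OF tendsto_divide_sqrt_at_top tendsto_const]] eventually_mono[OF eventually_ge_at_top[of t]]) auto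
      then show "norm (r t - r' t) \<le> (2 * S / 4 ^ Suc n) * exp (\<mu> / sqrt t) / sqrt t" by simp
    qed
  qed
  have "(\<lambda>n. (2 * S * (1 / 4) ^ n) * exp (\<mu> / sqrt t) / sqrt t) \<longlonglongrightarrow> (2 * S * 0) * exp (\<mu> / sqrt t) / sqrt t"
    using pos[OF t] by (intro tendsto_intros LIMSEQ_power_zero) auto
  moreover have "norm (r t - r' t) \<le> (2 * S * (1 / 4) ^ n) * exp (\<mu> / sqrt t) / sqrt t" for n
    using it[of n] t by (simp add: power_divide)
  ultimately have "norm (r t - r' t) \<le> (2 * S * 0) * exp (\<mu> / sqrt t) / sqrt t"
    by (intro LIMSEQ_le_const) auto
  then show ?thesis by simp
qed

text \<open>Each pass through the integral equation divides the part of size \<open>t\<^bsup>-1/2\<^esup>\<close> by four.\<close>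

lemma sol_Aop_decay:
  assumes r: "sol r R" and t: "t0 \<le> t"
  shows "norm (Aop (r t)) \<le> 2 * (Z' + Lc R * R) / t"
proof -
  note d = solD[OF r]
  define C where "C = Z' + Lc R * R"
  have LR: "0 \<le> Lc R * R" using Lc_nonneg[OF d(2)] d(2) by simp
  have C: "0 \<le> C" using nonneg LR by (simp add: C_def)
  have step: "norm (Aop (r t)) \<le> R / sqrt T + (Z' / t + norm (integral {t..T} (\<lambda>\<tau>. Aop (remainder_rhs r \<tau> - src \<tau>))))"
    if t: "t0 \<le> t" "t \<le> T" for t T
  proof -
    have T: "t0 \<le> T" using t by simp
    note I = remainder_rhs_integrable[OF d(1) t(1), of T] remainder_rhs_integrable[OF continuous_on_const[of _ 0] t(1), of T]
    have "integral {t..T} (remainder_rhs r) = integral {t..T} src + integral {t..T} (\<lambda>\<tau>. remainder_rhs r \<tau> - src \<tau>)"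
      by (simp only: integral_diff[OF I]) simp
    then have "Aop (integral {t..T} (remainder_rhs r)) = Aop (integral {t..T} src) + integral {t..T} (\<lambda>\<tau>. Aop (remainder_rhs r \<tau> - src \<tau>))"
      by (simp only: Aop_add integral_linear[OF integrable_diff[OF I] bounded_linear_Aop, unfolded o_def])
    then have "norm (Aop (integral {t..T} (remainder_rhs r))) \<le> Z' / t + norm (integral {t..T} (\<lambda>\<tau>. Aop (remainder_rhs r \<tau> - src \<tau>)))"
      by (simp only:) (intro norm_triangle_le add_mono src_bounds(2)[OF t] order_refl)
    moreover have "norm (Aop (r t)) = norm (Aop (sg (- T) (r T) - cs (\<i> * \<sigma>) (integral {t..T} (remainder_rhs r))))"
      unfolding d(4)[OF t, symmetric] by (simp add: Aop_sg)
    moreover have "\<dots> \<le> norm (Aop (r T)) + norm (Aop (integral {t..T} (remainder_rhs r)))"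
      unfolding Aop_diff Aop_sg Aop_cs
      by (rule order_trans[OF norm_triangle_ineq4]) (simp only: norm_sg norm_cs_unit[OF cmod_i_sigma] order_refl)
    moreover have "norm (Aop (r T)) \<le> R / sqrt T" by (rule order_trans[OF norm_Aop_le d(3)[OF T]])
    ultimately show ?thesis by linarith
  qed
  \<comment> \<open>The term \<open>2 * C / t\<close> reproduces itself: source and error contribute
    \<open>C / t\<close>, and the linear part adds an eighth of \<open>2 * C\<close>, so the total
    \<open>5 / 4 * C\<close> stays below \<open>2 * C\<close>. The other term is multiplied by 1/8
    and by the 2 from the time integral.\<close>
  have it: "\<forall>t\<ge>t0. norm (Aop (r t)) \<le> R / 4 ^ n / sqrt t + 2 * C / t" for n
  proof (induction n)
    case 0
    show ?case
    proof (intro allI impI)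
      fix t assume t: "t0 \<le> t"
      have "0 \<le> 2 * C / t" using C pos[OF t] by simp
      then show "norm (Aop (r t)) \<le> R / 4 ^ 0 / sqrt t + 2 * C / t"
        using order_trans[OF norm_Aop_le d(3)[OF t]] by simp
    qed
  next
    case (Suc n)
    show ?case
    proof (intro allI impI)
      fix t assume t: "t0 \<le> t"
      note t' = pos[OF t]
      let ?\<alpha> = "R / 4 ^ n"
      let ?c = "(1 / 8 * ?\<alpha>) * (2 / sqrt t) + (C / 4 + Lc R * R) * (1 / t)"
      have "norm (Aop (r t)) \<le> R / sqrt T + (Z' / t + ?c)" if T: "t \<le> T" for T
      proof (rule order_trans[OF step[OF t T] add_left_mono[OF add_left_mono]])
        have w: "((\<lambda>\<tau>. 1 / (\<tau> * sqrt \<tau>)) has_integral (2 / sqrt t - 2 / sqrt T)) {t..T}"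
          using weighted_integral[OF t' T, of 0] by simp
        note J = has_integral_add[OF has_integral_mult_right[OF w, of "1 / 8 * ?\<alpha>"]
            has_integral_mult_right[OF integral_inverse_square[OF t' T], of "C / 4 + Lc R * R"]]
        have "norm (integral {t..T} (\<lambda>\<tau>. Aop (remainder_rhs r \<tau> - src \<tau>))) \<le>
          integral {t..T} (\<lambda>\<tau>. (1 / 8 * ?\<alpha>) * (1 / (\<tau> * sqrt \<tau>)) + (C / 4 + Lc R * R) * (1 / \<tau>\<^sup>2))"
        proof (rule integral_norm_bound_integral[OF _ has_integral_integrable[OF J]])
          show "(\<lambda>\<tau>. Aop (remainder_rhs r \<tau> - src \<tau>)) integrable_on {t..T}"
            by (rule tail_integrable[OF _ t], rule bounded_linear.continuous_on[OF bounded_linear_Aop])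
              (intro continuous_intros remainder_rhs_continuous d(1))
          fix \<tau> assume "\<tau> \<in> {t..T}"
          with t have \<tau>: "t0 \<le> \<tau>" by simp
          note q = pos[OF \<tau>]
          have "norm (Aop (remainder_rhs r \<tau> - src \<tau>)) \<le> (1 / \<tau>) * ((1 / 8) * norm (Aop (r \<tau>))) + Lc R * R * (1 / \<tau>\<^sup>2)"
            by (rule norm_Aop_remainder_rhs_diff[of \<tau> R r, OF \<tau> d(2) d(3)[OF \<tau>]])
          also have "\<dots> \<le> (1 / \<tau>) * ((1 / 8) * (?\<alpha> / sqrt \<tau> + 2 * C / \<tau>)) + Lc R * R * (1 / \<tau>\<^sup>2)"
            using Suc \<tau> q by (intro add_right_mono mult_left_mono) auto
          also have "\<dots> = (1 / 8 * ?\<alpha>) * (1 / (\<tau> * sqrt \<tau>)) + (C / 4 + Lc R * R) * (1 / \<tau>\<^sup>2)"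
            by (simp add: distrib_left distrib_right power2_eq_square add_divide_distrib mult_ac)
          finally show "norm (Aop (remainder_rhs r \<tau> - src \<tau>)) \<le> (1 / 8 * ?\<alpha>) * (1 / (\<tau> * sqrt \<tau>)) + (C / 4 + Lc R * R) * (1 / \<tau>\<^sup>2)" .
        qed
        also have "\<dots> = (1 / 8 * ?\<alpha>) * (2 / sqrt t - 2 / sqrt T) + (C / 4 + Lc R * R) * (1 / t - 1 / T)"
          by (rule integral_unique[OF J])
        also have "\<dots> \<le> ?c"
          using d(2) C LR t' T by (intro add_mono mult_left_mono) auto
        finally show "norm (integral {t..T} (\<lambda>\<tau>. Aop (remainder_rhs r \<tau> - src \<tau>))) \<le> ?c" .
      qed
      then have "norm (Aop (r t)) \<le> 0 + (Z' / t + ?c)"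
        by (intro tendsto_lowerbound[OF tendsto_add[OF tendsto_divide_sqrt_at_top tendsto_const]] eventually_mono[OF eventually_ge_at_top[of t]]) auto
      also have "\<dots> = R / 4 ^ Suc n / sqrt t + (5 / 4 * C) / t"
        by (simp add: C_def add_divide_distrib distrib_right)
      also have "\<dots> \<le> R / 4 ^ Suc n / sqrt t + 2 * C / t"
        using C t' by (intro add_left_mono divide_right_mono) auto
      finally show "norm (Aop (r t)) \<le> R / 4 ^ Suc n / sqrt t + 2 * C / t" .
    qed
  qed
  have "(\<lambda>n. R * (1 / 4) ^ n / sqrt t + 2 * C / t) \<longlonglongrightarrow> R * 0 / sqrt t + 2 * C / t"
    using pos[OF t] by (intro tendsto_intros LIMSEQ_power_zero) auto
  moreover have "norm (Aop (r t)) \<le> R * (1 / 4) ^ n / sqrt t + 2 * C / t" for n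
    using it[of n] t by (simp add: power_divide)
  ultimately have "norm (Aop (r t)) \<le> R * 0 / sqrt t + 2 * C / t"
    by (intro LIMSEQ_le_const) auto
  then show ?thesis by (simp add: C_def)
qed

text \<open>Banach's theorem for \<open>sqrt t\<close> times the remainder, in a closed ball of
  bounded continuous functions. The source takes half of the radius, and the contraction factor 1/2
  leaves the other half to the difference from it.\<close>

lemma sol_exists:
  assumes L: "Lc R \<le> sqrt t0 / 8" and ZR: "2 * Z \<le> R"
  shows "\<exists>r. sol r R"
proof -
  have R: "0 \<le> R" using nonneg ZR by simp
  have k: "1 / 8 + Lc R / sqrt \<tau> \<le> 1 / 4 * (1 + 0 / sqrt \<tau>)" if \<tau>: "t0 \<le> \<tau>" for \<tau>
  proof -
    have "Lc R / sqrt \<tau> \<le> (sqrt t0 / 8) / sqrt t0" using L \<tau> t0 Lc_nonneg[OF R] by (intro frac_le) auto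
    moreover have "(sqrt t0 / 8) / sqrt t0 = 1 / 8" "1 / 4 * (1 + 0 / sqrt \<tau>) = 1 / 4" using t0 by simp_all
    ultimately show ?thesis by linarith
  qed
  \<comment> \<open>Candidates are stored multiplied by \<open>sqrt \<tau>\<close>, so that the ball
    of radius \<open>R\<close> means decay \<open>R / sqrt \<tau>\<close>.\<close>
  define rx where "rx x \<tau> = (1 / sqrt \<tau>) *\<^sub>R apply_bcontfun x \<tau>" for x :: "(real, l2) bcontfun" and \<tau>
  have rx_c: "continuous_on {t0..} (rx x)" for x
    unfolding rx_def[abs_def] by (intro continuous_intros) (use t0 in auto)
  have rx_d: "norm (rx x \<tau> - rx y \<tau>) \<le> dist x y * exp (0 / sqrt \<tau>) / sqrt \<tau>" if \<tau>: "t0 \<le> \<tau>" for x y \<tau>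
  proof -
    have "rx x \<tau> - rx y \<tau> = (1 / sqrt \<tau>) *\<^sub>R (apply_bcontfun x \<tau> - apply_bcontfun y \<tau>)"
      by (simp only: rx_def scaleR_diff_right)
    moreover have "norm (apply_bcontfun x \<tau> - apply_bcontfun y \<tau>) \<le> dist x y"
      using dist_bounded[of x \<tau> y] by (simp add: dist_norm)
    ultimately show ?thesis using pos[OF \<tau>] by (simp add: divide_right_mono)
  qed
  have rx_b: "norm (rx x \<tau>) \<le> R / sqrt \<tau>" if x: "x \<in> cball 0 R" and \<tau>: "t0 \<le> \<tau>" for x \<tau>
  proof -
    have "norm (rx x \<tau>) = norm (apply_bcontfun x \<tau>) / sqrt \<tau>" using pos[OF \<tau>] by (simp add: rx_def)
    also have "\<dots> \<le> R / sqrt \<tau>"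
      using order_trans[OF norm_bounded[of x \<tau>], of R] x pos[OF \<tau>] by (intro divide_right_mono) (auto simp: dist_norm)
    finally show ?thesis .
  qed
  have int: "norm (integral {t..T} (\<lambda>\<tau>. remainder_rhs (rx x) \<tau> - remainder_rhs (rx y) \<tau>)) \<le> (dist x y / 2) / sqrt t"
    if "x \<in> cball 0 R" "y \<in> cball 0 R" "t0 \<le> t" "t \<le> T" for x y t T
  proof -
    have "norm (integral {t..T} (\<lambda>\<tau>. remainder_rhs (rx x) \<tau> - remainder_rhs (rx y) \<tau>)) \<le> 2 * (1 / 4 * dist x y) * exp (0 / sqrt t) / sqrt t"
      by (rule integral_remainder_rhs_diff[OF rx_c rx_c R rx_b[OF that(1)] rx_b[OF that(2)] zero_le_dist rx_d _ k that(3,4)]) auto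
    then show ?thesis by simp
  qed
  have z: "remainder_rhs (rx 0) = src"
    by (rule ext, simp add: remainder_rhs_def rx_def)
  have int': "norm (integral {t..T} (remainder_rhs (rx x))) \<le> R / sqrt t" if x: "x \<in> cball 0 R" and t: "t0 \<le> t" "t \<le> T" for x t T
  proof -
    have "integral {t..T} (remainder_rhs (rx x)) = integral {t..T} src + integral {t..T} (\<lambda>\<tau>. remainder_rhs (rx x) \<tau> - remainder_rhs (rx 0) \<tau>)"
      using integral_diff[OF remainder_rhs_integrable[OF rx_c t(1), of x T] remainder_rhs_integrable[OF rx_c t(1), of 0 T]] by (simp add: z)
    also have "norm \<dots> \<le> (R / 2) / sqrt t + (dist x 0 / 2) / sqrt t"
    proof (intro norm_triangle_le add_mono int x t order_trans[OF src_bounds(1)[OF t]])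
      show "Z / sqrt t \<le> R / 2 / sqrt t" using ZR pos[OF t(1)] by (intro divide_right_mono) auto
      show "0 \<in> cball 0 R" using R by simp
    qed
    also have "\<dots> \<le> (R / 2) / sqrt t + (R / 2) / sqrt t"
      using x pos[OF t(1)] by (intro add_left_mono divide_right_mono) (auto simp: dist_commute)
    finally show ?thesis by simp
  qed
  have tc: "tail_converges t0 (remainder_rhs (rx x))" if "x \<in> cball 0 R" for x
    by (rule tail_convergesI[OF remainder_rhs_continuous[OF rx_c] int'[OF that] tendsto_divide_sqrt_at_top])
  \<comment> \<open>The minus sign belongs to integrating backwards from a profile that vanishes at
    infinite time.\<close>
  define G where "G x t = sqrt t *\<^sub>R cs (- (\<i> * \<sigma>)) (sg t (tail_integral (remainder_rhs (rx x)) t))" for x t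
  have nG: "norm (sqrt t *\<^sub>R cs (- (\<i> * \<sigma>)) (sg t F)) = sqrt t * norm F" if "t0 \<le> t" for t F
    using pos[OF that] cmod_i_sigma by (simp add: norm_cs_unit)
  have G_le: "norm (G x t) \<le> R" if x: "x \<in> cball 0 R" and t: "t0 \<le> t" for x t
  proof -
    have "norm (tail_integral (remainder_rhs (rx x)) t) \<le> R / sqrt t" by (rule tail_integral_norm_le[OF tc[OF x] t int'[OF x t]])
    then have "sqrt t * norm (tail_integral (remainder_rhs (rx x)) t) \<le> sqrt t * (R / sqrt t)" using pos[OF t] by (intro mult_left_mono) auto
    then show ?thesis unfolding G_def nG[OF t] using pos[OF t] by simp
  qed
  have G_c: "continuous_on UNIV (\<lambda>t. G x (max t0 t))" if x: "x \<in> cball 0 R" for x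
  proof -
    have "continuous_on {t0..} (G x)"
      unfolding G_def[abs_def] by (intro continuous_intros tail_integral_continuous[OF tc[OF x]])
    then show ?thesis by (rule continuous_on_compose2) (auto intro!: continuous_intros)
  qed
  \<comment> \<open>Bounded continuous functions live on the whole line, so the image is held
    constant before \<open>t0\<close>.\<close>
  define \<Phi> where "\<Phi> x = Bcontfun (\<lambda>t. G x (max t0 t))" for x :: "real \<Rightarrow>\<^sub>C l2"
  have \<Phi>: "apply_bcontfun (\<Phi> x) t = G x (max t0 t)" if x: "x \<in> cball 0 R" for x t
    unfolding \<Phi>_def by (subst Bcontfun_inverse) (auto intro: bcontfun_normI[OF G_c[OF x] G_le[OF x]])
  have "\<exists>!x\<in>(cball 0 R :: (real \<Rightarrow>\<^sub>C l2) set). \<Phi> x = x"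
  proof (rule Banach_fix[OF complete_eq_closed[THEN iffD2, OF closed_cball]])
    show "cball 0 R \<noteq> ({} :: (real \<Rightarrow>\<^sub>C l2) set)" using R by auto
    show "(0::real) \<le> 1 / 2" "(1 / 2 :: real) < 1" by simp_all
    show "\<Phi> ` cball 0 R \<subseteq> cball 0 R"
    proof (rule image_subsetI)
      fix x :: "real \<Rightarrow>\<^sub>C l2" assume x: "x \<in> cball 0 R"
      have "norm (\<Phi> x) \<le> R" by (rule norm_bound) (simp add: \<Phi>[OF x] G_le[OF x])
      then show "\<Phi> x \<in> cball 0 R" by (simp add: dist_norm)
    qed
    fix x y :: "real \<Rightarrow>\<^sub>C l2" assume xy: "x \<in> cball 0 R" "y \<in> cball 0 R"
    show "dist (\<Phi> x) (\<Phi> y) \<le> 1 / 2 * dist x y"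
    proof (rule dist_bound)
      fix u :: real
      define t where "t = max t0 u"
      have t: "t0 \<le> t" by (simp add: t_def)
      have "G x t - G y t = sqrt t *\<^sub>R cs (- (\<i> * \<sigma>)) (sg t (tail_integral (\<lambda>\<tau>. remainder_rhs (rx x) \<tau> - remainder_rhs (rx y) \<tau>) t))"
        unfolding G_def tail_converges_diff(2)[OF tc[OF xy(1)] tc[OF xy(2)] t]
        by (simp only: sg_diff bounded_bilinear.diff_right[OF bounded_bilinear_cs] scaleR_diff_right)
      then have "norm (G x t - G y t) = sqrt t * norm (tail_integral (\<lambda>\<tau>. remainder_rhs (rx x) \<tau> - remainder_rhs (rx y) \<tau>) t)" by (simp only: nG[OF t])
      also have "\<dots> \<le> sqrt t * ((dist x y / 2) / sqrt t)"
        using pos[OF t] by (intro mult_left_mono tail_integral_norm_le[OF tail_converges_diff(1)[OF tc[OF xy(1)] tc[OF xy(2)]] t int[OF xy t]]) auto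
      finally show "dist (apply_bcontfun (\<Phi> x) u) (apply_bcontfun (\<Phi> y) u) \<le> 1 / 2 * dist x y"
        using pos[OF t] by (simp add: \<Phi>[OF xy(1)] \<Phi>[OF xy(2)] dist_norm t_def)
    qed
  qed
  then obtain x where x: "x \<in> cball 0 R" "\<Phi> x = x" by auto
  have fp: "sg (- t) (rx x t) = - cs (\<i> * \<sigma>) (tail_integral (remainder_rhs (rx x)) t)" if t: "t0 \<le> t" for t
  proof -
    have "apply_bcontfun x t = G x t" using \<Phi>[OF x(1), of t] x(2) t by simp
    then have "rx x t = cs (- (\<i> * \<sigma>)) (sg t (tail_integral (remainder_rhs (rx x)) t))"
      using pos[OF t] by (simp add: rx_def G_def)
    then show ?thesis by (simp add: sg_cs bounded_bilinear.minus_left[OF bounded_bilinear_cs] sg_minus)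
  qed
  have "sol (rx x) R"
    unfolding sol_def
  proof (intro conjI allI impI rx_c R rx_b[OF x(1)])
    fix t T assume t: "t0 \<le> t" "t \<le> T"
    then have T: "t0 \<le> T" by simp
    show "sg (- t) (rx x t) = sg (- T) (rx x T) - cs (\<i> * \<sigma>) (integral {t..T} (remainder_rhs (rx x)))"
      unfolding fp[OF t(1)] fp[OF T] tail_integral_split[OF tc[OF x(1)] t]
      by (simp add: bounded_bilinear.add_right[OF bounded_bilinear_cs])
  qed
  then show ?thesis by blast
qed

end

section \<open>Sobolev functions and their encodings\<close>

text \<open>The induction uses \<open>F\<close> and its first derivative through
  \<open>en_Suc_I\<close>; the two summands double the constant at each order.\<close>

lemma enc_from_derivatives:
  assumes "\<And>k. k \<le> s \<Longrightarrow> dk k F (D k)"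
  shows "\<exists>c. F = E s c \<and> norm c \<le> 2 ^ s * (\<Sum>k\<le>s. norm (D k))"
  using assms
proof (induction s arbitrary: F D)
  case 0
  have "D 0 = F" using 0[OF order_refl] unfolding dk_0 .
  moreover have "en 0 F F" by (simp add: en_0)
  then have "F = E 0 F" by (simp add: en_iff)
  ultimately show ?case by (intro exI[of _ F]) auto
next
  case (Suc s)
  have d: "dk 1 F (D 1)" using Suc.prems[of 1] by simp
  have "\<exists>c. F = E s c \<and> norm c \<le> 2 ^ s * (\<Sum>k\<le>s. norm (D k))" by (rule Suc.IH) (use Suc.prems in auto)
  then obtain x where x: "F = E s x" "norm x \<le> 2 ^ s * (\<Sum>k\<le>s. norm (D k))" by blast
  have "\<exists>c. D 1 = E s c \<and> norm c \<le> 2 ^ s * (\<Sum>k\<le>s. norm (D (Suc k)))"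
  proof (rule Suc.IH)
    fix k assume "k \<le> s"
    then have "dk (1 + k) F (D (Suc k))" using Suc.prems[of "Suc k"] by (simp del: power_Suc)
    then show "dk k (D 1) (D (Suc k))" by (rule dk_split[OF _ d])
  qed
  then obtain y where y: "D 1 = E s y" "norm y \<le> 2 ^ s * (\<Sum>k\<le>s. norm (D (Suc k)))" by blast
  from en_Suc_I[of s F x "D 1" y] x y d obtain z where z: "F = E (Suc s) z" "norm z \<le> norm x + norm y"
    by (auto simp: en_iff)
  have "(\<Sum>k\<le>s. norm (D k)) \<le> (\<Sum>k\<le>Suc s. norm (D k))" by simp
  moreover have "(\<Sum>k\<le>s. norm (D (Suc k))) \<le> (\<Sum>k\<le>Suc s. norm (D k))"
    unfolding sum.atMost_Suc_shift[of _ s] by simp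
  ultimately have "norm x + norm y \<le> 2 ^ s * (\<Sum>k\<le>Suc s. norm (D k)) + 2 ^ s * (\<Sum>k\<le>Suc s. norm (D k))"
    by (intro add_mono order_trans[OF x(2)] order_trans[OF y(2)] mult_left_mono) auto
  with z show ?case by (intro exI[of _ z]) auto
qed

lemma sobolev_nabla_dk:
  assumes f: "f \<in> sobolev s 2" and k: "k \<le> s"
  shows "nabla k f \<in> Lp 2" "dk k (emb f) (emb (nabla k f))"
proof -
  from f k obtain g where g: "g \<in> Lp 2" "weak_deriv k f g" by (auto simp: sobolev_def)
  have d: "dk k (emb f) (emb g)" by (rule sobolev_dk[OF f k g(2,1)])
  from nabla_dk[OF sobolev_Lp2[OF f] d] d show "nabla k f \<in> Lp 2" "dk k (emb f) (emb (nabla k f))" by auto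
qed

lemma sobolev_enc:
  assumes f: "f \<in> sobolev s 2"
  obtains c where "emb f = E s c" "norm c \<le> 2 ^ s * sobolev_norm s 2 f"
proof -
  have "\<exists>c. emb f = E s c \<and> norm c \<le> 2 ^ s * (\<Sum>k\<le>s. norm (emb (nabla k f)))"
    by (rule enc_from_derivatives) (rule sobolev_nabla_dk[OF f])
  moreover have "(\<Sum>k\<le>s. norm (emb (nabla k f))) = sobolev_norm s 2 f"
    unfolding sobolev_norm_def by (rule sum.cong) (auto simp: norm_emb[OF sobolev_nabla_dk(1)[OF f]])
  ultimately show ?thesis using that by auto
qed

text \<open>All bounds are inequalities between symbols. For \<open>k \<ge> 1\<close> one factor
  \<open>\<bar>\<xi>\<bar>\<close> can be set aside and, with one power of the weight, makes up the
  symbol of \<open>Aop\<close>.\<close>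

lemma E_dk:
  assumes "k \<le> s"
  obtains G where "dk k (E s c) G" "norm G \<le> norm c" "1 \<le> k \<Longrightarrow> norm G \<le> norm (Aop c)"
proof -
  have le: "\<bar>\<xi>\<bar> ^ k \<le> (1 + \<bar>\<xi>\<bar>) ^ s" for \<xi> :: real
    by (rule order_trans[OF power_mono power_increasing[OF assms]]) auto
  have "\<exists>G. dk k (E s c) G"
    by (rule mrel_dominated[where C = 1, OF en_E]) (use le in \<open>auto simp: norm_mult norm_power wt_def simp flip: of_real_add of_real_power\<close>)
  then obtain G where G: "dk k (E s c) G" by blast
  have 1: "norm G \<le> 1 * norm c"
    by (rule mrel_norm_le[OF G en_E]) (use le in \<open>auto simp: norm_mult norm_power wt_def simp flip: of_real_add of_real_power\<close>)
  have 2: "norm G \<le> 1 * norm (Aop c)" if "1 \<le> k"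
  proof (rule mrel_norm_le[OF G mrel_comp[OF en_E]])
    show "mrel Aw c (Aop c)" by (simp add: mrel_bm Aop_def)
    fix \<xi> :: real
    from that assms obtain j r where j: "k = Suc j" "s = Suc r" by (cases k; cases s) auto
    then have "j \<le> r" using assms by simp
    then have "\<bar>\<xi>\<bar> ^ j \<le> (1 + \<bar>\<xi>\<bar>) ^ r"
      by (intro order_trans[OF power_mono power_increasing]) auto
    then have "\<bar>\<xi>\<bar> * \<bar>\<xi>\<bar> ^ j \<le> \<bar>\<xi>\<bar> * (1 + \<bar>\<xi>\<bar>) ^ r" by (rule mult_left_mono) simp
    moreover have "0 < 1 + \<bar>\<xi>\<bar>" by simp
    ultimately have "\<bar>\<xi>\<bar> ^ k \<le> \<bar>\<xi>\<bar> / (1 + \<bar>\<xi>\<bar>) * (1 + \<bar>\<xi>\<bar>) ^ s" unfolding j by simp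
    moreover have "cmod (Aw \<xi> * wt s \<xi>) = \<bar>\<xi>\<bar> / (1 + \<bar>\<xi>\<bar>) * (1 + \<bar>\<xi>\<bar>) ^ s"
      unfolding Aw_def wt_def norm_mult norm_of_real by simp
    ultimately show "cmod ((\<i> * complex_of_real \<xi>) ^ k) \<le> 1 * cmod (Aw \<xi> * wt s \<xi>)"
      by (simp add: norm_power norm_mult)
  qed simp
  from that[OF G] 1 2 show ?thesis by simp
qed

lemma sobolev_E:
  assumes f: "f \<in> Lp 2" and c: "emb f = E s c"
  shows "f \<in> sobolev s 2" "k \<le> s \<Longrightarrow> Lp_norm 2 (nabla k f) \<le> norm c"
    "1 \<le> k \<Longrightarrow> k \<le> s \<Longrightarrow> Lp_norm 2 (nabla k f) \<le> norm (Aop c)" "sobolev_norm s 2 f \<le> (real s + 1) * norm c"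
proof -
  have main: "Lp_norm 2 (nabla k f) \<le> norm c \<and> (1 \<le> k \<longrightarrow> Lp_norm 2 (nabla k f) \<le> norm (Aop c))" if k: "k \<le> s" for k
  proof -
    from E_dk[OF k, of c] obtain G where G: "dk k (emb f) G" "norm G \<le> norm c" "1 \<le> k \<Longrightarrow> norm G \<le> norm (Aop c)" unfolding c by blast
    from nabla_dk[OF f G(1)] have "Lp_norm 2 (nabla k f) = norm G" by (metis norm_emb)
    with G show ?thesis by simp
  qed
  from E_dk[OF order_refl, of s c] obtain G where "dk s (emb f) G" unfolding c by blast
  then show "f \<in> sobolev s 2" unfolding sobolev_2_iff[OF f] by blast
  show "k \<le> s \<Longrightarrow> Lp_norm 2 (nabla k f) \<le> norm c" "1 \<le> k \<Longrightarrow> k \<le> s \<Longrightarrow> Lp_norm 2 (nabla k f) \<le> norm (Aop c)"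
    using main by blast+
  have "sobolev_norm s 2 f \<le> (\<Sum>k\<le>s. norm c)" unfolding sobolev_norm_def using main by (intro sum_mono) auto
  then show "sobolev_norm s 2 f \<le> (real s + 1) * norm c" by (simp add: add.commute)
qed

section \<open>Antiderivatives and dispersive decay of the data\<close>

lemma mrel_add_fun:
  assumes "mrel m F G" "mrel n F H" shows "mrel (\<lambda>\<xi>. m \<xi> + n \<xi>) F (G + H)"
  unfolding mrel_def FT_add using assms[unfolded mrel_def] rep_plus[of "FT G" "FT H"]
  by eventually_elim (simp add: distrib_right)

lemma Hdot_minus2_mrel:
  assumes u: "u \<in> Hdot_minus2"
  obtains G where "mrel (\<lambda>\<xi>. 1 / complex_of_real (\<xi>\<^sup>2)) (emb u) G" "norm G \<le> Hdot_minus2_norm u"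
proof -
  have u2: "u \<in> Lp 2" and w: "(\<lambda>\<xi>. fourier u \<xi> / complex_of_real (\<bar>\<xi>\<bar>\<^sup>2)) \<in> Lp 2" using u by (auto simp: Hdot_minus2_def)
  let ?w = "\<lambda>\<xi>. fourier u \<xi> / complex_of_real (\<bar>\<xi>\<bar>\<^sup>2)"
  define G where "G = iFT (emb ?w)"
  have "mrel (\<lambda>\<xi>. 1 / complex_of_real (\<xi>\<^sup>2)) (emb u) G"
    unfolding mrel_def G_def FT_iFT emb_fourier[OF u2, symmetric]
    using rep_emb[OF w] rep_emb[OF fourier_Lp2[OF u2]] by eventually_elim simp
  moreover have "norm G \<le> Hdot_minus2_norm u"
  proof -
    have "sqrt (2 * pi) * norm G = Hdot_minus2_norm u"
      unfolding norm_FT[symmetric] G_def FT_iFT Hdot_minus2_norm_def norm_emb[OF w] ..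
    moreover have "1 * norm G \<le> sqrt (2 * pi) * norm G"
      using pi_gt3 by (intro mult_right_mono) auto
    ultimately show ?thesis by simp
  qed
  ultimately show ?thesis using that by blast
qed

text \<open>The symbol \<open>- wt s \<xi> / \<xi>\<^sup>2\<close> is split at frequency 1: below,
  the weight is at most \<open>2 ^ s\<close> and the norm of order -2 takes over; above, the
  quotient is dominated by the weight, hence by \<open>b\<close>. The bound on \<open>U\<close> is
  interpolation by one integration by parts.\<close>

lemma antiderivatives:
  assumes u: "u \<in> Hdot_minus2" and b: "emb u = E s b"
  obtains U V where "dk 1 U b" "dk 2 V b" "norm V \<le> 2 ^ s * Hdot_minus2_norm u + norm b" "(norm U)\<^sup>2 \<le> norm V * norm b"
proof -
  from Hdot_minus2_mrel[OF u] obtain G where G: "mrel (\<lambda>\<xi>. 1 / complex_of_real (\<xi>\<^sup>2)) (emb u) G" "norm G \<le> Hdot_minus2_norm u" .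
  have wb: "en s (emb u) b" by (simp add: b)
  define m1 where "m1 = (\<lambda>\<xi>. complex_of_real (indicat_real {-1..1} \<xi>) * (- wt s \<xi> / complex_of_real (\<xi>\<^sup>2)))"
  define m2 where "m2 = (\<lambda>\<xi>. complex_of_real (indicat_real (- {-1..1}) \<xi>) * (- wt s \<xi> / complex_of_real (\<xi>\<^sup>2)))"
  have [measurable]: "m1 \<in> borel_measurable borel" "m2 \<in> borel_measurable borel" unfolding m1_def m2_def by measurable
  have m1: "cmod (m1 \<xi>) \<le> 2 ^ s * cmod (1 / complex_of_real (\<xi>\<^sup>2))" for \<xi>
  proof (cases "\<xi> \<in> {-1..1}")
    case True
    then have "(1 + \<bar>\<xi>\<bar>) ^ s \<le> 2 ^ s" by (intro power_mono) auto
    then have "cmod (wt s \<xi>) \<le> 2 ^ s" unfolding wt_def norm_of_real by simp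
    then show ?thesis using True by (simp add: m1_def norm_mult norm_divide divide_right_mono)
  qed (simp add: m1_def)
  have m2: "cmod (m2 \<xi>) \<le> 1 * cmod (wt s \<xi>)" for \<xi>
  proof (cases "\<xi> \<in> {-1..1}")
    case False
    then have "1 \<le> \<bar>\<xi>\<bar>" by auto
    then have "1 \<le> \<xi>\<^sup>2" by (metis one_power2 power2_abs power_mono zero_le_one)
    then have "cmod (wt s \<xi>) / \<xi>\<^sup>2 \<le> cmod (wt s \<xi>) / 1" by (intro frac_le) auto
    then show ?thesis using False by (simp add: m2_def norm_mult norm_divide norm_power)
  qed (simp add: m2_def)
  have "\<exists>V1. mrel m1 (emb u) V1" by (rule mrel_dominated[OF G(1) _ _ m1]) measurable
  then obtain V1 where V1: "mrel m1 (emb u) V1" by blast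
  have "\<exists>V2. mrel m2 (emb u) V2" by (rule mrel_dominated[OF wb _ _ m2]) measurable
  then obtain V2 where V2: "mrel m2 (emb u) V2" by blast
  define V where "V = V1 + V2"
  have n1: "norm V1 \<le> 2 ^ s * norm G" by (rule mrel_norm_le[OF V1 G(1) _ m1]) simp
  have n2: "norm V2 \<le> 1 * norm b" by (rule mrel_norm_le[OF V2 wb _ m2]) simp
  have nV: "norm V \<le> 2 ^ s * Hdot_minus2_norm u + norm b"
    unfolding V_def using n1 n2 G(2) by (intro norm_triangle_le add_mono order_trans[OF n1] mult_left_mono) auto
  \<comment> \<open>The minus sign in the symbols matches the square of \<open>\<i> * \<xi>\<close>;
    the required identity holds except at frequency 0, a null set.\<close>
  have dV: "dk 2 V b"
    using mrel_add_fun[OF V1 V2, folded V_def] wb AE_lborel_singleton[of 0] unfolding mrel_def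
    by eventually_elim (auto simp: m1_def m2_def indicator_def power_mult_distrib)
  then obtain U where VU: "dk 1 V U" using dk_lower[of 2 V b 1] by auto
  have U: "dk 1 U b" by (rule dk_split[OF _ VU]) (use dV in \<open>simp add: numeral_2_eq_2\<close>)
  have "(norm U)\<^sup>2 = - inner V b" using dk_inner_skew[OF VU U] by (simp add: power2_norm_eq_inner)
  also have "\<dots> \<le> norm V * norm b" using norm_cauchy_schwarz[of "- V" b] by simp
  finally show ?thesis using that U dV nV by blast
qed

lemma Lp_norm_1: "Lp_norm 1 f = (LINT x|lborel. cmod (f x))"
  by (simp add: Lp_norm_def)

lemma sobolev_1_integrable:
  assumes f: "f \<in> sobolev s 1" and j: "j \<le> s"
  shows "integrable lborel (nabla j f)" "(LINT x|lborel. cmod (nabla j f x)) \<le> sobolev_norm s 1 f"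
proof -
  from f j obtain g where g: "g \<in> Lp 1" "weak_deriv j f g" by (auto simp: sobolev_def)
  have [measurable]: "nabla j f \<in> borel_measurable borel" "g \<in> borel_measurable borel"
    using weak_deriv_measurable(2)[OF weak_deriv_nabla[OF g(2)]] weak_deriv_measurable(2)[OF g(2)] by auto
  have "integrable lborel g" using g(1) by (auto simp: Lp_def integrable_norm_iff)
  then show "integrable lborel (nabla j f)"
    by (rule integrable_cong_AE_imp) (use nabla_AE[OF g(2)] in auto)
  have "Lp_norm 1 (nabla j f) \<le> sobolev_norm s 1 f"
    unfolding sobolev_norm_def
    by (rule member_le_sum) (use j in \<open>auto simp: Lp_norm_def\<close>)
  then show "(LINT x|lborel. cmod (nabla j f x)) \<le> sobolev_norm s 1 f" by (simp only: Lp_norm_1)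
qed

text \<open>The group commutes with derivatives, so the dispersive estimate holds for each of them
  up to order \<open>s\<close>, as multiplication on encodings demands.\<close>

lemma sobolev_1_decay:
  assumes u: "u \<in> sobolev s 2" "u \<in> sobolev s 1" and b: "emb u = E s b" and t: "0 < t" and s: "1 \<le> s"
  shows "norm (ph s (sg t b) f) \<le> 3 ^ s * sobolev_norm s 1 u / sqrt t * norm f"
proof -
  have "wb s (sobolev_norm s 1 u / sqrt t) (E s (sg t b))"
    unfolding wb_def sg_E[symmetric] b[symmetric]
  proof (intro allI impI)
    fix j assume j: "j \<le> s"
    have "bd (sobolev_norm s 1 u / sqrt t) (sg t (emb (nabla j u)))"
      by (rule bd_mono[OF dispersive[OF sobolev_nabla_dk(1)[OF u(1) j] sobolev_1_integrable(1)[OF u(2) j] t]])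
        (use t sobolev_1_integrable(2)[OF u(2) j] in \<open>simp add: divide_right_mono\<close>)
    then show "\<exists>Q. dk j (sg t (emb u)) Q \<and> bd (sobolev_norm s 1 u / sqrt t) Q"
      using dk_sg[OF sobolev_nabla_dk(2)[OF u(1) j]] by blast
  qed
  from wb_ph[OF s this] show ?thesis by simp
qed

section \<open>Time integrals and the nonlinearity in the Hilbert space\<close>

lemma emb_cmult: "f \<in> Lp 2 \<Longrightarrow> emb (\<lambda>x. c * f x) = cs c (emb f)"
  unfolding cs_def by (simp add: mulf_emb)

lemma emb_sum:
  "finite A \<Longrightarrow> (\<And>i. i \<in> A \<Longrightarrow> f i \<in> Lp 2) \<Longrightarrow> (\<lambda>x. \<Sum>i\<in>A. f i x) \<in> Lp 2 \<and> emb (\<lambda>x. \<Sum>i\<in>A. f i x) = (\<Sum>i\<in>A. emb (f i))"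
  by (induction A rule: finite_induct) (auto simp: Lp2_zero zero_l2_def emb_add Lp2_add)

text \<open>The map \<open>emb\<close> sends a Riemann sum to the Riemann sum of the embedded
  integrand, so both sides are the same limit along the division filter.\<close>

lemma has_L2_integral_iff:
  assumes ab: "a \<le> b" and G: "\<And>\<tau>. \<tau> \<in> {a..b} \<Longrightarrow> G \<tau> \<in> Lp 2"
  shows "has_L2_integral G J a b \<longleftrightarrow> J \<in> Lp 2 \<and> ((\<lambda>\<tau>. emb (G \<tau>)) has_integral emb J) {a..b}"
proof -
  have "((\<lambda>p. Lp_norm 2 (\<lambda>x. (\<Sum>(\<tau>, K)\<in>p. measure lborel K *\<^sub>R G \<tau> x) - J x)) \<longlongrightarrow> 0) (division_filter {a..b}) \<longleftrightarrow>
      ((\<lambda>p. norm ((\<Sum>(\<tau>, K)\<in>p. measure lborel K *\<^sub>R emb (G \<tau>)) - emb J)) \<longlongrightarrow> 0) (division_filter {a..b})" if J: "J \<in> Lp 2"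
  proof (rule tendsto_cong, rule eventually_mono[OF eventually_division_filter_tagged_division])
    fix p assume p: "p tagged_division_of {a..b}"
    have m: "case i of (\<tau>, K) \<Rightarrow> G \<tau> \<in> Lp 2" if "i \<in> p" for i
      using tagged_division_ofD(2,3)[OF p] that G by (cases i) blast
    have l: "(\<lambda>x. case i of (\<tau>, K) \<Rightarrow> measure lborel K *\<^sub>R G \<tau> x) \<in> Lp 2" "emb (\<lambda>x. case i of (\<tau>, K) \<Rightarrow> measure lborel K *\<^sub>R G \<tau> x) = (case i of (\<tau>, K) \<Rightarrow> measure lborel K *\<^sub>R emb (G \<tau>))"
      if "i \<in> p" for i
      using m[OF that] by (cases i, simp add: Lp2_scaleR emb_scaleR)+
    from emb_sum[OF tagged_division_ofD(1)[OF p] l(1)] l(2)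
    have "(\<lambda>x. \<Sum>(\<tau>, K)\<in>p. measure lborel K *\<^sub>R G \<tau> x) \<in> Lp 2" "emb (\<lambda>x. \<Sum>(\<tau>, K)\<in>p. measure lborel K *\<^sub>R G \<tau> x) = (\<Sum>(\<tau>, K)\<in>p. measure lborel K *\<^sub>R emb (G \<tau>))"
      by (auto simp: case_prod_unfold intro!: sum.cong)
    then show "Lp_norm 2 (\<lambda>x. (\<Sum>(\<tau>, K)\<in>p. measure lborel K *\<^sub>R G \<tau> x) - J x) = norm ((\<Sum>(\<tau>, K)\<in>p. measure lborel K *\<^sub>R emb (G \<tau>)) - emb J)"
      using J by (simp add: norm_emb[symmetric] emb_diff Lp2_diff)
  qed
  then show ?thesis
    unfolding has_L2_integral_def using G
      has_integral_cbox[of "\<lambda>\<tau>. emb (G \<tau>)" "emb J" a b]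
    by (auto simp: tendsto_norm_zero_iff LIM_zero_iff)
qed

lemma emb_nonlinearity:
  assumes s: "1 \<le> s" and g: "(\<lambda>x. f x - complex_of_real a) \<in> Lp 2" and q: "emb (\<lambda>x. f x - complex_of_real a) = E s q"
  shows "nonlinearity \<sigma> a \<tau> f \<in> Lp 2" "emb (nonlinearity \<sigma> a \<tau> f) = (\<sigma> / \<tau>) *\<^sub>R E s (Nh s a q)"
proof -
  let ?G = "E s q"
  let ?N = "a\<^sup>2 *\<^sub>R (?G + lcnj ?G) + (a *\<^sub>R pr ?G ?G + (2 * a) *\<^sub>R pr ?G (lcnj ?G) + pr ?G (pr ?G (lcnj ?G)))"
  have N: "E s (Nh s a q) = ?N"
    unfolding Nh_def
    by (simp only: linear_add[OF bounded_linear.linear[OF bounded_linear_E]] linear_cmul[OF bounded_linear.linear[OF bounded_linear_E]] lcnj_E E_ph[OF s])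
  have [measurable]: "f \<in> borel_measurable borel"
  proof -
    have "(\<lambda>x. (f x - complex_of_real a) + complex_of_real a) \<in> borel_measurable borel"
      by (intro borel_measurable_add Lp2_measurable[OF g]) simp
    then show ?thesis by simp
  qed
  note bd = E_bd[OF s, of q]
  \<comment> \<open>Expanding around the background \<open>a\<close> removes the constant term, so
    every summand contains \<open>w\<close> or its conjugate.\<close>
  have alg: "complex_of_real (\<sigma> / \<tau> * ((cmod z)\<^sup>2 - a\<^sup>2)) * z = (\<sigma> / \<tau>) *\<^sub>R (a\<^sup>2 *\<^sub>R (w + cnj w) + (a *\<^sub>R (w * w) + (2 * a) *\<^sub>R (w * cnj w) + w * (w * cnj w)))"
    if w: "w = z - complex_of_real a" for z w
  proof -
    have z: "z = w + complex_of_real a" using w by simp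
    have "complex_of_real ((cmod z)\<^sup>2 - a\<^sup>2) = (w + complex_of_real a) * (cnj w + complex_of_real a) - (complex_of_real a)\<^sup>2"
      unfolding of_real_diff complex_norm_square by (simp add: z)
    then have "complex_of_real (\<sigma> / \<tau> * ((cmod z)\<^sup>2 - a\<^sup>2)) * z = complex_of_real (\<sigma> / \<tau>) * (((w + complex_of_real a) * (cnj w + complex_of_real a) - (complex_of_real a)\<^sup>2) * (w + complex_of_real a))"
      unfolding of_real_mult[of "\<sigma> / \<tau>"] z[symmetric] by (simp only: mult.assoc)
    then show ?thesis by (simp add: scaleR_conv_of_real power2_eq_square) (simp add: algebra_simps)
  qed
  have "AE x in lborel. rep_l2 ((\<sigma> / \<tau>) *\<^sub>R ?N) x = nonlinearity \<sigma> a \<tau> f x"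
    using rep_emb[OF g] rep_scaleR[of "\<sigma> / \<tau>" ?N] rep_plus[of "a\<^sup>2 *\<^sub>R (?G + lcnj ?G)" "a *\<^sub>R pr ?G ?G + (2 * a) *\<^sub>R pr ?G (lcnj ?G) + pr ?G (pr ?G (lcnj ?G))"]
      rep_scaleR[of "a\<^sup>2" "?G + lcnj ?G"] rep_plus[of ?G "lcnj ?G"] rep_lcnj[of ?G]
      rep_plus[of "a *\<^sub>R pr ?G ?G + (2 * a) *\<^sub>R pr ?G (lcnj ?G)" "pr ?G (pr ?G (lcnj ?G))"]
      rep_plus[of "a *\<^sub>R pr ?G ?G" "(2 * a) *\<^sub>R pr ?G (lcnj ?G)"] rep_scaleR[of a "pr ?G ?G"] rep_scaleR[of "2 * a" "pr ?G (lcnj ?G)"]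
      rep_pr[OF bd, of ?G] rep_pr[OF bd, of "lcnj ?G"] rep_pr[OF bd, of "pr ?G (lcnj ?G)"]
    unfolding q
  proof eventually_elim
    case (elim x)
    show ?case unfolding nonlinearity_def alg[OF elim(1)] using elim(2-) by (simp only:)
  qed
  then have ae: "AE x in lborel. nonlinearity \<sigma> a \<tau> f x = rep_l2 ((\<sigma> / \<tau>) *\<^sub>R ?N) x" by eventually_elim simp
  show m: "nonlinearity \<sigma> a \<tau> f \<in> Lp 2"
    by (rule Lp2_cong[OF rep_l2_Lp2 _ ae]) (unfold nonlinearity_def, measurable)
  from emb_cong[OF m rep_l2_Lp2 ae] show "emb (nonlinearity \<sigma> a \<tau> f) = (\<sigma> / \<tau>) *\<^sub>R E s (Nh s a q)"
    by (simp add: N)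
qed

section \<open>Solutions of the equation\<close>

lemma Lp_norm_nonneg: "0 < p \<Longrightarrow> 0 \<le> Lp_norm p f"
  unfolding Lp_norm_def by (rule real_root_ge_zero) simp

lemma sobolev_norm_nonneg: "0 < p \<Longrightarrow> 0 \<le> sobolev_norm s p f"
  unfolding sobolev_norm_def by (intro sum_nonneg Lp_norm_nonneg)

lemma powr_minus_half: "0 < t \<Longrightarrow> t powr - (1 / 2) = 1 / sqrt t"
  by (simp add: powr_minus_divide powr_half_sqrt)

lemma E_add: "E s (F + G) = E s F + E s G"
  by (rule linear_add[OF bounded_linear.linear[OF bounded_linear_E]])

lemma E_diff: "E s (F - G) = E s F - E s G"
  by (rule linear_diff[OF bounded_linear.linear[OF bounded_linear_E]])

lemma E_scaleR: "E s (r *\<^sub>R F) = r *\<^sub>R E s F"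
  by (rule linear_cmul[OF bounded_linear.linear[OF bounded_linear_E]])

locale scattering = scattering_data +
  fixes u :: "real \<Rightarrow> complex"
  assumes u2: "u \<in> Lp 2" and ub: "emb u = E s b"
begin

definition P :: "real \<Rightarrow> l2" where "P t = cs (cis (\<sigma> * a\<^sup>2 * ln t)) b"

lemma sg_p: "sg (- t) (p t) = P t" by (simp add: p_def P_def sg_cs)

lemma P_deriv:
  assumes "0 < t"
  shows "(P has_vector_derivative cs (\<i> * \<sigma>) ((a\<^sup>2 / t) *\<^sub>R P t)) (at t within S)"
proof -
  have "((\<lambda>\<tau>. cis (\<sigma> * a\<^sup>2 * ln \<tau>)) has_vector_derivative (\<sigma> * a\<^sup>2 / t) *\<^sub>R (\<i> * cis (\<sigma> * a\<^sup>2 * ln t))) (at t within S)"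
    unfolding has_vector_derivative_def
    by (rule has_derivative_eq_rhs, rule has_derivative_cis[THEN has_derivative_compose[rotated]], (rule derivative_intros assms)+)
      (auto simp: fun_eq_iff scaleR_conv_of_real field_simps)
  from bounded_linear.has_vector_derivative[OF bounded_bilinear.bounded_linear_left[OF bounded_bilinear_cs, of b] this]
  show ?thesis unfolding P_def[abs_def]
    by (simp add: cs_of_real[symmetric] scaleR_conv_of_real mult_ac)
qed

lemma P_integral:
  assumes "t0 \<le> t" "t \<le> T"
  shows "((\<lambda>\<tau>. cs (\<i> * \<sigma>) ((a\<^sup>2 / \<tau>) *\<^sub>R P \<tau>)) has_integral (P T - P t)) {t..T}"
  by (rule fundamental_theorem_of_calculus[OF assms(2)], rule P_deriv) (use assms t0 in auto)

lemma v1_class: "(\<lambda>x. v1 \<sigma> a u t x - complex_of_real a) \<in> Lp 2" "emb (\<lambda>x. v1 \<sigma> a u t x - complex_of_real a) = E s (p t)"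
  by (simp_all add: v1_def Lp2_cmult schroedinger_Lp2[OF u2] emb_cmult emb_schroedinger[OF u2] ub p_def E_cs sg_E)

definition represents :: "(real \<Rightarrow> real \<Rightarrow> complex) \<Rightarrow> (real \<Rightarrow> l2) \<Rightarrow> bool" where
  "represents v r \<longleftrightarrow> (\<forall>t\<ge>t0. (\<lambda>x. v t x - v1 \<sigma> a u t x) \<in> Lp 2 \<and> emb (\<lambda>x. v t x - v1 \<sigma> a u t x) = E s (r t))"

lemma representsD:
  assumes "represents v r" "t0 \<le> t"
  shows "(\<lambda>x. v t x - v1 \<sigma> a u t x) \<in> Lp 2" "emb (\<lambda>x. v t x - v1 \<sigma> a u t x) = E s (r t)"
    "(\<lambda>x. v t x - complex_of_real a) \<in> Lp 2" "emb (\<lambda>x. v t x - complex_of_real a) = E s (p t + r t)"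
proof -
  show 1: "(\<lambda>x. v t x - v1 \<sigma> a u t x) \<in> Lp 2" "emb (\<lambda>x. v t x - v1 \<sigma> a u t x) = E s (r t)"
    using assms by (auto simp: represents_def)
  show "(\<lambda>x. v t x - complex_of_real a) \<in> Lp 2" "emb (\<lambda>x. v t x - complex_of_real a) = E s (p t + r t)"
    using Lp2_add[OF v1_class(1)[of t] 1(1)] emb_add[OF v1_class(1)[of t] 1(1)] by (simp_all add: v1_class 1 E_add)
qed

definition full_rhs :: "(real \<Rightarrow> l2) \<Rightarrow> real \<Rightarrow> l2" where
  "full_rhs r \<tau> = (\<sigma> / \<tau>) *\<^sub>R sg (- \<tau>) (Nh s a (p \<tau> + r \<tau>))"

lemma full_rhs_continuous: "continuous_on {t0..} r \<Longrightarrow> continuous_on {t0..} (full_rhs r)"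
  unfolding full_rhs_def[abs_def] by (intro continuous_intros p_continuous s) (use t0 in auto)

text \<open>By \<open>P_deriv\<close> the extra term is the time derivative of the logarithmic
  phase, so it integrates to the change of \<open>P\<close>; this is how the resonant term leaves
  the equation for the remainder.\<close>

lemma full_rhs_eq: "cs \<i> (full_rhs r \<tau>) = cs (\<i> * \<sigma>) (remainder_rhs r \<tau>) + cs (\<i> * \<sigma>) ((a\<^sup>2 / \<tau>) *\<^sub>R P \<tau>)"
proof -
  have "full_rhs r \<tau> = \<sigma> *\<^sub>R (remainder_rhs r \<tau> + (a\<^sup>2 / \<tau>) *\<^sub>R P \<tau>)"
    unfolding full_rhs_def remainder_rhs_def by (simp add: sg_diff sg_scaleR sg_p scaleR_diff_right scaleR_add_right)
  then show ?thesis
    by (simp add: cs_of_real[symmetric, of \<sigma>] bounded_bilinear.add_right[OF bounded_bilinear_cs])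
qed

lemma full_rhs_integral:
  assumes r: "continuous_on {t0..} r" and t: "t0 \<le> t"
  shows "cs \<i> (integral {t0..t} (full_rhs r)) = cs (\<i> * \<sigma>) (integral {t0..t} (remainder_rhs r)) + (P t - P t0)"
proof -
  note bl = bounded_bilinear.bounded_linear_right[OF bounded_bilinear_cs]
  have "((\<lambda>\<tau>. cs \<i> (full_rhs r \<tau>)) has_integral cs \<i> (integral {t0..t} (full_rhs r))) {t0..t}"
    using has_integral_linear[OF integrable_integral[OF tail_integrable[OF full_rhs_continuous[OF r] order_refl]] bl] by (simp add: o_def)
  moreover have "((\<lambda>\<tau>. cs \<i> (full_rhs r \<tau>)) has_integral cs (\<i> * \<sigma>) (integral {t0..t} (remainder_rhs r)) + (P t - P t0)) {t0..t}"
    unfolding full_rhs_eq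
    using has_integral_add[OF has_integral_linear[OF integrable_integral[OF remainder_rhs_integrable[OF r order_refl]] bl, unfolded o_def] P_integral[OF order_refl t]] .
  ultimately show ?thesis by (rule has_integral_unique)
qed

text \<open>Applying \<open>sg (- t)\<close> strips the free evolution from the Duhamel formula, and
  \<open>full_rhs_integral\<close> cancels the profile of \<open>v1\<close>. Since \<open>J\<close>
  is determined up to null sets, the existential statement amounts to one equation.\<close>

lemma duhamel_pointwise:
  assumes v: "represents v r" and r: "continuous_on {t0..} r" and t: "t0 \<le> t"
  shows "(\<exists>J. has_L2_integral (\<lambda>\<tau>. schroedinger (t - \<tau>) (nonlinearity \<sigma> a \<tau> (v \<tau>))) J t0 t \<and>
      (AE x in lborel. v t x - a = schroedinger (t - t0) (\<lambda>y. v t0 y - a) x + \<i> * J x)) \<longleftrightarrow>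
    sg (- t) (r t) = sg (- t0) (r t0) + cs (\<i> * \<sigma>) (integral {t0..t} (remainder_rhs r))"
proof -
  let ?G = "\<lambda>\<tau>. schroedinger (t - \<tau>) (nonlinearity \<sigma> a \<tau> (v \<tau>))"
  let ?S = "schroedinger (t - t0) (\<lambda>y. v t0 y - a)"
  let ?K = "integral {t0..t} (full_rhs r)"
  note D = representsD[OF v]
  note N = emb_nonlinearity[OF s D(3,4), of _ \<sigma>]
  have G: "?G \<tau> \<in> Lp 2" if "\<tau> \<in> {t0..t}" for \<tau> using that by (intro schroedinger_Lp2 N) auto
  have eG: "emb (?G \<tau>) = E s (sg t (full_rhs r \<tau>))" if "\<tau> \<in> {t0..t}" for \<tau>
    using that by (simp add: emb_schroedinger N full_rhs_def sg_scaleR sg_E E_scaleR)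
  have bl: "bounded_linear (\<lambda>x. E s (sg t x))" by (rule bounded_linear_compose[OF bounded_linear_E bounded_linear_sg])
  have "((\<lambda>\<tau>. E s (sg t (full_rhs r \<tau>))) has_integral E s (sg t ?K)) {t0..t}"
    using has_integral_linear[OF integrable_integral[OF tail_integrable[OF full_rhs_continuous[OF r] order_refl]] bl] by (simp add: o_def)
  then have I: "((\<lambda>\<tau>. emb (?G \<tau>)) has_integral E s (sg t ?K)) {t0..t}"
    by (rule has_integral_eq[rotated]) (simp add: eG)
  have S: "?S \<in> Lp 2" "emb ?S = E s (sg (t - t0) (p t0 + r t0))"
    by (simp_all add: schroedinger_Lp2 emb_schroedinger D[OF order_refl] sg_E)
  have J: "(AE x in lborel. v t x - a = ?S x + \<i> * J x) \<longleftrightarrow> E s (p t + r t) = E s (sg (t - t0) (p t0 + r t0) + cs \<i> (sg t ?K))"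
    if "J \<in> Lp 2" "emb J = E s (sg t ?K)" for J
    unfolding emb_eq_iff[OF D(3)[OF t] Lp2_add[OF S(1) Lp2_cmult[OF that(1)]], symmetric]
      emb_add[OF S(1) Lp2_cmult[OF that(1)]] S(2) emb_cmult[OF that(1)] that(2) D(4)[OF t] E_add E_cs ..
  have "(\<exists>J. has_L2_integral ?G J t0 t \<and> (AE x in lborel. v t x - a = ?S x + \<i> * J x)) \<longleftrightarrow>
      E s (p t + r t) = E s (sg (t - t0) (p t0 + r t0) + cs \<i> (sg t ?K))" (is "?L \<longleftrightarrow> ?R")
  proof
    assume ?L
    then obtain J where j: "has_L2_integral ?G J t0 t" "AE x in lborel. v t x - a = ?S x + \<i> * J x" by blast
    have "J \<in> Lp 2" "((\<lambda>\<tau>. emb (?G \<tau>)) has_integral emb J) {t0..t}"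
      using j(1) has_L2_integral_iff[OF t G, where J = J] by auto
    moreover from this(2) have "emb J = E s (sg t ?K)" by (rule has_integral_unique[OF _ I])
    ultimately show ?R using J j(2) by blast
  next
    assume ?R
    then have "AE x in lborel. v t x - a = ?S x + \<i> * rep_l2 (E s (sg t ?K)) x" by (subst J) auto
    moreover have "has_L2_integral ?G (rep_l2 (E s (sg t ?K))) t0 t" using I has_L2_integral_iff[OF t G, where J = "rep_l2 (E s (sg t ?K))"] by simp
    ultimately show ?L by blast
  qed
  also have "\<dots> \<longleftrightarrow> p t + r t = sg (t - t0) (p t0 + r t0) + cs \<i> (sg t ?K)" by (auto dest: E_inj)
  also have "\<dots> \<longleftrightarrow> sg (- t) (p t + r t) = sg (- t) (sg (t - t0) (p t0 + r t0) + cs \<i> (sg t ?K))"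
  proof
    assume "sg (- t) (p t + r t) = sg (- t) (sg (t - t0) (p t0 + r t0) + cs \<i> (sg t ?K))"
    then have "sg t (sg (- t) (p t + r t)) = sg t (sg (- t) (sg (t - t0) (p t0 + r t0) + cs \<i> (sg t ?K)))" by (rule arg_cong)
    then show "p t + r t = sg (t - t0) (p t0 + r t0) + cs \<i> (sg t ?K)" by simp
  qed simp
  also have "\<dots> \<longleftrightarrow> P t + sg (- t) (r t) = P t0 + sg (- t0) (r t0) + cs \<i> ?K"
    by (simp add: sg_add sg_cs sg_p[symmetric])
  also have "\<dots> \<longleftrightarrow> sg (- t) (r t) = sg (- t0) (r t0) + cs (\<i> * \<sigma>) (integral {t0..t} (remainder_rhs r))"
    unfolding full_rhs_integral[OF r t] by (simp add: algebra_simps)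
  finally show ?thesis .
qed

text \<open>Differences of the formula started at \<open>t0\<close> give it between any two later
  times. In this form the final time is free, and letting it grow leads to the equation from
  infinite time.\<close>

lemma duhamel_iff:
  assumes v: "represents v r" and r: "continuous_on {t0..} r"
  shows "duhamel_solution \<sigma> a t0 v \<longleftrightarrow>
    (\<forall>t\<ge>t0. \<forall>T\<ge>t. sg (- t) (r t) = sg (- T) (r T) - cs (\<i> * \<sigma>) (integral {t..T} (remainder_rhs r)))"
proof -
  note D = representsD[OF v]
  have "duhamel_solution \<sigma> a t0 v \<longleftrightarrow> (\<forall>t\<ge>t0. sg (- t) (r t) = sg (- t0) (r t0) + cs (\<i> * \<sigma>) (integral {t0..t} (remainder_rhs r)))" (is "_ \<longleftrightarrow> ?L")
    unfolding duhamel_solution_def using D(3) emb_nonlinearity(1)[OF s D(3,4)] duhamel_pointwise[OF v r] by simp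
  also have "\<dots> \<longleftrightarrow> (\<forall>t\<ge>t0. \<forall>T\<ge>t. sg (- t) (r t) = sg (- T) (r T) - cs (\<i> * \<sigma>) (integral {t..T} (remainder_rhs r)))" (is "_ \<longleftrightarrow> ?R")
  proof
    assume L: ?L
    show ?R
    proof (intro allI impI)
      fix t T assume t: "t0 \<le> t" "t \<le> T"
      then have T: "t0 \<le> T" by simp
      show "sg (- t) (r t) = sg (- T) (r T) - cs (\<i> * \<sigma>) (integral {t..T} (remainder_rhs r))"
        unfolding L[rule_format, OF t(1)] L[rule_format, OF T] tail_split[OF remainder_rhs_continuous[OF r] order_refl t]
        by (simp add: bounded_bilinear.add_right[OF bounded_bilinear_cs])
    qed
  next
    assume R: ?R
    show ?L
    proof (intro allI impI)
      fix t assume "t0 \<le> t"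
      with R have "sg (- t0) (r t0) = sg (- t) (r t) - cs (\<i> * \<sigma>) (integral {t0..t} (remainder_rhs r))" by blast
      then show "sg (- t) (r t) = sg (- t0) (r t0) + cs (\<i> * \<sigma>) (integral {t0..t} (remainder_rhs r))" by simp
    qed
  qed
  finally show ?thesis .
qed

lemma represents_diff:
  assumes v: "represents v r" and t: "t0 \<le> t" "t0 \<le> \<tau>"
  shows "(\<lambda>x. (v \<tau> x - v1 \<sigma> a u \<tau> x) - (v t x - v1 \<sigma> a u t x)) \<in> Lp 2"
    "emb (\<lambda>x. (v \<tau> x - v1 \<sigma> a u \<tau> x) - (v t x - v1 \<sigma> a u t x)) = E s (r \<tau> - r t)"
  using Lp2_diff[OF representsD(1)[OF v t(2)] representsD(1)[OF v t(1)]]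
    emb_diff[OF representsD(1)[OF v t(2)] representsD(1)[OF v t(1)]] representsD(2)[OF v t(2)] representsD(2)[OF v t(1)]
  by (simp_all add: E_diff)

lemma asymptotic_solution_if_sol:
  assumes v: "represents v r" and sol: "sol r R"
  shows "asymptotic_solution \<sigma> t0 s a u v"
  unfolding asymptotic_solution_def
proof (intro conjI allI impI)
  note d = solD[OF sol] and D = representsD[OF v]
  show "duhamel_solution \<sigma> a t0 v" unfolding duhamel_iff[OF v d(1)] using d(4) by blast
  show "continuous_into_Hs s {t0..} (\<lambda>t x. v t x - v1 \<sigma> a u t x)"
    unfolding continuous_into_Hs_def
  proof (intro conjI ballI)
    fix t assume t: "t \<in> {t0..}"
    then have t': "t0 \<le> t" by simp
    show "(\<lambda>x. v t x - v1 \<sigma> a u t x) \<in> sobolev s 2" by (rule sobolev_E(1)[OF D(1,2)[OF t']])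
    show "((\<lambda>\<tau>. sobolev_norm s 2 (\<lambda>x. (v \<tau> x - v1 \<sigma> a u \<tau> x) - (v t x - v1 \<sigma> a u t x))) \<longlongrightarrow> 0) (at t within {t0..})"
    proof (rule Lim_null_comparison)
      show "\<forall>\<^sub>F \<tau> in at t within {t0..}. norm (sobolev_norm s 2 (\<lambda>x. (v \<tau> x - v1 \<sigma> a u \<tau> x) - (v t x - v1 \<sigma> a u t x))) \<le> (real s + 1) * norm (r \<tau> - r t)"
        unfolding eventually_at_filter
      proof (rule always_eventually, intro allI impI)
        fix \<tau> assume "\<tau> \<in> {t0..}"
        then have "t0 \<le> \<tau>" by simp
        from sobolev_E(4)[OF represents_diff[OF v t' this]]
        show "norm (sobolev_norm s 2 (\<lambda>x. (v \<tau> x - v1 \<sigma> a u \<tau> x) - (v t x - v1 \<sigma> a u t x))) \<le> (real s + 1) * norm (r \<tau> - r t)"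
          by (simp add: sobolev_norm_nonneg)
      qed
      have "(r \<longlongrightarrow> r t) (at t within {t0..})" using d(1) t by (simp add: continuous_on_def)
      then have "((\<lambda>\<tau>. (real s + 1) * norm (r \<tau> - r t)) \<longlongrightarrow> (real s + 1) * norm (r t - r t)) (at t within {t0..})"
        by (intro tendsto_intros)
      then show "((\<lambda>\<tau>. (real s + 1) * norm (r \<tau> - r t)) \<longlongrightarrow> 0) (at t within {t0..})" by simp
    qed
  qed
  have ev: "\<forall>\<^sub>F t in at_top. t0 \<le> t" by (rule eventually_ge_at_top)
  show "(\<lambda>t. Lp_norm 2 (\<lambda>x. v t x - v1 \<sigma> a u t x)) \<in> O(\<lambda>t. t powr (-1/2))"
  proof (rule bigoI[of _ R], rule eventually_mono[OF ev])
    fix t assume t: "t0 \<le> t"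
    have "Lp_norm 2 (\<lambda>x. v t x - v1 \<sigma> a u t x) \<le> R / sqrt t"
      unfolding norm_emb[OF D(1)[OF t], symmetric] D(2)[OF t] by (rule order_trans[OF norm_E_le d(3)[OF t]])
    then show "norm (Lp_norm 2 (\<lambda>x. v t x - v1 \<sigma> a u t x)) \<le> R * norm (t powr (-1/2))"
      using pos[OF t] by (simp add: Lp_norm_nonneg powr_minus_half)
  qed
  fix j assume j: "0 < j \<and> j \<le> s"
  show "(\<lambda>t. Lp_norm 2 (nabla j (\<lambda>x. v t x - v1 \<sigma> a u t x))) \<in> O(\<lambda>t. t powr (-1))"
  proof (rule bigoI[of _ "2 * (Z' + Lc R * R)"], rule eventually_mono[OF ev])
    fix t assume t: "t0 \<le> t"
    have "Lp_norm 2 (nabla j (\<lambda>x. v t x - v1 \<sigma> a u t x)) \<le> 2 * (Z' + Lc R * R) / t"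
      using sobolev_E(3)[OF D(1,2)[OF t], of j] sol_Aop_decay[OF sol t] j by simp
    then show "norm (Lp_norm 2 (nabla j (\<lambda>x. v t x - v1 \<sigma> a u t x))) \<le> 2 * (Z' + Lc R * R) * norm (t powr (-1))"
      using pos[OF t] by (simp add: Lp_norm_nonneg powr_minus_divide)
  qed
qed

text \<open>Every competitor satisfies \<open>sol\<close> with some radius, not necessarily small:
  the asymptotic rates bound it for late times, and continuity does so on the remaining compact
  interval.\<close>

lemma sol_if_asymptotic_solution:
  assumes "asymptotic_solution \<sigma> t0 s a u v"
  obtains r R where "represents v r" "sol r R"
proof -
  let ?w = "\<lambda>t x. v t x - v1 \<sigma> a u t x"
  have duh: "duhamel_solution \<sigma> a t0 v" and cont: "continuous_into_Hs s {t0..} ?w"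
    and O0: "(\<lambda>t. Lp_norm 2 (?w t)) \<in> O(\<lambda>t. t powr (-1/2))"
    and O1: "\<And>j. 0 < j \<Longrightarrow> j \<le> s \<Longrightarrow> (\<lambda>t. Lp_norm 2 (nabla j (?w t))) \<in> O(\<lambda>t. t powr (-1))"
    using assms unfolding asymptotic_solution_def by auto
  have w: "?w t \<in> sobolev s 2" if "t0 \<le> t" for t using cont that by (simp add: continuous_into_Hs_def)
  have "\<exists>c. emb (?w t) = E s c \<and> norm c \<le> 2 ^ s * sobolev_norm s 2 (?w t)" if "t0 \<le> t" for t
    using sobolev_enc[OF w[OF that]] by metis
  then obtain r where r: "\<And>t. t0 \<le> t \<Longrightarrow> emb (?w t) = E s (r t)" "\<And>t. t0 \<le> t \<Longrightarrow> norm (r t) \<le> 2 ^ s * sobolev_norm s 2 (?w t)"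
    by metis
  have v: "represents v r" unfolding represents_def using r(1) sobolev_Lp2[OF w] by blast
  have rc: "continuous_on {t0..} r"
    unfolding continuous_on_def
  proof
    fix t assume t: "t \<in> {t0..}"
    then have t': "t0 \<le> t" by simp
    show "(r \<longlongrightarrow> r t) (at t within {t0..})"
    proof (rule Lim_null[THEN iffD2], rule Lim_null_comparison)
      let ?n = "\<lambda>\<tau>. sobolev_norm s 2 (\<lambda>x. ?w \<tau> x - ?w t x)"
      show "\<forall>\<^sub>F \<tau> in at t within {t0..}. norm (r \<tau> - r t) \<le> 2 ^ s * ?n \<tau>"
        unfolding eventually_at_filter
      proof (rule always_eventually, intro allI impI)
        fix \<tau> assume "\<tau> \<in> {t0..}"
        then have "t0 \<le> \<tau>" by simp
        note rd = represents_diff[OF v t' this]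
        from sobolev_enc[OF sobolev_E(1)[OF rd]] obtain c where "E s (r \<tau> - r t) = E s c" "norm c \<le> 2 ^ s * ?n \<tau>"
          unfolding rd(2) by blast
        then show "norm (r \<tau> - r t) \<le> 2 ^ s * ?n \<tau>" using E_inj by metis
      qed
      have "(?n \<longlongrightarrow> 0) (at t within {t0..})" using cont t unfolding continuous_into_Hs_def by blast
      from tendsto_mult_left[OF this, of "2 ^ s"] show "((\<lambda>\<tau>. 2 ^ s * ?n \<tau>) \<longlongrightarrow> 0) (at t within {t0..})" by simp
    qed
  qed
  \<comment> \<open>All orders are brought to one common rate. Order 0 is separate because
    \<open>nabla 0\<close> may return another representative of the function.\<close>
  have O: "(\<lambda>t. Lp_norm 2 (nabla j (?w t))) \<in> O(\<lambda>t. t powr (-1/2))" if j: "j \<in> {..s}" for j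
  proof (cases "j = 0")
    case True
    have "\<forall>\<^sub>F t in at_top. Lp_norm 2 (nabla 0 (?w t)) = Lp_norm 2 (?w t)"
    proof (rule eventually_mono[OF eventually_ge_at_top[of t0]])
      fix t assume "t0 \<le> t"
      note m = representsD(1)[OF v this]
      have "dk 0 (emb (?w t)) (emb (?w t))" unfolding dk_0 ..
      from nabla_dk[OF m this] show "Lp_norm 2 (nabla 0 (?w t)) = Lp_norm 2 (?w t)" using m by (metis norm_emb)
    qed
    then show ?thesis using O0 unfolding True by (simp only: landau_o.big.in_cong)
  next
    case False
    have "(\<lambda>t::real. t powr (-1)) \<in> O(\<lambda>t. t powr (-1/2))"
    proof (rule bigoI[of _ 1], rule eventually_mono[OF eventually_ge_at_top[of 1]])
      fix t :: real assume "1 \<le> t"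
      then have "t powr (-1) \<le> t powr (-1/2)" by (intro powr_mono) auto
      then show "norm (t powr (-1)) \<le> 1 * norm (t powr (-1/2))" by (simp only: real_norm_def abs_of_nonneg[OF powr_ge_zero] mult_1_left)
    qed
    with O1[of j] False j show ?thesis by (auto intro: landau_o.big_trans)
  qed
  have "(\<lambda>t. sobolev_norm s 2 (?w t)) \<in> O(\<lambda>t. t powr (-1/2))"
    unfolding sobolev_norm_def by (rule big_sum_in_bigo) (rule O)
  then obtain c where c: "0 < c" "\<forall>\<^sub>F t in at_top. norm (sobolev_norm s 2 (?w t)) \<le> c * norm (t powr (-1/2))"
    by (rule landau_o.bigE)
  then obtain N where N: "\<And>t. N \<le> t \<Longrightarrow> norm (sobolev_norm s 2 (?w t)) \<le> c * norm (t powr (-1/2))"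
    by (auto simp: eventually_at_top_linorder)
  have "continuous_on {t0..N} (\<lambda>t. sqrt t *\<^sub>R r t)"
    by (intro continuous_intros continuous_on_subset[OF rc]) auto
  then have "bounded ((\<lambda>t. sqrt t *\<^sub>R r t) ` {t0..N})"
    by (intro compact_imp_bounded compact_continuous_image) auto
  then obtain B where B: "\<And>t. t \<in> {t0..N} \<Longrightarrow> norm (sqrt t *\<^sub>R r t) \<le> B" unfolding bounded_iff by blast
  define R where "R = max (2 ^ s * c) B"
  have "norm (r t) \<le> R / sqrt t" if t: "t0 \<le> t" for t
  proof (cases "N \<le> t")
    case True
    have "norm (r t) \<le> 2 ^ s * (c * (1 / sqrt t))"
      using N[OF True] pos[OF t] by (intro order_trans[OF r(2)[OF t]] mult_left_mono) (auto simp: powr_minus_half)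
    also have "\<dots> = (2 ^ s * c) / sqrt t" by simp
    also have "\<dots> \<le> R / sqrt t" using pos[OF t] by (intro divide_right_mono) (auto simp: R_def)
    finally show ?thesis .
  next
    case False
    then have "sqrt t * norm (r t) \<le> B" using B[of t] t pos[OF t] by simp
    then have "sqrt t * norm (r t) \<le> R" by (simp add: R_def)
    then show ?thesis using pos[OF t] by (simp add: pos_le_divide_eq mult.commute)
  qed
  moreover have "0 \<le> R" using c(1) by (simp add: R_def le_max_iff_disj)
  ultimately have "sol r R" unfolding sol_def using rc duhamel_iff[OF v rc] duh by blast
  with v that show ?thesis by blast
qed

theorem asymptotic_solution_exists_unique:
  assumes L: "Lc R \<le> sqrt t0 / 8" and Z: "2 * Z \<le> R"
  shows "\<exists>v. asymptotic_solution \<sigma> t0 s a u v \<and>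
    (\<forall>v'. asymptotic_solution \<sigma> t0 s a u v' \<longrightarrow> (\<forall>t\<ge>t0. AE x in lborel. v' t x = v t x))"
proof -
  from sol_exists[OF L Z] obtain r where r: "sol r R" ..
  define v where "v t x = v1 \<sigma> a u t x + rep_l2 (E s (r t)) x" for t x
  have v: "represents v r" unfolding represents_def by (simp add: v_def)
  show ?thesis
  proof (intro exI[of _ v] conjI allI impI)
    show "asymptotic_solution \<sigma> t0 s a u v" by (rule asymptotic_solution_if_sol[OF v r])
    fix v' t assume "asymptotic_solution \<sigma> t0 s a u v'" and t: "t0 \<le> t"
    then obtain r' R' where r': "represents v' r'" "sol r' R'" by (elim sol_if_asymptotic_solution)
    have "emb (\<lambda>x. v' t x - v1 \<sigma> a u t x) = emb (\<lambda>x. v t x - v1 \<sigma> a u t x)"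
      unfolding representsD(2)[OF v t] representsD(2)[OF r'(1) t] sol_unique[OF r r'(2) t] ..
    then have "AE x in lborel. v' t x - v1 \<sigma> a u t x = v t x - v1 \<sigma> a u t x"
      unfolding emb_eq_iff[OF representsD(1)[OF r'(1) t] representsD(1)[OF v t]] .
    then show "AE x in lborel. v' t x = v t x" by eventually_elim simp
  qed
qed

end

section \<open>Choice of the constants\<close>

context scattering_data
begin

text \<open>The bound \<open>Z \<le> A * \<eta>\<close> dictates the radius
  \<open>2 * A * \<eta>\<close>, and with it \<open>M0 + phC s * R\<close> is at most
  \<open>\<eta> * B\<close>. Squares of \<open>\<eta>\<close> are replaced by \<open>\<eta>\<close>,
  so that one linear condition suffices.\<close>

lemma smallness:
  assumes \<eta>: "0 < \<eta>" "\<eta> \<le> 1" "norm b \<le> \<eta>" "norm U \<le> \<eta>" "norm V \<le> \<eta>" "M0 \<le> \<eta>"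
    and A: "A = (2 + phC s) / sqrt t0 + 1" and B: "B = 1 + 2 * phC s * A"
    and small: "\<eta> * (2 * B + 3 * B\<^sup>2 / sqrt t0) \<le> sqrt t0 / 8"
  shows "Lc (2 * A * \<eta>) \<le> sqrt t0 / 8" "2 * Z \<le> 2 * A * \<eta>"
proof -
  note C = nonneg(4)
  have "\<eta> * \<eta> \<le> \<eta> * 1" using \<eta> by (intro mult_left_mono) auto
  then have e2: "\<eta> * \<eta> \<le> \<eta>" by simp
  have "norm U * norm U \<le> \<eta> * \<eta>" using \<eta> by (intro mult_mono) auto
  then have 1: "phC s * (norm U * norm U) \<le> phC s * \<eta>" using C e2 by (intro mult_left_mono) auto
  have "M0\<^sup>2 * norm b \<le> (\<eta> * 1) * 1" unfolding power2_eq_square using \<eta> M0 by (intro mult_mono) auto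
  then have "S1 \<le> \<eta> + phC s * \<eta> + \<eta>" unfolding S1_def using \<eta> 1 by simp
  then have "S1 / sqrt t0 \<le> (\<eta> + phC s * \<eta> + \<eta>) / sqrt t0" using t0 by (intro divide_right_mono) auto
  moreover have "M0 * norm b \<le> \<eta> * \<eta>" using \<eta> M0 by (intro mult_mono) auto
  ultimately have "Z \<le> (\<eta> + phC s * \<eta> + \<eta>) / sqrt t0 + \<eta>" unfolding Z_def using e2 by simp
  also have "\<dots> = A * \<eta>" unfolding A by (simp add: algebra_simps add_divide_distrib)
  finally show "2 * Z \<le> 2 * A * \<eta>" by simp
  have A0: "0 \<le> A" unfolding A using C t0 by simp
  then have B0: "0 \<le> B" unfolding B using C by simp
  have "M0 + phC s * (2 * A * \<eta>) \<le> \<eta> + phC s * (2 * A * \<eta>)" using \<eta> by simp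
  also have "\<dots> = \<eta> * B" unfolding B by (simp add: algebra_simps)
  finally have M: "M0 + phC s * (2 * A * \<eta>) \<le> \<eta> * B" .
  have M': "0 \<le> M0 + phC s * (2 * A * \<eta>)" using M0 C A0 \<eta> by simp
  have "Lc (2 * A * \<eta>) \<le> 2 * (\<eta> * B) + 3 * (\<eta> * B)\<^sup>2 / sqrt t0"
    unfolding Lc_def using M M' t0 by (intro add_mono divide_right_mono mult_left_mono power_mono) auto
  also have "(\<eta> * B)\<^sup>2 \<le> \<eta> * B\<^sup>2" unfolding power_mult_distrib using e2 by (intro mult_right_mono) (auto simp: power2_eq_square)
  then have "2 * (\<eta> * B) + 3 * (\<eta> * B)\<^sup>2 / sqrt t0 \<le> 2 * (\<eta> * B) + 3 * (\<eta> * B\<^sup>2) / sqrt t0"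
    using t0 \<eta>(1) by (intro add_mono divide_right_mono mult_left_mono) auto
  also have "\<dots> = \<eta> * (2 * B + 3 * B\<^sup>2 / sqrt t0)" by (simp add: algebra_simps)
  also note small
  finally show "Lc (2 * A * \<eta>) \<le> sqrt t0 / 8" .
qed

end

theorem theorem1p4:
  fixes \<sigma> t0 :: real and s :: nat
  assumes "\<sigma> = 1 \<or> \<sigma> = -1" and "t0 > 0" and "s \<ge> 1"
  shows "\<exists>a0>0. \<exists>\<delta>>0. \<forall>a. 0 < a \<and> a < a0 \<longrightarrow>
    (\<forall>u. u \<in> Hdot_minus2 \<inter> sobolev s 2 \<inter> sobolev s 1 \<and>
         Hdot_minus2_norm u + sobolev_norm s 2 u + sobolev_norm s 1 u \<le> \<delta> \<longrightarrow>
       (\<exists>v. asymptotic_solution \<sigma> t0 s a u v \<and>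
            (\<forall>v'. asymptotic_solution \<sigma> t0 s a u v' \<longrightarrow>
               (\<forall>t\<ge>t0. AE x in lborel. v' t x = v t x))))"
proof -
  define A where "A = (2 + phC s) / sqrt t0 + 1"
  define B where "B = 1 + 2 * phC s * A"
  define K where "K = 2 * B + 3 * B\<^sup>2 / sqrt t0"
  have "0 \<le> A" unfolding A_def using phC(1)[OF assms(3)] assms(2) by simp
  then have "1 \<le> B" unfolding B_def using phC(1)[OF assms(3)] by simp
  then have K: "0 < K" unfolding K_def using assms(2) by (intro add_pos_nonneg) auto
  \<comment> \<open>The largest size not above 1 that meets the hypothesis of
    \<open>smallness\<close>; it involves \<open>s\<close> and \<open>t0\<close> only.\<close>
  define \<eta> where "\<eta> = min 1 (sqrt t0 / 8 / K)"
  have \<eta>: "0 < \<eta>" "\<eta> \<le> 1" unfolding \<eta>_def using assms(2) K by auto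
  have "\<eta> * K \<le> (sqrt t0 / 8 / K) * K" using K by (intro mult_right_mono) (auto simp: \<eta>_def)
  then have small: "\<eta> * (2 * B + 3 * B\<^sup>2 / sqrt t0) \<le> sqrt t0 / 8" using K by (simp add: K_def[symmetric])
  \<comment> \<open>The power \<open>3 ^ s\<close> covers both the loss \<open>2 ^ s\<close> of the
    encoding and the loss \<open>3 ^ s\<close> of multiplication; the 2 makes room for
    \<open>V\<close>, which is bounded by a sum of two such terms.\<close>
  define \<delta> where "\<delta> = \<eta> / (2 * 3 ^ s)"
  have \<delta>: "0 < \<delta>" using \<eta> by (simp add: \<delta>_def)
  have \<delta>\<eta>: "2 * (3 ^ s * \<delta>) = \<eta>" by (simp add: \<delta>_def)
  show ?thesis
  \<comment> \<open>The threshold for \<open>a\<close> is absolute, and \<open>\<delta>\<close> has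
    been fixed before \<open>a\<close>.\<close>
  proof (rule exI[of _ "1 / 4"], intro conjI exI[of _ \<delta>] allI impI)
    fix a :: real and u assume a: "0 < a \<and> a < 1 / 4"
      and u: "u \<in> Hdot_minus2 \<inter> sobolev s 2 \<inter> sobolev s 1 \<and> Hdot_minus2_norm u + sobolev_norm s 2 u + sobolev_norm s 1 u \<le> \<delta>"
    then have u': "u \<in> Hdot_minus2" "u \<in> sobolev s 2" "u \<in> sobolev s 1" by auto
    have nn: "0 \<le> Hdot_minus2_norm u" "0 \<le> sobolev_norm s 2 u" "0 \<le> sobolev_norm s 1 u"
      by (auto simp: Hdot_minus2_norm_def intro: Lp_norm_nonneg sobolev_norm_nonneg)
    then have le: "Hdot_minus2_norm u \<le> \<delta>" "sobolev_norm s 2 u \<le> \<delta>" "sobolev_norm s 1 u \<le> \<delta>" using u by auto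
    from sobolev_enc[OF u'(2)] obtain b where b: "emb u = E s b" "norm b \<le> 2 ^ s * sobolev_norm s 2 u" .
    from antiderivatives[OF u'(1) b(1)] obtain U V where UV: "dk 1 U b" "dk 2 V b"
      "norm V \<le> 2 ^ s * Hdot_minus2_norm u + norm b" "(norm U)\<^sup>2 \<le> norm V * norm b" .
    have p: "(2::real) ^ s \<le> 3 ^ s" by (rule power_mono) auto
    have 2: "2 ^ s * x \<le> 3 ^ s * \<delta>" if "0 \<le> x" "x \<le> \<delta>" for x
      using that p by (intro mult_mono) auto
    have nb: "norm b \<le> 3 ^ s * \<delta>" using b(2) 2[OF nn(2) le(2)] by simp
    have nV: "norm V \<le> \<eta>" using UV(3) 2[OF nn(1) le(1)] nb unfolding \<delta>\<eta>[symmetric] by simp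
    have nb': "norm b \<le> \<eta>" using nb \<delta> unfolding \<delta>\<eta>[symmetric] by (simp add: order_trans[OF nb])
    have "(norm U)\<^sup>2 \<le> \<eta>\<^sup>2"
      unfolding power2_eq_square[of \<eta>] using nV nb' \<eta> by (intro order_trans[OF UV(4)] mult_mono) auto
    then have nU: "norm U \<le> \<eta>" using \<eta> by (rule_tac power2_le_imp_le) auto
    define M0 where "M0 = 3 ^ s * sobolev_norm s 1 u"
    have "M0 \<le> 3 ^ s * \<delta>" unfolding M0_def using le(3) by (rule mult_left_mono) simp
    moreover have "0 \<le> 3 ^ s * \<delta>" using \<delta> by simp
    ultimately have M0_le: "M0 \<le> \<eta>" unfolding \<delta>\<eta>[symmetric] by linarith
    interpret scattering s t0 a \<sigma> M0 b U V u
    proof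
      show "0 \<le> M0" unfolding M0_def by (intro mult_nonneg_nonneg nn(3)) simp
      fix \<tau> f assume "t0 \<le> \<tau>"
      then have "0 < \<tau>" using assms(2) by simp
      from sobolev_1_decay[OF u'(2,3) b(1) this assms(3)]
      show "norm (ph s (sg \<tau> b) f) \<le> M0 / sqrt \<tau> * norm f" by (simp add: M0_def)
    qed (use assms a UV b sobolev_Lp2[OF u'(2)] in auto)
    from smallness[OF \<eta> nb' nU nV M0_le A_def B_def small]
    show "\<exists>v. asymptotic_solution \<sigma> t0 s a u v \<and>
        (\<forall>v'. asymptotic_solution \<sigma> t0 s a u v' \<longrightarrow> (\<forall>t\<ge>t0. AE x in lborel. v' t x = v t x))"
      by (rule asymptotic_solution_exists_unique)
  qed (use \<delta> in auto)
qed

end
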